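(* Let $0<\epsilon<1$ be a constant. There is a parallel algorithm which, given a sequence $S$ of length $n$ over the alphabet $\Sigma=\{0,\ldots,\sigma-1\}$ with $\sigma\le n$, constructs the wavelet tree of $S$ using $O(\frac{n}{\epsilon}\log\sigma)$ work and $O(\frac{1}{\epsilon}(\sigma^{\epsilon}+\log n))$ depth. In particular, if $\sigma=O(\log^c n)$ for a constant $c$, then choosing $\epsilon$ appropriately gives depth $O(\log n)$.
   Context: Model: work-depth model with concurrent reads and writes permitted, with unit-cost operations on machine words of $\Theta(\log n)$ bits. The work is the total number of operations and the depth is the number of parallel time steps. $\log$ is base 2, and, as usual in asymptotic bounds, logarithmic factors are read as being at least $1$. Sequences are indexed from $0$. The (standard, binary) wavelet tree of $S$ is defined recursively. The root represents the symbols $[0,\ldots,2^{\lceil\log\sigma\rceil}-1]$. A node $v$ representing the symbols $[a,\ldots,b]$ stores a bitmap: let $S_v$ be the subsequence of $S$ (in the original order) of all symbols lying in $[a,\ldots,b]$; the bitmap has length $|S_v|$ and has a $0$ in position $i$ if $S_v[i]\in[a,\ldots,\frac{a+b+1}{2}-1]$ and a $1$ otherwise. The left child of $v$ represents $[a,\ldots,\frac{a+b+1}{2}-1]$ and the right child represents $[\frac{a+b+1}{2},\ldots,b]$. The recursion stops when the size of the range is 2 or less, or if a node has no symbols to represent (its subsequence is empty). Along with its bitmap, each node stores a succinct rank/select structure (of size sub-linear in the bitmap length) supporting rank and select queries on the bitmap in $O(1)$ work. The bitmaps of all nodes on one level may be stored consecutively in one bitmap of length $n$, with each node storing its starting point and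 its length. *)

theory Defs
  imports Complex_Main "HOL-Library.Landau_Symbols"
begin

section \<open>Work-depth machine\<close>

text \<open>
  A synchronous shared-memory machine with arbitrary-winner concurrent writes. Every value in a
  register or memory cell is a word of \<open>w\<close> bits, represented by a natural number below
  \<open>2 ^ w\<close>; the whole model is parameterised by \<open>w\<close>. A fixed program mentions only
  finitely many registers, so copying the register file to a spawned thread moves a constant
  number of words.
\<close>

datatype binop = Add | Sub | Mul | Div | Mod | And | Or | Xor | Shl | Shr | Less | Equal

datatype operand = Reg nat | Lit nat | WordLen

datatype instr =
    Op binop nat operand operand
  | Load nat operand
  | Store operand operand
  | Cond operand "instr list" "instr list"
  | Loop operand "instr list"
  | ParFor nat operand "instr list"

type_synonym prog = "instr list"
type_synonym regs = "nat \<Rightarrow> nat"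
type_synonym mem = "nat \<Rightarrow> nat"

fun apply_op :: "nat \<Rightarrow> binop \<Rightarrow> nat \<Rightarrow> nat \<Rightarrow> nat" where
  "apply_op w Add x y = (x + y) mod 2 ^ w"
| "apply_op w Sub x y = (x + (2 ^ w - y)) mod 2 ^ w"
| "apply_op w Mul x y = (x * y) mod 2 ^ w"
| "apply_op w Div x y = x div y"
| "apply_op w Mod x y = x mod y"
| "apply_op w And x y = Bit_Operations.and x y"
| "apply_op w Or x y = Bit_Operations.or x y"
| "apply_op w Xor x y = Bit_Operations.xor x y"
| "apply_op w Shl x y = push_bit y x mod 2 ^ w"
| "apply_op w Shr x y = drop_bit y x"
| "apply_op w Less x y = of_bool (x < y)"
| "apply_op w Equal x y = of_bool (x = y)"

fun val :: "nat \<Rightarrow> regs \<Rightarrow> operand \<Rightarrow> nat" where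
  "val w rs (Reg r) = rs r"
| "val w rs (Lit c) = c mod 2 ^ w"
| "val w rs WordLen = w"

text \<open>
  \<open>Run cs rs\<close> is a thread about to execute \<open>cs\<close>; \<open>Wait ts cs rs\<close> is a thread that has
  spawned \<open>ts\<close> and resumes with \<open>cs\<close> once all of them have finished.
\<close>

datatype thread = Run prog regs | Wait "thread list" prog regs

fun finished :: "thread \<Rightarrow> bool" where
  "finished (Run cs rs) \<longleftrightarrow> cs = []"
| "finished (Wait ts cs rs) \<longleftrightarrow> False"

definition join :: "thread list \<Rightarrow> prog \<Rightarrow> regs \<Rightarrow> thread" where
  "join ts cs rs = (if \<forall>t\<in>set ts. finished t then Run cs rs else Wait ts cs rs)"

text \<open>
  In one time step every running thread executes one instruction, all of them reading the memory
  \<open>m\<close> as it was before the step. \<open>ParFor d x body\<close> spawns one thread for each \<open>i\<close> below the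
  value of \<open>x\<close>, with \<open>i\<close> in its register \<open>d\<close>. The spawn is one operation; waiting and joining are free.
\<close>

fun thread_step :: "nat \<Rightarrow> mem \<Rightarrow> thread \<Rightarrow> thread" where
  "thread_step w m (Run [] rs) = Run [] rs"
| "thread_step w m (Run (Op f d x y # cs) rs) =
     Run cs (rs(d := apply_op w f (val w rs x) (val w rs y)))"
| "thread_step w m (Run (Load d x # cs) rs) = Run cs (rs(d := m (val w rs x)))"
| "thread_step w m (Run (Store x y # cs) rs) = Run cs rs"
| "thread_step w m (Run (Cond x ds es # cs) rs) =
     Run ((if val w rs x \<noteq> 0 then ds else es) @ cs) rs"
| "thread_step w m (Run (Loop x ds # cs) rs) =
     Run (if val w rs x \<noteq> 0 then ds @ Loop x ds # cs else cs) rs"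
| "thread_step w m (Run (ParFor d x ds # cs) rs) =
     join (map (\<lambda>i. Run ds (rs(d := i))) [0..<val w rs x]) cs rs"
| "thread_step w m (Wait ts cs rs) = join (map (thread_step w m) ts) cs rs"

text \<open>The (address, value) pairs that the threads write in the next time step.\<close>

fun writes :: "nat \<Rightarrow> thread \<Rightarrow> (nat \<times> nat) list" where
  "writes w (Run (Store x y # cs) rs) = [(val w rs x, val w rs y)]"
| "writes w (Run cs rs) = []"
| "writes w (Wait ts cs rs) = concat (map (writes w) ts)"

text \<open>The number of operations performed in the next time step.\<close>

fun active :: "thread \<Rightarrow> nat" where
  "active (Run cs rs) = (if cs = [] then 0 else 1)"
| "active (Wait ts cs rs) = sum_list (map active ts)"

text \<open>
  \<open>arb a\<close> selects which of the values written concurrently to address \<open>a\<close> survives. An arbiter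
  of a whole run maps time and address to such a selection; letting it range over all functions
  covers all outcomes of arbitrary-winner concurrent writes.
\<close>

definition commit :: "(nat \<Rightarrow> nat) \<Rightarrow> (nat \<times> nat) list \<Rightarrow> mem \<Rightarrow> mem" where
  "commit arb ws m = (\<lambda>a. let vs = map snd (filter (\<lambda>p. fst p = a) ws)
     in if vs = [] then m a else vs ! (arb a mod length vs))"

fun machine_step :: "nat \<Rightarrow> (nat \<Rightarrow> nat) \<Rightarrow> thread \<times> mem \<Rightarrow> thread \<times> mem" where
  "machine_step w arb (t, m) = (thread_step w m t, commit arb (writes w t) m)"

fun exec :: "nat \<Rightarrow> (nat \<Rightarrow> nat \<Rightarrow> nat) \<Rightarrow> thread \<times> mem \<Rightarrow> nat \<Rightarrow> thread \<times> mem" where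
  "exec w arb cfg 0 = cfg"
| "exec w arb cfg (Suc k) = machine_step w (arb k) (exec w arb cfg k)"

definition total_work :: "nat \<Rightarrow> (nat \<Rightarrow> nat \<Rightarrow> nat) \<Rightarrow> thread \<times> mem \<Rightarrow> nat \<Rightarrow> nat" where
  "total_work w arb cfg k = (\<Sum>i<k. active (fst (exec w arb cfg i)))"

text \<open>
  However concurrent writes are resolved, the program halts within the given work and depth, and
  the final registers of the initial thread and the final memory satisfy \<open>Q\<close>.
\<close>

definition computes ::
  "nat \<Rightarrow> prog \<Rightarrow> regs \<Rightarrow> mem \<Rightarrow> real \<Rightarrow> real \<Rightarrow> (regs \<Rightarrow> mem \<Rightarrow> bool) \<Rightarrow> bool" where
  "computes w P rs m work depth Q \<longleftrightarrow>
     (\<forall>arb. \<exists>k rs' m'. exec w arb (Run P rs, m) k = (Run [] rs', m')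
        \<and> real k \<le> depth \<and> real (total_work w arb (Run P rs, m) k) \<le> work \<and> Q rs' m')"

section \<open>Wavelet trees\<close>

datatype wtree = Leaf "bool list" | Node "bool list" wtree wtree

text \<open>
  A node at which the recursion stops, in particular one with no symbols (and hence an empty
  bitmap), is a \<open>Leaf\<close>. Bit 1 is \<open>True\<close>.
\<close>

function wavelet :: "nat \<Rightarrow> nat \<Rightarrow> nat list \<Rightarrow> wtree" where
  "wavelet a b S =
     (let Sv = filter (\<lambda>s. a \<le> s \<and> s \<le> b) S;
          mid = (a + b + 1) div 2;
          bits = map (\<lambda>s. \<not> (a \<le> s \<and> s < mid)) Sv
      in if b + 1 - a \<le> 2 \<or> Sv = [] then Leaf bits
         else Node bits (wavelet a (mid - 1) S) (wavelet mid b S))"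
  by pat_completeness auto
termination
  by (relation "measure (\<lambda>(a, b, S). b + 1 - a)") auto

declare wavelet.simps [simp del]

definition wavelet_tree :: "nat \<Rightarrow> nat list \<Rightarrow> wtree" where
  "wavelet_tree \<sigma> S = wavelet 0 (2 ^ nat \<lceil>log 2 (real \<sigma>)\<rceil> - 1) S"

definition rank :: "bool \<Rightarrow> bool list \<Rightarrow> nat \<Rightarrow> nat" where
  "rank b B i = count_list (take i B) b"

text \<open>Occurrences are counted from 0.\<close>

definition select :: "bool \<Rightarrow> bool list \<Rightarrow> nat \<Rightarrow> nat" where
  "select b B k = filter (\<lambda>j. B ! j = b) [0..<length B] ! k"

section \<open>Wavelet trees in memory\<close>

text \<open>Memory viewed as one bit array, \<open>w\<close> bits per word, least significant bit first.\<close>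

definition mem_bit :: "nat \<Rightarrow> mem \<Rightarrow> nat \<Rightarrow> bool" where
  "mem_bit w m j = bit (m (j div w)) (j mod w)"

text \<open>
  A node is a record of six words at address \<open>p\<close>: bit address and length of its bitmap, bit
  address and length in bits of its rank/select structure, and the record addresses of its
  children (meaningless at a leaf).
\<close>

definition same_node_data :: "nat \<Rightarrow> nat \<Rightarrow> mem \<Rightarrow> mem \<Rightarrow> bool" where
  "same_node_data w p m m' \<longleftrightarrow>
     (\<forall>a\<in>{p..p + 3}. m' a = m a) \<and>
     (\<forall>j\<in>{m p..<m p + m (p + 1)} \<union> {m (p + 2)..<m (p + 2) + m (p + 3)}.
        mem_bit w m' j = mem_bit w m j)"

definition query_regs :: "nat \<Rightarrow> bool \<Rightarrow> nat \<Rightarrow> regs" where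
  "query_regs p b i = (\<lambda>_. 0)(0 := p, 1 := of_bool b, 2 := i)"

definition answers ::
  "nat \<Rightarrow> real \<Rightarrow> prog \<Rightarrow> nat \<Rightarrow> mem \<Rightarrow> bool \<Rightarrow> nat \<Rightarrow> nat \<Rightarrow> bool" where
  "answers w C P p m b i r \<longleftrightarrow>
     computes w P (query_regs p b i) m C C (\<lambda>rs m'. rs 0 = r \<and> m' = m)"

text \<open>
  Queries must also succeed on any memory \<open>m'\<close> that shares with \<open>m\<close> only the first four words
  of the record, the bitmap and the rank/select structure: they cannot consult anything else, so
  the bound \<open>f\<close> really limits the auxiliary space of the node.
\<close>

definition stores_node ::
  "nat \<Rightarrow> real \<Rightarrow> (nat \<Rightarrow> real) \<Rightarrow> prog \<Rightarrow> prog \<Rightarrow> mem \<Rightarrow> nat \<Rightarrow> bool list \<Rightarrow> bool" where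
  "stores_node w C f rankP selectP m p B \<longleftrightarrow>
     m (p + 1) = length B \<and>
     (\<forall>i<length B. mem_bit w m (m p + i) = B ! i) \<and>
     real (m (p + 3)) \<le> f (length B) \<and>
     (\<forall>m'. (\<forall>a. m' a < 2 ^ w) \<and> same_node_data w p m m' \<longrightarrow>
        (\<forall>b i. i \<le> length B \<longrightarrow> answers w C rankP p m' b i (rank b B i)) \<and>
        (\<forall>b k. k < count_list B b \<longrightarrow> answers w C selectP p m' b k (select b B k)))"

fun stores_tree ::
  "nat \<Rightarrow> real \<Rightarrow> (nat \<Rightarrow> real) \<Rightarrow> prog \<Rightarrow> prog \<Rightarrow> mem \<Rightarrow> nat \<Rightarrow> wtree \<Rightarrow> bool" where
  "stores_tree w C f rankP selectP m p (Leaf B) \<longleftrightarrow> stores_node w C f rankP selectP m p B"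
| "stores_tree w C f rankP selectP m p (Node B l r) \<longleftrightarrow>
     stores_node w C f rankP selectP m p B \<and>
     stores_tree w C f rankP selectP m (m (p + 4)) l \<and>
     stores_tree w C f rankP selectP m (m (p + 5)) r"

section \<open>Construction of wavelet trees\<close>

definition lg :: "nat \<Rightarrow> real" where
  "lg n = max 1 (log 2 (real n))"

definition word_len :: "nat \<Rightarrow> nat \<Rightarrow> nat" where
  "word_len W n = W * nat \<lceil>lg n\<rceil>"

definition input_regs :: "nat \<Rightarrow> nat \<Rightarrow> regs" where
  "input_regs n \<sigma> = (\<lambda>_. 0)(0 := n, 1 := \<sigma>)"

definition input_mem :: "nat list \<Rightarrow> mem" where
  "input_mem S = (\<lambda>a. if a < length S then S ! a else 0)"

definition valid_input :: "nat \<Rightarrow> nat list \<Rightarrow> bool" where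
  "valid_input \<sigma> S \<longleftrightarrow> S \<noteq> [] \<and> set S \<subseteq> {0..<\<sigma>} \<and> \<sigma> \<le> length S"

text \<open>The program leaves the address of the root record in register 0.\<close>

definition constructs_wavelet_tree ::
  "nat \<Rightarrow> real \<Rightarrow> (nat \<Rightarrow> real) \<Rightarrow> prog \<Rightarrow> prog \<Rightarrow> prog \<Rightarrow> nat \<Rightarrow> nat list \<Rightarrow> real \<Rightarrow> real \<Rightarrow> bool" where
  "constructs_wavelet_tree W C f rankP selectP P \<sigma> S work depth \<longleftrightarrow>
     (let w = word_len W (length S) in
      computes w P (input_regs (length S) \<sigma>) (input_mem S) work depth
        (\<lambda>rs m. stores_tree w C f rankP selectP m (rs 0) (wavelet_tree \<sigma> S)))"

end

theory Submission
  imports Defs "HOL-Real_Asymp.Real_Asymp"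
begin

text \<open>
  All levels of the tree are built independently. The nodes of level \<open>l\<close> are the classes of symbols with
  equal leading \<open>l\<close> of \<open>L\<close> bits, so sorting the positions stably by these bits makes every node contiguous.
  A radix sort with \<open>K = min \<lceil>1 / \<epsilon>\<rceil> L\<close> passes has radix \<open>R = O(\<sigma> powr \<epsilon>)\<close>; in each pass, blocks of \<open>R\<close>
  positions are counted sequentially and the block histograms are combined by prefix sums, which takes
  linear work and depth \<open>O(R + log n)\<close>. The orders of two consecutive levels and their inverses give, in
  constant time, rank and select on every bitmap. Hence all words of the bitmaps and of the rank/select
  directories can be computed independently of each other, one word sequentially in \<open>O(log n)\<close> steps.

  The directory of a node has two levels with sampling rates polynomial in \<open>w\<close> and in \<open>r\<close>, where \<open>r\<close> is
  about the tenth root of \<open>w\<close>; within a block of less than \<open>w\<close> bits, queries use word operations.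
  Since words have \<open>2 ^ 100 * \<lceil>lg n\<rceil>\<close> bits, addresses can be so sparse that no cell is ever reused.
\<close>

text \<open>Building the levels one after the other would multiply the depth by
  \<open>log \<sigma>\<close>; this is why every level sorts from scratch. The price is
  \<open>K\<close> linear passes for each of the \<open>L\<close> levels, which is exactly the
  claimed work.

  The query programs and the space bound are fixed once and for all, while \<open>w\<close> depends
  on the whole sequence and a node may be arbitrarily short. The rates are therefore tied to
  \<open>r\<close> with \<open>r ^ 10 \<le> w < (r + 1) ^ 10\<close>: a block of
  \<open>r ^ 4\<close> bits, spread quadratically, still fits into a word, offsets inside a dense
  coarse group fit into \<open>r\<close> bits, and a directory takes at most \<open>10 / r\<close>
  of its bitmap, which is sublinear because the logarithm of the bitmap length never exceeds
  \<open>w\<close>.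

  Interleavings and arbiters are never enumerated: concurrent threads own disjoint cells, and a
  thread is verified against every environment that leaves alone the cells it relies on.\<close>

section \<open>Threads in an interfering environment\<close>

definition agree :: "nat set \<Rightarrow> mem \<Rightarrow> mem \<Rightarrow> bool" where
  "agree A m m' \<longleftrightarrow> (\<forall>a\<in>A. m' a = m a)"

text \<open>Covers \<open>commit\<close> under every arbiter at once: a written cell holds one of
  the values written to it. Outside \<open>A\<close> nothing is promised, as other threads may write
  there.\<close>

definition evolves :: "nat set \<Rightarrow> (nat \<times> nat) list \<Rightarrow> mem \<Rightarrow> mem \<Rightarrow> bool" where
  "evolves A ws m m' \<longleftrightarrow>
     (\<forall>a\<in>A. if a \<in> fst ` set ws then (a, m' a) \<in> set ws else m' a = m a)"

lemma agree_refl [simp]: "agree A m m"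
  by (simp add: agree_def)

lemma agree_trans: "agree A m m' \<Longrightarrow> agree A m' m'' \<Longrightarrow> agree A m m''"
  by (simp add: agree_def)

lemma agree_mono: "agree A m m' \<Longrightarrow> B \<subseteq> A \<Longrightarrow> agree B m m'"
  by (auto simp: agree_def)

lemma evolves_agree: "agree A m0 m \<Longrightarrow> evolves A ws m m' \<Longrightarrow> evolves A ws m0 m'"
  unfolding evolves_def agree_def by metis

lemma evolves_no_writes: "evolves A [] m m' \<longleftrightarrow> agree A m m'"
  by (simp add: evolves_def agree_def)

text \<open>A rely-guarantee judgement: the environment does not write to \<open>A\<close>, the
  thread writes only to \<open>G\<close>, and \<open>K\<close> and \<open>W\<close> bound the
  remaining depth and work. \<open>m\<close> describes the memory on \<open>A\<close> only;
  \<open>m1\<close> is the full memory that is actually read in a step and \<open>m2\<close> the one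
  after it, both arbitrary elsewhere. The depth budget decreases strictly, so a derivation also
  proves termination.\<close>

inductive ok ::
  "nat \<Rightarrow> nat set \<Rightarrow> nat set \<Rightarrow> (regs \<Rightarrow> mem \<Rightarrow> bool) \<Rightarrow> thread \<Rightarrow> mem \<Rightarrow> nat \<Rightarrow> nat \<Rightarrow> bool"
  for w A G Q where
  ok_done: "(\<And>m'. agree A m m' \<Longrightarrow> Q rs m') \<Longrightarrow> ok w A G Q (Run [] rs) m K W"
| ok_step: "\<not> finished t \<Longrightarrow> fst ` set (writes w t) \<subseteq> G \<Longrightarrow>
    (\<And>m1 m2. agree A m m1 \<Longrightarrow> evolves A (writes w t) m m2 \<Longrightarrow>
       ok w A G Q (thread_step w m1 t) m2 K W) \<Longrightarrow>
    K < K' \<Longrightarrow> active t + W \<le> W' \<Longrightarrow> ok w A G Q t m K' W'"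

lemma ok_mono:
  assumes "ok w A G Q t m K W" "K \<le> K'" "W \<le> W'"
  shows "ok w A G Q t m K' W'"
  using assms(1)
proof cases
  case (ok_done rs)
  then show ?thesis by (auto intro: ok.ok_done)
next
  case (ok_step K0 W0)
  show ?thesis
    by (rule ok.ok_step[OF ok_step(1,2,3)], assumption+) (use assms(2,3) ok_step(4,5) in linarith)+
qed

text \<open>Both rules quantify over all memories that agree with \<open>m\<close> on
  \<open>A\<close>, so the judgement sees \<open>m\<close> only there; everything follows from
  transitivity of \<open>agree\<close>.\<close>

lemma ok_agree:
  assumes "ok w A G Q t m K W" "agree A m m'"
  shows "ok w A G Q t m' K W"
  using assms(1)
proof cases
  case (ok_done rs)
  then show ?thesis using assms(2) by (auto intro!: ok.ok_done intro: agree_trans)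
next
  case (ok_step K0 W0)
  show ?thesis
    by (rule ok.ok_step[OF ok_step(1,2) ok_step(3) ok_step(4,5)])
       (use assms(2) in \<open>auto intro: agree_trans evolves_agree\<close>)
qed

lemma ok_finishedD:
  assumes "ok w A G Q (Run [] rs) m K W"
  shows "Q rs m"
  using assms by cases auto

lemma exec_Suc_front:
  "exec w arb cfg (Suc k) = exec w (\<lambda>j. arb (Suc j)) (machine_step w (arb 0) cfg) k"
  by (induction k) auto

lemma total_work_Suc_front:
  "total_work w arb cfg (Suc k) =
     active (fst cfg) + total_work w (\<lambda>j. arb (Suc j)) (machine_step w (arb 0) cfg) k"
  unfolding total_work_def by (subst sum.lessThan_Suc_shift) (simp add: exec_Suc_front del: exec.simps(2))

lemma evolves_commit: "evolves A ws m (commit arb ws m)"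
  unfolding evolves_def
proof (intro ballI)
  fix a
  define vs where "vs = map snd (filter (\<lambda>p. fst p = a) ws)"
  have c: "commit arb ws m a = (if vs = [] then m a else vs ! (arb a mod length vs))"
    unfolding commit_def vs_def by (simp add: Let_def)
  have mem: "v \<in> set vs \<longleftrightarrow> (a, v) \<in> set ws" for v
    unfolding vs_def by force
  have "vs \<noteq> [] \<Longrightarrow> vs ! (arb a mod length vs) \<in> set vs" by simp
  moreover have "vs = [] \<longleftrightarrow> a \<notin> fst ` set ws"
    unfolding vs_def by (force simp: filter_empty_conv)
  ultimately show "if a \<in> fst ` set ws then (a, commit arb ws m a) \<in> set ws
      else commit arb ws m a = m a"
    using c mem by auto
qed

text \<open>The initial thread has no environment, which is the case \<open>A = UNIV\<close>; every
  arbiter is then one particular way to evolve. Runs are unrolled at the front, hence the arbiter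
  shifts by one time step.\<close>

lemma ok_exec:
  assumes "ok w UNIV G Q t m K W"
  shows "\<exists>k rs' m'. exec w arb (t, m) k = (Run [] rs', m') \<and> k \<le> K \<and>
           total_work w arb (t, m) k \<le> W \<and> Q rs' m'"
  using assms
proof (induction arbitrary: arb)
  case (ok_done m rs K W)
  then show ?case
    by (intro exI[of _ 0] exI[of _ rs] exI[of _ m]) (auto simp: total_work_def)
next
  case (ok_step t m K W K' W')
  let ?m2 = "commit (arb 0) (writes w t) m"
  have "\<exists>k rs' m'. exec w (\<lambda>j. arb (Suc j)) (thread_step w m t, ?m2) k = (Run [] rs', m') \<and> k \<le> K \<and>
      total_work w (\<lambda>j. arb (Suc j)) (thread_step w m t, ?m2) k \<le> W \<and> Q rs' m'"
    by (rule ok_step.IH[OF agree_refl evolves_commit])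
  then obtain k rs' m' where *: "exec w (\<lambda>j. arb (Suc j)) (thread_step w m t, ?m2) k = (Run [] rs', m')"
    "k \<le> K" "total_work w (\<lambda>j. arb (Suc j)) (thread_step w m t, ?m2) k \<le> W" "Q rs' m'"
    by blast
  show ?case
    by (intro exI[of _ "Suc k"] exI[of _ rs'] exI[of _ m'])
       (use * ok_step in \<open>auto simp: exec_Suc_front total_work_Suc_front simp del: exec.simps(2)\<close>)
qed

lemma ok_computes:
  assumes "ok w UNIV G Q (Run P rs) m K W" "real W \<le> work" "real K \<le> depth"
  shows "computes w P rs m work depth Q"
  unfolding computes_def
proof (intro allI)
  fix arb
  show "\<exists>k rs' m'. exec w arb (Run P rs, m) k = (Run [] rs', m') \<and> real k \<le> depth
    \<and> real (total_work w arb (Run P rs, m) k) \<le> work \<and> Q rs' m'"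
    using ok_exec[OF assms(1), of arb] assms(2,3) by (smt (verit) of_nat_mono)
qed

lemma computes_mono:
  assumes "computes w P rs m work depth Q" "work \<le> work'" "depth \<le> depth'"
    "\<And>rs m. Q rs m \<Longrightarrow> Q' rs m"
  shows "computes w P rs m work' depth' Q'"
  using assms unfolding computes_def by (meson order_trans)

subsection \<open>Rules for single instructions\<close>

lemma ok_Op:
  assumes "ok w A G Q (Run cs (rs(d := apply_op w f (val w rs x) (val w rs y)))) m K W"
  shows "ok w A G Q (Run (Op f d x y # cs) rs) m (Suc K) (Suc W)"
  by (rule ok_step[where K=K and W=W]) (use assms in \<open>auto simp: evolves_no_writes intro: ok_agree\<close>)

lemma ok_Load:
  assumes "ok w A G Q (Run cs (rs(d := m (val w rs x)))) m K W" "val w rs x \<in> A"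
  shows "ok w A G Q (Run (Load d x # cs) rs) m (Suc K) (Suc W)"
  by (rule ok_step[where K=K and W=W])
     (use assms in \<open>auto simp: evolves_no_writes agree_def intro: ok_agree\<close>)

lemma ok_Store:
  assumes "ok w A G Q (Run cs rs) (m(val w rs x := val w rs y)) K W" "val w rs x \<in> G"
  shows "ok w A G Q (Run (Store x y # cs) rs) m (Suc K) (Suc W)"
proof (rule ok_step[where K=K and W=W])
  fix m1 m2
  assume "evolves A (writes w (Run (Store x y # cs) rs)) m m2"
  then have "agree A (m(val w rs x := val w rs y)) m2"
    by (auto simp: evolves_def agree_def split: if_splits)
  then show "ok w A G Q (thread_step w m1 (Run (Store x y # cs) rs)) m2 K W"
    using ok_agree[OF assms(1)] by simp
qed (use assms in auto)

lemma ok_Cond: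
  assumes "ok w A G Q (Run ((if val w rs x \<noteq> 0 then ds else es) @ cs) rs) m K W"
  shows "ok w A G Q (Run (Cond x ds es # cs) rs) m (Suc K) (Suc W)"
  by (rule ok_step[where K=K and W=W])
     (use assms in \<open>auto simp: evolves_no_writes simp del: if_split intro: ok_agree\<close>)

lemma ok_Loop:
  assumes "ok w A G Q (Run (if val w rs x \<noteq> 0 then ds @ Loop x ds # cs else cs) rs) m K W"
  shows "ok w A G Q (Run (Loop x ds # cs) rs) m (Suc K) (Suc W)"
  by (rule ok_step[where K=K and W=W])
     (use assms in \<open>auto simp: evolves_no_writes simp del: if_split intro: ok_agree\<close>)

text \<open>
  A child may read everything in \<open>Ac i\<close> because no sibling writes there; hence its run is not
  influenced by the interleaving, and what it has established when it halts persists until the join.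
\<close>

lemma ok_join:
  assumes "\<And>i. i < length ts \<Longrightarrow> ok w (Ac i) (Oc i) (\<lambda>_. Qc i) (ts ! i) m K (Wc i)"
    and "\<And>i. i < length ts \<Longrightarrow> Ac i \<subseteq> A" "\<And>i. i < length ts \<Longrightarrow> Oc i \<subseteq> G"
    and "\<And>i j. i < length ts \<Longrightarrow> j < length ts \<Longrightarrow> i \<noteq> j \<Longrightarrow> Oc i \<inter> Ac j = {}"
    and "\<And>a. a \<in> A \<Longrightarrow> (\<forall>i<length ts. a \<notin> Oc i) \<Longrightarrow> m a = m0 a"
    and "\<And>m'. (\<And>i. i < length ts \<Longrightarrow> Qc i m') \<Longrightarrow>
           (\<And>a. a \<in> A \<Longrightarrow> (\<forall>i<length ts. a \<notin> Oc i) \<Longrightarrow> m' a = m0 a) \<Longrightarrow>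
           ok w A G Q (Run cs rs) m' K' W'"
  shows "ok w A G Q (join ts cs rs) m (K + K') ((\<Sum>i<length ts. Wc i) + W')"
  using assms
\<comment> \<open>\<open>K\<close> bounds the slowest child. \<open>m0\<close> stays fixed as the
  memory at the time of the spawn, so the frame condition always refers to it.\<close>
proof (induction K arbitrary: ts m Wc rule: less_induct)
  case (less K)
  show ?case
  proof (cases "\<forall>t\<in>set ts. finished t")
    case True
    have "Qc i m" if i: "i < length ts" for i
    proof -
      from True i have "finished (ts ! i)" by simp
      then obtain rsi where "ts ! i = Run [] rsi" by (cases "ts ! i") auto
      then show ?thesis using less.prems(1)[OF i] ok_finishedD by metis
    qed
    then have "ok w A G Q (Run cs rs) m K' W'"
      using less.prems(5,6) by blast
    then show ?thesis
      using True by (auto simp: join_def intro: ok_mono)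
  next
    case False
    then obtain i0 where i0: "i0 < length ts" "\<not> finished (ts ! i0)"
      by (metis in_set_conv_nth)
    have Kpos: "0 < K"
      using less.prems(1)[OF i0(1)] i0(2) by cases auto
    define ws where "ws = concat (map (writes w) ts)"
    have childwr: "fst ` set (writes w (ts ! i)) \<subseteq> Oc i" if i: "i < length ts" for i
      using less.prems(1)[OF i] by cases auto
    \<comment> \<open>A child that has already halted keeps its whole work budget, so one uniform
      step with depth \<open>K - 1\<close> covers running and halted children.\<close>
    have "\<exists>Wi. active (ts ! i) + Wi \<le> Wc i \<and>
           (\<forall>m1 m2. agree (Ac i) m m1 \<longrightarrow> evolves (Ac i) (writes w (ts ! i)) m m2 \<longrightarrow>
              ok w (Ac i) (Oc i) (\<lambda>_. Qc i) (thread_step w m1 (ts ! i)) m2 (K - 1) Wi)"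
      if i: "i < length ts" for i
      using less.prems(1)[OF i]
    proof cases
      case (ok_done rs)
      then show ?thesis
        by (intro exI[of _ "Wc i"])
           (auto simp: evolves_no_writes intro!: ok.ok_done intro: agree_trans)
    next
      case (ok_step K0 W0)
      show ?thesis
      proof (intro exI[of _ W0] conjI allI impI)
        fix m1 m2 assume "agree (Ac i) m m1" "evolves (Ac i) (writes w (ts ! i)) m m2"
        then show "ok w (Ac i) (Oc i) (\<lambda>_. Qc i) (thread_step w m1 (ts ! i)) m2 (K - 1) W0"
          by (rule ok_mono[OF ok_step(3)]) (use ok_step(4) in auto)
      qed (use ok_step in auto)
    qed
    then obtain Wn where Wn: "\<And>i. i < length ts \<Longrightarrow> active (ts ! i) + Wn i \<le> Wc i"
      "\<And>i m1 m2. i < length ts \<Longrightarrow> agree (Ac i) m m1 \<Longrightarrow> evolves (Ac i) (writes w (ts ! i)) m m2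
          \<Longrightarrow> ok w (Ac i) (Oc i) (\<lambda>_. Qc i) (thread_step w m1 (ts ! i)) m2 (K - 1) (Wn i)"
      by metis
    have wsmem: "(a, v) \<in> set ws \<longleftrightarrow> (\<exists>i<length ts. (a, v) \<in> set (writes w (ts ! i)))" for a v
    proof -
      have "(a, v) \<in> set ws \<longleftrightarrow> (\<exists>t\<in>set ts. (a, v) \<in> set (writes w t))"
        by (simp add: ws_def)
      then show ?thesis by (metis in_set_conv_nth)
    qed
    have wsO: "\<exists>i<length ts. a \<in> Oc i" if av: "(a, v) \<in> set ws" for a v
    proof -
      obtain i where "i < length ts" "(a, v) \<in> set (writes w (ts ! i))" using av wsmem by blast
      then show ?thesis using childwr[of i] by force
    qed
    \<comment> \<open>A write that hits \<open>Ac i\<close> can only come from child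
      \<open>i\<close>, because the cells of the other children are disjoint from
      \<open>Ac i\<close>. So the joint step looks to child \<open>i\<close> like its own.\<close>
    have evc: "evolves (Ac i) (writes w (ts ! i)) m m2"
      if ev: "evolves A ws m m2" and i: "i < length ts" for i m2
      unfolding evolves_def
    proof (intro ballI)
      fix a assume a: "a \<in> Ac i"
      have eq: "(a, v) \<in> set ws \<longleftrightarrow> (a, v) \<in> set (writes w (ts ! i))" for v
      proof
        assume "(a, v) \<in> set ws"
        then obtain j where j: "j < length ts" "(a, v) \<in> set (writes w (ts ! j))" using wsmem by blast
        then have "a \<in> Oc j" using childwr[of j] by force
        then have "j = i" using less.prems(4)[OF j(1) i] a by blast
        then show "(a, v) \<in> set (writes w (ts ! i))" using j by simp
      qed (use i wsmem in blast)
      then have "a \<in> fst ` set ws \<longleftrightarrow> a \<in> fst ` set (writes w (ts ! i))" by force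
      then show "if a \<in> fst ` set (writes w (ts ! i)) then (a, m2 a) \<in> set (writes w (ts ! i))
           else m2 a = m a"
        using ev a eq less.prems(2)[OF i] unfolding evolves_def by (metis subsetD)
    qed
    have act: "active (Wait ts cs rs) = (\<Sum>i<length ts. active (ts ! i))"
      by (simp add: sum_list_sum_nth atLeast0LessThan)
    have "ok w A G Q (Wait ts cs rs) m (K + K') ((\<Sum>i<length ts. Wc i) + W')"
    proof (rule ok_step[where K="K - 1 + K'" and W="(\<Sum>i<length ts. Wn i) + W'"])
      show "fst ` set (writes w (Wait ts cs rs)) \<subseteq> G"
      proof -
        have "a \<in> G" if "(a, v) \<in> set ws" for a v
          using wsO[OF that] less.prems(3) by blast
        then have "fst ` set ws \<subseteq> G" by force
        then show ?thesis by (simp add: ws_def)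
      qed
      show "K - 1 + K' < K + K'" using Kpos by simp
      have "(\<Sum>i<length ts. active (ts ! i)) + (\<Sum>i<length ts. Wn i) \<le> (\<Sum>i<length ts. Wc i)"
        unfolding sum.distrib[symmetric] by (rule sum_mono) (use Wn(1) in auto)
      then show "active (Wait ts cs rs) + (sum Wn {..<length ts} + W') \<le> sum Wc {..<length ts} + W'"
        unfolding act by simp
      fix m1 m2
      assume m1: "agree A m m1" and "evolves A (writes w (Wait ts cs rs)) m m2"
      then have ev: "evolves A ws m m2" by (simp add: ws_def)
      have "ok w A G Q (join (map (thread_step w m1) ts) cs rs) m2 (K - 1 + K')
              ((\<Sum>i<length (map (thread_step w m1) ts). Wn i) + W')"
      proof (rule less.IH)
        show "K - 1 < K" using Kpos by simp
        show "ok w (Ac i) (Oc i) (\<lambda>_. Qc i) (map (thread_step w m1) ts ! i) m2 (K - 1) (Wn i)"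
          if "i < length (map (thread_step w m1) ts)" for i
          using that Wn(2)[of i m1 m2] evc[OF ev] m1 less.prems(2)[of i]
          by (auto intro: agree_mono)
        show "m2 a = m0 a" if "a \<in> A" "\<forall>i<length (map (thread_step w m1) ts). a \<notin> Oc i" for a
        proof -
          have "a \<notin> fst ` set ws" using that wsO by force
          then have "m2 a = m a" using ev that unfolding evolves_def by auto
          then show ?thesis using that less.prems(5) by simp
        qed
        show "ok w A G Q (Run cs rs) m' K' W'"
          if "\<And>i. i < length (map (thread_step w m1) ts) \<Longrightarrow> Qc i m'"
            "\<And>a. a \<in> A \<Longrightarrow> \<forall>i<length (map (thread_step w m1) ts). a \<notin> Oc i \<Longrightarrow> m' a = m0 a" for m'
          using that less.prems(6) by simp
      qed (use less.prems(2-4) in auto)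
      then show "ok w A G Q (thread_step w m1 (Wait ts cs rs)) m2 (K - 1 + K')
              ((\<Sum>i<length ts. Wn i) + W')" by simp
    qed simp
    then show ?thesis using False unfolding join_def by (simp only: if_False)
  qed
qed

lemma ok_ParFor:
  assumes "\<And>i. i < val w rs x \<Longrightarrow> ok w (Ac i) (Oc i) (\<lambda>_. Qc i) (Run ds (rs(d := i))) m K (Wc i)"
    and "\<And>i. i < val w rs x \<Longrightarrow> Ac i \<subseteq> A" "\<And>i. i < val w rs x \<Longrightarrow> Oc i \<subseteq> G"
    and "\<And>i j. i < val w rs x \<Longrightarrow> j < val w rs x \<Longrightarrow> i \<noteq> j \<Longrightarrow> Oc i \<inter> Ac j = {}"
    and "\<And>m'. (\<And>i. i < val w rs x \<Longrightarrow> Qc i m') \<Longrightarrow>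
           (\<And>a. a \<in> A \<Longrightarrow> (\<forall>i<val w rs x. a \<notin> Oc i) \<Longrightarrow> m' a = m a) \<Longrightarrow>
           ok w A G Q (Run cs rs) m' K' W'"
  shows "ok w A G Q (Run (ParFor d x ds # cs) rs) m (Suc (K + K')) (Suc ((\<Sum>i<val w rs x. Wc i) + W'))"
proof (rule ok_step[where K="K + K'" and W="(\<Sum>i<val w rs x. Wc i) + W'"])
  fix m1 m2
  assume "evolves A (writes w (Run (ParFor d x ds # cs) rs)) m m2"
  then have *: "agree A m m2" by (simp add: evolves_no_writes)
  let ?ts = "map (\<lambda>i. Run ds (rs(d := i))) [0..<val w rs x]"
  have "ok w A G Q (join ?ts cs rs) m (K + K') ((\<Sum>i<length ?ts. Wc i) + W')"
  proof (rule ok_join[where Ac=Ac and Oc=Oc and Qc=Qc and m0=m])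
    show "ok w A G Q (Run cs rs) m' K' W'"
      if "\<And>i. i < length ?ts \<Longrightarrow> Qc i m'"
        "\<And>a. a \<in> A \<Longrightarrow> \<forall>i<length ?ts. a \<notin> Oc i \<Longrightarrow> m' a = m a" for m'
      using that by (intro assms(5)) simp_all
  qed (use assms(1-4) in simp_all)
  from ok_agree[OF this *]
  show "ok w A G Q (thread_step w m1 (Run (ParFor d x ds # cs) rs)) m2 (K + K')
      ((\<Sum>i<val w rs x. Wc i) + W')"
    unfolding thread_step.simps by simp
next
  show "\<not> finished (Run (ParFor d x ds # cs) rs)" by simp
next
  show "fst ` set (writes w (Run (ParFor d x ds # cs) rs)) \<subseteq> G" by simp
next
  show "active (Run (ParFor d x ds # cs) rs) + ((\<Sum>i<val w rs x. Wc i) + W') \<le> Suc ((\<Sum>i<val w rs x. Wc i) + W')"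
    unfolding active.simps by simp
next
  show "K + K' < Suc (K + K')" by (rule lessI)
qed

section \<open>A structured language and its compilation\<close>

datatype expr = Cn nat | Vr nat | WL | Bn binop expr expr | Ld expr | Ite expr expr expr

datatype stmt =
    Asg nat expr
  | Wr expr expr
  | When expr "stmt list" "stmt list"
  | For nat expr "stmt list"
  | Par nat expr "stmt list"

text \<open>Variables live in the even registers, temporaries in the odd ones.\<close>

fun comp_e :: "nat \<Rightarrow> expr \<Rightarrow> prog" where
  "comp_e t (Cn c) = [Op Or (2 * t + 1) (Lit c) (Lit 0)]"
| "comp_e t (Vr x) = [Op Or (2 * t + 1) (Reg (2 * x)) (Lit 0)]"
| "comp_e t WL = [Op Or (2 * t + 1) WordLen (Lit 0)]"
| "comp_e t (Bn f a b) = comp_e t a @ comp_e (Suc t) b @ [Op f (2 * t + 1) (Reg (2 * t + 1)) (Reg (2 * t + 3))]"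
| "comp_e t (Ld a) = comp_e t a @ [Load (2 * t + 1) (Reg (2 * t + 1))]"
| "comp_e t (Ite c a b) = comp_e t c @ [Cond (Reg (2 * t + 1)) (comp_e t a) (comp_e t b)]"

fun comp :: "stmt \<Rightarrow> prog" where
  "comp (Asg x e) = comp_e 0 e @ [Op Or (2 * x) (Reg 1) (Lit 0)]"
| "comp (Wr a e) = comp_e 0 a @ comp_e 1 e @ [Store (Reg 1) (Reg 3)]"
| "comp (When e ds es) = comp_e 0 e @ [Cond (Reg 1) (concat (map comp ds)) (concat (map comp es))]"
| "comp (For v e ds) = Op Or (2 * v) (Lit 0) (Lit 0) # comp_e 0 (Bn Less (Vr v) e) @
     [Loop (Reg 1) (concat (map comp ds) @ [Op Add (2 * v) (Reg (2 * v)) (Lit 1)] @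
        comp_e 0 (Bn Less (Vr v) e))]"
| "comp (Par v e ds) = comp_e 0 e @ [ParFor (2 * v) (Reg 1) (concat (map comp ds))]"

definition comps :: "stmt list \<Rightarrow> prog" where
  "comps cs = concat (map comp cs)"

lemma comps_simps [simp]: "comps [] = []" "comps (c # cs) = comp c @ comps cs"
  "comps (cs @ ds) = comps cs @ comps ds"
  by (simp_all add: comps_def)

fun aval :: "nat \<Rightarrow> (nat \<Rightarrow> nat) \<Rightarrow> mem \<Rightarrow> expr \<Rightarrow> nat" where
  "aval w s m (Cn c) = c mod 2 ^ w"
| "aval w s m (Vr x) = s x"
| "aval w s m WL = w"
| "aval w s m (Bn f a b) = apply_op w f (aval w s m a) (aval w s m b)"
| "aval w s m (Ld a) = m (aval w s m a)"
| "aval w s m (Ite c a b) = (if aval w s m c \<noteq> 0 then aval w s m a else aval w s m b)"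

text \<open>For a conditional only the branch taken has to stay inside \<open>A\<close>; this is
  what allows guarded loads, such as reading the predecessor of a position that may be 0.\<close>

fun reads_in :: "nat \<Rightarrow> nat set \<Rightarrow> (nat \<Rightarrow> nat) \<Rightarrow> mem \<Rightarrow> expr \<Rightarrow> bool" where
  "reads_in w A s m (Cn c) \<longleftrightarrow> True"
| "reads_in w A s m (Vr x) \<longleftrightarrow> True"
| "reads_in w A s m WL \<longleftrightarrow> True"
| "reads_in w A s m (Bn f a b) \<longleftrightarrow> reads_in w A s m a \<and> reads_in w A s m b"
| "reads_in w A s m (Ld a) \<longleftrightarrow> reads_in w A s m a \<and> aval w s m a \<in> A"
| "reads_in w A s m (Ite c a b) \<longleftrightarrow> reads_in w A s m c \<and>
     (if aval w s m c \<noteq> 0 then reads_in w A s m a else reads_in w A s m b)"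

text \<open>Both branches of a conditional are counted, so this is an upper bound that does not
  depend on the state.\<close>

fun esz :: "expr \<Rightarrow> nat" where
  "esz (Bn f a b) = esz a + esz b + 1"
| "esz (Ld a) = esz a + 1"
| "esz (Ite c a b) = esz c + esz a + esz b + 1"
| "esz _ = 1"

definition vars :: "regs \<Rightarrow> nat \<Rightarrow> nat" where
  "vars rs = (\<lambda>x. rs (2 * x))"

lemma vars_upd_temp [simp]: "vars (rs(Suc (2 * t) := v)) = vars rs"
  unfolding vars_def by (rule ext) (simp, presburger?)

lemma vars_upd_var [simp]: "vars (rs(2 * x := v)) = (vars rs)(x := v)"
  unfolding vars_def by (rule ext) simp

lemma vars_upd_eta [simp]:
  "vars (\<lambda>a. if a = Suc (2 * t) then v else rs a) = vars rs"
  "vars (\<lambda>a. if a = 2 * x then v else rs a) = (vars rs)(x := v)"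
  using vars_upd_temp[of rs t v] vars_upd_var[of rs x v] by (simp_all add: fun_upd_def)

lemma vars_apply: "vars rs x = rs (2 * x)"
  by (simp add: vars_def)

text \<open>Code compiled at height \<open>t\<close> overwrites temporaries from \<open>t\<close>
  upwards only. This keeps a left operand alive while the right one is computed at
  \<open>Suc t\<close>.\<close>

lemma ok_comp_e:
  assumes "reads_in w A (vars rs) m e"
    and "\<And>rs'. vars rs' = vars rs \<Longrightarrow> (\<And>u. u < t \<Longrightarrow> rs' (2 * u + 1) = rs (2 * u + 1)) \<Longrightarrow>
      rs' (2 * t + 1) = aval w (vars rs) m e \<Longrightarrow> ok w A G Q (Run cs rs') m K W"
  shows "ok w A G Q (Run (comp_e t e @ cs) rs) m (esz e + K) (esz e + W)"
  using assms
proof (induction e arbitrary: t rs cs K W)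
  case (Cn c)
  then show ?case by (auto intro!: ok_Op)
next
  case (Vr x)
  then show ?case by (auto intro!: ok_Op simp: vars_apply[of rs x])
next
  case WL
  then show ?case by (auto intro!: ok_Op)
next
  case (Bn f a b)
  have "ok w A G Q (Run (comp_e t a @ comp_e (Suc t) b @
      Op f (2 * t + 1) (Reg (2 * t + 1)) (Reg (2 * t + 3)) # cs) rs) m
      (esz a + (esz b + Suc K)) (esz a + (esz b + Suc W))"
  proof (rule Bn.IH(1))
    show "reads_in w A (vars rs) m a" using Bn.prems by simp
    fix rs1 assume 1: "vars rs1 = vars rs" "\<And>u. u < t \<Longrightarrow> rs1 (2 * u + 1) = rs (2 * u + 1)"
      "rs1 (2 * t + 1) = aval w (vars rs) m a"
    show "ok w A G Q (Run (comp_e (Suc t) b @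
      Op f (2 * t + 1) (Reg (2 * t + 1)) (Reg (2 * t + 3)) # cs) rs1) m (esz b + Suc K) (esz b + Suc W)"
    proof (rule Bn.IH(2))
      show "reads_in w A (vars rs1) m b" using Bn.prems 1 by simp
      fix rs2 assume 2: "vars rs2 = vars rs1" "\<And>u. u < Suc t \<Longrightarrow> rs2 (2 * u + 1) = rs1 (2 * u + 1)"
        "rs2 (2 * Suc t + 1) = aval w (vars rs1) m b"
      have 3: "rs2 (Suc (Suc (Suc (2 * t)))) = aval w (vars rs) m b" "rs2 (Suc (2 * t)) = aval w (vars rs) m a"
        using 1 2(2)[of t] 2(1,3) by auto
      show "ok w A G Q (Run (Op f (2 * t + 1) (Reg (2 * t + 1)) (Reg (2 * t + 3)) # cs) rs2) m (Suc K) (Suc W)"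
      proof (rule ok_Op, rule Bn.prems(2))
        show "(rs2(2 * t + 1 := apply_op w f (val w rs2 (Reg (2 * t + 1))) (val w rs2 (Reg (2 * t + 3)))))
           (2 * t + 1) = aval w (vars rs) m (Bn f a b)"
          using 3 by (simp add: eval_nat_numeral)
      qed (use 1 2 in auto)
    qed
  qed
  then show ?case by (simp add: add.assoc)
next
  case (Ld a)
  have "ok w A G Q (Run (comp_e t a @ Load (2 * t + 1) (Reg (2 * t + 1)) # cs) rs) m
      (esz a + Suc K) (esz a + Suc W)"
    by (rule Ld.IH) (use Ld.prems in \<open>auto intro!: ok_Load Ld.prems(2)\<close>)
  then show ?case by simp
next
  case (Ite c a b)
  let ?e = "if aval w (vars rs) m c \<noteq> 0 then a else b"
  have "ok w A G Q (Run (comp_e t c @ Cond (Reg (2 * t + 1)) (comp_e t a) (comp_e t b) # cs) rs) m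
      (esz c + Suc (esz ?e + K)) (esz c + Suc (esz ?e + W))"
  proof (rule Ite.IH(1))
    show "reads_in w A (vars rs) m c" using Ite.prems by simp
    fix rs1 assume 1: "vars rs1 = vars rs" "\<And>u. u < t \<Longrightarrow> rs1 (2 * u + 1) = rs (2 * u + 1)"
      "rs1 (2 * t + 1) = aval w (vars rs) m c"
    have eq: "(if val w rs1 (Reg (2 * t + 1)) \<noteq> 0 then comp_e t a else comp_e t b) = comp_e t ?e"
      using 1(3) by simp
    have "ok w A G Q (Run (comp_e t ?e @ cs) rs1) m (esz ?e + K) (esz ?e + W)"
    proof (cases "aval w (vars rs) m c \<noteq> 0")
      case True
      have "ok w A G Q (Run (comp_e t a @ cs) rs1) m (esz a + K) (esz a + W)"
        by (rule Ite.IH(2)) (use Ite.prems 1 True in auto)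
      then show ?thesis using True by simp
    next
      case False
      have "ok w A G Q (Run (comp_e t b @ cs) rs1) m (esz b + K) (esz b + W)"
        by (rule Ite.IH(3)) (use Ite.prems 1 False in auto)
      then show ?thesis using False by simp
    qed
    then show "ok w A G Q (Run (Cond (Reg (2 * t + 1)) (comp_e t a) (comp_e t b) # cs) rs1) m
        (Suc (esz ?e + K)) (Suc (esz ?e + W))"
      by (intro ok_Cond) (simp only: eq)
  qed
  then have "ok w A G Q (Run (comp_e t (Ite c a b) @ cs) rs) m
      (esz c + Suc (esz ?e + K)) (esz c + Suc (esz ?e + W))" by simp
  then show ?case by (rule ok_mono) auto
qed

subsection \<open>Evaluation without overflow\<close>

definition ev :: "nat \<Rightarrow> nat set \<Rightarrow> (nat \<Rightarrow> nat) \<Rightarrow> mem \<Rightarrow> expr \<Rightarrow> nat \<Rightarrow> bool" where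
  "ev w A s m e v \<longleftrightarrow> aval w s m e = v \<and> reads_in w A s m e"

lemma ev_N: "c < 2 ^ w \<Longrightarrow> ev w A s m (Cn c) c"
  by (simp add: ev_def)
lemma ev_V: "s x = v \<Longrightarrow> ev w A s m (Vr x) v"
  by (simp add: ev_def)
lemma ev_WL: "ev w A s m WL w"
  by (simp add: ev_def)
lemma ev_Add: "ev w A s m a x \<Longrightarrow> ev w A s m b y \<Longrightarrow> x + y < 2 ^ w \<Longrightarrow> ev w A s m (Bn Add a b) (x + y)"
  by (simp add: ev_def)
lemma ev_Sub:
  assumes "ev w A s m a x" "ev w A s m b y" "y \<le> x" "x < 2 ^ w"
  shows "ev w A s m (Bn Sub a b) (x - y)"
proof -
  have "x + (2 ^ w - y) = 2 ^ w + (x - y)" using assms by linarith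
  then have "(x + (2 ^ w - y)) mod 2 ^ w = (x - y) mod 2 ^ w" by simp
  then show ?thesis using assms by (simp add: ev_def less_imp_diff_less)
qed
lemma ev_Mul: "ev w A s m a x \<Longrightarrow> ev w A s m b y \<Longrightarrow> x * y < 2 ^ w \<Longrightarrow> ev w A s m (Bn Mul a b) (x * y)"
  by (simp add: ev_def)
text \<open>The search in a block multiplies two full words and only looks at low-order digits of
  the product, so there the overflow is intended.\<close>

lemma ev_Mul_mod: "ev w A s m a x \<Longrightarrow> ev w A s m b y \<Longrightarrow> ev w A s m (Bn Mul a b) (x * y mod 2 ^ w)"
  by (simp add: ev_def)
lemma ev_Div: "ev w A s m a x \<Longrightarrow> ev w A s m b y \<Longrightarrow> ev w A s m (Bn Div a b) (x div y)"
  by (simp add: ev_def)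
lemma ev_Mod: "ev w A s m a x \<Longrightarrow> ev w A s m b y \<Longrightarrow> ev w A s m (Bn Mod a b) (x mod y)"
  by (simp add: ev_def)
lemma ev_And: "ev w A s m a x \<Longrightarrow> ev w A s m b y \<Longrightarrow> ev w A s m (Bn And a b) (Bit_Operations.and x y)"
  by (simp add: ev_def)
lemma ev_Or: "ev w A s m a x \<Longrightarrow> ev w A s m b y \<Longrightarrow> ev w A s m (Bn Or a b) (Bit_Operations.or x y)"
  by (simp add: ev_def)
lemma ev_Xor: "ev w A s m a x \<Longrightarrow> ev w A s m b y \<Longrightarrow> ev w A s m (Bn Xor a b) (Bit_Operations.xor x y)"
  by (simp add: ev_def)
lemma ev_Shl: "ev w A s m a x \<Longrightarrow> ev w A s m b y \<Longrightarrow> ev w A s m (Bn Shl a b) (push_bit y x mod 2 ^ w)"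
  by (simp add: ev_def)
lemma ev_Shl_small: "ev w A s m a x \<Longrightarrow> ev w A s m b y \<Longrightarrow> x * 2 ^ y < 2 ^ w \<Longrightarrow> ev w A s m (Bn Shl a b) (x * 2 ^ y)"
  by (simp add: ev_def push_bit_eq_mult)
lemma ev_Shr: "ev w A s m a x \<Longrightarrow> ev w A s m b y \<Longrightarrow> ev w A s m (Bn Shr a b) (x div 2 ^ y)"
  by (simp add: ev_def drop_bit_eq_div)
lemma ev_Less: "ev w A s m a x \<Longrightarrow> ev w A s m b y \<Longrightarrow> ev w A s m (Bn Less a b) (of_bool (x < y))"
  by (simp add: ev_def)
lemma ev_Equal: "ev w A s m a x \<Longrightarrow> ev w A s m b y \<Longrightarrow> ev w A s m (Bn Equal a b) (of_bool (x = y))"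
  by (simp add: ev_def)
lemma ev_M: "ev w A s m a x \<Longrightarrow> x \<in> A \<Longrightarrow> ev w A s m (Ld a) (m x)"
  by (simp add: ev_def)
lemma ev_Ite: "ev w A s m c x \<Longrightarrow> (x \<noteq> 0 \<Longrightarrow> ev w A s m a v) \<Longrightarrow> (x = 0 \<Longrightarrow> ev w A s m b v) \<Longrightarrow>
    ev w A s m (Ite c a b) v"
  by (simp add: ev_def)
lemma ev_If: "ev w A s m c (of_bool P) \<Longrightarrow> (P \<Longrightarrow> ev w A s m a x) \<Longrightarrow> (\<not> P \<Longrightarrow> ev w A s m b y) \<Longrightarrow>
    ev w A s m (Ite c a b) (if P then x else y)"
  by (auto simp: ev_def)
lemma ev_eq: "ev w A s m e x \<Longrightarrow> x = y \<Longrightarrow> ev w A s m e y"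
  by simp
subsection \<open>Hoare triples\<close>

text \<open>
  \<open>ht w A G cs s m Q K W\<close>: from variables \<open>s\<close> and memory \<open>m\<close>, in an environment that does not
  touch the addresses in \<open>A\<close>, the statements \<open>cs\<close> write only to \<open>G\<close> and establish \<open>Q\<close> within
  depth \<open>K\<close> and work \<open>W\<close>. The continuation-passing form makes sequencing immediate.
\<close>

definition ht ::
  "nat \<Rightarrow> nat set \<Rightarrow> nat set \<Rightarrow> stmt list \<Rightarrow> (nat \<Rightarrow> nat) \<Rightarrow> mem \<Rightarrow> ((nat \<Rightarrow> nat) \<Rightarrow> mem \<Rightarrow> bool) \<Rightarrow>
    nat \<Rightarrow> nat \<Rightarrow> bool" where
  "ht w A G cs s m Q K W \<longleftrightarrow> (\<forall>rs cs' Q' K' W'. vars rs = s \<longrightarrow>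
     (\<forall>rs' m'. Q (vars rs') m' \<longrightarrow> ok w A G Q' (Run cs' rs') m' K' W') \<longrightarrow>
     ok w A G Q' (Run (comps cs @ cs') rs) m (K + K') (W + W'))"

lemma htI:
  assumes "\<And>rs cs' Q' K' W'. vars rs = s \<Longrightarrow>
     (\<And>rs' m'. Q (vars rs') m' \<Longrightarrow> ok w A G Q' (Run cs' rs') m' K' W') \<Longrightarrow>
     ok w A G Q' (Run (comps cs @ cs') rs) m (K + K') (W + W')"
  shows "ht w A G cs s m Q K W"
  unfolding ht_def using assms by blast

lemma htD:
  assumes "ht w A G cs s m Q K W" "vars rs = s"
    "\<And>rs' m'. Q (vars rs') m' \<Longrightarrow> ok w A G Q' (Run cs' rs') m' K' W'"
  shows "ok w A G Q' (Run (comps cs @ cs') rs) m (K + K') (W + W')"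
  using assms unfolding ht_def by blast

lemma ht_mono:
  assumes "ht w A G cs s m Q K W" "\<And>s' m'. Q s' m' \<Longrightarrow> Q' s' m'" "K \<le> K'" "W \<le> W'"
  shows "ht w A G cs s m Q' K' W'"
proof (rule htI)
  fix rs cs' Q'' K'' W''
  assume "vars rs = s" "\<And>rs' m'. Q' (vars rs') m' \<Longrightarrow> ok w A G Q'' (Run cs' rs') m' K'' W''"
  then have "ok w A G Q'' (Run (comps cs @ cs') rs) m (K + K'') (W + W'')"
    by (intro htD[OF assms(1)]) (use assms(2) in auto)
  then show "ok w A G Q'' (Run (comps cs @ cs') rs) m (K' + K'') (W' + W'')"
    by (rule ok_mono) (use assms(3,4) in auto)
qed

lemma ht_cost: "ht w A G cs s m Q K W \<Longrightarrow> K \<le> K' \<Longrightarrow> W \<le> W' \<Longrightarrow> ht w A G cs s m Q K' W'"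
  by (rule ht_mono)

lemma ht_post: "ht w A G cs s m Q K W \<Longrightarrow> (\<And>s' m'. Q s' m' \<Longrightarrow> Q' s' m') \<Longrightarrow> ht w A G cs s m Q' K W"
  by (erule ht_mono) auto

lemma ht_Nil: "Q s m \<Longrightarrow> ht w A G [] s m Q 0 0"
  by (rule htI) auto

lemma ht_append:
  assumes "ht w A G cs s m Q1 K1 W1" "\<And>s' m'. Q1 s' m' \<Longrightarrow> ht w A G ds s' m' Q K2 W2"
  shows "ht w A G (cs @ ds) s m Q (K1 + K2) (W1 + W2)"
proof (rule htI)
  fix rs cs' Q' K' W'
  assume *: "vars rs = s" "\<And>rs' m'. Q (vars rs') m' \<Longrightarrow> ok w A G Q' (Run cs' rs') m' K' W'"
  have "ok w A G Q' (Run (comps cs @ comps ds @ cs') rs) m (K1 + (K2 + K')) (W1 + (W2 + W'))"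
    by (rule htD[OF assms(1) *(1)], rule htD[OF assms(2)]) (use * in auto)
  then show "ok w A G Q' (Run (comps (cs @ ds) @ cs') rs) m (K1 + K2 + K') (W1 + W2 + W')"
    by (simp add: add.assoc)
qed

lemma ht_Cons:
  assumes "ht w A G [c] s m Q1 K1 W1" "\<And>s' m'. Q1 s' m' \<Longrightarrow> ht w A G cs s' m' Q K2 W2"
  shows "ht w A G (c # cs) s m Q (K1 + K2) (W1 + W2)"
  using ht_append[OF assms] by simp

lemma ht_Asg:
  assumes "ev w A s m e v" "Q (s(x := v)) m"
  shows "ht w A G [Asg x e] s m Q (esz e + 1) (esz e + 1)"
proof (rule htI)
  fix rs cs' Q' K' W'
  assume *: "vars rs = s" "\<And>rs' m'. Q (vars rs') m' \<Longrightarrow> ok w A G Q' (Run cs' rs') m' K' W'"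
  have "ok w A G Q' (Run (comp_e 0 e @ Op Or (2 * x) (Reg 1) (Lit 0) # cs') rs) m
      (esz e + Suc K') (esz e + Suc W')"
  proof (rule ok_comp_e)
    fix rs' assume "vars rs' = vars rs" "rs' (2 * 0 + 1) = aval w (vars rs) m e"
    then show "ok w A G Q' (Run (Op Or (2 * x) (Reg 1) (Lit 0) # cs') rs') m (Suc K') (Suc W')"
      using assms * by (intro ok_Op *(2)) (simp add: ev_def)
  qed (use assms * in \<open>simp add: ev_def\<close>)
  then show "ok w A G Q' (Run (comps [Asg x e] @ cs') rs) m (esz e + 1 + K') (esz e + 1 + W')"
    by simp
qed

lemma ht_Wr:
  assumes "ev w A s m a x" "ev w A s m e v" "x \<in> G" "Q s (m(x := v))"
  shows "ht w A G [Wr a e] s m Q (esz a + esz e + 1) (esz a + esz e + 1)"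
proof (rule htI)
  fix rs cs' Q' K' W'
  assume *: "vars rs = s" "\<And>rs' m'. Q (vars rs') m' \<Longrightarrow> ok w A G Q' (Run cs' rs') m' K' W'"
  have "ok w A G Q' (Run (comp_e 0 a @ comp_e 1 e @ Store (Reg 1) (Reg 3) # cs') rs) m
      (esz a + (esz e + Suc K')) (esz a + (esz e + Suc W'))"
  proof (rule ok_comp_e)
    fix rs1 assume 1: "vars rs1 = vars rs" "rs1 (2 * 0 + 1) = aval w (vars rs) m a"
    show "ok w A G Q' (Run (comp_e 1 e @ Store (Reg 1) (Reg 3) # cs') rs1) m (esz e + Suc K') (esz e + Suc W')"
    proof (rule ok_comp_e)
      fix rs2 assume 2: "vars rs2 = vars rs1" "\<And>u. u < 1 \<Longrightarrow> rs2 (2 * u + 1) = rs1 (2 * u + 1)"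
        "rs2 (2 * 1 + 1) = aval w (vars rs1) m e"
      have "rs2 1 = x" "rs2 3 = v" "vars rs2 = s"
        using 1 2 2(2)[of 0] assms * by (auto simp: ev_def eval_nat_numeral)
      then show "ok w A G Q' (Run (Store (Reg 1) (Reg 3) # cs') rs2) m (Suc K') (Suc W')"
        using assms by (intro ok_Store *(2)) auto
    qed (use assms * 1 in \<open>simp add: ev_def\<close>)
  qed (use assms * in \<open>simp add: ev_def\<close>)
  then show "ok w A G Q' (Run (comps [Wr a e] @ cs') rs) m
      (esz a + esz e + 1 + K') (esz a + esz e + 1 + W')"
    by (simp add: add.assoc)
qed

text \<open>The counter is incremented by code behind the body; hence the body must leave it at
  \<open>i\<close>, and the invariant for \<open>Suc i\<close> speaks of the updated state.
  \<open>N < 2 ^ w\<close> and \<open>0 < w\<close> prevent the counter and the literal 1 from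
  wrapping around.\<close>

lemma ht_For:
  assumes init: "I 0 (s(v := 0)) m"
    and N: "N < 2 ^ w" "0 < w"
    and ve: "\<And>i s m. i \<le> N \<Longrightarrow> I i s m \<Longrightarrow> s v = i \<Longrightarrow> ev w A s m e N"
    and body: "\<And>i s m. i < N \<Longrightarrow> I i s m \<Longrightarrow> s v = i \<Longrightarrow>
        ht w A G ds s m (\<lambda>s' m'. s' v = i \<and> I (Suc i) (s'(v := Suc i)) m') K W"
    and fin: "\<And>s m. I N s m \<Longrightarrow> s v = N \<Longrightarrow> Q s m"
  shows "ht w A G [For v e ds] s m Q (esz e + 4 + N * (K + esz e + 4)) (esz e + 4 + N * (W + esz e + 4))"
proof (rule htI)
  fix rs cs' Q' K' W'
  assume *: "vars rs = s" "\<And>rs' m'. Q (vars rs') m' \<Longrightarrow> ok w A G Q' (Run cs' rs') m' K' W'"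
  let ?t = "comp_e 0 (Bn Less (Vr v) e)"
  let ?L = "Loop (Reg 1) (comps ds @ Op Add (2 * v) (Reg (2 * v)) (Lit 1) # ?t)"
  have one: "1 mod 2 ^ w = (1::nat)" using N(2) by simp
  \<comment> \<open>Induction over the number \<open>j\<close> of iterations still to come, started
    at the evaluation of the loop test.\<close>
  have loop: "ok w A G Q' (Run (?t @ ?L # cs') rs) m
      (esz e + 3 + j * (K + esz e + 4) + K') (esz e + 3 + j * (W + esz e + 4) + W')"
    if "i + j = N" "I i (vars rs) m" "vars rs v = i" for i j rs m
    using that
  proof (induction j arbitrary: i rs m)
    case 0
    have "ok w A G Q' (Run (?t @ ?L # cs') rs) m (esz (Bn Less (Vr v) e) + Suc K') (esz (Bn Less (Vr v) e) + Suc W')"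
    proof (rule ok_comp_e)
      show "reads_in w A (vars rs) m (Bn Less (Vr v) e)"
        using ve[of i "vars rs" m] 0 by (simp add: ev_def)
      fix rs1 assume 1: "vars rs1 = vars rs" "rs1 (2 * 0 + 1) = aval w (vars rs) m (Bn Less (Vr v) e)"
      then have "rs1 1 = 0" using 0 ve[of i "vars rs" m] by (simp add: ev_def)
      moreover have "Q (vars rs1) m" using fin 0 1 by auto
      ultimately show "ok w A G Q' (Run (?L # cs') rs1) m (Suc K') (Suc W')"
        by (intro ok_Loop) (simp add: *(2))
    qed
    then show ?case by (rule ok_mono) auto
  next
    case (Suc j)
    let ?K = "esz e + 3 + j * (K + esz e + 4) + K'" and ?W = "esz e + 3 + j * (W + esz e + 4) + W'"
    have i: "i < N" using Suc.prems by simp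
    have "ok w A G Q' (Run (?t @ ?L # cs') rs) m (esz (Bn Less (Vr v) e) + Suc (K + Suc ?K))
        (esz (Bn Less (Vr v) e) + Suc (W + Suc ?W))"
    proof (rule ok_comp_e)
      show "reads_in w A (vars rs) m (Bn Less (Vr v) e)"
        using ve[of i "vars rs" m] Suc.prems by (simp add: ev_def)
      fix rs1 assume 1: "vars rs1 = vars rs" "rs1 (2 * 0 + 1) = aval w (vars rs) m (Bn Less (Vr v) e)"
      then have r: "rs1 1 = 1" using Suc.prems ve[of i "vars rs" m] by (simp add: ev_def)
      have "ok w A G Q' (Run (comps ds @ (Op Add (2 * v) (Reg (2 * v)) (Lit 1) # ?t @ ?L # cs')) rs1) m
          (K + Suc ?K) (W + Suc ?W)"
      proof (rule htD[OF body[OF i]])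
        show "I i (vars rs1) m" "vars rs1 v = i" "vars rs1 = vars rs1" using Suc.prems 1 by auto
        fix rs2 m2 assume 2: "vars rs2 v = i \<and> I (Suc i) ((vars rs2)(v := Suc i)) m2"
        have s: "Suc i mod 2 ^ w = Suc i" using N(1) i by simp
        have "rs2 (2 * v) = i" using 2 by (simp add: vars_apply)
        then have e2: "apply_op w Add (val w rs2 (Reg (2 * v))) (val w rs2 (Lit 1)) = Suc i"
          using s one by simp
        have "ok w A G Q' (Run (?t @ ?L # cs') (rs2(2 * v := Suc i))) m2 ?K ?W"
          by (rule Suc.IH[of "Suc i"]) (use Suc.prems 2 in \<open>auto simp: fun_upd_def\<close>)
        then show "ok w A G Q' (Run (Op Add (2 * v) (Reg (2 * v)) (Lit 1) # ?t @ ?L # cs') rs2) m2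
            (Suc ?K) (Suc ?W)"
          by (intro ok_Op) (simp only: e2)
      qed
      then show "ok w A G Q' (Run (?L # cs') rs1) m (Suc (K + Suc ?K)) (Suc (W + Suc ?W))"
        by (intro ok_Loop) (simp add: r[simplified])
    qed
    then show ?case by (rule ok_mono) auto
  qed
  have "ok w A G Q' (Run (Op Or (2 * v) (Lit 0) (Lit 0) # ?t @ ?L # cs') rs) m
     (Suc (esz e + 3 + N * (K + esz e + 4) + K')) (Suc (esz e + 3 + N * (W + esz e + 4) + W'))"
    by (rule ok_Op, rule loop[of 0]) (use init * in auto)
  then show "ok w A G Q' (Run (comps [For v e ds] @ cs') rs) m
      (esz e + 4 + N * (K + esz e + 4) + K') (esz e + 4 + N * (W + esz e + 4) + W')"
    by (simp add: comps_def ac_simps)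
qed

text \<open>Thread \<open>i\<close> of a parallel loop owns the cells \<open>a\<close> of \<open>R\<close> with \<open>own a = i\<close>.\<close>

lemma ht_Par:
  assumes "ev w A s m e N"
    and sub: "R \<subseteq> G" "R \<subseteq> A"
    and child: "\<And>i. i < N \<Longrightarrow>
        ht w (A - {a\<in>R. own a \<noteq> i}) {a\<in>R. own a = i} ds (s(v := i)) m (\<lambda>s' m'. P i m') K (W i)"
    and loc: "\<And>i m1 m2. i < N \<Longrightarrow> (\<And>a. a \<in> R \<Longrightarrow> own a = i \<Longrightarrow> m2 a = m1 a) \<Longrightarrow> P i m1 \<Longrightarrow> P i m2"
    and fin: "\<And>m'. (\<And>i. i < N \<Longrightarrow> P i m') \<Longrightarrow>
        (\<And>a. a \<in> A \<Longrightarrow> a \<notin> R \<or> N \<le> own a \<Longrightarrow> m' a = m a) \<Longrightarrow> Q s m'"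
  shows "ht w A G [Par v e ds] s m Q (esz e + 1 + K) (esz e + 1 + (\<Sum>i<N. W i))"
proof (rule htI)
  fix rs cs' Q' K' W'
  assume *: "vars rs = s" "\<And>rs' m'. Q (vars rs') m' \<Longrightarrow> ok w A G Q' (Run cs' rs') m' K' W'"
  have "ok w A G Q' (Run (comp_e 0 e @ ParFor (2 * v) (Reg 1) (comps ds) # cs') rs) m
      (esz e + Suc (K + K')) (esz e + Suc ((\<Sum>i<N. W i) + W'))"
  proof (rule ok_comp_e)
    fix rs1 assume 1: "vars rs1 = vars rs" "rs1 (2 * 0 + 1) = aval w (vars rs) m e"
    have val: "val w rs1 (Reg 1) = N" using 1 assms(1) * by (simp add: ev_def)
    have "ok w A G Q' (Run (ParFor (2 * v) (Reg 1) (comps ds) # cs') rs1) m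
        (Suc (K + K')) (Suc ((\<Sum>i<val w rs1 (Reg 1). W i) + W'))"
    proof (rule ok_ParFor[where Ac="\<lambda>i. A - {a\<in>R. own a \<noteq> i}" and Oc="\<lambda>i. {a\<in>R. own a = i}"
          and Qc = P], unfold val)
      fix i assume i: "i < N"
      have "ok w (A - {a\<in>R. own a \<noteq> i}) {a\<in>R. own a = i} (\<lambda>_. P i)
          (Run (comps ds @ []) (rs1(2 * v := i))) m (K + 0) (W i + 0)"
      proof (rule htD[OF child[OF i]])
        show "vars (rs1(2 * v := i)) = s(v := i)" using 1 * by simp
        fix rs' m' assume P: "P i m'"
        \<comment> \<open>A halted child waits while its siblings still write. Its result survives
          because, by \<open>loc\<close>, it depends only on the cells the child owns.\<close>
        show "ok w (A - {a\<in>R. own a \<noteq> i}) {a\<in>R. own a = i} (\<lambda>_. P i) (Run [] rs') m' 0 0"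
          by (rule ok_done, rule loc[OF i _ P]) (use sub in \<open>auto simp: agree_def\<close>)
      qed
      then show "ok w (A - {a\<in>R. own a \<noteq> i}) {a\<in>R. own a = i} (\<lambda>_. P i)
          (Run (comps ds) (rs1(2 * v := i))) m K (W i)" by simp
    next
      fix m' assume P: "\<And>i. i < N \<Longrightarrow> P i m'"
        and frame: "\<And>a. a \<in> A \<Longrightarrow> \<forall>i<N. a \<notin> {a \<in> R. own a = i} \<Longrightarrow> m' a = m a"
      have "Q s m'" by (rule fin[OF P]) (auto intro!: frame)
      then show "ok w A G Q' (Run cs' rs1) m' K' W'" using *(2)[of rs1 m'] 1 * by simp
    qed (use sub in auto)
    then show "ok w A G Q' (Run (ParFor (2 * v) (Reg 1) (comps ds) # cs') rs1) m
        (Suc (K + K')) (Suc ((\<Sum>i<N. W i) + W'))" unfolding val .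
  qed (use assms * in \<open>simp add: ev_def\<close>)
  then show "ok w A G Q' (Run (comps [Par v e ds] @ cs') rs) m
      (esz e + 1 + K + K') (esz e + 1 + (\<Sum>i<N. W i) + W')"
    by (simp add: comps_def add.assoc)
qed

subsection \<open>Straight-line code\<close>

fun stmt_cost :: "stmt \<Rightarrow> nat" where
  "stmt_cost (Asg x e) = esz e + 1"
| "stmt_cost (Wr a e) = esz a + esz e + 1"
| "stmt_cost (When e ds es) = esz e + 1 + sum_list (map stmt_cost ds) + sum_list (map stmt_cost es)"
| "stmt_cost _ = 0"

definition cost :: "stmt list \<Rightarrow> nat" where
  "cost cs = sum_list (map stmt_cost cs)"

text \<open>The cost is only meaningful for code without loops.\<close>

definition hs ::
  "nat \<Rightarrow> nat set \<Rightarrow> nat set \<Rightarrow> stmt list \<Rightarrow> (nat \<Rightarrow> nat) \<Rightarrow> mem \<Rightarrow> ((nat \<Rightarrow> nat) \<Rightarrow> mem \<Rightarrow> bool) \<Rightarrow> bool" where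
  "hs w A G cs s m Q = ht w A G cs s m Q (cost cs) (cost cs)"

lemma hs_Nil: "Q s m \<Longrightarrow> hs w A G [] s m Q"
  unfolding hs_def cost_def by (simp add: ht_Nil)

lemma hs_Asg:
  assumes "ev w A s m e v" "hs w A G cs (s(x := v)) m Q"
  shows "hs w A G (Asg x e # cs) s m Q"
proof -
  have "ht w A G (Asg x e # cs) s m Q (esz e + 1 + cost cs) (esz e + 1 + cost cs)"
    by (rule ht_Cons[OF ht_Asg[where Q="\<lambda>s' m'. s' = s(x := v) \<and> m' = m", OF assms(1)]])
      (use assms(2) in \<open>auto simp: hs_def\<close>)
  then show ?thesis by (simp add: hs_def cost_def)
qed

lemma hs_Wr:
  assumes "ev w A s m a x" "ev w A s m e v" "x \<in> G" "hs w A G cs s (m(x := v)) Q"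
  shows "hs w A G (Wr a e # cs) s m Q"
proof -
  have "ht w A G (Wr a e # cs) s m Q (esz a + esz e + 1 + cost cs) (esz a + esz e + 1 + cost cs)"
    by (rule ht_Cons[OF ht_Wr[where Q="\<lambda>s' m'. s' = s \<and> m' = m(x := v)", OF assms(1-3)]])
      (use assms(4) in \<open>auto simp: hs_def\<close>)
  then show ?thesis by (simp add: hs_def cost_def)
qed

text \<open>The continuation \<open>cs\<close> is verified separately behind either branch, so no
  common postcondition of the branches is needed. The cost adds both branches.\<close>

lemma hs_When:
  assumes "ev w A s m e v" "v \<noteq> 0 \<Longrightarrow> hs w A G (ds @ cs) s m Q" "v = 0 \<Longrightarrow> hs w A G (es @ cs) s m Q"
  shows "hs w A G (When e ds es # cs) s m Q"
  unfolding hs_def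
proof (rule htI)
  fix rs cs' Q' K' W'
  assume *: "vars rs = s" "\<And>rs' m'. Q (vars rs') m' \<Longrightarrow> ok w A G Q' (Run cs' rs') m' K' W'"
  let ?c = "cost (ds @ es @ cs)"
  let ?b = "if v \<noteq> 0 then ds else es"
  have "ok w A G Q' (Run (comp_e 0 e @ Cond (Reg 1) (comps ds) (comps es) # comps cs @ cs') rs) m
      (esz e + Suc (?c + K')) (esz e + Suc (?c + W'))"
  proof (rule ok_comp_e)
    fix rs1 assume 1: "vars rs1 = vars rs" "rs1 (2 * 0 + 1) = aval w (vars rs) m e"
    have "hs w A G (?b @ cs) s m Q" using assms(2,3) by simp
    then have "ok w A G Q' (Run (comps (?b @ cs) @ cs') rs1) m (cost (?b @ cs) + K') (cost (?b @ cs) + W')"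
      unfolding hs_def by (rule htD) (use 1 * in auto)
    then have "ok w A G Q' (Run ((if v \<noteq> 0 then comps ds else comps es) @ comps cs @ cs') rs1) m (?c + K') (?c + W')"
      by (cases "v = 0") (auto simp: cost_def elim!: ok_mono)
    then show "ok w A G Q' (Run (Cond (Reg 1) (comps ds) (comps es) # comps cs @ cs') rs1) m
        (Suc (?c + K')) (Suc (?c + W'))"
      using 1 assms(1) * by (intro ok_Cond) (simp add: ev_def)
  qed (use assms * in \<open>simp add: ev_def\<close>)
  then show "ok w A G Q' (Run (comps (When e ds es # cs) @ cs') rs) m
      (cost (When e ds es # cs) + K') (cost (When e ds es # cs) + W')"
    by (simp add: comps_def cost_def ac_simps)
qed

lemma ht_hs: "hs w A G cs s m Q \<Longrightarrow> ht w A G cs s m Q (cost cs) (cost cs)"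
  by (simp add: hs_def)

text \<open>Arguments arrive in registers 0, 1, 2, but variable \<open>x\<close> lives in register
  \<open>2 * x\<close>. Register 2 must be saved to 4 before it is overwritten by register
  1.\<close>

definition move_args :: prog where
  "move_args = [Op Or 4 (Reg 2) (Lit 0), Op Or 2 (Reg 1) (Lit 0)]"

lemma ht_computes:
  assumes "ht w UNIV G cs s m Q K W" "s 0 = rs 0" "s 1 = rs 1" "s 2 = rs 2"
    "\<And>x. 2 < x \<Longrightarrow> s x = rs (2 * x)"
    "\<And>s' rs' m'. Q s' m' \<Longrightarrow> rs' 0 = s' 0 \<Longrightarrow> Q' rs' m'"
    "real (W + 2) \<le> work" "real (K + 2) \<le> depth"
  shows "computes w (move_args @ comps cs) rs m work depth Q'"
proof (rule ok_computes)
  have "vars (rs(4 := rs 2, 2 := rs 1)) x = s x" for x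
  proof -
    consider "x = 0" | "x = 1" | "x = 2" | "2 < x" by linarith
    then show ?thesis using assms(2-5) by cases (auto simp: vars_apply)
  qed
  then have v: "vars (rs(4 := rs 2, 2 := rs 1)) = s" by blast
  have "ok w UNIV G Q' (Run (comps cs @ []) (rs(4 := rs 2, 2 := rs 1))) m (K + 0) (W + 0)"
  proof (rule htD[OF assms(1) v])
    fix rs' m' assume Q: "Q (vars rs') m'"
    show "ok w UNIV G Q' (Run [] rs') m' 0 0"
    proof (rule ok_done)
      fix m'' assume "agree UNIV m' m''"
      then have "m'' = m'" by (auto simp: agree_def)
      then show "Q' rs' m''" using assms(6)[OF Q] by (simp add: vars_apply)
    qed
  qed
  then show "ok w UNIV G Q' (Run (move_args @ comps cs) rs) m (K + 2) (W + 2)"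
    unfolding move_args_def by (auto intro!: ok_Op)
qed (use assms in auto)

subsection \<open>Digit sums\<close>

text \<open>The number with digits \<open>d 0, ..., d (N - 1)\<close> in base \<open>2 ^ s\<close>,
  least significant first. A word is treated as a short vector of such digits.\<close>

definition dsum :: "nat \<Rightarrow> nat \<Rightarrow> (nat \<Rightarrow> nat) \<Rightarrow> nat" where
  "dsum s N d = (\<Sum>i<N. d i * 2 ^ (s * i))"

lemma dsum_0 [simp]: "dsum s 0 d = 0"
  by (simp add: dsum_def)

lemma dsum_Suc: "dsum s (Suc N) d = dsum s N d + d N * 2 ^ (s * N)"
  by (simp add: dsum_def)

lemma dsum_less: "(\<And>i. i < N \<Longrightarrow> d i < 2 ^ s) \<Longrightarrow> dsum s N d < 2 ^ (s * N)"
proof (induction N)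
  case (Suc N)
  have "d N \<le> 2 ^ s - 1" using Suc.prems[of N] by simp
  then have "d N * 2 ^ (s * N) \<le> (2 ^ s - 1) * 2 ^ (s * N)" by (rule mult_right_mono) simp
  moreover have "dsum s N d < 2 ^ (s * N)" using Suc by simp
  ultimately have "dsum s (Suc N) d < 2 ^ (s * N) + (2 ^ s - 1) * 2 ^ (s * N)"
    unfolding dsum_Suc by linarith
  also have "\<dots> = 2 ^ (s * Suc N)"
    by (simp add: diff_mult_distrib power_add)
  finally show ?case .
qed simp

lemma bit_add_mult_power2:
  fixes a b :: nat
  assumes "a < 2 ^ n"
  shows "bit (a + b * 2 ^ n) j \<longleftrightarrow> (if j < n then bit a j else bit b (j - n))"
proof -
  have na: "\<not> bit a j" if "n \<le> j" for j
    using assms that by (metis bit_take_bit_iff leD take_bit_nat_eq_self)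
  have disj: "Bit_Operations.and a (push_bit n b) = 0"
    by (rule bit_eqI) (use na in \<open>auto simp: bit_simps\<close>)
  have "a + b * 2 ^ n = a + push_bit n b" by (simp add: push_bit_eq_mult)
  also have "\<dots> = Bit_Operations.or a (push_bit n b)" by (rule disjunctive_add_eq_or) (fact disj)
  finally have e: "a + b * 2 ^ n = Bit_Operations.or a (push_bit n b)" .
  show ?thesis unfolding e using na by (auto simp: bit_simps)
qed

lemma bit_dsum:
  assumes "\<And>i. i < N \<Longrightarrow> d i < 2 ^ s" "0 < s"
  shows "bit (dsum s N d) j \<longleftrightarrow> j div s < N \<and> bit (d (j div s)) (j mod s)"
  using assms(1)
proof (induction N)
  case (Suc N)
  have less: "dsum s N d < 2 ^ (s * N)" using Suc by (intro dsum_less) auto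
  have dN: "\<not> bit (d N) i" if "s \<le> i" for i
    using Suc.prems[of N] that by (metis bit_take_bit_iff leD lessI take_bit_nat_eq_self)
  have b: "bit (dsum s (Suc N) d) j \<longleftrightarrow> (if j < s * N then bit (dsum s N d) j else bit (d N) (j - s * N))"
    unfolding dsum_Suc using bit_add_mult_power2[OF less] by simp
  show ?case
  proof (cases "j < s * N")
    case True
    then have "j div s < N" using assms(2) by (simp add: div_less_iff_less_mult mult.commute)
    then show ?thesis using b True Suc by simp
  next
    case F: False
    then have ge: "N \<le> j div s" using assms(2) by (simp add: less_eq_div_iff_mult_less_eq mult.commute)
    show ?thesis
    proof (cases "j < s * Suc N")
      case True
      then have "j div s < Suc N" using assms(2) by (simp add: div_less_iff_less_mult mult.commute)
      then have eq: "j div s = N" using ge by simp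
      have "j - s * N = j mod s" using eq by (metis minus_mult_div_eq_mod)
      then show ?thesis using b F eq by simp
    next
      case False
      then have "Suc N \<le> j div s"
        using assms(2) by (metis less_eq_div_iff_mult_less_eq mult.commute not_less)
      moreover have "\<not> bit (d N) (j - s * N)" using False by (intro dN) (simp add: algebra_simps)
      ultimately show ?thesis using b F by simp
    qed
  qed
qed simp

text \<open>Casting out: \<open>2 ^ s\<close> is congruent to 1 modulo \<open>2 ^ s - 1\<close>, so
  a single remainder adds up all digits.\<close>

lemma dsum_mod:
  "dsum s N d mod (2 ^ s - 1) = (\<Sum>i<N. d i) mod (2 ^ s - 1)"
proof (induction N)
  case (Suc N)
  let ?M = "2 ^ s - 1 :: nat"
  have "2 ^ s mod ?M = (?M + 1) mod ?M" by simp
  also have "\<dots> = 1 mod ?M" by (metis mod_add_self1)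
  finally have "(2 ^ s) ^ N mod ?M = 1 ^ N mod ?M" by (metis power_mod)
  then have "d N * 2 ^ (s * N) mod ?M = d N * 1 mod ?M"
    by (intro mod_mult_cong) (simp_all only: power_mult power_one)
  then have "d N * 2 ^ (s * N) mod ?M = d N mod ?M" by (simp only: mult_1_right)
  then show ?case unfolding dsum_Suc sum.lessThan_Suc using Suc by (intro mod_add_cong)
qed simp

text \<open>The geometric series. Read as a division, it produces the word with a 1 in every digit
  in constantly many operations.\<close>

lemma dsum_ones: "dsum s N (\<lambda>_. 1) * (2 ^ s - 1) = 2 ^ (s * N) - 1"
proof (induction N)
  case (Suc N)
  have "dsum s (Suc N) (\<lambda>_. 1) * (2 ^ s - 1) = (2 ^ (s * N) - 1) + 2 ^ (s * N) * (2 ^ s - 1)"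
    unfolding dsum_Suc add_mult_distrib Suc by simp
  also have "\<dots> = 2 ^ (s * Suc N) - 1"
    by (simp add: diff_mult_distrib2 power_add mult.commute)
  finally show ?case .
qed simp

lemma dsum_ones_div: "0 < s \<Longrightarrow> (2 ^ (s * N) - 1) div (2 ^ s - 1) = dsum s N (\<lambda>_. 1)"
proof -
  assume "0 < s"
  then have "(2::nat) ^ s - 1 \<noteq> 0" by (metis diff_is_0_eq nat_power_eq_Suc_0_iff le_antisym
    less_numeral_extra(3) numeral_eq_one_iff One_nat_def one_le_numeral one_le_power semiring_norm(85))
  then show ?thesis by (metis dsum_ones nonzero_mult_div_cancel_right)
qed

lemma dsum_const: "z * dsum s N (\<lambda>_. 1) = dsum s N (\<lambda>_. z)"
  by (simp add: dsum_def sum_distrib_left)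

lemma one_less_power2: "(1::nat) < 2 ^ (c + 1)"
  by (rule one_less_power) auto

text \<open>Copies of \<open>z\<close> are laid out with stride \<open>c\<close>, the mask has
  stride \<open>c + 1\<close>. Since \<open>i * (c + 1) = i * c + i\<close>, the \<open>i\<close>-th
  mask bit hits exactly bit \<open>i\<close> of the \<open>i\<close>-th copy; every bit of
  \<open>z\<close> thus gets a digit of its own.\<close>

lemma dsum_spread:
  assumes "z < 2 ^ c"
  shows "Bit_Operations.and (dsum c c (\<lambda>_. z)) (dsum (c + 1) c (\<lambda>_. 1)) =
         dsum (c + 1) c (\<lambda>i. of_bool (bit z i))"
proof (cases "c = 0")
  case False
  have m: "bit (dsum (c + 1) c d) j \<longleftrightarrow> j div (c + 1) < c \<and> bit (d (j div (c + 1))) (j mod (c + 1))"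
    if "\<And>i. d i \<le> 1" for d j
  proof (rule bit_dsum)
    show "d i < 2 ^ (c + 1)" for i
      using that[of i] by (rule le_less_trans) (rule one_less_power2)
  qed simp
  have one: "bit (1::nat) i \<longleftrightarrow> i = 0" for i by (simp add: bit_Suc_0_iff)
  have ob: "bit (of_bool b :: nat) i \<longleftrightarrow> b \<and> i = 0" for b i by (cases b) (auto simp: bit_Suc_0_iff)
  show ?thesis
  proof (rule bit_eqI)
    fix j
    have "j div c = j div (c + 1) \<and> j mod c = j div (c + 1)"
      if "j div (c + 1) < c" "j mod (c + 1) = 0"
    proof -
      define i where "i = j div (c + 1)"
      have "j = i + i * c" using that(2) div_mult_mod_eq[of j "c + 1"] by (simp add: i_def)
      then show ?thesis using that(1) unfolding i_def[symmetric] by simp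
    qed
    moreover have "bit (dsum c c (\<lambda>_. z)) j \<longleftrightarrow> j div c < c \<and> bit z (j mod c)"
      by (rule bit_dsum) (use assms False in auto)
    moreover have "bit (dsum (c + 1) c (\<lambda>_. 1)) j \<longleftrightarrow> j div (c + 1) < c \<and> j mod (c + 1) = 0"
      by (subst m) (simp_all only: one order_refl)
    moreover have "bit (dsum (c + 1) c (\<lambda>i. of_bool (bit z i))) j \<longleftrightarrow>
        j div (c + 1) < c \<and> bit z (j div (c + 1)) \<and> j mod (c + 1) = 0"
      by (subst m) (simp_all only: ob of_bool_less_eq_one)
    ultimately show "bit (Bit_Operations.and (dsum c c (\<lambda>_. z)) (dsum (c + 1) c (\<lambda>_. 1))) j \<longleftrightarrow>
        bit (dsum (c + 1) c (\<lambda>i. of_bool (bit z i))) j"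
      unfolding bit_and_iff by metis
  qed
qed simp

text \<open>Multiplication by the all-ones vector adds up all shifted copies of \<open>d\<close>, so
  digit \<open>x\<close> collects \<open>d i\<close> for all \<open>i \<le> x\<close>. What is
  shifted beyond digit \<open>N\<close> is a multiple of \<open>2 ^ (s * N)\<close>.\<close>

lemma dsum_prefix:
  "dsum s N d * dsum s N (\<lambda>_. 1) mod 2 ^ (s * N) = dsum s N (\<lambda>x. \<Sum>i\<le>x. d i) mod 2 ^ (s * N)"
proof -
  \<comment> \<open>The all-ones vector shifted by \<open>i\<close> digits, separated into the
    digits below \<open>N\<close> and the overflow.\<close>
  have row: "2 ^ (s * i) * dsum s N (\<lambda>_. 1) = (\<Sum>x\<in>{i..<N}. 2 ^ (s * x)) + 2 ^ (s * N) * dsum s i (\<lambda>_. 1)"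
    if "i \<le> N" for i
  proof -
    have "2 ^ (s * i) * dsum s N (\<lambda>_. 1) = (\<Sum>x\<in>{0..<N}. 2 ^ (s * (x + i)))"
      unfolding dsum_def by (simp add: sum_distrib_left power_add algebra_simps atLeast0LessThan)
    also have "\<dots> = (\<Sum>x\<in>{0 + i..<N + i}. 2 ^ (s * x))"
      by (rule sum.shift_bounds_nat_ivl[symmetric])
    also have "\<dots> = (\<Sum>x\<in>{i..<N}. 2 ^ (s * x)) + (\<Sum>x\<in>{N..<N + i}. 2 ^ (s * x))"
      using that by (simp add: sum.atLeastLessThan_concat)
    also have "(\<Sum>x\<in>{N..<N + i}. 2 ^ (s * x)) = (\<Sum>x\<in>{0..<i}. 2 ^ (s * (x + N)))"
      using sum.shift_bounds_nat_ivl[of "\<lambda>x. 2 ^ (s * x)" 0 N i] by (simp add: add.commute)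
    also have "\<dots> = 2 ^ (s * N) * dsum s i (\<lambda>_. 1)"
      unfolding dsum_def by (simp add: sum_distrib_left power_add algebra_simps atLeast0LessThan)
    finally show ?thesis .
  qed
  have "dsum s N d * dsum s N (\<lambda>_. 1) = (\<Sum>i<N. d i * (2 ^ (s * i) * dsum s N (\<lambda>_. 1)))"
    by (subst dsum_def) (simp add: sum_distrib_right mult.assoc)
  also have "\<dots> = (\<Sum>i<N. d i * ((\<Sum>x\<in>{i..<N}. 2 ^ (s * x)) + 2 ^ (s * N) * dsum s i (\<lambda>_. 1)))"
    by (intro sum.cong refl arg_cong2[where f="(*)"] row) simp
  also have "\<dots> = (\<Sum>i<N. d i * (\<Sum>x\<in>{i..<N}. 2 ^ (s * x))) + 2 ^ (s * N) * (\<Sum>i<N. d i * dsum s i (\<lambda>_. 1))"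
    by (simp add: distrib_left sum.distrib sum_distrib_left mult.left_commute)
  also have "(\<Sum>i<N. d i * (\<Sum>x\<in>{i..<N}. 2 ^ (s * x))) = (\<Sum>i<N. \<Sum>x\<in>{x\<in>{..<N}. i \<le> x}. d i * 2 ^ (s * x))"
    by (intro sum.cong refl) (auto simp: sum_distrib_left intro!: sum.cong)
  also have "\<dots> = (\<Sum>x<N. \<Sum>i\<in>{i\<in>{..<N}. i \<le> x}. d i * 2 ^ (s * x))"
    by (rule sum.swap_restrict) auto
  also have "\<dots> = dsum s N (\<lambda>x. \<Sum>i\<le>x. d i)"
    unfolding dsum_def by (intro sum.cong refl) (auto simp: sum_distrib_right intro!: sum.cong)
  finally show ?thesis by simp
qed

subsection \<open>Counting and searching inside a short block of bits\<close>

definition pop :: "nat \<Rightarrow> nat \<Rightarrow> nat" where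
  "pop z x = card {i. i < x \<and> bit z i}"

lemma pop_sum: "(\<Sum>i<x. of_bool (bit z i)) = pop z x"
proof -
  have "(\<Sum>i<x. of_bool (bit z i)) = card ({..<x} \<inter> {i. bit z i})" by (simp add: sum.If_cases of_bool_def)
  then show ?thesis by (simp add: pop_def Int_def)
qed

lemma pop_le: "pop z x \<le> x"
  unfolding pop_sum[symmetric] by (rule order_trans[OF sum_mono[of _ _ "\<lambda>_. 1"]]) auto

text \<open>The number of ones is at most \<open>c\<close>, hence smaller than the modulus, and the
  remainder is the count itself.\<close>

lemma pop_via_mod:
  assumes "c < 2 ^ (c + 1) - 1"
  shows "dsum (c + 1) c (\<lambda>i. of_bool (bit z i)) mod (2 ^ (c + 1) - 1) = pop z c"
  unfolding dsum_mod pop_sum using pop_le[of z c] assms by simp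

lemma blk_less: "(c::nat) < 2 ^ (c + 1) - 1"
  using less_exp[of c] by (simp del: less_exp)

text \<open>A comparison in all digits at once. Every digit of width \<open>c + 1\<close> holds
  \<open>2 ^ c + k\<close> minus a prefix count; no digit borrows from its neighbour, and its top
  bit survives iff the prefix count is at most \<open>k\<close>. Isolating the top bits and adding
  them up counts the positions up to which at most \<open>k\<close> ones have occurred, which is the
  position of the \<open>k\<close>-th one, counted from 0.\<close>

lemma search_block:
  fixes c k z :: nat
  assumes "0 < c" "k < 2 ^ c"
  defines "S \<equiv> c + 1" and "O1 \<equiv> dsum (c + 1) c (\<lambda>_. 1)"
  defines "Y \<equiv> dsum (c + 1) c (\<lambda>i. of_bool (bit z i))"
  shows "Y * O1 mod 2 ^ (S * c) \<le> (2 ^ c + k) * O1"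
    and "(2 ^ c + k) * O1 < 2 ^ (S * c)"
    and "Bit_Operations.and (((2 ^ c + k) * O1 - Y * O1 mod 2 ^ (S * c)) div 2 ^ c) O1 mod (2 ^ S - 1) =
         card {x. x < c \<and> pop z (Suc x) \<le> k}"
proof -
  let ?pre = "\<lambda>x. pop z (Suc x)"
  have pre: "?pre x < 2 ^ c" if "x < c" for x
    using pop_le[of z "Suc x"] that by (metis Suc_leI le_trans less_exp order.strict_trans1)
  have "Y * O1 mod 2 ^ (S * c) = dsum S c (\<lambda>x. \<Sum>i\<le>x. of_bool (bit z i)) mod 2 ^ (S * c)"
    unfolding Y_def O1_def S_def by (rule dsum_prefix)
  also have "dsum S c (\<lambda>x. \<Sum>i\<le>x. of_bool (bit z i)) = dsum S c ?pre"
    by (simp add: pop_sum[symmetric] lessThan_Suc_atMost)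
  also have "\<dots> < 2 ^ (S * c)"
    by (rule dsum_less) (use pre in \<open>force simp: S_def\<close>)
  then have "dsum S c ?pre mod 2 ^ (S * c) = dsum S c ?pre" by simp
  finally have e1: "Y * O1 mod 2 ^ (S * c) = dsum S c ?pre" .
  have e2: "(2 ^ c + k) * O1 = dsum S c (\<lambda>_. 2 ^ c + k)"
    unfolding O1_def S_def by (rule dsum_const)
  have le: "?pre x \<le> 2 ^ c + k" if "x < c" for x using pre[OF that] by simp
  show "Y * O1 mod 2 ^ (S * c) \<le> (2 ^ c + k) * O1"
    unfolding e1 e2 dsum_def by (intro sum_mono mult_right_mono le) auto
  show "(2 ^ c + k) * O1 < 2 ^ (S * c)"
    unfolding e2 by (rule dsum_less) (use assms(2) in \<open>simp add: S_def\<close>)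
  define f where "f x = 2 ^ c + k - ?pre x" for x
  have f: "f x < 2 ^ S" for x unfolding f_def S_def using assms(2) by simp
  have e3: "(2 ^ c + k) * O1 - Y * O1 mod 2 ^ (S * c) = dsum S c f"
    unfolding e1 e2 dsum_def f_def
    by (subst sum_subtractf_nat[symmetric]) (auto simp: diff_mult_distrib intro!: le)
  have fbit: "bit (f x) c \<longleftrightarrow> ?pre x \<le> k" if "x < c" for x
  proof -
    have "odd (f x div 2 ^ c) \<longleftrightarrow> ?pre x \<le> k"
    proof (cases "?pre x \<le> k")
      case True
      then have "f x = (k - ?pre x) + 2 ^ c" unfolding f_def by simp
      moreover have "k - ?pre x < 2 ^ c" using assms(2) by simp
      ultimately have "f x div 2 ^ c = 1" by simp
      then show ?thesis using True by simp
    next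
      case False
      then have "f x < 2 ^ c" unfolding f_def using pre[OF that] by simp
      then show ?thesis using False by simp
    qed
    then show ?thesis by (simp add: bit_iff_odd)
  qed
  have one: "bit (1::nat) i \<longleftrightarrow> i = 0" for i by (simp add: bit_Suc_0_iff)
  have ob: "bit (of_bool b :: nat) i \<longleftrightarrow> b \<and> i = 0" for b i by (cases b) (auto simp: bit_Suc_0_iff)
  have e4: "Bit_Operations.and (dsum S c f div 2 ^ c) O1 = dsum S c (\<lambda>x. of_bool (?pre x \<le> k))"
  proof (rule bit_eqI)
    fix j
    have s1: "(1::nat) < 2 ^ S" unfolding S_def by (rule one_less_power2)
    have o1: "of_bool b < (2::nat) ^ S" for b using s1 by (cases b) auto
    have L: "bit (dsum S c f div 2 ^ c) j \<longleftrightarrow> (c + j) div S < c \<and> bit (f ((c + j) div S)) ((c + j) mod S)"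
      using bit_dsum[of c f S "c + j"] f unfolding S_def
      by (simp add: drop_bit_eq_div[symmetric] bit_drop_bit_eq)
    have L2: "bit O1 j \<longleftrightarrow> j div S < c \<and> j mod S = 0"
      unfolding O1_def using bit_dsum[of c "\<lambda>_. 1" S j] s1 one unfolding S_def by simp
    have Rr: "bit (dsum S c (\<lambda>x. of_bool (?pre x \<le> k))) j \<longleftrightarrow>
        j div S < c \<and> ?pre (j div S) \<le> k \<and> j mod S = 0"
      using bit_dsum[of c "\<lambda>x. of_bool (?pre x \<le> k)" S j] o1 ob unfolding S_def by simp
    \<comment> \<open>The shift by \<open>c\<close> moves the top bit of each digit to the lowest
      position of that digit, where the mask of ones picks it.\<close>
    have "(c + j) div S = j div S \<and> (c + j) mod S = c" if "j mod S = 0"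
    proof -
      from that have "S dvd j" by (simp add: mod_eq_0_iff_dvd)
      then obtain i where j: "j = S * i" by (rule dvdE)
      have "c < S" by (simp add: S_def)
      then show ?thesis unfolding j by simp
    qed
    then show "bit (Bit_Operations.and (dsum S c f div 2 ^ c) O1) j \<longleftrightarrow>
        bit (dsum S c (\<lambda>x. of_bool (?pre x \<le> k))) j"
      unfolding bit_and_iff L L2 Rr using fbit[of "j div S"] by (cases "j mod S = 0") auto
  qed
  have "(\<Sum>x<c. of_bool (?pre x \<le> k)) = card {x. x < c \<and> ?pre x \<le> k}"
    by (simp add: sum.If_cases of_bool_def Int_def)
  moreover have "card {x. x < c \<and> ?pre x \<le> k} \<le> c"
    using card_mono[of "{..<c}" "{x. x < c \<and> ?pre x \<le> k}"] by auto
  ultimately show "Bit_Operations.and (((2 ^ c + k) * O1 - Y * O1 mod 2 ^ (S * c)) div 2 ^ c) O1 mod (2 ^ S - 1) =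
         card {x. x < c \<and> pop z (Suc x) \<le> k}"
    unfolding e3 e4 dsum_mod using blk_less[of c] unfolding S_def by simp
qed

section \<open>The word operations as expressions\<close>

abbreviation "addE a b \<equiv> Bn Add a b"
abbreviation "subE a b \<equiv> Bn Sub a b"
abbreviation "mulE a b \<equiv> Bn Mul a b"
abbreviation "divE a b \<equiv> Bn Div a b"
abbreviation "modE a b \<equiv> Bn Mod a b"
abbreviation "lessE a b \<equiv> Bn Less a b"
abbreviation "pow2E a \<equiv> Bn Shl (Cn 1) a"

lemma ev_pow2: "ev w A s m e k \<Longrightarrow> k < w \<Longrightarrow> ev w A s m (pow2E e) (2 ^ k)"
  by (rule ev_eq[OF ev_Shl_small[OF ev_N]]) (auto intro: one_less_power simp del: One_nat_def)

lemma ev_pow2_minus: "ev w A s m e k \<Longrightarrow> k < w \<Longrightarrow> ev w A s m (subE (pow2E e) (Cn 1)) (2 ^ k - 1)"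
  by (intro ev_Sub ev_pow2 ev_N) (auto intro: one_less_power simp del: One_nat_def)

definition onesE :: "expr \<Rightarrow> expr \<Rightarrow> expr" where
  "onesE s N = divE (subE (pow2E (mulE s N)) (Cn 1)) (subE (pow2E s) (Cn 1))"

definition spreadE :: "expr \<Rightarrow> expr \<Rightarrow> expr" where
  "spreadE c z = Bn And (mulE z (onesE c c)) (onesE (addE c (Cn 1)) c)"

definition popE :: "expr \<Rightarrow> expr \<Rightarrow> expr" where
  "popE c z = modE (spreadE c z) (subE (pow2E (addE c (Cn 1))) (Cn 1))"

definition searchE :: "expr \<Rightarrow> expr \<Rightarrow> expr \<Rightarrow> expr" where
  "searchE c z k = modE (Bn And (Bn Shr (subE (mulE (addE (pow2E c) k) (onesE (addE c (Cn 1)) c))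
      (modE (mulE (spreadE c z) (onesE (addE c (Cn 1)) c)) (pow2E (mulE (addE c (Cn 1)) c)))) c)
      (onesE (addE c (Cn 1)) c)) (subE (pow2E (addE c (Cn 1))) (Cn 1))"

lemma ev_ones:
  assumes "ev w A s m a x" "ev w A s m b y" "0 < x" "0 < y" "x * y < w"
  shows "ev w A s m (onesE a b) (dsum x y (\<lambda>_. 1))"
proof -
  have "x \<le> x * y" using assms by simp
  then have "x < w" using assms(5) by (rule le_less_trans)
  moreover have "w < 2 ^ w" by simp
  ultimately show ?thesis unfolding onesE_def
    by (intro ev_eq[OF ev_Div dsum_ones_div] ev_pow2_minus ev_Mul assms) (use assms in linarith)+
qed

lemma ev_spread:
  assumes c: "ev w A s m a c" and z: "ev w A s m b z" and "0 < c" "z < 2 ^ c" "(c + 1) * c < w"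
  shows "ev w A s m (spreadE a b) (dsum (c + 1) c (\<lambda>i. of_bool (bit z i)))"
proof -
  have w: "w < 2 ^ w" by simp
  have cw: "c * c < w" "c + 1 < w + 1" "c < w" using assms(3,5) by (auto simp: algebra_simps)
  have "z * dsum c c (\<lambda>_. 1) < 2 ^ (c * c)"
    unfolding dsum_const by (rule dsum_less) (use assms in simp)
  also have "(2::nat) ^ (c * c) < 2 ^ w" using cw(1) by simp
  finally have zc: "z * dsum c c (\<lambda>_. 1) < 2 ^ w" .
  have "ev w A s m (spreadE a b) (Bit_Operations.and (z * dsum c c (\<lambda>_. 1)) (dsum (c + 1) c (\<lambda>_. 1)))"
    unfolding spreadE_def
    by (intro ev_And ev_Mul ev_ones ev_Add ev_N c z zc) (use assms cw w le_less_trans[OF _ w, of "c + 1"] in \<open>simp_all del: One_nat_def\<close>)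
  then show ?thesis unfolding dsum_const dsum_spread[OF assms(4)] .
qed

lemma ev_pop:
  assumes "ev w A s m a c" "ev w A s m b z" "0 < c" "z < 2 ^ c" "(c + 1) * c < w" "c + 1 < w"
  shows "ev w A s m (popE a b) (pop z c)"
proof -
  have w: "w < 2 ^ w" by simp
  have "ev w A s m (popE a b) (dsum (c + 1) c (\<lambda>i. of_bool (bit z i)) mod (2 ^ (c + 1) - 1))"
    unfolding popE_def
    by (intro ev_Mod ev_spread ev_pow2_minus ev_Add ev_N assms)
      (use assms less_trans[OF assms(6) w] in \<open>simp_all del: One_nat_def\<close>)
  then show ?thesis using pop_via_mod[OF blk_less[of c]] by simp
qed

lemma ev_search:
  assumes c: "ev w A s m a c" and z: "ev w A s m b z" and k: "ev w A s m e k"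
    and "0 < c" "z < 2 ^ c" "(c + 1) * c < w" "c + 1 < w" "k < 2 ^ c"
  shows "ev w A s m (searchE a b e) (card {x. x < c \<and> pop z (Suc x) \<le> k})"
proof -
  have w: "w < 2 ^ w" by simp
  let ?O = "dsum (c + 1) c (\<lambda>_. 1)" and ?Y = "dsum (c + 1) c (\<lambda>i. of_bool (bit z i))"
  note sb = search_block(1)[of c k z, OF assms(4,8)] search_block(2)[OF assms(4,8)]
    search_block(3)[of c k z, OF assms(4,8)]
  have pw: "(2::nat) ^ ((c + 1) * c) < 2 ^ w" using assms(6) by (simp del: One_nat_def)
  have p1: "2 ^ c + k < (2::nat) ^ w"
  proof -
    have "2 ^ c + k < (2::nat) ^ (c + 1)" using assms(8) by simp
    also have "\<dots> \<le> 2 ^ w" using assms(7) by (intro power_increasing) auto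
    finally show ?thesis .
  qed
  \<comment> \<open>The machine product is reduced modulo \<open>2 ^ w\<close>; this is harmless
    because \<open>2 ^ ((c + 1) * c)\<close> divides \<open>2 ^ w\<close>.\<close>
  have mm: "(?Y * ?O mod 2 ^ w) mod 2 ^ ((c + 1) * c) = ?Y * ?O mod 2 ^ ((c + 1) * c)"
    by (rule mod_mod_cancel) (use assms(6) in \<open>simp add: le_imp_power_dvd del: One_nat_def\<close>)
  have c1: "c + 1 < 2 ^ w" "(c + 1) * c < 2 ^ w" "c < w" using assms(6,7) w by linarith+
  have one: "1 < (2::nat) ^ w" using c1(1) by linarith
  have e0: "ev w A s m (addE a (Cn 1)) (c + 1)" by (intro ev_Add ev_N c one c1)
  have e1: "ev w A s m (onesE (addE a (Cn 1)) a) ?O"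
    by (rule ev_ones[OF e0 c]) (use assms in simp_all)
  have e2: "ev w A s m (modE (mulE (spreadE a b) (onesE (addE a (Cn 1)) a)) (pow2E (mulE (addE a (Cn 1)) a)))
      (?Y * ?O mod 2 ^ w mod 2 ^ ((c + 1) * c))"
    by (intro ev_Mod ev_Mul_mod ev_spread[OF c z assms(4-6)] e1 ev_pow2 ev_Mul e0 c c1 assms(6))
  have e3: "ev w A s m (mulE (addE (pow2E a) e) (onesE (addE a (Cn 1)) a)) ((2 ^ c + k) * ?O)"
    by (intro ev_Mul ev_Add ev_pow2 e1 c k c1 p1 less_trans[OF sb(2) pw])
  have "ev w A s m (searchE a b e) (Bit_Operations.and (((2 ^ c + k) * ?O - (?Y * ?O mod 2 ^ w) mod 2 ^ ((c + 1) * c)) div 2 ^ c) ?O mod (2 ^ (c + 1) - 1))"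
    unfolding searchE_def
    by (intro ev_Mod ev_And ev_Shr ev_Sub e3 e2 e1 c ev_pow2_minus e0 assms(7) less_trans[OF sb(2) pw])
      (use sb(1) mm in simp)
  then show ?thesis unfolding mm sb(3) .
qed

subsection \<open>Rank and its partial inverse\<close>

lemma rank_0 [simp]: "rank v B 0 = 0"
  by (simp add: rank_def)

lemma rank_Suc: "y < length B \<Longrightarrow> rank v B (Suc y) = rank v B y + of_bool (B ! y = v)"
  by (simp add: rank_def take_Suc_conv_app_nth)

lemma rank_beyond: "length B \<le> y \<Longrightarrow> rank v B y = count_list B v"
  by (simp add: rank_def)

lemma rank_mono: "x \<le> y \<Longrightarrow> rank v B x \<le> rank v B y"
proof (induction y rule: dec_induct)
  case (step y)
  have "rank v B y \<le> rank v B (Suc y)"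
    by (cases "y < length B") (auto simp: rank_Suc rank_beyond)
  then show ?case using step by simp
qed simp

lemma rank_le_count: "rank v B y \<le> count_list B v"
  using rank_mono[of y "max y (length B)" v B] rank_beyond[of B "max y (length B)" v] by simp

lemma rank_diff_le: "x \<le> y \<Longrightarrow> rank v B y \<le> rank v B x + (y - x)"
proof (induction y rule: dec_induct)
  case (step y)
  have "rank v B (Suc y) \<le> rank v B y + 1"
    by (cases "y < length B") (auto simp: rank_Suc rank_beyond)
  then show ?case using step by simp
qed simp

lemma rank_le: "rank v B y \<le> y"
  using rank_diff_le[of 0 y v B] by simp

lemma rank_False: "y \<le> length B \<Longrightarrow> rank False B y = y - rank True B y"
proof (induction y)
  case (Suc y)
  then show ?case using rank_le[of True B y] by (auto simp: rank_Suc)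
qed simp

text \<open>\<open>after v B j\<close> is the position just behind the \<open>j\<close>-th occurrence of \<open>v\<close>.\<close>

definition after :: "bool \<Rightarrow> bool list \<Rightarrow> nat \<Rightarrow> nat" where
  "after v B j = (if j \<le> count_list B v then LEAST y. j \<le> rank v B y else length B)"

text \<open>\<open>after\<close> and \<open>rank\<close> form a Galois connection, as
  \<open>rank\<close> is monotone; the order facts below all come from it.\<close>

lemma after_le_iff:
  assumes "j \<le> count_list B v"
  shows "after v B j \<le> y \<longleftrightarrow> j \<le> rank v B y"
proof -
  have ex: "j \<le> rank v B (length B)" using assms by (simp add: rank_beyond)
  have a: "after v B j = (LEAST y. j \<le> rank v B y)" using assms by (simp add: after_def)
  have "j \<le> rank v B (after v B j)" unfolding a by (rule LeastI, rule ex)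
  then show ?thesis
    using rank_mono[of "after v B j" y v B] Least_le[of "\<lambda>y. j \<le> rank v B y" y] unfolding a
    by (meson le_trans)
qed

lemma after_le_length: "after v B j \<le> length B"
proof (cases "j \<le> count_list B v")
  case True
  then show ?thesis using after_le_iff[OF True, of "length B"] by (simp add: rank_beyond)
qed (simp add: after_def)

lemma after_0 [simp]: "after v B 0 = 0"
  using after_le_iff[of 0 B v 0] by simp

lemma after_mono: "i \<le> j \<Longrightarrow> after v B i \<le> after v B j"
proof (cases "j \<le> count_list B v")
  case True
  assume "i \<le> j"
  moreover have "j \<le> rank v B (after v B j)" using after_le_iff[OF True, of "after v B j"] by simp
  ultimately show ?thesis using after_le_iff[of i B v "after v B j"] True by simp
next
  case False
  then show ?thesis using after_le_length by (simp add: after_def[of v B j])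
qed

lemma after_unique:
  assumes "0 < y" "y \<le> length B" "B ! (y - 1) = v" "rank v B y = j"
  shows "after v B j = y"
proof -
  have j: "j \<le> count_list B v" using assms rank_le_count by metis
  have "rank v B y = rank v B (y - 1) + 1"
    using rank_Suc[of "y - 1" B v] assms by simp
  then have "\<not> after v B j \<le> y - 1" using after_le_iff[OF j] assms by simp
  moreover have "after v B j \<le> y" using after_le_iff[OF j] assms by simp
  ultimately show ?thesis using assms by linarith
qed

lemma select_props:
  assumes "k < rank v B n" "n \<le> length B"
  shows "k < length (filter (\<lambda>j. B ! j = v) [0..<n]) \<and>
    (let y = filter (\<lambda>j. B ! j = v) [0..<n] ! k in y < n \<and> B ! y = v \<and> rank v B y = k)"
  using assms
proof (induction n)
  case (Suc n)
  have len: "length (filter (\<lambda>j. B ! j = v) [0..<n]) = rank v B n" if "n \<le> length B" for n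
    using that by (induction n) (auto simp: rank_Suc)
  show ?case
  proof (cases "k < rank v B n")
    case True
    then have "k < length (filter (\<lambda>j. B ! j = v) [0..<n])" using len Suc.prems by simp
    then show ?thesis using Suc.IH True Suc.prems by (auto simp: Let_def nth_append)
  next
    case False
    moreover have "rank v B (Suc n) = rank v B n + of_bool (B ! n = v)" using Suc.prems by (simp add: rank_Suc)
    ultimately have "B ! n = v" "k = rank v B n" using Suc.prems by (cases "B ! n = v"; simp)+
    then show ?thesis using len[of n] Suc.prems by (auto simp: Let_def nth_append)
  qed
qed simp

text \<open>\<open>select\<close> counts occurrences from 0 and gives the position of one,
  \<open>after\<close> counts from 1 and gives the position behind one; this accounts for both
  successors.\<close>

lemma select_after:
  assumes "k < count_list B v"
  shows "select v B k < length B" "B ! select v B k = v" "rank v B (select v B k) = k"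
    "after v B (Suc k) = Suc (select v B k)"
proof -
  have "k < rank v B (length B)" using assms by (simp add: rank_beyond)
  from select_props[OF this]
  show *: "select v B k < length B" "B ! select v B k = v" "rank v B (select v B k) = k"
    by (auto simp: select_def Let_def)
  show "after v B (Suc k) = Suc (select v B k)"
    by (rule after_unique) (use * in \<open>auto simp: rank_Suc\<close>)
qed

subsection \<open>The rank/select structure of a node\<close>

text \<open>
  Both levels of the directory have the same shape: sampled ranks, and for either bit value the
  positions behind every \<open>T\<close>-th occurrence together with explicit answers for those groups of
  \<open>T\<close> occurrences that spread over at least \<open>D\<close> positions. A sparse group contains a position
  \<open>(u + 1) * D - 1\<close>, which makes \<open>u\<close> a slot for its explicit answers that no other group uses.
  Positions are relative to the enclosing block of the coarser level, given by \<open>Tc\<close>; with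
  \<open>Tc = 0\<close> they are absolute because \<open>x div 0 = 0\<close>.
\<close>

definition entries :: "nat \<Rightarrow> nat \<Rightarrow> nat \<Rightarrow> nat" where
  "entries n T D = n div T + 2 * (n div T + n div D * T)"

text \<open>An index beyond the samples encodes slot \<open>u\<close> and offset \<open>t\<close> as
  \<open>u * T + t\<close>. The group that the slot serves is recovered from the rank at the probe
  \<open>Suc u * D - 1\<close>. Hence every entry can be computed on its own, without knowing which
  groups are sparse.\<close>

definition occ :: "bool list \<Rightarrow> nat \<Rightarrow> nat \<Rightarrow> bool \<Rightarrow> nat \<Rightarrow> nat" where
  "occ B T D v i = (if i < length B div T then Suc i * T
     else rank v B (Suc ((i - length B div T) div T) * D - 1) div T * T +
          (i - length B div T) mod T + 1)"

text \<open>The layout is \<open>q\<close> rank samples, then \<open>q'\<close> position entries for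
  \<open>False\<close> and \<open>q'\<close> for \<open>True\<close>. Ranks are sampled for
  \<open>True\<close> only, since those of \<open>False\<close> are the complement. Using
  \<open>c - 1\<close> makes the last occurrence of a coarse group relative to the start of that
  group and not of the next one.\<close>

definition entry :: "bool list \<Rightarrow> nat \<Rightarrow> nat \<Rightarrow> nat \<Rightarrow> nat \<Rightarrow> nat" where
  "entry B T D Tc j =
     (let q = length B div T; q' = q + length B div D * T in
      if j < q then rank True B (Suc j * T) - rank True B (Suc j * T div Tc * Tc)
      else let v = (q' \<le> j - q); c = occ B T D v ((j - q) - (if v then q' else 0))
           in after v B c - after v B ((c - 1) div Tc * Tc))"

text \<open>The rates make each kind of entry take at most a fraction \<open>1 / r\<close> of the
  bitmap: a sample of \<open>w\<close> bits every \<open>w * r ^ 2\<close> items, and for a sparse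
  group \<open>T1\<close> answers of \<open>w\<close> bits per \<open>T1 * w * r\<close> positions.
  The second level repeats this with entries of \<open>r\<close> bits, which gives
  \<open>r ^ 2\<close> and \<open>r ^ 4\<close>.\<close>

definition T1 :: "nat \<Rightarrow> nat \<Rightarrow> nat" where "T1 w r = w * (r * r)"
definition D1 :: "nat \<Rightarrow> nat \<Rightarrow> nat" where "D1 w r = T1 w r * (w * r)"
definition T2 :: "nat \<Rightarrow> nat" where "T2 r = r * r"
definition D2 :: "nat \<Rightarrow> nat" where "D2 r = T2 r * T2 r"

definition ents1 :: "nat \<Rightarrow> nat \<Rightarrow> nat \<Rightarrow> nat" where "ents1 w r n = entries n (T1 w r) (D1 w r)"
definition ents2 :: "nat \<Rightarrow> nat \<Rightarrow> nat" where "ents2 r n = entries n (T2 r) (D2 r)"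

definition aux_bits :: "nat \<Rightarrow> nat \<Rightarrow> nat \<Rightarrow> nat" where
  "aux_bits w r n = ents1 w r n * w + ents2 r n * r"

text \<open>The memory image of a node, bitmap followed by both directory levels, given bit by bit.
  In this form any word of it can be produced without the others.\<close>

definition node_bit :: "nat \<Rightarrow> nat \<Rightarrow> bool list \<Rightarrow> nat \<Rightarrow> bool" where
  "node_bit w r B x =
     (if x < length B then B ! x
      else let y = x - length B; e = ents1 w r (length B) * w in
        if y < e then bit (entry B (T1 w r) (D1 w r) 0 (y div w)) (y mod w)
        else bit (entry B (T2 r) (D2 r) (T1 w r) ((y - e) div r)) ((y - e) mod r))"

lemma entry_rank:
  "j < length B div T \<Longrightarrow>
   entry B T D Tc j = rank True B (Suc j * T) - rank True B (Suc j * T div Tc * Tc)"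
  by (simp add: entry_def)

lemma entry_occ:
  assumes "i < length B div T + length B div D * T"
  shows "entry B T D Tc (length B div T + of_bool v * (length B div T + length B div D * T) + i) =
     after v B (occ B T D v i) - after v B ((occ B T D v i - 1) div Tc * Tc)"
  using assms by (cases v) (auto simp: entry_def Let_def)

lemma occ_sample: "i < length B div T \<Longrightarrow> occ B T D v i = Suc i * T"
  by (simp add: occ_def)

text \<open>The probe is the last position of the aligned block of \<open>D\<close> positions that
  contains the start of the group. A group spreading over at least \<open>D\<close> positions
  reaches beyond the probe, so the rank there still belongs to the same group.\<close>

lemma occ_slot:
  assumes k: "k < count_list B v" and D: "0 < D" and T: "0 < T"
    and sparse: "after v B (k div T * T) + D \<le> after v B (Suc (k div T) * T)"
  defines "u \<equiv> after v B (k div T * T) div D"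
  shows "u < length B div D" "occ B T D v (length B div T + u * T + k mod T) = Suc k"
proof -
  let ?X = "after v B (k div T * T)" and ?X' = "after v B (Suc (k div T) * T)"
  define y where "y = Suc u * D - 1"
  have XD: "u * D \<le> ?X" "?X < Suc u * D"
    using D by (simp_all add: u_def dividend_less_div_times)
  have y: "?X \<le> y" "y < ?X'" "Suc y = Suc u * D" using XD sparse D unfolding y_def by auto
  have "Suc u * D \<le> length B" using y after_le_length[of v B "Suc (k div T) * T"] by simp
  then have "Suc u \<le> length B div D" using D by (simp add: less_eq_div_iff_mult_less_eq)
  then show "u < length B div D" by simp
  have kT: "k div T * T \<le> count_list B v" using k div_times_less_eq_dividend[of k T] by linarith
  have lo: "k div T * T \<le> rank v B y" using after_le_iff[OF kT] y by simp
  \<comment> \<open>The last group may be incomplete; then \<open>after\<close> takes its default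
    value and the total count gives the bound.\<close>
  have hi: "rank v B y < Suc (k div T) * T"
  proof (cases "Suc (k div T) * T \<le> count_list B v")
    case True
    then show ?thesis using after_le_iff[OF True, of y] y by simp
  next
    case False
    then show ?thesis using rank_le_count[of v B y] by simp
  qed
  have "rank v B y div T = k div T"
    using lo hi by (intro div_nat_eqI) (auto simp: mult.commute)
  moreover have "(u * T + k mod T) div T = u" "(u * T + k mod T) mod T = k mod T" using T by simp_all
  moreover have "\<not> length B div T + u * T + k mod T < length B div T" by simp
  ultimately show "occ B T D v (length B div T + u * T + k mod T) = Suc k"
    unfolding occ_def y_def by (simp add: add.assoc)
qed

subsection \<open>Reading bit fields\<close>

text \<open>Joins the upper part of one word with the lower part of the next. If the address is
  aligned, the second part is shifted by \<open>w\<close> and vanishes modulo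
  \<open>2 ^ w\<close>.\<close>

definition field :: "nat \<Rightarrow> mem \<Rightarrow> nat \<Rightarrow> nat \<Rightarrow> nat" where
  "field w m a l = take_bit l (Bit_Operations.or (drop_bit (a mod w) (m (a div w)))
      (push_bit (w - a mod w) (m (a div w + 1)) mod 2 ^ w))"

lemma bit_field:
  assumes "0 < w" "l \<le> w" "m (a div w) < 2 ^ w"
  shows "bit (field w m a l) i \<longleftrightarrow> i < l \<and> mem_bit w m (a + i)"
proof -
  have out: "\<not> bit (m (a div w)) j" if "w \<le> j" for j
    using assms(3) that by (metis bit_take_bit_iff leD take_bit_nat_eq_self)
  have aw: "a mod w < w" "a = a div w * w + a mod w" using assms by simp_all
  show ?thesis
  proof (cases "i < l")
    case True
    show ?thesis
    proof (cases "a mod w + i < w")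
      case less: True
      have "a + i = a div w * w + (a mod w + i)" using aw(2) by simp
      then have "(a + i) div w = a div w" "(a + i) mod w = a mod w + i"
        using less by (metis div_mult_self3 add.commute add.right_neutral div_less less_nat_zero_code,
          metis mod_less mod_mult_self3)
      moreover have "\<not> w - a mod w \<le> i" using less by simp
      ultimately show ?thesis using True unfolding field_def mem_bit_def
        by (simp add: bit_simps flip: take_bit_eq_mod)
    next
      case ge: False
      have "a + i = (a div w + 1) * w + (a mod w + i - w)" using aw(2) ge by simp
      moreover have "a mod w + i - w < w" using aw(1) True assms(2) ge by linarith
      ultimately have "(a + i) div w = a div w + 1" "(a + i) mod w = a mod w + i - w"
        by (metis div_mult_self3 add.commute add.right_neutral div_less less_nat_zero_code,
          metis mod_less mod_mult_self3)
      moreover have "\<not> bit (m (a div w)) (a mod w + i)" using out ge by simp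
      moreover have "w - a mod w \<le> i" "i < w" "i - (w - a mod w) = a mod w + i - w"
        using ge aw True assms by auto
      ultimately show ?thesis using True unfolding field_def mem_bit_def
        by (simp add: bit_simps flip: take_bit_eq_mod)
    qed
  qed (simp add: field_def bit_simps)
qed

lemma field_less: "field w m a l < 2 ^ l"
  unfolding field_def by (rule take_bit_nat_less_exp)

text \<open>Entries are stored truncated to \<open>l\<close> bits; it is left to the uses to show
  that the entries they read are small enough.\<close>

lemma field_entry:
  assumes "0 < w" "l \<le> w" "m ((a + j * l) div w) < 2 ^ w" "j < N"
    and bits: "\<And>x. x < N * l \<Longrightarrow> mem_bit w m (a + x) \<longleftrightarrow> bit (E (x div l)) (x mod l)"
  shows "field w m (a + j * l) l = E j mod 2 ^ l"
proof (rule bit_eqI)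
  fix i
  have "mem_bit w m (a + j * l + i) \<longleftrightarrow> bit (E j) i" if "i < l"
  proof -
    have "j * l + i < Suc j * l" using that by simp
    also have "\<dots> \<le> N * l" using assms(4) by (intro mult_right_mono) auto
    finally show ?thesis using bits[of "j * l + i"] that by (simp add: add.assoc)
  qed
  then show "bit (field w m (a + j * l) l) i \<longleftrightarrow> bit (E j mod 2 ^ l) i"
    using bit_field[of w l m "a + j * l" i] assms(1-3)
    by (auto simp: bit_simps simp flip: take_bit_eq_mod)
qed

definition fieldE :: "expr \<Rightarrow> expr \<Rightarrow> expr" where
  "fieldE a l = modE (Bn Or (Bn Shr (Ld (divE a WL)) (modE a WL))
      (Bn Shl (Ld (addE (divE a WL) (Cn 1))) (subE WL (modE a WL)))) (pow2E l)"

lemma ev_field: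
  assumes a: "ev w UNIV s m e a" and l: "ev w UNIV s m f l"
    and "0 < w" "l \<le> w" "a + w < 2 ^ w" "m (a div w) < 2 ^ w"
  shows "ev w UNIV s m (fieldE e f) (field w m a l)"
proof -
  have 1: "1 < (2::nat) ^ w" using assms(3) one_less_power2[of "w - 1"] by simp
  have "a div w + 1 \<le> a + w" using assms(3) div_le_dividend[of a w] by linarith
  then have 2: "a div w + 1 < 2 ^ w" using assms(5) by simp
  have 3: "a mod w \<le> w" using assms(3) by (simp add: less_imp_le)
  let ?x = "Bit_Operations.or (m (a div w) div 2 ^ (a mod w)) (push_bit (w - a mod w) (m (a div w + 1)) mod 2 ^ w)"
  have "ev w UNIV s m (fieldE e f) (?x mod (push_bit l 1 mod 2 ^ w))"
    unfolding fieldE_def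
    by (intro ev_Mod ev_Or ev_Shr ev_Shl ev_M ev_Div ev_Add ev_Sub ev_WL ev_N a l 1 2 3 UNIV_I) simp
  moreover have "?x mod (push_bit l 1 mod 2 ^ w) = take_bit l ?x"
  proof (cases "l < w")
    case True
    then show ?thesis by (simp add: push_bit_eq_mult take_bit_eq_mod)
  next
    \<comment> \<open>For \<open>l = w\<close> the power of 2 wraps around to 0, and
      \<open>x mod 0 = x\<close> keeps the whole word.\<close>
    case False
    then have "l = w" using assms(4) by simp
    have "m (a div w) div 2 ^ (a mod w) < 2 ^ w"
      using assms(6) by (meson div_le_dividend le_less_trans)
    then have "take_bit w ?x = ?x"
      by (simp add: take_bit_or take_bit_nat_eq_self flip: take_bit_eq_mod)
    then show ?thesis using \<open>l = w\<close> by (simp add: push_bit_eq_mult)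
  qed
  ultimately show ?thesis by (simp add: field_def drop_bit_eq_div)
qed


subsection \<open>Rank and select queries\<close>

text \<open>The base of the address digits. Four digits use about a quarter of the bits of a word,
  which leaves space for the factor \<open>w\<close> in bit addresses and for small offsets.\<close>

definition HH :: "nat \<Rightarrow> nat" where "HH w = 2 ^ (w div 16)"
definition HE :: expr where "HE = pow2E (divE WL (Cn 16))"

lemma ev_HE: "16 < (2::nat) ^ w \<Longrightarrow> 0 < w \<Longrightarrow> ev w A s m HE (HH w)"
  unfolding HE_def HH_def by (intro ev_pow2 ev_Div ev_WL ev_N) auto

text \<open>\<open>r ^ 10 \<le> w\<close> lets a block of \<open>r ^ 4\<close> bits be spread into
  digits within one word; \<open>w ^ 2 * r ^ 3\<close> is \<open>D1\<close>, so positions inside a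
  dense coarse group fit into \<open>r\<close> bits; \<open>r < HH w\<close> lets \<open>r\<close>
  be stored as the last digit of an address.\<close>

definition good :: "nat \<Rightarrow> nat \<Rightarrow> bool" where
  "good w r \<longleftrightarrow> 2 \<le> r \<and> r ^ 10 \<le> w \<and> w ^ 2 * r ^ 3 \<le> 2 ^ r \<and> r < HH w"

lemma goodD:
  assumes "good w r"
  shows "0 < r" "r \<le> w" "0 < w" "16 < (2::nat) ^ w" "0 < T2 r" "0 < T1 w r" "0 < D1 w r" "0 < D2 r"
    "T1 w r = T2 r * w" "T1 w r \<le> D1 w r" "D1 w r \<le> 2 ^ r" "T2 r \<le> D2 r" "(D2 r + 1) * D2 r < w"
    "D2 r + 1 < w" "w * r \<le> D1 w r" "(2::nat) ^ r \<le> 2 ^ w" "w < 2 ^ w" "D2 r < w" "r * r \<le> T1 w r"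
proof -
  have r: "2 \<le> r" "r ^ 10 \<le> w" "w ^ 2 * r ^ 3 \<le> 2 ^ r" using assms by (auto simp: good_def)
  show r0: "0 < r" using r by simp
  have "r ^ 1 \<le> r ^ 10" using r by (intro power_increasing) auto
  then show rw: "r \<le> w" using r by simp
  then show w0: "0 < w" using r by simp
  have "(2::nat) ^ 10 \<le> r ^ 10" using r by (intro power_mono) auto
  then have "1024 \<le> w" using r by simp
  then have "(2::nat) ^ 1024 \<le> 2 ^ w" by (intro power_increasing) auto
  moreover have "(2::nat) ^ 5 \<le> 2 ^ 1024" by (rule power_increasing) auto
  ultimately show "(16::nat) < 2 ^ w" by simp
  show t2: "0 < T2 r" "0 < T1 w r" "0 < D1 w r" "0 < D2 r"
    using r0 w0 by (simp_all add: T2_def T1_def D1_def D2_def)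
  show "T1 w r = T2 r * w" by (simp add: T1_def T2_def)
  show "T1 w r \<le> D1 w r" using r0 w0 by (simp add: D1_def)
  have "D1 w r = w ^ 2 * r ^ 3" by (simp add: D1_def T1_def power2_eq_square power3_eq_cube)
  then show "D1 w r \<le> 2 ^ r" using r by simp
  show "T2 r \<le> D2 r" using t2 by (simp add: D2_def)
  have d2: "D2 r = r ^ 4" by (simp add: D2_def T2_def eval_nat_numeral)
  have "1 \<le> r ^ 4" using r0 by simp
  then have "(D2 r + 1) * D2 r \<le> (r ^ 4 + r ^ 4) * r ^ 4"
    unfolding d2 by (intro mult_right_mono add_left_mono) auto
  also have "\<dots> = 2 * r ^ 8" by (simp add: eval_nat_numeral algebra_simps)
  also have "\<dots> \<le> r * r ^ 8" using r by simp
  also have "\<dots> < r ^ 10" using r by (simp add: power_Suc[symmetric] del: power_Suc)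
  finally show x: "(D2 r + 1) * D2 r < w" using r by simp
  have "r ^ 1 \<le> r ^ 4" using r0 by (intro power_increasing) auto
  then have "D2 r + 1 + 1 \<le> (D2 r + 1) * D2 r" unfolding d2 using r
    by (cases "r ^ 4") (auto simp: algebra_simps)
  then show y: "D2 r + 1 < w" using x by simp
  show "w * r \<le> D1 w r" using t2(2) by (simp add: D1_def)
  show "(2::nat) ^ r \<le> 2 ^ w" using rw by (intro power_increasing) auto
  show "w < 2 ^ w" by simp
  show "D2 r < w" using y by simp
  show "r * r \<le> T1 w r" using w0 by (simp add: T1_def)
qed

definition entriesE :: "expr \<Rightarrow> expr \<Rightarrow> expr \<Rightarrow> expr" where
  "entriesE n T D = addE (divE n T) (mulE (Cn 2) (addE (divE n T) (mulE (divE n D) T)))"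

lemma entries_bound:
  "n div T \<le> entries n T D" "n div D * T \<le> entries n T D" "n div T + n div D * T \<le> entries n T D"
  "2 * (n div T + n div D * T) \<le> entries n T D"
  by (auto simp: entries_def)

lemma ev_entries:
  assumes "ev w A s m n x" "ev w A s m T t" "ev w A s m D d" "entries x t d < 2 ^ w" "16 < (2::nat) ^ w"
  shows "ev w A s m (entriesE n T D) (entries x t d)"
  unfolding entriesE_def entries_def
  by (intro ev_Add ev_Mul ev_Div ev_N assms) (use assms(4,5) in \<open>auto simp: entries_def\<close>)

text \<open>Variables: 0 node, 1 bit, 2 argument, 3 \<open>r\<close>, 4 bitmap, 5 length, 6-9 \<open>T1, D1, T2, D2\<close>,
  10 and 11 the two levels of the directory.\<close>

definition prologue :: "stmt list" where
  "prologue = [Asg 3 (modE (Vr 0) HE), Asg 4 (Ld (Vr 0)), Asg 5 (Ld (addE (Vr 0) (Cn 1))),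
     Asg 6 (mulE WL (mulE (Vr 3) (Vr 3))), Asg 7 (mulE (Vr 6) (mulE WL (Vr 3))),
     Asg 8 (mulE (Vr 3) (Vr 3)), Asg 9 (mulE (Vr 8) (Vr 8)), Asg 10 (Ld (addE (Vr 0) (Cn 2))),
     Asg 11 (addE (Vr 10) (mulE (entriesE (Vr 5) (Vr 6) (Vr 7)) WL))]"

definition field1E :: "expr \<Rightarrow> expr" where
  "field1E j = fieldE (addE (Vr 10) (mulE j WL)) WL"
definition field2E :: "expr \<Rightarrow> expr" where
  "field2E j = fieldE (addE (Vr 11) (mulE j (Vr 3))) (Vr 3)"

text \<open>A coarse sample, a fine sample relative to it, and a popcount of the remaining
  \<open>i mod T2\<close> bits. Entry \<open>j\<close> belongs to the multiple \<open>Suc j\<close>,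
  so 1 is subtracted and the multiple 0 is handled apart. The popcount uses the block width
  \<open>D2\<close> of the select search.\<close>

definition rank_code :: "stmt list" where
  "rank_code = [
     Asg 12 (Ite (lessE (Vr 2) (Vr 6)) (Cn 0) (field1E (subE (divE (Vr 2) (Vr 6)) (Cn 1)))),
     Asg 13 (Ite (lessE (Vr 2) (Vr 8)) (Cn 0) (field2E (subE (divE (Vr 2) (Vr 8)) (Cn 1)))),
     Asg 14 (fieldE (addE (Vr 4) (mulE (divE (Vr 2) (Vr 8)) (Vr 8))) (modE (Vr 2) (Vr 8))),
     Asg 15 (addE (addE (Vr 12) (Vr 13)) (popE (Vr 9) (Vr 14))),
     Asg 0 (Ite (Vr 1) (Vr 15) (subE (Vr 2) (Vr 15)))]"

definition offsetE :: "expr \<Rightarrow> expr \<Rightarrow> expr" where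
  "offsetE T D = addE (divE (Vr 5) T) (mulE (Vr 1) (addE (divE (Vr 5) T) (mulE (divE (Vr 5) D) T)))"

text \<open>Variables 13 and 14 receive the bounds of the coarse group of the argument, 16 and 17
  those of its fine group. A sparse group at either level yields a stored answer; a doubly dense one
  lies within \<open>D2\<close> bits, which are complemented for bit value 0 and searched by word
  operations.\<close>

definition select_code :: "stmt list" where
  "select_code = [
     Asg 12 (offsetE (Vr 6) (Vr 7)),
     Asg 13 (Ite (lessE (Vr 2) (Vr 6)) (Cn 0) (field1E (addE (Vr 12) (subE (divE (Vr 2) (Vr 6)) (Cn 1))))),
     Asg 14 (Ite (lessE (divE (Vr 2) (Vr 6)) (divE (Vr 5) (Vr 6)))
       (field1E (addE (Vr 12) (divE (Vr 2) (Vr 6)))) (Vr 5)),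
     When (lessE (subE (Vr 14) (Vr 13)) (Vr 7))
      [Asg 15 (offsetE (Vr 8) (Vr 9)),
       Asg 16 (Ite (lessE (modE (Vr 2) (Vr 6)) (Vr 8)) (Vr 13)
         (addE (Vr 13) (field2E (addE (Vr 15) (subE (divE (Vr 2) (Vr 8)) (Cn 1)))))),
       Asg 17 (Ite (lessE (divE (Vr 2) (Vr 8)) (divE (Vr 5) (Vr 8)))
         (addE (Vr 13) (field2E (addE (Vr 15) (divE (Vr 2) (Vr 8))))) (Vr 5)),
       When (lessE (subE (Vr 17) (Vr 16)) (Vr 9))
        [Asg 18 (fieldE (addE (Vr 4) (Vr 16)) (Vr 9)),
         Asg 19 (Ite (Vr 1) (Vr 18) (Bn Xor (Vr 18) (subE (pow2E (Vr 9)) (Cn 1)))),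
         Asg 0 (addE (Vr 16) (searchE (Vr 9) (Vr 19) (modE (Vr 2) (Vr 8))))]
        [Asg 0 (subE (addE (Vr 13) (field2E (addE (Vr 15) (addE (addE (divE (Vr 5) (Vr 8))
           (mulE (divE (Vr 16) (Vr 9)) (Vr 8))) (modE (Vr 2) (Vr 8)))))) (Cn 1))]]
      [Asg 0 (subE (field1E (addE (Vr 12) (addE (addE (divE (Vr 5) (Vr 6))
         (mulE (divE (Vr 13) (Vr 7)) (Vr 6))) (modE (Vr 2) (Vr 6))))) (Cn 1))]]"

definition rank_prog :: prog where "rank_prog = move_args @ comps (prologue @ rank_code)"
definition select_prog :: prog where "select_prog = move_args @ comps (prologue @ select_code)"

lemma pop_Suc: "pop z (Suc x) = pop z x + of_bool (bit z x)"
  by (simp add: pop_sum[symmetric])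

lemma pop_beyond: "x \<le> y \<Longrightarrow> (\<And>i. x \<le> i \<Longrightarrow> \<not> bit z i) \<Longrightarrow> pop z y = pop z x"
  by (induction y rule: dec_induct) (auto simp: pop_Suc)

lemma pop_mono: "x \<le> y \<Longrightarrow> pop z x \<le> pop z y"
  by (induction y rule: dec_induct) (auto simp: pop_Suc)

lemma pop_rank:
  assumes "\<And>x. x < l \<Longrightarrow> bit z x \<longleftrightarrow> B ! (a + x) = v" "a + l \<le> length B"
  shows "rank v B a + pop z l = rank v B (a + l)"
  using assms by (induction l) (auto simp: pop_Suc rank_Suc pop_def[of z 0])

lemma rank_after: "j \<le> count_list B v \<Longrightarrow> rank v B (after v B j) = j"
proof (cases j)
  case (Suc i)
  assume "j \<le> count_list B v"
  then show ?thesis using select_after[of i B v] Suc by (simp add: rank_Suc)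
qed simp

text \<open>The situation of a query: a memory of which only the record, the bitmap and the
  directory of one node are known. \<open>room\<close> includes an extra \<open>w\<close>, since
  reading a field also touches the following word.\<close>

locale node_view =
  fixes w r :: nat and m :: mem and p :: nat and B :: "bool list"
  assumes good: "good w r" and words: "\<And>a. m a < 2 ^ w"
    and len: "m (p + 1) = length B" and aux: "m (p + 2) = m p + length B"
    and p: "p mod HH w = r" "p + 3 < 2 ^ w"
    and room: "m p + length B + aux_bits w r (length B) + w < 2 ^ w"
    and bits: "\<And>x. x < length B + aux_bits w r (length B) \<Longrightarrow>
      mem_bit w m (m p + x) = node_bit w r B x"
begin

abbreviation "n \<equiv> length B"
abbreviation "t1 \<equiv> T1 w r" abbreviation "d1 \<equiv> D1 w r"
abbreviation "t2 \<equiv> T2 r" abbreviation "d2 \<equiv> D2 r"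

lemmas g = goodD[OF good]

definition ready :: "bool \<Rightarrow> nat \<Rightarrow> (nat \<Rightarrow> nat) \<Rightarrow> bool" where
  "ready v i s \<longleftrightarrow> s 1 = of_bool v \<and> s 2 = i \<and> s 3 = r \<and> s 4 = m p \<and> s 5 = n \<and> s 6 = t1 \<and>
     s 7 = d1 \<and> s 8 = t2 \<and> s 9 = d2 \<and> s 10 = m p + n \<and> s 11 = m p + n + ents1 w r n * w"

lemma room2: "n < 2 ^ w" "m p + n + ents1 w r n * w + ents2 r n * r + w < 2 ^ w"
  "ents1 w r n < 2 ^ w" "ents2 r n < 2 ^ w" "ents1 w r n * w < 2 ^ w" "ents2 r n * r < 2 ^ w"
proof -
  show a: "m p + n + ents1 w r n * w + ents2 r n * r + w < 2 ^ w" "n < 2 ^ w"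
    using room unfolding aux_bits_def by simp_all
  have "ents1 w r n \<le> ents1 w r n * w" "ents2 r n \<le> ents2 r n * r" using g(1,3) by simp_all
  then show "ents1 w r n < 2 ^ w" "ents2 r n < 2 ^ w" "ents1 w r n * w < 2 ^ w" "ents2 r n * r < 2 ^ w"
    using a by linarith+
qed

lemma t_bounds: "t1 < 2 ^ w" "d1 < 2 ^ w" "t2 < 2 ^ w" "d2 < 2 ^ w" "w * r < 2 ^ w" "r * r < 2 ^ w" "r < 2 ^ w"
  "1 < (2::nat) ^ w"
proof -
  have "r < w" "d2 < 2 ^ w" using g(1-3,18,12,5) by (auto simp: T2_def D2_def intro: less_trans le_less_trans)
    (metis One_nat_def Suc_leI T2_def g(12) g(18) le_less_trans le_square order_trans)+
  then have "(2::nat) ^ r < 2 ^ w" by simp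
  then show "t1 < 2 ^ w" "d1 < 2 ^ w" "t2 < 2 ^ w" "d2 < 2 ^ w" "w * r < 2 ^ w" "r * r < 2 ^ w" "r < 2 ^ w"
    "1 < (2::nat) ^ w"
    using g \<open>d2 < 2 ^ w\<close> \<open>r < w\<close> by linarith+
qed

lemma hs_prologue:
  assumes "s 0 = p" "s 1 = of_bool v" "s 2 = i"
    and "\<And>s'. ready v i s' \<Longrightarrow> hs w UNIV G cs s' m Q"
  shows "hs w UNIV G (prologue @ cs) s m Q"
  unfolding prologue_def append.simps
  apply (rule hs_Asg[where v=r])
  subgoal by (rule ev_eq[OF ev_Mod[OF ev_V[OF refl] ev_HE]]) (use g p assms in auto)
  apply (rule hs_Asg[where v="m p"])
  subgoal using assms by (simp add: ev_def)
  apply (rule hs_Asg[where v=n])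
  subgoal using assms p len g(3) by (simp add: ev_def)
  apply (rule hs_Asg[where v=t1])
  subgoal using t_bounds by (simp add: ev_def T1_def)
  apply (rule hs_Asg[where v=d1])
  subgoal using t_bounds by (simp add: ev_def D1_def)
  apply (rule hs_Asg[where v=t2])
  subgoal using t_bounds by (simp add: ev_def T2_def)
  apply (rule hs_Asg[where v=d2])
  subgoal using t_bounds by (simp add: ev_def D2_def)
  apply (rule hs_Asg[where v="m p + n"])
  subgoal using assms p aux g(4) by (simp add: ev_def)
  apply (rule hs_Asg[where v="m p + n + ents1 w r n * w"])
  subgoal using room2 g unfolding ents1_def by (intro ev_Add ev_Mul ev_entries ev_V ev_WL) auto
  apply (rule assms(4))
  using assms(1-3) by (simp add: ready_def)


lemma field1:
  assumes "ev w UNIV s m e j" "j < ents1 w r n" "s 10 = m p + n" "v = entry B t1 d1 0 j" "v < 2 ^ w"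
  shows "ev w UNIV s m (field1E e) v"
proof -
  have jw: "Suc j * w \<le> ents1 w r n * w" using assms by (intro mult_right_mono) auto
  have "field w m (m p + n + j * w) w = entry B t1 d1 0 j mod 2 ^ w"
  proof (rule field_entry[OF g(3) order_refl words assms(2)])
    fix x assume x: "x < ents1 w r n * w"
    then have "mem_bit w m (m p + (n + x)) = node_bit w r B (n + x)"
      by (intro bits) (simp add: aux_bits_def)
    then show "mem_bit w m (m p + n + x) = bit (entry B t1 d1 0 (x div w)) (x mod w)"
      using x by (simp add: node_bit_def Let_def add.assoc)
  qed
  then have f: "field w m (m p + n + j * w) w = v" using assms(4,5) by simp
  show ?thesis unfolding field1E_def f[symmetric]
    by (intro ev_field ev_Add ev_Mul ev_WL ev_V assms words order_refl g) (use jw room2(2) in simp_all)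
qed

lemma field2:
  assumes "ev w UNIV s m e j" "j < ents2 r n" "s 11 = m p + n + ents1 w r n * w" "s 3 = r"
    "v = entry B t2 d2 t1 j mod 2 ^ r"
  shows "ev w UNIV s m (field2E e) v"
proof -
  have jr: "Suc j * r \<le> ents2 r n * r" using assms by (intro mult_right_mono) auto
  have "field w m (m p + n + ents1 w r n * w + j * r) r = entry B t2 d2 t1 j mod 2 ^ r"
  proof (rule field_entry[OF g(3) g(2) words assms(2)])
    fix x assume x: "x < ents2 r n * r"
    then have "mem_bit w m (m p + (n + (ents1 w r n * w + x))) = node_bit w r B (n + (ents1 w r n * w + x))"
      by (intro bits) (simp add: aux_bits_def)
    then show "mem_bit w m (m p + n + ents1 w r n * w + x) = bit (entry B t2 d2 t1 (x div r)) (x mod r)"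
      using x by (simp add: node_bit_def Let_def add.assoc)
  qed
  then have f: "field w m (m p + n + ents1 w r n * w + j * r) r = v" using assms(5) by simp
  show ?thesis unfolding field2E_def f[symmetric]
    by (intro ev_field ev_Add ev_Mul ev_V assms words g) (use jr g(2) room2(2) in simp_all)
qed

text \<open>\<open>T1\<close> is a multiple of \<open>T2\<close>, so rounding down to
  \<open>T2\<close> and then to \<open>T1\<close> is rounding down to \<open>T1\<close>. The
  difference of the two ranks is below \<open>T1 \<le> 2 ^ r\<close> and is not truncated by its
  field.\<close>

lemma split_rank:
  assumes "i \<le> n"
  shows "rank True B (i div t1 * t1) + (rank True B (i div t2 * t2) - rank True B (i div t2 * t2 div t1 * t1))
     = rank True B (i div t2 * t2)"
    and "rank True B (i div t2 * t2) - rank True B (i div t2 * t2 div t1 * t1) < 2 ^ r"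
proof -
  have d: "i div t2 * t2 div t1 = i div t1"
    using g(5) unfolding g(9) by (simp add: div_mult2_eq)
  have le: "i div t1 * t1 \<le> i div t2 * t2" unfolding d[symmetric] by simp
  have "i div t2 * t2 < i div t1 * t1 + t1" unfolding d[symmetric]
    using g(6) by (metis add.commute dividend_less_div_times)
  then have "rank True B (i div t2 * t2) < rank True B (i div t1 * t1) + t1"
    using rank_diff_le[OF le, of True B] le by linarith
  then show "rank True B (i div t2 * t2) - rank True B (i div t2 * t2 div t1 * t1) < 2 ^ r"
    unfolding d using g(10,11) zero_less_power[of "2::nat" r] by linarith
  show "rank True B (i div t1 * t1) + (rank True B (i div t2 * t2) - rank True B (i div t2 * t2 div t1 * t1))
     = rank True B (i div t2 * t2)"
    unfolding d using rank_mono[OF le, of True B] by simp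
qed

lemma ready_ev:
  assumes "ready v i s"
  shows "ev w UNIV s m (Vr 1) (of_bool v)" "ev w UNIV s m (Vr 2) i" "ev w UNIV s m (Vr 3) r"
    "ev w UNIV s m (Vr 4) (m p)" "ev w UNIV s m (Vr 5) n" "ev w UNIV s m (Vr 6) t1"
    "ev w UNIV s m (Vr 7) d1" "ev w UNIV s m (Vr 8) t2" "ev w UNIV s m (Vr 9) d2"
    "s 10 = m p + n" "s 11 = m p + n + ents1 w r n * w" "s 3 = r"
  using assms by (auto simp: ready_def ev_def)

lemma ready_upd: "11 < x \<Longrightarrow> ready v i (s(x := y)) = ready v i s"
  by (auto simp: ready_def)

lemma hs_rank:
  assumes "ready v i s" "i \<le> n"
  shows "hs w UNIV {} rank_code s m (\<lambda>s' m'. s' 0 = rank v B i \<and> m' = m)"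
proof -
  have iw: "i < 2 ^ w" using assms(2) room2(1) by simp
  have tp: "0 < t1" "0 < t2" using g by auto
  have lt: "rank True B j < 2 ^ w" if "j \<le> n" for j using rank_le[of True B j] that room2(1) by linarith
  define a1 where "a1 = rank True B (i div t1 * t1)"
  define a2 where "a2 = rank True B (i div t2 * t2) - rank True B (i div t2 * t2 div t1 * t1)"
  define z where "z = field w m (m p + i div t2 * t2) (i mod t2)"
  have idiv: "i div t1 * t1 \<le> i" "i div t2 * t2 \<le> i" by simp_all
  have c1: "ev w UNIV s m (Ite (lessE (Vr 2) (Vr 6)) (Cn 0) (field1E (subE (divE (Vr 2) (Vr 6)) (Cn 1)))) a1"
  proof (rule ev_Ite[OF ev_Less[OF ready_ev(2)[OF assms(1)] ready_ev(6)[OF assms(1)]]])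
    assume "of_bool (i < t1) \<noteq> (0::nat)"
    then have "a1 = 0" by (simp add: a1_def)
    then show "ev w UNIV s m (Cn 0) a1" by (auto intro: ev_N)
  next
    assume "of_bool (i < t1) = (0::nat)"
    then have q: "0 < i div t1" using tp by (simp add: div_greater_zero_iff)
    have "i div t1 \<le> n div t1" using assms(2) by (rule div_le_mono)
    then have j: "i div t1 - 1 < n div t1" using q by simp
    show "ev w UNIV s m (field1E (subE (divE (Vr 2) (Vr 6)) (Cn 1))) a1"
    proof (rule field1)
      show "ev w UNIV s m (subE (divE (Vr 2) (Vr 6)) (Cn 1)) (i div t1 - 1)"
        by (intro ev_Sub ev_Div ev_N ready_ev[OF assms(1)] t_bounds)
          (use q iw div_le_dividend[of i t1] in linarith)+
      show "i div t1 - 1 < ents1 w r n"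
        using j entries_bound(1)[of n t1 d1] unfolding ents1_def by linarith
      show "s 10 = m p + n" by (rule ready_ev[OF assms(1)])
      show "a1 = entry B t1 d1 0 (i div t1 - 1)" unfolding a1_def entry_rank[OF j] using q by simp
      show "a1 < 2 ^ w" unfolding a1_def by (rule lt) (use idiv assms(2) in linarith)
    qed
  qed
  let ?s1 = "s(12 := a1)"
  have r1: "ready v i ?s1" using assms(1) by (simp add: ready_upd)
  have c2: "ev w UNIV ?s1 m (Ite (lessE (Vr 2) (Vr 8)) (Cn 0) (field2E (subE (divE (Vr 2) (Vr 8)) (Cn 1)))) a2"
  proof (rule ev_Ite[OF ev_Less[OF ready_ev(2)[OF r1] ready_ev(8)[OF r1]]])
    assume "of_bool (i < t2) \<noteq> (0::nat)"
    then have "a2 = 0" by (simp add: a2_def)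
    then show "ev w UNIV ?s1 m (Cn 0) a2" by (auto intro: ev_N)
  next
    assume "of_bool (i < t2) = (0::nat)"
    then have q: "0 < i div t2" using tp by (simp add: div_greater_zero_iff)
    have "i div t2 \<le> n div t2" using assms(2) by (rule div_le_mono)
    then have j: "i div t2 - 1 < n div t2" using q by simp
    show "ev w UNIV ?s1 m (field2E (subE (divE (Vr 2) (Vr 8)) (Cn 1))) a2"
    proof (rule field2)
      show "ev w UNIV ?s1 m (subE (divE (Vr 2) (Vr 8)) (Cn 1)) (i div t2 - 1)"
        by (intro ev_Sub ev_Div ev_N ready_ev[OF r1] t_bounds)
          (use q iw div_le_dividend[of i t2] in linarith)+
      show "i div t2 - 1 < ents2 r n"
        using j entries_bound(1)[of n t2 d2] unfolding ents2_def by linarith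
      show "?s1 11 = m p + n + ents1 w r n * w" "?s1 3 = r" by (rule ready_ev[OF r1])+
      show "a2 = entry B t2 d2 t1 (i div t2 - 1) mod 2 ^ r"
        unfolding a2_def entry_rank[OF j] using q split_rank(2)[OF assms(2)] by simp
    qed
  qed
  let ?s2 = "?s1(13 := a2)"
  have r2: "ready v i ?s2" using r1 by (simp add: ready_upd)
  have im: "i mod t2 < t2" using tp by simp
  have c3: "ev w UNIV ?s2 m (fieldE (addE (Vr 4) (mulE (divE (Vr 2) (Vr 8)) (Vr 8))) (modE (Vr 2) (Vr 8))) z"
    unfolding z_def
    by (intro ev_field ev_Add ev_Mul ev_Div ev_Mod ready_ev[OF r2] g words)
      (use idiv assms(2) room2(2) iw im g(12,18) in linarith)+
  let ?s3 = "?s2(14 := z)"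
  have r3: "ready v i ?s3" using r2 by (simp add: ready_upd)
  have zb: "bit z x \<longleftrightarrow> x < i mod t2 \<and> mem_bit w m (m p + i div t2 * t2 + x)" for x
    unfolding z_def using bit_field[OF g(3), of "i mod t2" m] words im g(12,18) by simp
  \<comment> \<open>Only \<open>i mod t2\<close> bits were read, so the popcount over the full width
    adds nothing.\<close>
  have p1: "pop z d2 = pop z (i mod t2)" by (rule pop_beyond) (use zb im g(12) in auto)
  have p2: "rank True B (i div t2 * t2) + pop z (i mod t2) = rank True B (i div t2 * t2 + i mod t2)"
  proof (rule pop_rank)
    fix x assume x: "x < i mod t2"
    have ii: "i div t2 * t2 + i mod t2 = i" by simp
    then have "i div t2 * t2 + x < n" using x assms(2) by linarith
    then have "mem_bit w m (m p + (i div t2 * t2 + x)) = B ! (i div t2 * t2 + x)"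
      by (subst bits) (simp_all add: node_bit_def)
    then show "bit z x \<longleftrightarrow> B ! (i div t2 * t2 + x) = True" using zb x by (simp add: add.assoc)
  qed (use assms(2) in simp)
  have tot: "a1 + a2 + pop z d2 = rank True B i"
    unfolding p1 a1_def a2_def split_rank(1)[OF assms(2)] p2 by simp
  have z2: "z < 2 ^ d2"
    using field_less[of w m "m p + i div t2 * t2" "i mod t2"] im g(12) unfolding z_def
    by (meson le_less_trans less_imp_le less_le_trans one_le_numeral power_increasing)
  have c4: "ev w UNIV ?s3 m (addE (addE (Vr 12) (Vr 13)) (popE (Vr 9) (Vr 14))) (rank True B i)"
    unfolding tot[symmetric]
    by (intro ev_Add ev_pop ready_ev[OF r3] ev_V g z2) (use tot lt[OF assms(2)] in auto)
  let ?s4 = "?s3(15 := rank True B i)"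
  have r4: "ready v i ?s4" using r3 by (simp add: ready_upd)
  have c5: "ev w UNIV ?s4 m (Ite (Vr 1) (Vr 15) (subE (Vr 2) (Vr 15))) (rank v B i)"
  proof (rule ev_Ite[OF ready_ev(1)[OF r4]])
    assume "of_bool v \<noteq> (0::nat)"
    then show "ev w UNIV ?s4 m (Vr 15) (rank v B i)" by (simp add: ev_def)
  next
    assume "of_bool v = (0::nat)"
    then have e: "rank v B i = i - rank True B i" using rank_False[OF assms(2)] by simp
    show "ev w UNIV ?s4 m (subE (Vr 2) (Vr 15)) (rank v B i)" unfolding e
      by (intro ev_Sub ready_ev[OF r4] ev_V rank_le iw) simp
  qed
  show ?thesis unfolding rank_code_def
    by (rule hs_Asg[OF c1], rule hs_Asg[OF c2], rule hs_Asg[OF c3], rule hs_Asg[OF c4],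
        rule hs_Asg[OF c5], rule hs_Nil) simp
qed


lemma slot_bound:
  assumes "i < n div T + n div D * T"
  shows "n div T + of_bool v * (n div T + n div D * T) + i < entries n T D"
  using assms by (cases v) (auto simp: entries_def mult.commute)

lemma ev_offset:
  assumes "ev w UNIV s m a T" "ev w UNIV s m b D" "ready v k s" "entries n T D < 2 ^ w"
  shows "ev w UNIV s m (offsetE a b) (n div T + of_bool v * (n div T + n div D * T))"
  unfolding offsetE_def
  by (intro ev_Add ev_Mul ev_Div ready_ev[OF assms(3)] assms)
    (use assms(4) in \<open>cases v; auto simp: entries_def\<close>)+

text \<open>Behind the last full sample a group ends at the end of the bitmap: fewer occurrences
  exist than asked for, and this is the default value of \<open>after\<close>.\<close>

lemma after_group:
  assumes "k < count_list B v" "0 < T" "n div T \<le> k div T"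
  shows "after v B (Suc (k div T) * T) = n"
proof -
  have "n < Suc (n div T) * T" using assms(2) by (simp add: dividend_less_div_times)
  also have "\<dots> \<le> Suc (k div T) * T" using assms(3) by (intro mult_right_mono) auto
  finally have "count_list B v < Suc (k div T) * T" using count_le_length[of B v] by linarith
  then show ?thesis by (simp add: after_def)
qed

lemma hs_select:
  assumes rd: "ready v k s" and k: "k < count_list B v"
  shows "hs w UNIV {} select_code s m (\<lambda>s' m'. s' 0 = select v B k \<and> m' = m)"
proof -
  have kn: "k < n" using k count_le_length[of B v] by linarith
  have kw: "k < 2 ^ w" using kn room2(1) by simp
  have tp: "0 < t1" "0 < t2" "0 < d1" "0 < d2" using g by auto
  define q where "q = k div t1"
  define h where "h = k div t2"
  define X where "X = after v B (q * t1)"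
  define X' where "X' = after v B (Suc q * t1)"
  define Y where "Y = after v B (h * t2)"
  define Y' where "Y' = after v B (Suc h * t2)"
  have hq: "h div w = q" unfolding h_def q_def g(9) by (simp add: div_mult2_eq)
  have q1: "q * t1 \<le> k" "k < Suc q * t1" unfolding q_def using tp by (simp_all add: dividend_less_div_times)
  have h1: "h * t2 \<le> k" "k < Suc h * t2" unfolding h_def using tp by (simp_all add: dividend_less_div_times)
  have qh: "q * t1 \<le> h * t2"
  proof -
    have "q * w \<le> h" unfolding hq[symmetric] by simp
    then have "q * w * t2 \<le> h * t2" by (rule mult_right_mono) simp
    then show ?thesis unfolding g(9) by (simp add: ac_simps)
  qed
  have hq': "Suc h * t2 \<le> Suc q * t1"
  proof -
    have "h < Suc q * w" unfolding hq[symmetric] using g(3) by (simp add: dividend_less_div_times)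
    then have "Suc h * t2 \<le> Suc q * w * t2" by (intro mult_right_mono) auto
    then show ?thesis unfolding g(9) by (simp only: mult.assoc mult.commute[of w])
  qed
  have sel: "after v B (Suc k) = Suc (select v B k)" "select v B k < n" using select_after[OF k] by auto
  \<comment> \<open>The answer lies in the fine interval \<open>[Y, Y')\<close>, which is nested in
    the coarse interval \<open>[X, X')\<close>.\<close>
  have ord: "X \<le> Y" "Y \<le> select v B k" "Suc (select v B k) \<le> Y'" "Y' \<le> X'" "X' \<le> n" "Y' \<le> n"
  proof -
    show "X \<le> Y" unfolding X_def Y_def by (rule after_mono[OF qh])
    have "h * t2 \<le> rank v B (select v B k)" using h1 select_after(3)[OF k] by simp
    then show "Y \<le> select v B k" unfolding Y_def using after_le_iff[of "h * t2" B v] h1 k by simp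
    show "Suc (select v B k) \<le> Y'" unfolding sel(1)[symmetric] Y'_def by (rule after_mono) (use h1 in simp)
    show "Y' \<le> X'" unfolding X'_def Y'_def by (rule after_mono[OF hq'])
    show "X' \<le> n" "Y' \<le> n" unfolding X'_def Y'_def by (rule after_le_length)+
  qed
  have nw: "j < 2 ^ w" if "j \<le> n" for j using that room2(1) by simp
  define o1 where "o1 = n div t1 + of_bool v * (n div t1 + n div d1 * t1)"
  define o2 where "o2 = n div t2 + of_bool v * (n div t2 + n div d2 * t2)"
  have kd: "k div t1 \<le> n div t1" "k div t2 \<le> n div t2" using kn by (simp_all add: div_le_mono)
  have o1: "o1 + i < ents1 w r n" "o1 + i < 2 ^ w" "entry B t1 d1 0 (o1 + i) = after v B (occ B t1 d1 v i)"
    if "i < n div t1 + n div d1 * t1" for i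
    using slot_bound[OF that, of v] entry_occ[OF that, of 0 v] room2(3)
    unfolding o1_def ents1_def by simp_all
  have o2: "o2 + i < ents2 r n" "o2 + i < 2 ^ w" "entry B t2 d2 t1 (o2 + i) =
      after v B (occ B t2 d2 v i) - after v B ((occ B t2 d2 v i - 1) div t1 * t1)"
    if "i < n div t2 + n div d2 * t2" for i
    using slot_bound[OF that, of v] entry_occ[OF that, of t1 v] room2(4)
    unfolding o2_def ents2_def by simp_all
  have c12: "ev w UNIV s m (offsetE (Vr 6) (Vr 7)) o1" unfolding o1_def
    by (rule ev_offset[OF ready_ev(6,7)[OF rd] rd]) (use room2(3) in \<open>simp add: ents1_def\<close>)
  let ?s1 = "s(12 := o1)"
  have r1: "ready v k ?s1" using rd by (simp add: ready_upd)
  have c13: "ev w UNIV ?s1 m (Ite (lessE (Vr 2) (Vr 6)) (Cn 0) (field1E (addE (Vr 12) (subE (divE (Vr 2) (Vr 6)) (Cn 1))))) X"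
  proof (rule ev_Ite[OF ev_Less[OF ready_ev(2)[OF r1] ready_ev(6)[OF r1]]])
    assume "of_bool (k < t1) \<noteq> (0::nat)"
    then have "X = 0" by (simp add: X_def q_def)
    then show "ev w UNIV ?s1 m (Cn 0) X" by (auto intro: ev_N)
  next
    assume "of_bool (k < t1) = (0::nat)"
    then have q: "0 < q" using tp by (simp add: q_def div_greater_zero_iff)
    have i: "q - 1 < n div t1" using kd q unfolding q_def by linarith
    then have i': "q - 1 < n div t1 + n div d1 * t1" by simp
    show "ev w UNIV ?s1 m (field1E (addE (Vr 12) (subE (divE (Vr 2) (Vr 6)) (Cn 1)))) X"
    proof (rule field1)
      show "ev w UNIV ?s1 m (addE (Vr 12) (subE (divE (Vr 2) (Vr 6)) (Cn 1))) (o1 + (q - 1))" unfolding q_def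
        by (intro ev_Add ev_Sub ev_Div ev_N ready_ev[OF r1] t_bounds ev_V o1(2)[OF i', unfolded q_def])
          (use q[unfolded q_def] kw div_le_dividend[of k t1] in \<open>simp_all del: div_le_dividend\<close>)
      show "X = entry B t1 d1 0 (o1 + (q - 1))" unfolding o1(3)[OF i'] occ_sample[OF i] X_def using q by simp
    qed (use o1(1)[OF i'] ready_ev(10)[OF r1] ord nw in auto)
  qed
  let ?s2 = "?s1(13 := X)"
  have r2: "ready v k ?s2" using r1 by (simp add: ready_upd)
  have c14: "ev w UNIV ?s2 m (Ite (lessE (divE (Vr 2) (Vr 6)) (divE (Vr 5) (Vr 6)))
       (field1E (addE (Vr 12) (divE (Vr 2) (Vr 6)))) (Vr 5)) X'"
  proof (rule ev_Ite[OF ev_Less[OF ev_Div[OF ready_ev(2,6)[OF r2]] ev_Div[OF ready_ev(5,6)[OF r2]]]])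
    assume "of_bool (k div t1 < n div t1) = (0::nat)"
    then have "X' = n" unfolding X'_def q_def by (intro after_group k tp) simp
    then show "ev w UNIV ?s2 m (Vr 5) X'" using ready_ev(5)[OF r2] by simp
  next
    assume "of_bool (k div t1 < n div t1) \<noteq> (0::nat)"
    then have i: "q < n div t1" by (simp add: q_def)
    then have i': "q < n div t1 + n div d1 * t1" by simp
    show "ev w UNIV ?s2 m (field1E (addE (Vr 12) (divE (Vr 2) (Vr 6)))) X'"
    proof (rule field1)
      show "ev w UNIV ?s2 m (addE (Vr 12) (divE (Vr 2) (Vr 6))) (o1 + q)" unfolding q_def
        by (intro ev_Add ev_Div ready_ev[OF r2] ev_V o1(2)[OF i', unfolded q_def]) simp
      show "X' = entry B t1 d1 0 (o1 + q)" unfolding o1(3)[OF i'] occ_sample[OF i] X'_def by simp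
    qed (use o1(1)[OF i'] ready_ev(10)[OF r2] ord nw in auto)
  qed
  let ?s3 = "?s2(14 := X')"
  have r3: "ready v k ?s3" using r2 by (simp add: ready_upd)
  have c15: "ev w UNIV ?s3 m (lessE (subE (Vr 14) (Vr 13)) (Vr 7)) (of_bool (X' - X < d1))"
    by (intro ev_Less ev_Sub ev_V ready_ev[OF r3]) (use ord nw in auto)
  have sparse1: "ev w UNIV ?s3 m (subE (field1E (addE (Vr 12) (addE (addE (divE (Vr 5) (Vr 6))
         (mulE (divE (Vr 13) (Vr 7)) (Vr 6))) (modE (Vr 2) (Vr 6))))) (Cn 1)) (select v B k)"
    if "\<not> X' - X < d1"
  proof -
    define i where "i = n div t1 + X div d1 * t1 + k mod t1"
    have sp: "after v B (k div t1 * t1) + d1 \<le> after v B (Suc (k div t1) * t1)"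
      using that ord unfolding X_def X'_def q_def by linarith
    note sl = occ_slot[OF k tp(3) tp(1) sp, folded q_def, folded X_def]
    have "X div d1 * t1 + k mod t1 < Suc (X div d1) * t1" using tp by simp
    also have "\<dots> \<le> n div d1 * t1" using sl(1) by (intro mult_right_mono) auto
    finally have i': "i < n div t1 + n div d1 * t1" by (simp add: i_def)
    have "ev w UNIV ?s3 m (field1E (addE (Vr 12) (addE (addE (divE (Vr 5) (Vr 6))
         (mulE (divE (Vr 13) (Vr 7)) (Vr 6))) (modE (Vr 2) (Vr 6))))) (Suc (select v B k))"
    proof (rule field1)
      have "i < 2 ^ w" using o1(2)[OF i'] by simp
      then show "ev w UNIV ?s3 m (addE (Vr 12) (addE (addE (divE (Vr 5) (Vr 6))
         (mulE (divE (Vr 13) (Vr 7)) (Vr 6))) (modE (Vr 2) (Vr 6)))) (o1 + i)"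
        unfolding i_def by (intro ev_Add ev_Mul ev_Mod ev_Div ready_ev[OF r3] ev_V o1(2)[OF i', unfolded i_def]) auto
      show "Suc (select v B k) = entry B t1 d1 0 (o1 + i)"
        unfolding o1(3)[OF i'] unfolding i_def sl(2) sel(1) ..
    qed (use o1(1)[OF i'] ready_ev(10)[OF r3] sel(2) nw in auto)
    \<comment> \<open>Directory entries are positions behind an occurrence, hence the final
      subtraction of 1.\<close>
    from ev_Sub[OF this ev_N[OF t_bounds(8)]] show ?thesis using sel(2) nw[of "Suc (select v B k)"] by simp
  qed
  have dense1: "hs w UNIV {} ([Asg 15 (offsetE (Vr 8) (Vr 9)),
       Asg 16 (Ite (lessE (modE (Vr 2) (Vr 6)) (Vr 8)) (Vr 13)
         (addE (Vr 13) (field2E (addE (Vr 15) (subE (divE (Vr 2) (Vr 8)) (Cn 1)))))),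
       Asg 17 (Ite (lessE (divE (Vr 2) (Vr 8)) (divE (Vr 5) (Vr 8)))
         (addE (Vr 13) (field2E (addE (Vr 15) (divE (Vr 2) (Vr 8))))) (Vr 5)),
       When (lessE (subE (Vr 17) (Vr 16)) (Vr 9))
        [Asg 18 (fieldE (addE (Vr 4) (Vr 16)) (Vr 9)),
         Asg 19 (Ite (Vr 1) (Vr 18) (Bn Xor (Vr 18) (subE (pow2E (Vr 9)) (Cn 1)))),
         Asg 0 (addE (Vr 16) (searchE (Vr 9) (Vr 19) (modE (Vr 2) (Vr 8))))]
        [Asg 0 (subE (addE (Vr 13) (field2E (addE (Vr 15) (addE (addE (divE (Vr 5) (Vr 8))
           (mulE (divE (Vr 16) (Vr 9)) (Vr 8))) (modE (Vr 2) (Vr 8)))))) (Cn 1))]] @ [])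
      ?s3 m (\<lambda>s' m'. s' 0 = select v B k \<and> m' = m)"
    if dense: "X' - X < d1"
  proof -
    have c15: "ev w UNIV ?s3 m (offsetE (Vr 8) (Vr 9)) o2" unfolding o2_def
      by (rule ev_offset[OF ready_ev(8,9)[OF r3] r3]) (use room2(4) in \<open>simp add: ents2_def\<close>)
    let ?s4 = "?s3(15 := o2)"
    have r4: "ready v k ?s4" using r3 by (simp add: ready_upd)
    \<comment> \<open>Density of the coarse group is what makes the truncated second-level entries
      exact.\<close>
    have rel: "(after v B c - X) mod 2 ^ r = after v B c - X" if "c \<le> Suc q * t1" for c
    proof -
      have "after v B c \<le> X'" unfolding X'_def by (rule after_mono[OF that])
      then have "after v B c - X < 2 ^ r" using dense g(11) by linarith
      then show ?thesis by simp
    qed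
    have grp: "(c - 1) div t1 = q" if "q * t1 < c" "c \<le> Suc q * t1" for c
      by (rule div_nat_eqI) (use that in \<open>auto simp: mult.commute\<close>)
    have c16: "ev w UNIV ?s4 m (Ite (lessE (modE (Vr 2) (Vr 6)) (Vr 8)) (Vr 13)
         (addE (Vr 13) (field2E (addE (Vr 15) (subE (divE (Vr 2) (Vr 8)) (Cn 1)))))) Y"
    proof (rule ev_Ite[OF ev_Less[OF ev_Mod[OF ready_ev(2,6)[OF r4]] ready_ev(8)[OF r4]]])
      \<comment> \<open>The first fine group of a coarse group starts at \<open>X\<close> itself.
        The sample for this boundary would be relative to the preceding coarse group and must not be
        added to \<open>X\<close>.\<close>
      assume "of_bool (k mod t1 < t2) \<noteq> (0::nat)"
      then have "k mod t1 < t2" by simp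
      moreover have "k = q * t1 + k mod t1" unfolding q_def by (rule div_mult_mod_eq[symmetric])
      ultimately have "k < q * t1 + t2" by linarith
      moreover have "q * t1 = q * w * t2" unfolding g(9) by simp
      ultimately have "h * t2 < (q * w + 1) * t2" using h1 by (simp add: algebra_simps)
      then have "h < q * w + 1" using tp(2) by (simp only: mult_less_cancel2)
      then have "h * t2 \<le> q * w * t2" by (intro mult_right_mono) auto
      then have "h * t2 = q * t1" using qh \<open>q * t1 = q * w * t2\<close> by linarith
      then show "ev w UNIV ?s4 m (Vr 13) Y" by (simp add: ev_def Y_def X_def)
    next
      assume "of_bool (k mod t1 < t2) = (0::nat)"
      then have "t2 \<le> k mod t1" by simp
      moreover have "k = q * t1 + k mod t1" unfolding q_def by (rule div_mult_mod_eq[symmetric])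
      ultimately have "q * t1 + t2 \<le> k" by linarith
      then have lt: "q * t1 < h * t2" using h1 by simp
      then have hp: "0 < h" by (cases h) auto
      have i: "h - 1 < n div t2" using kd hp unfolding h_def by linarith
      then have i': "h - 1 < n div t2 + n div d2 * t2" by simp
      have le: "h * t2 \<le> Suc q * t1" using hq' by simp
      have "ev w UNIV ?s4 m (addE (Vr 13) (field2E (addE (Vr 15) (subE (divE (Vr 2) (Vr 8)) (Cn 1))))) (X + (Y - X))"
      proof (intro ev_Add field2)
        show "ev w UNIV ?s4 m (Vr 13) X" by (simp add: ev_def)
        show "ev w UNIV ?s4 m (addE (Vr 15) (subE (divE (Vr 2) (Vr 8)) (Cn 1))) (o2 + (h - 1))" unfolding h_def
          by (intro ev_Add ev_Sub ev_Div ev_N ready_ev[OF r4] t_bounds ev_V o2(2)[OF i', unfolded h_def])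
            (use hp[unfolded h_def] kw div_le_dividend[of k t2] in \<open>simp_all del: div_le_dividend\<close>)
        show "o2 + (h - 1) < ents2 r n" by (rule o2[OF i'])
        show "?s4 11 = m p + n + ents1 w r n * w" "?s4 3 = r" by (rule ready_ev[OF r4])+
        have "occ B t2 d2 v (h - 1) = h * t2" using hp unfolding occ_sample[OF i] by simp
        then show "Y - X = entry B t2 d2 t1 (o2 + (h - 1)) mod 2 ^ r"
          unfolding o2(3)[OF i'] Y_def using grp[OF lt le] rel[OF le] by (simp add: X_def)
        show "X + (Y - X) < 2 ^ w" using ord nw by simp
      qed
      then show "ev w UNIV ?s4 m (addE (Vr 13) (field2E (addE (Vr 15) (subE (divE (Vr 2) (Vr 8)) (Cn 1))))) Y"
        using ord by simp
    qed
    let ?s5 = "?s4(16 := Y)"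
    have r5: "ready v k ?s5" using r4 by (simp add: ready_upd)
    have c17: "ev w UNIV ?s5 m (Ite (lessE (divE (Vr 2) (Vr 8)) (divE (Vr 5) (Vr 8)))
         (addE (Vr 13) (field2E (addE (Vr 15) (divE (Vr 2) (Vr 8))))) (Vr 5)) Y'"
    proof (rule ev_Ite[OF ev_Less[OF ev_Div[OF ready_ev(2,8)[OF r5]] ev_Div[OF ready_ev(5,8)[OF r5]]]])
      assume "of_bool (k div t2 < n div t2) = (0::nat)"
      then have "Y' = n" unfolding Y'_def h_def by (intro after_group k tp) simp
      then show "ev w UNIV ?s5 m (Vr 5) Y'" using ready_ev(5)[OF r5] by simp
    next
      assume "of_bool (k div t2 < n div t2) \<noteq> (0::nat)"
      then have i: "h < n div t2" by (simp add: h_def)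
      then have i': "h < n div t2 + n div d2 * t2" by simp
      have lt: "q * t1 < Suc h * t2" using q1 h1 by linarith
      have "ev w UNIV ?s5 m (addE (Vr 13) (field2E (addE (Vr 15) (divE (Vr 2) (Vr 8))))) (X + (Y' - X))"
      proof (intro ev_Add field2)
        show "ev w UNIV ?s5 m (Vr 13) X" by (simp add: ev_def)
        show "ev w UNIV ?s5 m (addE (Vr 15) (divE (Vr 2) (Vr 8))) (o2 + h)" unfolding h_def
          by (intro ev_Add ev_Div ready_ev[OF r5] ev_V o2(2)[OF i', unfolded h_def]) simp
        show "o2 + h < ents2 r n" by (rule o2[OF i'])
        show "?s5 11 = m p + n + ents1 w r n * w" "?s5 3 = r" by (rule ready_ev[OF r5])+
        show "Y' - X = entry B t2 d2 t1 (o2 + h) mod 2 ^ r"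
          unfolding o2(3)[OF i'] Y'_def occ_sample[OF i] using grp[OF lt hq'] rel[OF hq'] by (simp add: X_def)
        show "X + (Y' - X) < 2 ^ w" using ord nw by simp
      qed
      then show "ev w UNIV ?s5 m (addE (Vr 13) (field2E (addE (Vr 15) (divE (Vr 2) (Vr 8))))) Y'"
        using ord by simp
    qed
    let ?s6 = "?s5(17 := Y')"
    have r6: "ready v k ?s6" using r5 by (simp add: ready_upd)
    have c18: "ev w UNIV ?s6 m (lessE (subE (Vr 17) (Vr 16)) (Vr 9)) (of_bool (Y' - Y < d2))"
      by (intro ev_Less ev_Sub ev_V ready_ev[OF r6]) (use ord nw in auto)
    have sparse2: "ev w UNIV ?s6 m (subE (addE (Vr 13) (field2E (addE (Vr 15) (addE (addE (divE (Vr 5) (Vr 8))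
           (mulE (divE (Vr 16) (Vr 9)) (Vr 8))) (modE (Vr 2) (Vr 8)))))) (Cn 1)) (select v B k)"
      if "\<not> Y' - Y < d2"
    proof -
      define i where "i = n div t2 + Y div d2 * t2 + k mod t2"
      have sp: "after v B (k div t2 * t2) + d2 \<le> after v B (Suc (k div t2) * t2)"
        using that ord unfolding Y_def Y'_def h_def by linarith
      note sl = occ_slot[OF k tp(4) tp(2) sp, folded h_def, folded Y_def]
      have "Y div d2 * t2 + k mod t2 < Suc (Y div d2) * t2" using tp by simp
      also have "\<dots> \<le> n div d2 * t2" using sl(1) by (intro mult_right_mono) auto
      finally have i': "i < n div t2 + n div d2 * t2" by (simp add: i_def)
      have "ev w UNIV ?s6 m (addE (Vr 13) (field2E (addE (Vr 15) (addE (addE (divE (Vr 5) (Vr 8))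
           (mulE (divE (Vr 16) (Vr 9)) (Vr 8))) (modE (Vr 2) (Vr 8)))))) (X + (Suc (select v B k) - X))"
      proof (intro ev_Add[where b="field2E _"] field2)
        show "ev w UNIV ?s6 m (Vr 13) X" by (simp add: ev_def)
        have "i < 2 ^ w" using o2(2)[OF i'] by simp
        then show "ev w UNIV ?s6 m (addE (Vr 15) (addE (addE (divE (Vr 5) (Vr 8))
           (mulE (divE (Vr 16) (Vr 9)) (Vr 8))) (modE (Vr 2) (Vr 8)))) (o2 + i)"
          unfolding i_def by (intro ev_Add ev_Mul ev_Mod ev_Div ready_ev[OF r6] ev_V o2(2)[OF i', unfolded i_def]) auto
        show "o2 + i < ents2 r n" by (rule o2[OF i'])
        show "?s6 11 = m p + n + ents1 w r n * w" "?s6 3 = r" by (rule ready_ev[OF r6])+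
        have "(Suc k - 1) div t1 = q" by (simp add: q_def)
        moreover have "Suc k \<le> Suc q * t1" using q1 by simp
        ultimately show "Suc (select v B k) - X = entry B t2 d2 t1 (o2 + i) mod 2 ^ r"
          unfolding o2(3)[OF i'] using rel[of "Suc k"] sl(2) sel(1) by (simp add: X_def i_def)
        show "X + (Suc (select v B k) - X) < 2 ^ w" using ord nw[of "Suc (select v B k)"] sel by simp
      qed
      from ev_Sub[OF this ev_N[OF t_bounds(8)]] show ?thesis
        using ord sel(2) nw[of "Suc (select v B k)"] by simp
    qed
    define z where "z = field w m (m p + Y) d2"
    define z' where "z' = (if v then z else Bit_Operations.xor z (2 ^ d2 - 1))"
    have z2: "z < 2 ^ d2" unfolding z_def by (rule field_less)
    have mask: "(2::nat) ^ d2 - 1 = mask d2" by (simp add: mask_eq_exp_minus_1)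
    have z2': "z' < 2 ^ d2"
    proof -
      have "Bit_Operations.xor z (2 ^ d2 - 1) = take_bit d2 (Bit_Operations.xor z (2 ^ d2 - 1))"
        using z2 unfolding mask by (simp add: take_bit_xor take_bit_nat_eq_self)
      then have "Bit_Operations.xor z (2 ^ d2 - 1) < 2 ^ d2" by (metis take_bit_nat_less_exp)
      then show ?thesis using z2 by (simp add: z'_def)
    qed
    have zb: "bit z' x \<longleftrightarrow> B ! (Y + x) = v" if x: "x < d2" "Y + x < n" for x
    proof -
      have "bit z x \<longleftrightarrow> mem_bit w m (m p + (Y + x))"
        unfolding z_def using bit_field[OF g(3), of d2 m "m p + Y" x] words x g(18) by (simp add: add.assoc)
      also have "\<dots> \<longleftrightarrow> B ! (Y + x)" using x by (subst bits) (simp_all add: node_bit_def)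
      finally show ?thesis using x(1) unfolding z'_def mask by (auto simp: bit_simps)
    qed
    have c19: "ev w UNIV ?s6 m (fieldE (addE (Vr 4) (Vr 16)) (Vr 9)) z" unfolding z_def
      by (intro ev_field ev_Add ev_V ready_ev[OF r6] g words) (use g(18) room2(2) ord in auto)
    let ?s7 = "?s6(18 := z)"
    have r7: "ready v k ?s7" using r6 by (simp add: ready_upd)
    have c20: "ev w UNIV ?s7 m (Ite (Vr 1) (Vr 18) (Bn Xor (Vr 18) (subE (pow2E (Vr 9)) (Cn 1)))) z'"
    proof (rule ev_Ite[OF ready_ev(1)[OF r7]])
      assume "of_bool v \<noteq> (0::nat)"
      then show "ev w UNIV ?s7 m (Vr 18) z'" by (simp add: ev_def z'_def)
    next
      assume "of_bool v = (0::nat)"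
      then have xo: "z' = Bit_Operations.xor z (2 ^ d2 - 1)" by (simp add: z'_def)
      show "ev w UNIV ?s7 m (Bn Xor (Vr 18) (subE (pow2E (Vr 9)) (Cn 1))) z'"
        unfolding xo by (intro ev_Xor ev_V ev_pow2_minus ready_ev[OF r7] g(18)) simp
    qed
    let ?s8 = "?s7(19 := z')"
    have r8: "ready v k ?s8" using r7 by (simp add: ready_upd)
    have dense2: "ev w UNIV ?s8 m (addE (Vr 16) (searchE (Vr 9) (Vr 19) (modE (Vr 2) (Vr 8)))) (select v B k)"
      if d: "Y' - Y < d2"
    proof -
      define x0 where "x0 = select v B k - Y"
      have x0: "x0 < d2" "Y + x0 = select v B k" using d ord by (auto simp: x0_def)
      have km: "k mod t2 < 2 ^ d2"
      proof -
        have "k mod t2 < t2" using tp by simp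
        also have "t2 \<le> d2" by (rule g)
        also have "d2 < 2 ^ d2" by simp
        finally show ?thesis .
      qed
      have rY: "rank v B Y = h * t2" unfolding Y_def by (rule rank_after) (use h1 k in simp)
      have pr: "h * t2 + pop z' x = rank v B (Y + x)" if "x \<le> Suc x0" for x
        unfolding rY[symmetric] by (rule pop_rank, rule zb) (use that x0 sel in auto)
      have kk: "k = h * t2 + k mod t2" unfolding h_def by (rule div_mult_mod_eq[symmetric])
      have p0: "pop z' x0 = k mod t2" using pr[of x0] x0 select_after(3)[OF k] kk by simp
      have p1: "pop z' (Suc x0) = Suc (k mod t2)"
        using pr[of "Suc x0"] x0 rank_Suc[of "select v B k" B v] select_after[OF k] kk by simp
      \<comment> \<open>Prefix counts are monotone and step from \<open>k mod t2\<close> to its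
        successor at \<open>x0\<close>, so those not exceeding \<open>k mod t2\<close> are exactly
        the ones before \<open>x0\<close>, even if the block read extends beyond the group.\<close>
      have "{x. x < d2 \<and> pop z' (Suc x) \<le> k mod t2} = {..<x0}"
      proof (intro set_eqI iffI)
        fix x assume "x \<in> {x. x < d2 \<and> pop z' (Suc x) \<le> k mod t2}"
        then have "\<not> x0 \<le> x" using pop_mono[of "Suc x0" "Suc x" z'] p1 by auto
        then show "x \<in> {..<x0}" by simp
      next
        fix x assume "x \<in> {..<x0}"
        then show "x \<in> {x. x < d2 \<and> pop z' (Suc x) \<le> k mod t2}"
          using pop_mono[of "Suc x" x0 z'] p0 x0 by auto
      qed
      then have c: "card {x. x < d2 \<and> pop z' (Suc x) \<le> k mod t2} = x0" by simp
      have "ev w UNIV ?s8 m (searchE (Vr 9) (Vr 19) (modE (Vr 2) (Vr 8))) x0"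
        unfolding c[symmetric] by (intro ev_search ev_Mod ready_ev[OF r8] ev_V g z2' km) simp
      then show ?thesis unfolding x0(2)[symmetric]
        by (intro ev_Add ev_V) (use x0 sel nw in auto)
    qed
    show ?thesis unfolding append.simps
      by (rule hs_Asg[OF c15], rule hs_Asg[OF c16], rule hs_Asg[OF c17], rule hs_When[OF c18], unfold append.simps,
        rule hs_Asg[OF c19], rule hs_Asg[OF c20], rule hs_Asg[OF dense2], simp, rule hs_Nil, simp,
        rule hs_Asg[OF sparse2], simp, rule hs_Nil, simp)
  qed
  show ?thesis unfolding select_code_def
    by (rule hs_Asg[OF c12], rule hs_Asg[OF c13], rule hs_Asg[OF c14], rule hs_When[OF c15],
        rule dense1, simp, unfold append.simps, rule hs_Asg[OF sparse1], simp, rule hs_Nil, simp)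
qed

end

definition query_cost :: real where
  "query_cost = real (cost (prologue @ rank_code) + cost (prologue @ select_code) + 2)"

context node_view
begin

lemma answers_code:
  assumes code: "\<And>s. ready v i s \<Longrightarrow> hs w UNIV {} code s m (\<lambda>s' m'. s' 0 = x \<and> m' = m)"
    and "cost (prologue @ code) + 2 \<le> query_cost" "query_cost \<le> C"
  shows "answers w C (move_args @ comps (prologue @ code)) p m v i x"
  unfolding answers_def
proof (rule ht_computes[OF ht_hs])
  let ?s = "\<lambda>x. if x = 1 then of_bool v else if x = 2 then i else query_regs p v i (2 * x)"
  show "hs w UNIV {} (prologue @ code) ?s m (\<lambda>s' m'. s' 0 = x \<and> m' = m)"
    by (rule hs_prologue[OF _ _ _ code]) (simp_all add: query_regs_def)
qed (use assms(2,3) in \<open>auto simp: query_regs_def\<close>)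

lemma answers_rank:
  assumes "i \<le> length B" "query_cost \<le> C"
  shows "answers w C rank_prog p m v i (rank v B i)"
  unfolding rank_prog_def
  by (rule answers_code[OF hs_rank[OF _ assms(1)] _ assms(2)]) (simp_all add: query_cost_def)

lemma answers_select:
  assumes "k < count_list B v" "query_cost \<le> C"
  shows "answers w C select_prog p m v k (select v B k)"
  unfolding select_prog_def
  by (rule answers_code[OF hs_select[OF _ assms(1)] _ assms(2)]) (simp_all add: query_cost_def)

end

subsection \<open>Stable sorting by a key\<close>

definition before :: "(nat \<Rightarrow> nat) \<Rightarrow> nat \<Rightarrow> nat \<Rightarrow> bool" where
  "before f j i \<longleftrightarrow> f j < f i \<or> f j = f i \<and> j < i"

definition spos :: "(nat \<Rightarrow> nat) \<Rightarrow> nat \<Rightarrow> nat \<Rightarrow> nat" where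
  "spos f n i = card {j. j < n \<and> before f j i}"

definition item :: "(nat \<Rightarrow> nat) \<Rightarrow> nat \<Rightarrow> nat \<Rightarrow> nat" where
  "item f n = inv_into {..<n} (spos f n)"

lemma spos_mono: "i < n \<Longrightarrow> before f i j \<Longrightarrow> spos f n i < spos f n j"
  unfolding spos_def by (rule psubset_card_mono) (auto simp: before_def)

lemma spos_less: "i < n \<Longrightarrow> spos f n i < n"
proof -
  assume i: "i < n"
  have "{j. j < n \<and> before f j i} \<subset> {..<n}" using i by (auto simp: before_def)
  from psubset_card_mono[OF _ this] show ?thesis unfolding spos_def by simp
qed

lemma spos_less_iff: "i < n \<Longrightarrow> j < n \<Longrightarrow> spos f n i < spos f n j \<longleftrightarrow> before f i j"
  using spos_mono[of i n f j] spos_mono[of j n f i]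
  by (metis before_def less_asym' linorder_neqE_nat order_less_irrefl)

lemma bij_spos: "bij_betw (spos f n) {..<n} {..<n}"
proof -
  have "inj_on (spos f n) {..<n}"
  proof (rule inj_onI)
    fix i j assume ij: "i \<in> {..<n}" "j \<in> {..<n}" "spos f n i = spos f n j"
    then have "\<not> before f i j" "\<not> before f j i"
      using spos_mono[of i n f j] spos_mono[of j n f i] by auto
    then show "i = j" unfolding before_def by (meson linorder_neqE_nat)
  qed
  moreover have "spos f n ` {..<n} \<subseteq> {..<n}" using spos_less by auto
  ultimately show ?thesis by (simp add: bij_betw_def endo_inj_surj)
qed

lemma item_less: "y < n \<Longrightarrow> item f n y < n"
  using bij_betw_inv_into[OF bij_spos[of f n]] unfolding item_def bij_betw_def by blast

lemma spos_item: "y < n \<Longrightarrow> spos f n (item f n y) = y"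
  using bij_betw_inv_into_right[OF bij_spos[of f n], of y] unfolding item_def by simp

lemma item_spos: "i < n \<Longrightarrow> item f n (spos f n i) = i"
  using bij_betw_inv_into_left[OF bij_spos[of f n], of i] unfolding item_def by simp

lemma spos_const: "(\<And>i. i < n \<Longrightarrow> f i = c) \<Longrightarrow> i < n \<Longrightarrow> spos f n i = i"
proof -
  assume "\<And>i. i < n \<Longrightarrow> f i = c" "i < n"
  then have "{j. j < n \<and> before f j i} = {..<i}" by (auto simp: before_def)
  then show ?thesis by (simp add: spos_def)
qed

lemma item_const: "(\<And>i. i < n \<Longrightarrow> f i = c) \<Longrightarrow> y < n \<Longrightarrow> item f n y = y"
  by (metis item_spos spos_const)

lemma spos_cong: "(\<And>i. i < n \<Longrightarrow> f i = g i) \<Longrightarrow> i < n \<Longrightarrow> spos f n i = spos g n i"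
  unfolding spos_def before_def by (rule arg_cong[where f=card]) auto

lemma item_cong: "(\<And>i. i < n \<Longrightarrow> f i = g i) \<Longrightarrow> y < n \<Longrightarrow> item f n y = item g n y"
  by (metis item_less item_spos spos_cong spos_item)

lemma spos_split:
  "spos f n i = card {j. j < n \<and> f j < f i} + card {j. j < n \<and> j < i \<and> f j = f i}"
proof -
  have "{j. j < n \<and> before f j i} = {j. j < n \<and> f j < f i} \<union> {j. j < n \<and> j < i \<and> f j = f i}"
    by (auto simp: before_def)
  then show ?thesis unfolding spos_def by (simp add: card_Un_disjoint disjoint_iff)
qed

lemma card_item: "card {y. y < n \<and> P (item f n y)} = card {j. j < n \<and> P j}"
proof (rule bij_betw_same_card[of "item f n"], rule bij_betwI'[where f="item f n"])
  fix x y assume "x \<in> {y. y < n \<and> P (item f n y)}" "y \<in> {y. y < n \<and> P (item f n y)}"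
  then show "item f n x = item f n y \<longleftrightarrow> x = y" by (metis mem_Collect_eq spos_item)
next
  fix x assume "x \<in> {y. y < n \<and> P (item f n y)}"
  then show "item f n x \<in> {j. j < n \<and> P j}" by (simp add: item_less)
next
  fix j assume "j \<in> {j. j < n \<and> P j}"
  then show "\<exists>x\<in>{y. y < n \<and> P (item f n y)}. j = item f n x"
    by (intro bexI[of _ "spos f n j"]) (auto simp: item_spos spos_less)
qed

lemma digit_less: "(d :: nat) < d' \<Longrightarrow> r < b \<Longrightarrow> d * b + r < d' * b + r'"
proof -
  assume "d < d'" "r < b"
  then have "d * b + r < Suc d * b" by simp
  also have "\<dots> \<le> d' * b" using \<open>d < d'\<close> by (intro mult_right_mono) auto
  finally show ?thesis by simp
qed

text \<open>One pass of radix sort: \<open>x j\<close> is the next digit of the element that is currently at position \<open>j\<close>.\<close>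

lemma spos_digit:
  fixes d f :: "nat \<Rightarrow> nat"
  assumes f: "\<And>i. i < n \<Longrightarrow> f i < b" and i: "i < n"
  defines "x \<equiv> \<lambda>j. d (item f n j)"
  shows "spos (\<lambda>i. d i * b + f i) n i = card {j. j < n \<and> x j < x (spos f n i)} +
    card {j. j < spos f n i \<and> x j = x (spos f n i)}"
proof -
  let ?h = "\<lambda>i. d i * b + f i"
  \<comment> \<open>As \<open>f\<close> is below \<open>b\<close>, the combined key compares
    lexicographically by digit and then by old key; ties are broken by index in both orders.\<close>
  have be: "before ?h j i \<longleftrightarrow> d j < d i \<or> d j = d i \<and> before f j i" if j: "j < n" for j
    using digit_less[of "d j" "d i" "f j" b "f i"] digit_less[of "d i" "d j" "f i" b "f j"] f[OF i] f[OF j]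
    unfolding before_def by (cases "d j" "d i" rule: linorder_cases) auto
  have xi: "x (spos f n i) = d i" by (simp add: x_def item_spos[OF i])
  have sp: "y < spos f n i \<longleftrightarrow> before f (item f n y) i" if "y < n" for y
    using spos_less_iff[OF item_less[OF that] i] spos_item[OF that] by metis
  have "{j. j < n \<and> before ?h j i} = {j. j < n \<and> d j < d i} \<union> {j. j < n \<and> (d j = d i \<and> before f j i)}"
    using be by auto
  then have "spos ?h n i = card {j. j < n \<and> d j < d i} + card {j. j < n \<and> (d j = d i \<and> before f j i)}"
    unfolding spos_def by (simp add: card_Un_disjoint disjoint_iff)
  also have "card {j. j < n \<and> d j < d i} = card {y. y < n \<and> d (item f n y) < d i}"
    by (rule card_item[symmetric])
  also have "card {j. j < n \<and> (d j = d i \<and> before f j i)} =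
      card {y. y < n \<and> (d (item f n y) = d i \<and> before f (item f n y) i)}"
    by (rule card_item[symmetric])
  also have "{y. y < n \<and> (d (item f n y) = d i \<and> before f (item f n y) i)} = {y. y < spos f n i \<and> x y = d i}"
    using sp less_trans[OF _ spos_less[OF i, of f]] by (auto simp: x_def)
  finally show ?thesis unfolding xi by (simp add: x_def)
qed

subsection \<open>Counting within blocks\<close>

lemma sum_card_fibres: "(\<Sum>e<m. card {j. j < n \<and> f j = e}) = card {j::nat. j < n \<and> f j < (m::nat)}"
proof (induction m)
  case (Suc m)
  have "{j. j < n \<and> f j < Suc m} = {j. j < n \<and> f j < m} \<union> {j. j < n \<and> f j = m}" by auto
  then show ?case using Suc by (simp add: card_Un_disjoint disjoint_iff)
qed simp

text \<open>Buckets are numbered by digit first and block second. An earlier position with the same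
  digit lies either in an earlier block, and is counted among the smaller buckets, or in the block
  of \<open>j\<close>.\<close>

lemma bucket_split:
  fixes R nb n :: nat
  assumes j: "j < n" and nb: "\<And>j. j < n \<Longrightarrow> j div R < nb"
  shows "card {k. k < n \<and> x k * nb + k div R < x j * nb + j div R} +
      card {k. k < j \<and> k div R = j div R \<and> x k = x j} =
    card {k. k < n \<and> x k < x j} + card {k. k < j \<and> x k = (x j :: nat)}"
proof -
  have iff: "x k * nb + k div R < x j * nb + j div R \<longleftrightarrow> x k < x j \<or> x k = x j \<and> k div R < j div R"
    if "k < n" for k
    using digit_less[of "x k" "x j" "k div R" nb "j div R"] digit_less[of "x j" "x k" "j div R" nb "k div R"]
      nb[OF j] nb[OF that] by (cases "x k" "x j" rule: linorder_cases) auto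
  have lt: "k < j" if "k div R < j div R" for k
    using that by (meson div_le_mono not_less)
  have "{k. k < n \<and> x k * nb + k div R < x j * nb + j div R} =
      {k. k < n \<and> x k < x j} \<union> {k. k < j \<and> x k = x j \<and> k div R < j div R}"
    using iff lt less_trans[OF lt j] j by auto
  then have 1: "card {k. k < n \<and> x k * nb + k div R < x j * nb + j div R} =
      card {k. k < n \<and> x k < x j} + card {k. k < j \<and> x k = x j \<and> k div R < j div R}"
    by (simp add: card_Un_disjoint disjoint_iff)
  have "{k. k < j \<and> x k = x j} = {k. k < j \<and> x k = x j \<and> k div R < j div R} \<union>
      {k. k < j \<and> k div R = j div R \<and> x k = x j}"
    using div_le_mono[of _ j R] by (auto simp: le_less)
  then have 2: "card {k. k < j \<and> x k = x j} = card {k. k < j \<and> x k = x j \<and> k div R < j div R} +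
      card {k. k < j \<and> k div R = j div R \<and> x k = x j}"
    by (simp add: card_Un_disjoint disjoint_iff)
  show ?thesis unfolding 1 2 by simp
qed

subsection \<open>Prefix sums by doubling\<close>

text \<open>The sum of the last \<open>t\<close> values up to \<open>c\<close>, cut off at index 0:
  the state of a doubling scan when the stride has reached \<open>t\<close>. Once
  \<open>t > c\<close> it is the full prefix sum.\<close>

definition window :: "(nat \<Rightarrow> nat) \<Rightarrow> nat \<Rightarrow> nat \<Rightarrow> nat" where
  "window u t c = (\<Sum>k\<in>{Suc c - t..c}. u k)"

lemma window_1: "window u 1 c = u c"
  by (simp add: window_def)

lemma window_double: "window u (2 * t) c = window u t c + (if c < t then 0 else window u t (c - t))"
proof (cases "c < t")
  case False
  have "{Suc c - 2 * t..c} = {Suc c - t..c} \<union> {Suc (c - t) - t..c - t}" using False by auto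
  moreover have "{Suc c - t..c} \<inter> {Suc (c - t) - t..c - t} = {}" using False by auto
  ultimately show ?thesis using False unfolding window_def by (simp add: sum.union_disjoint)
next
  case True
  then have "Suc c - 2 * t = 0" "Suc c - t = 0" by auto
  then show ?thesis using True by (simp add: window_def)
qed

text \<open>Chunk sums moved by one place, so that the inclusive scan yields the sum of all chunks
  strictly before \<open>c\<close>.\<close>

definition shifted :: "nat \<Rightarrow> (nat \<Rightarrow> nat) \<Rightarrow> nat \<Rightarrow> nat" where
  "shifted g C c = (if c = 0 then 0 else \<Sum>e\<in>{(c - 1) * g..<c * g}. C e)"

lemma window_shifted: "c < t \<Longrightarrow> window (shifted g C) t c = (\<Sum>e<c * g. C e)"
proof -
  assume "c < t"
  then have "window (shifted g C) t c = (\<Sum>k\<le>c. shifted g C k)"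
    by (simp add: window_def atLeast0AtMost)
  also have "\<dots> = (\<Sum>e<c * g. C e)"
  proof (induction c)
    case (Suc c)
    have "(\<Sum>e<Suc c * g. C e) = (\<Sum>e<c * g. C e) + (\<Sum>e\<in>{c * g..<Suc c * g}. C e)"
      using sum.atLeastLessThan_concat[of 0 "c * g" "Suc c * g" C] by (simp add: atLeast0LessThan)
    then show ?case using Suc by (simp add: shifted_def)
  qed (simp add: shifted_def)
  finally show ?thesis .
qed

lemma prefix_split: "(\<Sum>e'<(e::nat). C e') = (\<Sum>e'<e div g * g. C e') + (\<Sum>e'\<in>{e div g * g..<e}. (C e' :: nat))"
  using sum.atLeastLessThan_concat[of 0 "e div g * g" e C] by (simp add: atLeast0LessThan)

subsection \<open>Bit strings of wavelet tree nodes\<close>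

text \<open>The leading \<open>l\<close> bits of an \<open>L\<close>-bit symbol, that is, the number
  of the node within level \<open>l\<close> that the symbol belongs to.\<close>

definition key :: "nat \<Rightarrow> (nat \<Rightarrow> nat) \<Rightarrow> nat \<Rightarrow> nat \<Rightarrow> nat" where
  "key L f l i = f i div 2 ^ (L - l)"

definition node_bits :: "nat \<Rightarrow> (nat \<Rightarrow> nat) \<Rightarrow> nat \<Rightarrow> nat \<Rightarrow> nat \<Rightarrow> bool list" where
  "node_bits L f n l c = map (\<lambda>i. odd (key L f (Suc l) i)) (filter (\<lambda>i. key L f l i = c) [0..<n])"

lemma key_Suc: "l < L \<Longrightarrow> key L f (Suc l) i = 2 * key L f l i + of_bool (odd (key L f (Suc l) i))"
proof -
  assume "l < L"
  then have "L - l = Suc (L - Suc l)" by simp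
  then have "key L f l i = key L f (Suc l) i div 2"
    unfolding key_def by (simp add: div_mult2_eq[symmetric] mult.commute)
  then show ?thesis by (simp add: odd_two_times_div_two_succ)
qed

lemma key_child: "l < L \<Longrightarrow> key L f (Suc l) i = 2 * c + of_bool v \<longleftrightarrow>
    key L f l i = c \<and> odd (key L f (Suc l) i) = v"
  using key_Suc[of l L f i] by (cases v; cases "odd (key L f (Suc l) i)"; simp; presburger)

lemma key_less: "f i < 2 ^ L \<Longrightarrow> l \<le> L \<Longrightarrow> key L f l i < 2 ^ l"
  unfolding key_def by (simp add: div_less_iff_less_mult flip: power_add)

definition local_rank :: "nat \<Rightarrow> (nat \<Rightarrow> nat) \<Rightarrow> nat \<Rightarrow> nat \<Rightarrow> nat" where
  "local_rank L f l i = card {j. j < i \<and> key L f l j = key L f l i}"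

lemma length_filter_upt: "length (filter P [0..<i]) = card {j. j < i \<and> P j}"
proof -
  have "length (filter P [0..<i]) = card (set (filter P [0..<i]))"
    by (rule distinct_card[symmetric]) simp
  also have "set (filter P [0..<i]) = {j. j < i \<and> P j}" by auto
  finally show ?thesis .
qed

lemma take_filter_upt:
  "i \<le> n \<Longrightarrow> take (card {j. j < i \<and> P j}) (filter P [0..<n]) = filter P [0..<i]"
  using upt_add_eq_append[of 0 i "n - i"] by (simp add: length_filter_upt[symmetric])

lemma nth_filter_upt:
  "i < n \<Longrightarrow> P i \<Longrightarrow> filter P [0..<n] ! card {j. j < i \<and> P j} = i"
proof -
  assume i: "i < n" "P i"
  then have "[0..<n] = [0..<i] @ i # [Suc i..<n]"
    using upt_add_eq_append[of 0 i "n - i"] by (simp add: upt_conv_Cons)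
  then show ?thesis using i by (simp add: nth_append length_filter_upt[symmetric])
qed

lemma card_filter_less: "(i::nat) < n \<Longrightarrow> P i \<Longrightarrow> card {j. j < i \<and> P j} < card {j. j < n \<and> P j}"
proof -
  assume i: "i < n" "P i"
  have "{j. j < i \<and> P j} \<subseteq> {j. j < n \<and> P j}" using i(1) by auto
  moreover have "i \<in> {j. j < n \<and> P j} - {j. j < i \<and> P j}" using i by simp
  ultimately show ?thesis by (intro psubset_card_mono) (simp, blast)
qed

lemma length_node_bits: "length (node_bits L f n l c) = card {j. j < n \<and> key L f l j = c}"
  by (simp add: node_bits_def length_filter_upt)

lemma local_rank_less:
  "i < n \<Longrightarrow> local_rank L f l i < length (node_bits L f n l (key L f l i))"
  unfolding local_rank_def length_node_bits by (rule card_filter_less) auto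

lemma node_bits_nth:
  assumes "i < n"
  shows "node_bits L f n l (key L f l i) ! local_rank L f l i = odd (key L f (Suc l) i)"
proof -
  have "local_rank L f l i < length (filter (\<lambda>j. key L f l j = key L f l i) [0..<n])"
    using local_rank_less[OF assms] by (simp add: node_bits_def)
  then show ?thesis
    using nth_filter_upt[of i n "\<lambda>j. key L f l j = key L f l i"] assms
    by (simp add: node_bits_def local_rank_def)
qed

lemma count_list_map: "count_list (map f xs) v = length (filter (\<lambda>x. f x = v) xs)"
  by (induction xs) auto

lemma rank_node_bits:
  assumes "i < n" "l < L"
  shows "rank v (node_bits L f n l (key L f l i)) (local_rank L f l i) =
    card {j. j < i \<and> key L f (Suc l) j = 2 * key L f l i + of_bool v}"
proof -
  have "take (local_rank L f l i) (node_bits L f n l (key L f l i)) =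
      map (\<lambda>i. odd (key L f (Suc l) i)) (filter (\<lambda>j. key L f l j = key L f l i) [0..<i])"
    unfolding node_bits_def local_rank_def take_map using assms(1) by (subst take_filter_upt) auto
  then show ?thesis
    unfolding rank_def count_list_map
    by (simp add: count_list_map key_child[OF assms(2)] length_filter_upt conj_commute)
qed

lemma count_node_bits:
  assumes "l < L"
  shows "count_list (node_bits L f n l c) v = card {j. j < n \<and> key L f (Suc l) j = 2 * c + of_bool v}"
  unfolding node_bits_def count_list_map
  by (simp add: key_child[OF assms] length_filter_upt conj_commute)

text \<open>The items of a child are the items of the parent with the child's bit, in the same
  order. So the index of an item within the child is a rank in the parent, and the sorted orders
  answer rank by a lookup.\<close>

lemma rank_local_rank:
  fixes f :: "nat \<Rightarrow> nat"
  assumes "i < n" "l < L"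
  defines "v \<equiv> odd (key L f (Suc l) i)" and "B \<equiv> node_bits L f n l (key L f l i)"
  shows "rank v B (Suc (local_rank L f l i)) = Suc (local_rank L f (Suc l) i)"
proof -
  have "rank v B (local_rank L f l i) = local_rank L f (Suc l) i"
    unfolding B_def rank_node_bits[OF assms(1,2)] unfolding local_rank_def v_def
    using key_Suc[OF assms(2), of f i] by simp
  then show ?thesis
    using rank_Suc[OF local_rank_less[OF assms(1), of L f l]] node_bits_nth[OF assms(1), of L f l]
    by (simp add: B_def v_def)
qed

text \<open>The converse lookup: the item with a given index in a child sits in the parent at the
  occurrence with that number.\<close>

lemma after_local_rank:
  assumes "i < n" "l < L" "key L f (Suc l) i = 2 * c + of_bool v"
  shows "after v (node_bits L f n l c) (Suc (local_rank L f (Suc l) i)) = Suc (local_rank L f l i)"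
proof -
  have c: "c = key L f l i" "v = odd (key L f (Suc l) i)" using key_child[OF assms(2)] assms(3) by auto
  show ?thesis unfolding c
    by (rule after_unique)
      (use rank_local_rank[OF assms(1,2)] local_rank_less[OF assms(1)] node_bits_nth[OF assms(1)] in
        \<open>auto simp: Suc_le_eq\<close>)
qed

text \<open>Node \<open>c\<close> of level \<open>l\<close> represents an aligned interval of
  \<open>2 ^ (L - l)\<close> symbols, so membership in it is an equation between leading bits and
  halving it appends one bit. This turns the definition by intervals into one by keys.\<close>

lemma wavelet_node_bits:
  assumes "l < L"
  shows "wavelet (c * 2 ^ (L - l)) (Suc c * 2 ^ (L - l) - 1) (map f [0..<n]) =
    (if Suc l = L \<or> node_bits L f n l c = [] then Leaf (node_bits L f n l c)
     else Node (node_bits L f n l c)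
       (wavelet (2 * c * 2 ^ (L - Suc l)) (Suc (2 * c) * 2 ^ (L - Suc l) - 1) (map f [0..<n]))
       (wavelet ((2 * c + 1) * 2 ^ (L - Suc l)) (Suc (2 * c + 1) * 2 ^ (L - Suc l) - 1) (map f [0..<n])))"
proof -
  define h :: nat where "h = 2 ^ (L - Suc l)"
  have h: "2 ^ (L - l) = 2 * h" "0 < h"
    using assms unfolding h_def by (auto simp: Suc_diff_Suc simp flip: power_Suc)
  have mid: "(c * (2 * h) + (Suc c * (2 * h) - 1) + 1) div 2 = (2 * c + 1) * h"
  proof -
    have "c * (2 * h) + (Suc c * (2 * h) - 1) + 1 = 2 * ((2 * c + 1) * h)" using h by (simp add: algebra_simps)
    then show ?thesis by simp
  qed
  have kl: "key L f l i = f i div (2 * h)" for i by (simp add: key_def h)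
  have ks: "key L f (Suc l) i = f i div h" for i by (simp add: key_def h_def)
  have rng: "c * (2 * h) \<le> y \<and> y \<le> Suc c * (2 * h) - 1 \<longleftrightarrow> y div (2 * h) = c" for y
  proof -
    have "y \<le> Suc c * (2 * h) - 1 \<longleftrightarrow> y < Suc c * (2 * h)" using h by auto
    then show ?thesis using h(2)
      by (simp add: less_eq_div_iff_mult_less_eq[symmetric] div_less_iff_less_mult[symmetric] del: mult_Suc) auto
  qed
  have bit: "\<not> (c * (2 * h) \<le> y \<and> y < (2 * c + 1) * h) \<longleftrightarrow> odd (y div h)" if "y div (2 * h) = c" for y
  proof -
    have "c * (2 * h) \<le> y" using rng that by blast
    moreover have "y < (2 * c + 1) * h \<longleftrightarrow> y div h < 2 * c + 1" using h(2) by (simp add: div_less_iff_less_mult)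
    moreover have "y div h div 2 = c" using that by (simp add: div_mult2_eq[symmetric] mult.commute)
    moreover have "q < 2 * c + 1 \<longleftrightarrow> even q" if "q div 2 = c" for q :: nat using that by presburger
    ultimately show ?thesis by blast
  qed
  have sv: "filter (\<lambda>s. c * (2 * h) \<le> s \<and> s \<le> Suc c * (2 * h) - 1) (map f [0..<n]) =
      map f (filter (\<lambda>i. key L f l i = c) [0..<n])"
    unfolding rng filter_map kl by (simp add: comp_def)
  have bits: "map (\<lambda>s. \<not> (c * (2 * h) \<le> s \<and> s < (2 * c + 1) * h))
      (map f (filter (\<lambda>i. key L f l i = c) [0..<n])) = node_bits L f n l c"
    unfolding node_bits_def using bit by (auto simp: kl ks)
  have nil: "map f (filter (\<lambda>i. key L f l i = c) [0..<n]) = [] \<longleftrightarrow> node_bits L f n l c = []"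
    by (simp add: node_bits_def)
  \<comment> \<open>Intervals of nodes with \<open>l < L\<close> have at least two symbols, so the
    size test succeeds exactly at the last level.\<close>
  have stop: "Suc c * (2 * h) - 1 + 1 - c * (2 * h) \<le> 2 \<longleftrightarrow> Suc l = L"
  proof -
    have "Suc c * (2 * h) - 1 + 1 - c * (2 * h) = 2 * h" using h(2) by simp
    moreover have "h = 1 \<longleftrightarrow> L - Suc l = 0" unfolding h_def by (metis nat_power_eq_Suc_0_iff One_nat_def
      numeral_eq_one_iff semiring_norm(85) power_0)
    ultimately show ?thesis using assms h(2) by auto
  qed
  have a2: "(2 * c + 1) * h - 1 = Suc (2 * c) * h - 1" "c * (2 * h) = 2 * c * h"
    "Suc c * (2 * h) - 1 = Suc (2 * c + 1) * h - 1" by (simp_all add: algebra_simps)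
  have a3: "Suc c * (2 * h) - Suc 0 = Suc (Suc (2 * c)) * h - Suc 0" by (simp add: algebra_simps)
  show ?thesis
    unfolding h(1) h_def[symmetric]
    apply (subst wavelet.simps)
    unfolding Let_def mid sv bits nil stop
    by (simp add: a2(1)[symmetric] a2(2) a2(3)[symmetric] a3 del: mult_Suc)
qed

text \<open>For \<open>\<sigma> = 1\<close> the root has the one-symbol interval with middle 0, so
  its bits are all 1. Shifting the symbols to 1 and taking \<open>L = 1\<close> gives the same leaf,
  and the construction needs no special case.\<close>

lemma wavelet_tree_root:
  fixes S :: "nat list" and \<sigma> :: nat
  assumes "set S \<subseteq> {0..<\<sigma>}" "S \<noteq> []"
  defines "L \<equiv> max 1 (nat \<lceil>log 2 (real \<sigma>)\<rceil>)"
  shows "wavelet_tree \<sigma> S = wavelet 0 (2 ^ L - 1) (map (\<lambda>i. S ! i + of_bool (\<sigma> = 1)) [0..<length S])"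
proof (cases "\<sigma> = 1")
  case True
  have z: "S ! i = 0" if "i < length S" for i using assms(1) True nth_mem[OF that] by auto
  have S: "filter (\<lambda>s. s = 0) S = S" "\<And>s. s \<in> set S \<Longrightarrow> s = 0"
    using z by (auto simp: filter_id_conv in_set_conv_nth)
  have "wavelet 0 0 S = Leaf (map (\<lambda>_. True) S)"
    by (subst wavelet.simps) (use S in \<open>auto simp: Let_def\<close>)
  moreover have "wavelet 0 1 (map (\<lambda>i. S ! i + 1) [0..<length S]) = Leaf (map (\<lambda>_. True) S)"
    by (subst wavelet.simps) (use z in \<open>auto simp: Let_def intro!: nth_equalityI\<close>)
  ultimately show ?thesis using True by (simp add: wavelet_tree_def L_def)
next
  case False
  have "0 < \<sigma>" using assms(1,2) by (cases S) auto
  then have "1 < \<sigma>" using False by simp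
  then have "0 < log 2 (real \<sigma>)" by simp
  then have "1 \<le> nat \<lceil>log 2 (real \<sigma>)\<rceil>" by linarith
  then have "L = nat \<lceil>log 2 (real \<sigma>)\<rceil>" by (simp add: L_def)
  moreover have "map (\<lambda>i. S ! i + of_bool (\<sigma> = 1)) [0..<length S] = S"
    using False by (simp add: map_nth)
  ultimately show ?thesis by (simp add: wavelet_tree_def)
qed

subsection \<open>Sparse memory layout\<close>

text \<open>
  A cell is addressed by four indices below \<open>HH w\<close>: kind, level, pass (or node), index. The input
  is kind 0. No cell is used for two purposes, so all of them can be assumed to be 0 initially.
\<close>

definition adr :: "nat \<Rightarrow> nat \<Rightarrow> nat \<Rightarrow> nat \<Rightarrow> nat \<Rightarrow> nat" where
  "adr w k l p i = ((k * HH w + l) * HH w + p) * HH w + i"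

definition kd :: "nat \<Rightarrow> nat \<Rightarrow> nat" where "kd w a = a div HH w div HH w div HH w"
definition lv :: "nat \<Rightarrow> nat \<Rightarrow> nat" where "lv w a = a div HH w div HH w mod HH w"
definition ps :: "nat \<Rightarrow> nat \<Rightarrow> nat" where "ps w a = a div HH w mod HH w"
definition ix :: "nat \<Rightarrow> nat \<Rightarrow> nat" where "ix w a = a mod HH w"

definition adrE :: "expr \<Rightarrow> expr \<Rightarrow> expr \<Rightarrow> expr \<Rightarrow> expr" where
  "adrE k l p i = addE (mulE (addE (mulE (addE (mulE k HE) l) HE) p) HE) i"

lemma HH_pos: "0 < HH w"
  by (simp add: HH_def)

lemma adr_sel:
  assumes "l < HH w" "p < HH w" "i < HH w"
  shows "kd w (adr w k l p i) = k" "lv w (adr w k l p i) = l" "ps w (adr w k l p i) = p"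
    "ix w (adr w k l p i) = i"
  using assms by (simp_all add: adr_def kd_def lv_def ps_def ix_def)

lemma kd_small: "a < HH w \<Longrightarrow> kd w a = 0"
  by (simp add: kd_def)

lemma adr_less:
  assumes "k < HH w" "l < HH w" "p < HH w" "i < HH w"
  shows "adr w k l p i < 2 ^ w"
proof -
  have s: "x * HH w + y < z * HH w" if "x < z" "y < HH w" for x y z
    using digit_less[of x z y "HH w" 0] that by simp
  have "adr w k l p i < HH w * HH w * HH w * HH w"
    unfolding adr_def by (intro s assms)
  also have "\<dots> = 2 ^ (w div 16 + w div 16 + w div 16 + w div 16)" by (simp add: HH_def power_add)
  also have "\<dots> \<le> 2 ^ w" by (intro power_increasing) auto
  finally show ?thesis .
qed

lemma HH_le: "HH w \<le> 2 ^ w"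
  unfolding HH_def by (intro power_increasing) auto

lemma ev_adr:
  assumes "16 < (2::nat) ^ w" "0 < w"
    and "ev w A s m kE k" "ev w A s m lE l" "ev w A s m pE p" "ev w A s m iE i"
    and b: "k < HH w" "l < HH w" "p < HH w" "i < HH w"
  shows "ev w A s m (adrE kE lE pE iE) (adr w k l p i)"
proof -
  have le: "x \<le> x * HH w" for x using HH_pos[of w] by simp
  have "adr w k l p i < 2 ^ w" by (rule adr_less[OF b])
  then have 1: "((k * HH w + l) * HH w + p) * HH w + i < 2 ^ w" by (simp add: adr_def)
  then have 2: "((k * HH w + l) * HH w + p) * HH w < 2 ^ w" by linarith
  then have 3: "(k * HH w + l) * HH w + p < 2 ^ w" using le by (metis le_less_trans)
  then have 4: "(k * HH w + l) * HH w < 2 ^ w" by linarith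
  then have 5: "k * HH w + l < 2 ^ w" using le by (metis le_less_trans)
  then have 6: "k * HH w < 2 ^ w" by linarith
  show ?thesis unfolding adrE_def adr_def
    by (intro ev_Add ev_Mul ev_HE assms 1 2 3 4 5 6)
qed

subsection \<open>One level of the wavelet tree\<close>

text \<open>Variables: 0 \<open>n\<close>, 2 offset of the symbols, 4 \<open>L\<close>, 5 \<open>K\<close>, 6 \<open>d\<close>, 7 \<open>R\<close>, 8 \<open>nb\<close>, 9 \<open>g\<close>, 10 \<open>Mc\<close>,
  11 level, 12 pass, from 13 on local. Kinds: 1 current order, 2 block histograms, 3 ranks within a
  block, 4 prefix sums within a chunk, \<open>20 + k\<close> prefix sums over chunks after \<open>k\<close> doublings,
  7 positions, 8 and 9 node boundaries.\<close>

abbreviation "itemC p j \<equiv> adrE (Cn 1) (Vr 11) p j"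
abbreviation "cntC e \<equiv> adrE (Cn 2) (Vr 11) (Vr 12) e"
abbreviation "offC j \<equiv> adrE (Cn 3) (Vr 11) (Vr 12) j"
abbreviation "locC e \<equiv> adrE (Cn 4) (Vr 11) (Vr 12) e"
abbreviation "dblC k c \<equiv> adrE (addE (Cn 20) k) (Vr 11) (Vr 12) c"

definition keyE :: "expr \<Rightarrow> expr \<Rightarrow> expr" where
  "keyE i l = Bn Shr (addE (Ld i) (Vr 2)) (subE (Vr 4) l)"

definition digitE :: "expr \<Rightarrow> expr" where
  "digitE j = modE (Bn Shr (keyE (Ld (itemC (Vr 12) j)) (Vr 11)) (mulE (Vr 12) (Vr 6))) (Vr 7)"

abbreviation "blkE \<equiv> addE (mulE (Vr 13) (Vr 7)) (Vr 14)"

text \<open>The counter is stored as the offset of the current position before it is incremented; it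
  then equals the number of earlier positions of the block with the same digit.\<close>

definition count_body :: "stmt list" where
  "count_body = [When (lessE blkE (Vr 0))
     [Asg 15 (addE (mulE (digitE blkE) (Vr 8)) (Vr 13)),
      Wr (offC blkE) (Ld (cntC (Vr 15))),
      Wr (cntC (Vr 15)) (addE (Ld (cntC (Vr 15))) (Cn 1))] []]"

definition count_code :: stmt where
  "count_code = Par 13 (Vr 8) [For 14 (Vr 7) count_body]"

text \<open>\<open>L \<le> K * d\<close> makes \<open>K\<close> digits cover a key, and
  \<open>K * d \<le> 2 * L\<close> keeps shift amounts small. \<open>R * nb < 2 ^ (g + 2)\<close>
  bounds the number of doubling rounds. \<open>room\<close> makes every index and every array size
  an address digit.\<close>

locale level =
  fixes w n L K d R nb g Mc ad :: nat and f :: "nat \<Rightarrow> nat"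
  assumes w: "16 < (2::nat) ^ w" "0 < w"
    and R: "R = 2 ^ d" "0 < d" and nb: "nb = (n + R - 1) div R" and n: "0 < n"
    and f: "\<And>i. i < n \<Longrightarrow> f i < 2 ^ L" and passes: "L \<le> K * d" "K * d \<le> 2 * L"
    and g: "0 < g" and Mc: "Mc = R * nb div g + 1" and rounds: "R * nb < 2 ^ (g + 2)" "g + 2 < w"
    and room: "8 * (n + R + R * nb + g + K + L + w + 2 ^ g + 2 ^ L + 32) < HH w"
begin

abbreviation "cell \<equiv> adr w"
abbreviation "kk \<equiv> key L f"

definition glob :: "(nat \<Rightarrow> nat) \<Rightarrow> bool" where
  "glob s \<longleftrightarrow> s 0 = n \<and> s 2 = ad \<and> s 4 = L \<and> s 5 = K \<and> s 6 = d \<and> s 7 = R \<and> s 8 = nb \<and> s 9 = g \<and> s 10 = Mc"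

definition inp :: "mem \<Rightarrow> bool" where
  "inp m \<longleftrightarrow> (\<forall>i<n. m i + ad = f i)"

definition own :: "nat \<Rightarrow> nat set" where
  "own l = {a. 1 \<le> kd w a \<and> lv w a = l}"

lemma glob_upd: "10 < x \<Longrightarrow> glob (s(x := v)) = glob s"
  by (auto simp: glob_def)

lemma Rpos: "0 < R" "1 < R"
  using R one_less_power2[of "d - 1"] by auto

lemma div_R: "j < n \<Longrightarrow> j div R < nb"
proof -
  assume "j < n"
  then have "j div R \<le> (n - 1) div R" by (intro div_le_mono) simp
  moreover have "nb = (n - 1) div R + 1" unfolding nb using n Rpos
    by (metis Nat.add_diff_assoc2 One_nat_def Suc_leI add.commute div_add_self1 gr_implies_not0 Suc_eq_plus1)
  ultimately show ?thesis by simp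
qed

lemma nbpos: "0 < nb" using div_R[OF n] by simp

lemma HHs: "n < HH w" "R < HH w" "R * nb < HH w" "g < HH w" "K < HH w" "L < HH w" "w < HH w" "2 ^ g < HH w"
    "2 ^ L < HH w" "32 < HH w" "nb < HH w" "2 ^ (g + 2) < HH w" "2 * L < HH w" "n + 1 < HH w" "R * nb + g < HH w"
    "20 + g + 2 < HH w"
proof -
  show a: "n < HH w" "R < HH w" "R * nb < HH w" "g < HH w" "K < HH w" "L < HH w" "w < HH w" "2 ^ g < HH w"
    "2 ^ L < HH w" "32 < HH w" "2 ^ (g + 2) < HH w" "2 * L < HH w" "n + 1 < HH w" "R * nb + g < HH w"
    "20 + g + 2 < HH w"
    using room by simp_all
  have "nb \<le> R * nb" using Rpos by simp
  then show "nb < HH w" using a(3) by (rule le_less_trans)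
qed

lemma H2: "x < HH w \<Longrightarrow> x < 2 ^ w"
  using HH_le[of w] by simp

lemma ev_cell:
  assumes "ev w A s m kE k" "ev w A s m lE l" "ev w A s m pE p" "ev w A s m iE i"
    "k < HH w" "l < HH w" "p < HH w" "i < HH w"
  shows "ev w A s m (adrE kE lE pE iE) (cell k l p i)"
  by (rule ev_adr[OF w assms])

lemma ev_C: "c \<le> 32 \<Longrightarrow> ev w A s m (Cn c) c"
  using HHs(10) HH_le[of w] by (intro ev_N) simp

lemma ev_glob:
  assumes "glob s"
  shows "ev w A s m (Vr 0) n" "ev w A s m (Vr 2) ad" "ev w A s m (Vr 4) L" "ev w A s m (Vr 5) K"
    "ev w A s m (Vr 6) d" "ev w A s m (Vr 7) R" "ev w A s m (Vr 8) nb" "ev w A s m (Vr 9) g" "ev w A s m (Vr 10) Mc"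
  using assms by (auto simp: glob_def ev_def)

lemma ev_key:
  assumes "ev w A s m iE i" "ev w A s m lE l" "glob s" "inp m" "i < n" "{..<n} \<subseteq> A" "l \<le> L"
  shows "ev w A s m (keyE iE lE) (kk l i)"
proof -
  have e: "m i + ad = f i" using assms by (simp add: inp_def)
  have "f i < 2 ^ w" using f[OF assms(5)] HHs(9) H2 by (meson less_trans)
  then have "ev w A s m (addE (Ld iE) (Vr 2)) (m i + ad)"
    using assms e by (intro ev_Add ev_M ev_glob) auto
  then show ?thesis unfolding keyE_def key_def e[symmetric]
    by (intro ev_Shr ev_Sub assms ev_glob) (use HHs(6) H2 in auto)
qed

definition dig :: "nat \<Rightarrow> nat \<Rightarrow> nat \<Rightarrow> nat" where
  "dig l p i = kk l i div R ^ p mod R"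

definition part :: "nat \<Rightarrow> nat \<Rightarrow> nat \<Rightarrow> nat" where
  "part l p i = kk l i mod R ^ p"

definition xd :: "nat \<Rightarrow> nat \<Rightarrow> nat \<Rightarrow> nat" where
  "xd l p j = dig l p (item (part l p) n j)"

definition bucket :: "nat \<Rightarrow> nat \<Rightarrow> nat \<Rightarrow> nat" where
  "bucket l p j = xd l p j * nb + j div R"

definition hist :: "nat \<Rightarrow> nat \<Rightarrow> nat \<Rightarrow> nat" where
  "hist l p e = card {j. j < n \<and> bucket l p j = e}"

definition offs :: "nat \<Rightarrow> nat \<Rightarrow> nat \<Rightarrow> nat" where
  "offs l p j = card {k. k < j \<and> k div R = j div R \<and> xd l p k = xd l p j}"

lemma xd_less: "xd l p j < R"
  using Rpos by (simp add: xd_def dig_def)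

lemma bucket_less: "x < R \<Longrightarrow> b < nb \<Longrightarrow> x * nb + b < R * nb"
  using digit_less[of x R b nb 0] by simp

definition sorted_upto :: "nat \<Rightarrow> nat \<Rightarrow> mem \<Rightarrow> bool" where
  "sorted_upto l p m \<longleftrightarrow> (\<forall>j<n. m (cell 1 l p j) = item (part l p) n j)"

lemma ev_digit:
  assumes "ev w A s m jE j" "glob s" "s 11 = l" "s 12 = p" "inp m" "j < n" "sorted_upto l p m"
    "{..<n} \<subseteq> A" "cell 1 l p j \<in> A" "l \<le> L" "p < K"
  shows "ev w A s m (digitE jE) (xd l p j)"
proof -
  have h: "l < HH w" "p < HH w" "j < HH w" using assms(6,10,11) HHs by linarith+
  have "ev w A s m (Ld (itemC (Vr 12) jE)) (m (cell 1 l p j))"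
    by (intro ev_M ev_cell ev_C ev_V assms h) (use HHs(10) in auto)
  then have i: "ev w A s m (Ld (itemC (Vr 12) jE)) (item (part l p) n j)"
    using assms(6,7) by (simp add: sorted_upto_def)
  have k: "ev w A s m (keyE (Ld (itemC (Vr 12) jE)) (Vr 11)) (kk l (item (part l p) n j))"
    by (intro ev_key i ev_V assms item_less)
  have "p * d \<le> K * d" using assms(11) by (intro mult_right_mono) auto
  then have "p * d < 2 ^ w" using passes(2) HHs(13) HH_le[of w] by linarith
  then have "ev w A s m (digitE jE) (kk l (item (part l p) n j) div 2 ^ (p * d) mod R)"
    unfolding digitE_def by (intro ev_Mod ev_Shr k ev_Mul ev_V assms ev_glob)
  moreover have "(2::nat) ^ (p * d) = R ^ p" unfolding R(1) by (simp add: power_mult[symmetric] mult.commute)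
  ultimately show ?thesis by (simp only: xd_def dig_def)
qed

text \<open>Bucket \<open>x * nb + b\<close> is a counter of block \<open>b\<close>, so its owner is
  the remainder by \<open>nb\<close>; an offset belongs to the block of its position.\<close>

definition owner1 :: "nat \<Rightarrow> nat" where
  "owner1 a = (if kd w a = 2 then ix w a mod nb else ix w a div R)"

definition region1 :: "nat \<Rightarrow> nat \<Rightarrow> nat set" where
  "region1 l p = {a. lv w a = l \<and> ps w a = p \<and> (kd w a = 2 \<and> ix w a < R * nb \<or> kd w a = 3 \<and> ix w a < n)}"

definition inv1 :: "nat \<Rightarrow> nat \<Rightarrow> nat \<Rightarrow> mem \<Rightarrow> nat \<Rightarrow> (nat \<Rightarrow> nat) \<Rightarrow> mem \<Rightarrow> bool" where
  "inv1 l p b m0 t s m \<longleftrightarrow> glob s \<and> s 11 = l \<and> s 12 = p \<and> s 13 = b \<and>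
     (\<forall>a. \<not> (a \<in> region1 l p \<and> owner1 a = b) \<longrightarrow> m a = m0 a) \<and>
     (\<forall>x<R. m (cell 2 l p (x * nb + b)) = card {j. b * R \<le> j \<and> j < b * R + t \<and> j < n \<and> xd l p j = x}) \<and>
     (\<forall>j. b * R \<le> j \<and> j < b * R + t \<and> j < n \<longrightarrow> m (cell 3 l p j) = offs l p j)"

lemma in_region1:
  assumes "l < HH w" "p < HH w"
  shows "e < R * nb \<Longrightarrow> cell 2 l p e \<in> region1 l p" "j < n \<Longrightarrow> cell 3 l p j \<in> region1 l p"
    "e < R * nb \<Longrightarrow> owner1 (cell 2 l p e) = e mod nb" "j < n \<Longrightarrow> owner1 (cell 3 l p j) = j div R"
  using assms HHs(1,3) by (auto simp: region1_def owner1_def adr_sel)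

lemma cell_inject:
  assumes "l < HH w" "p < HH w" "i < HH w" "l' < HH w" "p' < HH w" "i' < HH w"
  shows "cell k l p i = cell k' l' p' i' \<longleftrightarrow> k = k' \<and> l = l' \<and> p = p' \<and> i = i'"
  using assms adr_sel by metis

lemma count_step:
  assumes inv: "inv1 l p b m0 t s m" and st: "s 14 = t" and tb: "t < R" "b < nb"
    and m0: "inp m0" "sorted_upto l p m0" and lp: "l \<le> L" "p < K"
    and A: "{..<n} \<subseteq> A" "own l \<subseteq> A"
  defines "Ab \<equiv> A - {a \<in> region1 l p. owner1 a \<noteq> b}" and "Gb \<equiv> {a \<in> region1 l p. owner1 a = b}"
  shows "hs w Ab Gb count_body s m (\<lambda>s' m'. s' 14 = t \<and> inv1 l p b m0 (Suc t) (s'(14 := Suc t)) m')"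
proof -
  define j where "j = b * R + t"
  have s: "glob s" "s 11 = l" "s 12 = p" "s 13 = b"
    and fr: "\<And>a. \<not> (a \<in> region1 l p \<and> owner1 a = b) \<Longrightarrow> m a = m0 a"
    and c2: "\<And>x. x < R \<Longrightarrow> m (cell 2 l p (x * nb + b)) = card {j. b * R \<le> j \<and> j < b * R + t \<and> j < n \<and> xd l p j = x}"
    and c3: "\<And>j. b * R \<le> j \<Longrightarrow> j < b * R + t \<Longrightarrow> j < n \<Longrightarrow> m (cell 3 l p j) = offs l p j"
    using inv unfolding inv1_def by auto
  have h: "l < HH w" "p < HH w" using lp HHs by linarith+
  have "b * R + t < nb * R" using digit_less[OF tb(2) tb(1), of 0] by simp
  then have jH: "j < HH w" unfolding j_def using HHs(3) by (simp add: mult.commute)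
  have jb: "b * R < 2 ^ w" using jH H2 by (simp add: j_def)
  have jE: "ev w Ab s' m' blkE j" if "glob s'" "s' 13 = b" "s' 14 = t" for s' m'
    unfolding j_def by (intro ev_Add ev_Mul ev_V ev_glob that) (use jb H2[OF jH] in \<open>auto simp: j_def\<close>)
  have kds: "kd w (cell 1 l p j) = 1" if "j < n" for j using that h HHs(1) by (simp add: adr_sel)
  have cond: "ev w Ab s m (lessE blkE (Vr 0)) (of_bool (j < n))"
    by (intro ev_Less jE s st ev_glob)
  show ?thesis unfolding count_body_def
  proof (rule hs_When[OF cond], goal_cases)
    case 2
    \<comment> \<open>The last block may be incomplete; iterations beyond \<open>n\<close> leave the
      invariant as it is.\<close>
    then have jn: "\<not> j < n" by simp
    have "{j. b * R \<le> j \<and> j < b * R + Suc t \<and> j < n \<and> xd l p j = x} =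
        {j. b * R \<le> j \<and> j < b * R + t \<and> j < n \<and> xd l p j = x}" for x
      using jn unfolding j_def by (auto simp: less_Suc_eq)
    moreover have "j' < b * R + t" if "j' < b * R + Suc t" "j' < n" for j'
      using that jn unfolding j_def by (simp add: less_Suc_eq)
    ultimately have "inv1 l p b m0 (Suc t) (s(14 := Suc t)) m"
      using s fr c2 c3 unfolding inv1_def by (simp add: glob_upd)
    then show ?case using st by (auto intro!: hs_Nil)
  next
    case 1
    then have jn: "j < n" by simp
    define x where "x = xd l p j"
    define e where "e = x * nb + b"
    have xR: "x < R" using xd_less by (simp add: x_def)
    have eN: "e < R * nb" unfolding e_def by (rule bucket_less[OF xR tb(2)])
    have eH: "e < HH w" using eN HHs(3) by simp
    have jdiv: "j div R = b" unfolding j_def using tb by simp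
    have emod: "e mod nb = b" unfolding e_def using tb by simp
    have cA: "cell 2 l p e \<in> Gb" "cell 3 l p j \<in> Gb" unfolding Gb_def
      using in_region1[OF h] eN jn emod jdiv by auto
    have cA': "cell 2 l p e \<in> Ab" unfolding Ab_def
      using in_region1[OF h] eN emod A(2) h eH by (auto simp: own_def adr_sel)
    have c1A: "cell 1 l p j \<in> Ab"
      unfolding Ab_def using A(2) h jH by (auto simp: own_def adr_sel region1_def)
    have inA: "{..<n} \<subseteq> Ab"
      unfolding Ab_def using A(1) HHs(1) kd_small[of _ w] by (force simp: region1_def)
    have inpm: "inp m" unfolding inp_def
    proof (intro allI impI)
      fix i assume i: "i < n"
      then have "kd w i = 0" using HHs(1) by (intro kd_small) simp
      then have "m i = m0 i" by (intro fr) (simp add: region1_def)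
      then show "m i + ad = f i" using m0(1) i by (simp add: inp_def)
    qed
    have so: "sorted_upto l p m" unfolding sorted_upto_def
    proof (intro allI impI)
      fix i assume i: "i < n"
      then have "m (cell 1 l p i) = m0 (cell 1 l p i)" using kds by (intro fr) (auto simp: region1_def)
      then show "m (cell 1 l p i) = item (part l p) n i" using m0(2) i by (simp add: sorted_upto_def)
    qed
    have e15: "ev w Ab s m (addE (mulE (digitE blkE) (Vr 8)) (Vr 13)) e" unfolding e_def x_def
      by (intro ev_Add ev_Mul ev_digit[where l=l and p=p] jE ev_V ev_glob s st inpm so inA c1A lp jn)
        (use eH H2 in \<open>auto simp: e_def x_def\<close>)
    let ?s = "s(15 := e)"
    have s': "glob ?s" "?s 11 = l" "?s 12 = p" "?s 13 = b" "?s 14 = t" using s st by (auto simp: glob_upd)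
    let ?v = "m (cell 2 l p e)"
    have v: "?v = card {j. b * R \<le> j \<and> j < b * R + t \<and> j < n \<and> xd l p j = x}"
      unfolding e_def by (rule c2[OF xR])
    \<comment> \<open>The processed positions of block \<open>b\<close> with the same digit are
      precisely those counted by \<open>offs\<close>.\<close>
    have off: "?v = offs l p j" unfolding v offs_def
    proof (rule arg_cong[where f=card], rule set_eqI, unfold mem_Collect_eq)
      fix k
      have "k div R = j div R \<longleftrightarrow> b * R \<le> k \<and> k < Suc b * R" unfolding jdiv
        using Rpos(1) by (metis div_nat_eqI dividend_less_div_times mult.commute times_div_less_eq_dividend add.commute mult_Suc)
      then show "b * R \<le> k \<and> k < b * R + t \<and> k < n \<and> xd l p k = x \<longleftrightarrow>
          k < j \<and> k div R = j div R \<and> xd l p k = xd l p j"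
        using jn tb unfolding x_def[symmetric] by (auto simp: j_def)
    qed
    have e_ev: "ev w Ab ?s m' (cntC (Vr 15)) (cell 2 l p e)" for m'
      by (intro ev_cell ev_C ev_V s' h eH) (use HHs(10) in auto)
    have o_ev: "ev w Ab ?s m' (offC blkE) (cell 3 l p j)" for m'
      by (intro ev_cell ev_C ev_V s' h jE jH) (use HHs(10) in auto)
    have ne: "cell 3 l p j \<noteq> cell 2 l p e" using cell_inject[OF h jH h eH] by simp
    let ?m1 = "m(cell 3 l p j := ?v)" and ?m2 = "m(cell 3 l p j := ?v, cell 2 l p e := Suc ?v)"
    have "?v \<le> n"
      unfolding v by (rule order_trans[OF card_mono[of "{..<n}"]]) auto
    then have v1: "?v + 1 < 2 ^ w" using HHs(14) HH_le[of w] by linarith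
    have ld: "ev w Ab ?s ?m1 (addE (Ld (cntC (Vr 15))) (Cn 1)) (?m1 (cell 2 l p e) + 1)"
      by (intro ev_Add ev_M e_ev cA' ev_C) (use v1 ne in auto)
    have final: "inv1 l p b m0 (Suc t) (?s(14 := Suc t)) ?m2"
      unfolding inv1_def
    proof (intro conjI allI impI)
      show "glob (?s(14 := Suc t))" using s by (simp add: glob_upd)
      show "(?s(14 := Suc t)) 11 = l" "(?s(14 := Suc t)) 12 = p" "(?s(14 := Suc t)) 13 = b" using s by auto
      fix a assume "\<not> (a \<in> region1 l p \<and> owner1 a = b)"
      then have "a \<noteq> cell 3 l p j" "a \<noteq> cell 2 l p e" "m a = m0 a" using cA fr unfolding Gb_def by auto
      then show "?m2 a = m0 a" by simp
    next
      fix y assume y: "y < R"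
      have yH: "y * nb + b < HH w" using bucket_less[OF y tb(2)] HHs(3) by simp
      have n3: "cell 2 l p (y * nb + b) \<noteq> cell 3 l p j" using cell_inject[OF h yH h jH] by simp
      let ?S = "\<lambda>t. {j. b * R \<le> j \<and> j < b * R + t \<and> j < n \<and> xd l p j = y}"
      show "?m2 (cell 2 l p (y * nb + b)) = card (?S (Suc t))"
      proof (cases "y = x")
        case True
        have "?S (Suc t) = insert j (?S t)" using jn True unfolding x_def j_def by (auto simp: less_Suc_eq)
        moreover have "j \<notin> ?S t" "finite (?S t)" by (auto simp: j_def)
        ultimately show ?thesis using True v by (simp add: e_def)
      next
        case False
        have "?S (Suc t) = ?S t" using False unfolding x_def j_def by (auto simp: less_Suc_eq)
        moreover have "y * nb + b \<noteq> e" unfolding e_def using False nbpos by simp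
        then have "cell 2 l p (y * nb + b) \<noteq> cell 2 l p e" using cell_inject[OF h yH h eH] by simp
        ultimately show ?thesis using c2[OF y] n3 by simp
      qed
    next
      fix i assume i: "b * R \<le> i \<and> i < b * R + Suc t \<and> i < n"
      then have iH: "i < HH w" using HHs(1) by simp
      have n2: "cell 3 l p i \<noteq> cell 2 l p e" using cell_inject[OF h iH h eH] by simp
      show "?m2 (cell 3 l p i) = offs l p i"
      proof (cases "i = j")
        case True
        then show ?thesis using n2 off by simp
      next
        case False
        then have "i < b * R + t" using i by (simp add: j_def)
        moreover have "cell 3 l p i \<noteq> cell 3 l p j" using cell_inject[OF h iH h jH] False by simp
        ultimately show ?thesis using n2 c3 i by simp
      qed
    qed
    have m2: "?m1(cell 2 l p e := ?m1 (cell 2 l p e) + 1) = ?m2" using ne by simp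
    show ?case unfolding append.simps
      by (rule hs_Asg[OF e15], rule hs_Wr[OF o_ev ev_M[OF e_ev cA'] cA(2)], rule hs_Wr[OF e_ev ld cA(1)],
          unfold m2, rule hs_Nil) (use final s' in auto)
  qed
qed

definition count_depth :: nat where "count_depth = cost count_body + esz (Vr 7) + 4"

text \<open>Counters are never cleared. Each pass has cells of its own, which are still 0 from the
  start; this is the hypothesis \<open>z\<close>.\<close>

lemma ht_count:
  assumes s: "glob s" "s 11 = l" "s 12 = p"
    and m0: "inp m0" "sorted_upto l p m0" and z: "\<And>e. e < HH w \<Longrightarrow> m0 (cell 2 l p e) = 0"
    and lp: "l \<le> L" "p < K" and A: "{..<n} \<subseteq> A" "own l \<subseteq> A" "own l \<subseteq> G"
  shows "ht w A G [count_code] s m0 (\<lambda>s' m. s' = s \<and> (\<forall>a\<in>A. a \<notin> region1 l p \<longrightarrow> m a = m0 a) \<and>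
      (\<forall>e<R * nb. m (cell 2 l p e) = hist l p e) \<and> (\<forall>j<n. m (cell 3 l p j) = offs l p j))
    (esz (Vr 8) + 1 + (R + 1) * count_depth) (esz (Vr 8) + 1 + nb * ((R + 1) * count_depth))"
proof -
  have h: "l < HH w" "p < HH w" using lp HHs by linarith+
  have reg: "region1 l p \<subseteq> own l" by (auto simp: region1_def own_def)
  let ?Ab = "\<lambda>b. A - {a \<in> region1 l p. owner1 a \<noteq> b}" and ?Gb = "\<lambda>b. {a \<in> region1 l p. owner1 a = b}"
  let ?P = "\<lambda>b m. (\<forall>e<R * nb. e mod nb = b \<longrightarrow> m (cell 2 l p e) = hist l p e) \<and>
      (\<forall>j<n. j div R = b \<longrightarrow> m (cell 3 l p j) = offs l p j)"
  have sum: "(\<Sum>i<nb. (R + 1) * count_depth) = nb * ((R + 1) * count_depth)" by simp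
  show ?thesis unfolding count_code_def sum[symmetric]
  proof (rule ht_Par[where R="region1 l p" and own=owner1 and N=nb and P="?P"])
    show "ev w A s m0 (Vr 8) nb" by (rule ev_glob[OF s(1)])
    show "region1 l p \<subseteq> G" "region1 l p \<subseteq> A" using reg A by auto
  next
    fix b assume b: "b < nb"
    have start: "inv1 l p b m0 0 (s(13 := b, 14 := 0)) m0" unfolding inv1_def
    proof (intro conjI allI impI)
      fix x assume "x < R"
      then have "x * nb + b < HH w" using bucket_less[OF _ b] HHs(3) by (meson less_trans)
      moreover have "{j. b * R \<le> j \<and> j < b * R + 0 \<and> j < n \<and> xd l p j = x} = {}" by auto
      ultimately show "m0 (cell 2 l p (x * nb + b)) = card {j. b * R \<le> j \<and> j < b * R + 0 \<and> j < n \<and> xd l p j = x}"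
        using z by simp
    qed (use s in \<open>auto simp: glob_upd\<close>)
    have stop: "?P b m" if "inv1 l p b m0 R s' m" for s' m
    proof (intro conjI allI impI)
      fix e assume e: "e < R * nb" "e mod nb = b"
      have ed: "e div nb < R" using e(1) nbpos by (simp add: div_less_iff_less_mult)
      have ee: "e = e div nb * nb + b" using e(2) by auto
      have "{j. b * R \<le> j \<and> j < b * R + R \<and> j < n \<and> xd l p j = e div nb} = {j. j < n \<and> bucket l p j = e}"
      proof (rule set_eqI, unfold mem_Collect_eq)
        fix j
        have "j div R = b \<longleftrightarrow> b * R \<le> j \<and> j < b * R + R"
          using Rpos(1) by (metis div_nat_eqI dividend_less_div_times mult.commute times_div_less_eq_dividend add.commute mult_Suc)
        moreover have "bucket l p j = e \<longleftrightarrow> xd l p j = e div nb \<and> j div R = b" if "j < n"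
        proof
          assume "bucket l p j = e"
          then show "xd l p j = e div nb \<and> j div R = b"
            using div_R[OF that] e(2) unfolding bucket_def by auto
        qed (use ee in \<open>simp add: bucket_def\<close>)
        ultimately show "b * R \<le> j \<and> j < b * R + R \<and> j < n \<and> xd l p j = e div nb \<longleftrightarrow> j < n \<and> bucket l p j = e"
          by blast
      qed
      moreover have "m (cell 2 l p (e div nb * nb + b)) =
          card {j. b * R \<le> j \<and> j < b * R + R \<and> j < n \<and> xd l p j = e div nb}"
        using that ed unfolding inv1_def by blast
      ultimately show "m (cell 2 l p e) = hist l p e" unfolding ee[symmetric] hist_def by (rule trans[rotated, OF arg_cong])
    next
      fix j assume j: "j < n" "j div R = b"
      then have "b * R \<le> j" "j < b * R + R"
        using dividend_less_div_times[OF Rpos(1), of j] by (auto simp: add.commute)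
      then show "m (cell 3 l p j) = offs l p j" using that j unfolding inv1_def by blast
    qed
    have "ht w (?Ab b) (?Gb b) [For 14 (Vr 7) count_body] (s(13 := b)) m0 (\<lambda>s' m'. ?P b m')
        (esz (Vr 7) + 4 + R * (cost count_body + esz (Vr 7) + 4)) (esz (Vr 7) + 4 + R * (cost count_body + esz (Vr 7) + 4))"
    proof (rule ht_For[where I="inv1 l p b m0"])
      show "ht w (?Ab b) (?Gb b) count_body s' m' (\<lambda>s'' m''. s'' 14 = i \<and> inv1 l p b m0 (Suc i) (s''(14 := Suc i)) m'')
          (cost count_body) (cost count_body)" if "i < R" "inv1 l p b m0 i s' m'" "s' 14 = i" for i s' m'
        by (rule ht_hs, rule count_step) (use that b m0 lp A in auto)
      show "ev w (?Ab b) s' m' (Vr 7) R" if "inv1 l p b m0 i s' m'" for i s' m'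
        by (rule ev_glob) (use that in \<open>simp add: inv1_def\<close>)
    qed (use start stop w HHs H2 in auto)
    then show "ht w (?Ab b) (?Gb b) [For 14 (Vr 7) count_body] (s(13 := b)) m0 (\<lambda>s' m'. ?P b m')
        ((R + 1) * count_depth) ((R + 1) * count_depth)"
      by (rule ht_cost) (auto simp: count_depth_def)
  next
    fix b m1 m2 assume b: "b < nb" and eq: "\<And>a. a \<in> region1 l p \<Longrightarrow> owner1 a = b \<Longrightarrow> m2 a = m1 a" and P: "?P b m1"
    show "?P b m2" using P eq in_region1[OF h] by auto
  next
    fix m' assume P: "\<And>b. b < nb \<Longrightarrow> ?P b m'" and fr: "\<And>a. a \<in> A \<Longrightarrow> a \<notin> region1 l p \<or> nb \<le> owner1 a \<Longrightarrow> m' a = m0 a"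
    show "s = s \<and> (\<forall>a\<in>A. a \<notin> region1 l p \<longrightarrow> m' a = m0 a) \<and>
      (\<forall>e<R * nb. m' (cell 2 l p e) = hist l p e) \<and> (\<forall>j<n. m' (cell 3 l p j) = offs l p j)"
    proof (intro conjI allI impI ballI refl)
      show "m' a = m0 a" if "a \<in> A" "a \<notin> region1 l p" for a using fr that by blast
      show "m' (cell 2 l p e) = hist l p e" if "e < R * nb" for e using P[of "e mod nb"] that nbpos by simp
      show "m' (cell 3 l p j) = offs l p j" if "j < n" for j using P[of "j div R"] that div_R by simp
    qed
  qed
qed

end

section \<open>Prefix sums over the buckets and the move to the new order\<close>

definition chunk_body :: "stmt list" where
  "chunk_body = [Wr (locC (addE (mulE (Vr 13) (Vr 9)) (Vr 14))) (Vr 15),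
     Asg 15 (addE (Vr 15) (Ld (cntC (addE (mulE (Vr 13) (Vr 9)) (Vr 14)))))]"

text \<open>The assignments that do not occur in \<open>chunk_code\<close> pay for the loop
  control.\<close>

definition chunk_cost :: nat where
  "chunk_cost = cost (Asg 15 (Cn 0) # Asg 0 (Vr 9) # chunk_body @ [Wr (dblC (Cn 0) (addE (Vr 13) (Cn 1))) (Vr 15), Asg 0 (addE (Vr 0) (Cn 0))])"

text \<open>Doubling costs a logarithmic factor in work. Scanning chunks of \<open>g\<close> buckets
  sequentially leaves about \<open>R * nb / g\<close> chunk sums, on which \<open>g + 2\<close>
  rounds are affordable. The sum of chunk \<open>c\<close> is written to index \<open>c + 1\<close>,
  which makes the scan exclusive.\<close>

definition chunk_code :: stmt where
  "chunk_code = Par 13 (Vr 10) [Asg 15 (Cn 0), For 14 (Vr 9) chunk_body,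
     Wr (dblC (Cn 0) (addE (Vr 13) (Cn 1))) (Vr 15)]"

definition double_body :: "stmt list" where
  "double_body = [Wr (dblC (addE (Vr 16) (Cn 1)) (Vr 13))
     (addE (Ld (dblC (Vr 16) (Vr 13))) (Ite (lessE (Vr 13) (pow2E (Vr 16))) (Cn 0)
        (Ld (dblC (Vr 16) (subE (Vr 13) (pow2E (Vr 16)))))))]"

text \<open>Every round writes an array of its own, so no thread overwrites a value that a sibling
  has yet to read.\<close>

definition double_code :: stmt where
  "double_code = For 16 (addE (Vr 9) (Cn 2)) [Par 13 (Vr 10) double_body]"

definition move_body :: "stmt list" where
  "move_body = [Asg 14 (addE (mulE (digitE (Vr 13)) (Vr 8)) (divE (Vr 13) (Vr 7))),
     Asg 15 (addE (addE (Ld (locC (Vr 14))) (Ld (dblC (addE (Vr 9) (Cn 2)) (divE (Vr 14) (Vr 9))))) (Ld (offC (Vr 13)))),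
     Wr (itemC (addE (Vr 12) (Cn 1)) (Vr 15)) (Ld (itemC (Vr 12) (Vr 13)))]"

definition move_code :: stmt where
  "move_code = Par 13 (Vr 0) move_body"

context level
begin

lemma Mc_bounds: "Mc \<le> R * nb + 1" "R * nb < Mc * g" "Mc * g \<le> R * nb + g" "Mc \<le> 2 ^ (g + 2)" "Mc < HH w" "Mc * g < HH w"
proof -
  have "R * nb div g \<le> R * nb" by (rule div_le_dividend)
  then show a: "Mc \<le> R * nb + 1" unfolding Mc by simp
  show "R * nb < Mc * g" unfolding Mc using dividend_less_div_times[OF g, of "R * nb"] by simp
  show b: "Mc * g \<le> R * nb + g" unfolding Mc by simp
  show "Mc \<le> 2 ^ (g + 2)" using a rounds(1) by simp
  show "Mc < HH w" using a HHs(3,12) rounds(1) by linarith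
  show "Mc * g < HH w" using b HHs(15) by linarith
qed

lemma sum_hist: "(\<Sum>e<E. hist l p e) = card {j. j < n \<and> bucket l p j < E}"
  unfolding hist_def by (rule sum_card_fibres)

lemma hist_sum_le: "finite E \<Longrightarrow> (\<Sum>e\<in>E. hist l p e) \<le> n"
proof -
  assume fin: "finite E"
  then obtain N where "\<forall>e\<in>E. e < N" unfolding finite_nat_set_iff_bounded by (rule exE)
  then have "E \<subseteq> {..<N}" by auto
  then have "(\<Sum>e\<in>E. hist l p e) \<le> (\<Sum>e<N. hist l p e)" by (intro sum_mono2) auto
  also have "\<dots> \<le> card {..<n}" unfolding sum_hist by (rule card_mono) auto
  finally show ?thesis by simp
qed

text \<open>The last chunk may extend beyond the \<open>R * nb\<close> buckets; the cells there were
  never written, and their 0 is the right count.\<close>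

lemma hist_beyond: "R * nb \<le> e \<Longrightarrow> hist l p e = 0"
proof -
  assume e: "R * nb \<le> e"
  have "bucket l p j < R * nb" if "j < n" for j
    unfolding bucket_def by (rule bucket_less[OF xd_less div_R[OF that]])
  then have "{j. j < n \<and> bucket l p j = e} = {}" using e by fastforce
  then show ?thesis by (simp add: hist_def)
qed

definition locs :: "nat \<Rightarrow> nat \<Rightarrow> nat \<Rightarrow> nat" where
  "locs l p e = (\<Sum>e'\<in>{e div g * g..<e}. hist l p e')"

text \<open>Index 0 of the chunk sums is excluded: it keeps its initial 0, the sum of no chunks.
  Thread \<open>c\<close> owns index \<open>c + 1\<close>.\<close>

definition region2 :: "nat \<Rightarrow> nat \<Rightarrow> nat set" where
  "region2 l p = {a. lv w a = l \<and> ps w a = p \<and> (kd w a = 4 \<or> kd w a = 20 \<and> 0 < ix w a)}"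

definition owner2 :: "nat \<Rightarrow> nat" where
  "owner2 a = (if kd w a = 4 then ix w a div g else ix w a - 1)"

lemma in_region2:
  assumes "l < HH w" "p < HH w" "e < HH w"
  shows "cell 4 l p e \<in> region2 l p" "owner2 (cell 4 l p e) = e div g"
    "0 < e \<Longrightarrow> cell 20 l p e \<in> region2 l p" "owner2 (cell 20 l p e) = e - 1"
    "cell 2 l p e \<notin> region2 l p"
  using assms by (auto simp: region2_def owner2_def adr_sel)

definition inv2 :: "nat \<Rightarrow> nat \<Rightarrow> nat \<Rightarrow> mem \<Rightarrow> nat \<Rightarrow> (nat \<Rightarrow> nat) \<Rightarrow> mem \<Rightarrow> bool" where
  "inv2 l p c m0 t s m \<longleftrightarrow> glob s \<and> s 11 = l \<and> s 12 = p \<and> s 13 = c \<and>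
     s 15 = (\<Sum>e\<in>{c * g..<c * g + t}. hist l p e) \<and> (\<forall>e<HH w. m (cell 2 l p e) = m0 (cell 2 l p e)) \<and>
     (\<forall>e. c * g \<le> e \<and> e < c * g + t \<longrightarrow> m (cell 4 l p e) = locs l p e)"

lemma ht_chunk:
  assumes s: "glob s" "s 11 = l" "s 12 = p"
    and cnt: "\<And>e. e < HH w \<Longrightarrow> m0 (cell 2 l p e) = hist l p e" and z: "m0 (cell 20 l p 0) = 0"
    and lp: "l \<le> L" "p < K" and A: "own l \<subseteq> A" "own l \<subseteq> G"
  shows "ht w A G [chunk_code] s m0 (\<lambda>s' m. s' = s \<and> (\<forall>a\<in>A. a \<notin> region2 l p \<longrightarrow> m a = m0 a) \<and>
      (\<forall>e<Mc * g. m (cell 4 l p e) = locs l p e) \<and> (\<forall>c<Mc. m (cell 20 l p c) = shifted g (hist l p) c))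
    (esz (Vr 10) + 1 + (g + 1) * chunk_cost)
    (esz (Vr 10) + 1 + Mc * ((g + 1) * chunk_cost))"
proof -
  have h: "l < HH w" "p < HH w" using lp HHs by linarith+
  have reg: "region2 l p \<subseteq> own l" by (auto simp: region2_def own_def)
  let ?Ac = "\<lambda>c. A - {a \<in> region2 l p. owner2 a \<noteq> c}" and ?Gc = "\<lambda>c. {a \<in> region2 l p. owner2 a = c}"
  let ?P = "\<lambda>c m. (\<forall>e. c * g \<le> e \<and> e < c * g + g \<longrightarrow> m (cell 4 l p e) = locs l p e) \<and>
      m (cell 20 l p (Suc c)) = shifted g (hist l p) (Suc c)"
  have sum: "(\<Sum>i<Mc. (g + 1) * chunk_cost) = Mc * ((g + 1) * chunk_cost)" by simp
  have dv: "e div g = c \<longleftrightarrow> c * g \<le> e \<and> e < c * g + g" for e c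
    using g by (metis div_nat_eqI dividend_less_div_times mult.commute times_div_less_eq_dividend add.commute mult_Suc)
  have cH: "c * g + g < HH w" "Suc c < HH w" if "c < Mc" for c
  proof -
    have "Suc c * g \<le> Mc * g" using that by (intro mult_right_mono) auto
    then show "c * g + g < HH w" using Mc_bounds(6) by simp
    show "Suc c < HH w" using that Mc_bounds(5) by simp
  qed
  show ?thesis unfolding chunk_code_def sum[symmetric]
  proof (rule ht_Par[where R="region2 l p" and own=owner2 and N=Mc and P="?P"])
    show "ev w A s m0 (Vr 10) Mc" by (rule ev_glob[OF s(1)])
    show "region2 l p \<subseteq> G" "region2 l p \<subseteq> A" using reg A by auto
  next
    fix c assume c: "c < Mc"
    have loop: "ht w (?Ac c) (?Gc c) [For 14 (Vr 9) chunk_body] (s(13 := c, 15 := 0)) m0 (\<lambda>s' m'. inv2 l p c m0 g s' m')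
        (esz (Vr 9) + 4 + g * (cost chunk_body + esz (Vr 9) + 4)) (esz (Vr 9) + 4 + g * (cost chunk_body + esz (Vr 9) + 4))"
    proof (rule ht_For[where I="inv2 l p c m0"])
      show "inv2 l p c m0 0 ((s(13 := c, 15 := 0))(14 := 0)) m0"
        using s by (simp add: inv2_def glob_upd)
    next
      fix t s' m' assume t: "t < g" and inv: "inv2 l p c m0 t s' m'" and s14: "s' 14 = t"
      have s': "glob s'" "s' 11 = l" "s' 12 = p" "s' 13 = c"
        and v: "s' 15 = (\<Sum>e\<in>{c * g..<c * g + t}. hist l p e)"
        and m2: "\<And>e. e < HH w \<Longrightarrow> m' (cell 2 l p e) = hist l p e"
        and m4: "\<And>e. c * g \<le> e \<Longrightarrow> e < c * g + t \<Longrightarrow> m' (cell 4 l p e) = locs l p e"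
        using inv cnt unfolding inv2_def by auto
      define e where "e = c * g + t"
      have eH: "e < HH w" using cH[OF c] t by (simp add: e_def)
      have ed: "e div g = c" using dv[of e c] t by (simp add: e_def)
      have eE: "ev w (?Ac c) s'' m'' (addE (mulE (Vr 13) (Vr 9)) (Vr 14)) e"
        if "glob s''" "s'' 13 = c" "s'' 14 = t" for s'' m''
        unfolding e_def by (intro ev_Add ev_Mul ev_V ev_glob that) (use eH H2 in \<open>auto simp: e_def\<close>)
      have o: "ev w (?Ac c) s' m' (locC (addE (mulE (Vr 13) (Vr 9)) (Vr 14))) (cell 4 l p e)"
        by (intro ev_cell ev_C ev_V eE s' s14 h eH) (use HHs(10) in auto)
      have oG: "cell 4 l p e \<in> ?Gc c" using in_region2[OF h eH] ed by simp
      have inA: "cell 2 l p e \<in> ?Ac c" using in_region2[OF h eH] A(1) h eH by (auto simp: own_def adr_sel)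
      let ?m = "m'(cell 4 l p e := s' 15)"
      have ne: "cell 2 l p x \<noteq> cell 4 l p e" if "x < HH w" for x using cell_inject[OF h that h eH] by simp
      have "{c * g..<c * g + Suc t} = insert e {c * g..<c * g + t}" by (auto simp: e_def)
      then have sm: "s' 15 + hist l p e = (\<Sum>e\<in>{c * g..<c * g + Suc t}. hist l p e)" using v by (simp add: e_def)
      have le: "s' 15 + hist l p e < 2 ^ w" unfolding sm
        using hist_sum_le[of "{c * g..<c * g + Suc t}" l p] H2[OF HHs(1)] by simp
      have ld: "ev w (?Ac c) s' ?m (addE (Vr 15) (Ld (cntC (addE (mulE (Vr 13) (Vr 9)) (Vr 14))))) (s' 15 + ?m (cell 2 l p e))"
        by (intro ev_Add ev_M ev_cell ev_C ev_V eE s' s14 h eH inA refl)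
          (use HHs(10) ne[OF eH] m2[OF eH] le in auto)
      have fin: "inv2 l p c m0 (Suc t) (s'(15 := s' 15 + ?m (cell 2 l p e), 14 := Suc t)) ?m"
        unfolding inv2_def
      proof (intro conjI allI impI)
        show "(s'(15 := s' 15 + ?m (cell 2 l p e), 14 := Suc t)) 15 = (\<Sum>e\<in>{c * g..<c * g + Suc t}. hist l p e)"
          using sm ne[OF eH] m2[OF eH] by simp
        show "?m (cell 2 l p x) = m0 (cell 2 l p x)" if "x < HH w" for x using m2 cnt ne that by simp
        fix x assume x: "c * g \<le> x \<and> x < c * g + Suc t"
        then have xH: "x < HH w" using eH by (simp add: e_def)
        show "?m (cell 4 l p x) = locs l p x"
        proof (cases "x = e")
          case True
          then show ?thesis using v ed by (simp add: locs_def e_def)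
        next
          case False
          then have "cell 4 l p x \<noteq> cell 4 l p e" using cell_inject[OF h xH h eH] by simp
          moreover have "x < c * g + t" using False x by (simp add: e_def)
          ultimately show ?thesis using m4 x by simp
        qed
      qed (use s' in \<open>auto simp: glob_upd\<close>)
      show "ht w (?Ac c) (?Gc c) chunk_body s' m' (\<lambda>s'' m''. s'' 14 = t \<and> inv2 l p c m0 (Suc t) (s''(14 := Suc t)) m'')
          (cost chunk_body) (cost chunk_body)"
        unfolding chunk_body_def
        by (rule ht_hs, rule hs_Wr[OF o ev_V[OF refl] oG], rule hs_Asg[OF ld], rule hs_Nil) (use s14 fin in simp)
    next
      show "ev w (?Ac c) s' m' (Vr 9) g" if "inv2 l p c m0 i s' m'" for i s' m'
        by (rule ev_glob) (use that in \<open>simp add: inv2_def\<close>)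
    qed (use w H2[OF HHs(4)] in auto)
    have last: "ht w (?Ac c) (?Gc c) [Wr (dblC (Cn 0) (addE (Vr 13) (Cn 1))) (Vr 15)] s' m' (\<lambda>s'' m''. ?P c m'')
        (esz (dblC (Cn 0) (addE (Vr 13) (Cn 1))) + esz (Vr 15) + 1) (esz (dblC (Cn 0) (addE (Vr 13) (Cn 1))) + esz (Vr 15) + 1)"
      if inv: "inv2 l p c m0 g s' m'" for s' m'
    proof (rule ht_Wr[OF _ ev_V[OF refl]])
      have s': "glob s'" "s' 11 = l" "s' 12 = p" "s' 13 = c"
        and v: "s' 15 = (\<Sum>e\<in>{c * g..<c * g + g}. hist l p e)"
        and m4: "\<And>e. c * g \<le> e \<Longrightarrow> e < c * g + g \<Longrightarrow> m' (cell 4 l p e) = locs l p e"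
        using inv unfolding inv2_def by auto
      have "ev w (?Ac c) s' m' (dblC (Cn 0) (addE (Vr 13) (Cn 1))) (cell (20 + 0) l p (c + 1))"
        by (intro ev_cell ev_C ev_V ev_Add s' h) (use HHs(10) cH[OF c] H2 HH_le[of w] in auto)
      then show "ev w (?Ac c) s' m' (dblC (Cn 0) (addE (Vr 13) (Cn 1))) (cell 20 l p (Suc c))" by simp
      show "cell 20 l p (Suc c) \<in> ?Gc c" using in_region2[OF h cH(2)[OF c]] by simp
      show "?P c (m'(cell 20 l p (Suc c) := s' 15))"
      proof (intro conjI allI impI)
        fix e assume e: "c * g \<le> e \<and> e < c * g + g"
        then have "e < HH w" using cH[OF c] by simp
        then show "(m'(cell 20 l p (Suc c) := s' 15)) (cell 4 l p e) = locs l p e"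
          using m4 e cell_inject[OF h _ h cH(2)[OF c]] by simp
      qed (simp add: v shifted_def add.commute)
    qed
    have "ht w (?Ac c) (?Gc c) (Asg 15 (Cn 0) # For 14 (Vr 9) chunk_body # [Wr (dblC (Cn 0) (addE (Vr 13) (Cn 1))) (Vr 15)])
       (s(13 := c)) m0 (\<lambda>s' m'. ?P c m')
       ((esz (Cn 0) + 1) + ((esz (Vr 9) + 4 + g * (cost chunk_body + esz (Vr 9) + 4)) + (esz (dblC (Cn 0) (addE (Vr 13) (Cn 1))) + esz (Vr 15) + 1)))
       ((esz (Cn 0) + 1) + ((esz (Vr 9) + 4 + g * (cost chunk_body + esz (Vr 9) + 4)) + (esz (dblC (Cn 0) (addE (Vr 13) (Cn 1))) + esz (Vr 15) + 1)))"
    proof (rule ht_Cons[OF ht_Asg[where Q="\<lambda>s' m'. s' = s(13 := c, 15 := 0) \<and> m' = m0"]])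
      show "ev w (?Ac c) (s(13 := c)) m0 (Cn 0) 0" by (rule ev_C) simp
    qed (use ht_Cons[OF loop last] in auto)
    then show "ht w (?Ac c) (?Gc c) [Asg 15 (Cn 0), For 14 (Vr 9) chunk_body, Wr (dblC (Cn 0) (addE (Vr 13) (Cn 1))) (Vr 15)]
       (s(13 := c)) m0 (\<lambda>s' m'. ?P c m') ((g + 1) * chunk_cost) ((g + 1) * chunk_cost)"
      by (rule ht_cost) (simp_all add: chunk_cost_def cost_def algebra_simps)
  next
    fix c m1 m2 assume c: "c < Mc" and eq: "\<And>a. a \<in> region2 l p \<Longrightarrow> owner2 a = c \<Longrightarrow> m2 a = m1 a" and P: "?P c m1"
    show "?P c m2"
    proof (intro conjI allI impI)
      fix e assume e: "c * g \<le> e \<and> e < c * g + g"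
      then have "e < HH w" "e div g = c" using cH[OF c] dv by auto
      then show "m2 (cell 4 l p e) = locs l p e" using eq in_region2[OF h] P e by auto
    next
      show "m2 (cell 20 l p (Suc c)) = shifted g (hist l p) (Suc c)"
        using eq in_region2[OF h cH(2)[OF c]] P by auto
    qed
  next
    fix m' assume P: "\<And>c. c < Mc \<Longrightarrow> ?P c m'" and fr: "\<And>a. a \<in> A \<Longrightarrow> a \<notin> region2 l p \<or> Mc \<le> owner2 a \<Longrightarrow> m' a = m0 a"
    show "s = s \<and> (\<forall>a\<in>A. a \<notin> region2 l p \<longrightarrow> m' a = m0 a) \<and>
      (\<forall>e<Mc * g. m' (cell 4 l p e) = locs l p e) \<and> (\<forall>c<Mc. m' (cell 20 l p c) = shifted g (hist l p) c)"
    proof (intro conjI allI impI ballI refl)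
      show "m' a = m0 a" if "a \<in> A" "a \<notin> region2 l p" for a using fr that by blast
      show "m' (cell 4 l p e) = locs l p e" if e: "e < Mc * g" for e
      proof -
        have "e div g < Mc" using e g by (simp add: div_less_iff_less_mult)
        moreover have "e div g * g \<le> e \<and> e < e div g * g + g" using dv[of e "e div g"] by simp
        ultimately show ?thesis using P by blast
      qed
      show "m' (cell 20 l p c) = shifted g (hist l p) c" if c: "c < Mc" for c
      proof (cases c)
        case 0
        have "cell 20 l p 0 \<notin> region2 l p" "cell 20 l p 0 \<in> A"
          using h A(1) HH_pos[of w] by (auto simp: region2_def own_def adr_sel)
        then show ?thesis using fr z 0 by (simp add: shifted_def)
      next
        case (Suc c')
        then show ?thesis using P[of c'] c by simp
      qed
    qed
  qed
qed

end

context level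
begin

definition region3 :: "nat \<Rightarrow> nat \<Rightarrow> nat set" where
  "region3 l p = {a. lv w a = l \<and> ps w a = p \<and> 21 \<le> kd w a}"

abbreviation "wsum l p \<equiv> window (shifted g (hist l p))"

text \<open>Bucket sizes add up to at most \<open>n\<close>, so no partial sum can overflow.\<close>

lemma wsum_le: "wsum l p t c \<le> n"
proof -
  have "wsum l p t c \<le> wsum l p (Suc c) c" unfolding window_def by (rule sum_mono2) auto
  also have "\<dots> = (\<Sum>e<c * g. hist l p e)" by (rule window_shifted) simp
  also have "\<dots> \<le> n" by (rule hist_sum_le) simp
  finally show ?thesis .
qed

definition inv3 :: "nat \<Rightarrow> nat \<Rightarrow> nat set \<Rightarrow> mem \<Rightarrow> nat \<Rightarrow> (nat \<Rightarrow> nat) \<Rightarrow> mem \<Rightarrow> bool" where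
  "inv3 l p A m0 k s m \<longleftrightarrow> glob s \<and> s 11 = l \<and> s 12 = p \<and> (\<forall>a\<in>A. a \<notin> region3 l p \<longrightarrow> m a = m0 a) \<and>
     (\<forall>c<Mc. m (cell (20 + k) l p c) = wsum l p (2 ^ k) c)"

definition double_cost :: nat where "double_cost = cost double_body + esz (Vr 10) + 2 * esz (addE (Vr 9) (Cn 2)) + 9"

lemma ht_double:
  assumes s: "glob s" "s 11 = l" "s 12 = p"
    and t0: "\<And>c. c < Mc \<Longrightarrow> m0 (cell 20 l p c) = shifted g (hist l p) c"
    and lp: "l \<le> L" "p < K" and A: "own l \<subseteq> A" "own l \<subseteq> G"
  shows "ht w A G [double_code] s m0 (inv3 l p A m0 (g + 2))
    ((g + 3) * double_cost) ((g + 3) * ((Mc + 1) * double_cost))"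
proof -
  have h: "l < HH w" "p < HH w" using lp HHs by linarith+
  have step: "ht w A G [Par 13 (Vr 10) double_body] s' m' (\<lambda>s'' m''. s'' 16 = k \<and> inv3 l p A m0 (Suc k) (s''(16 := Suc k)) m'')
      (esz (Vr 10) + 1 + cost double_body) (esz (Vr 10) + 1 + (\<Sum>c<Mc. cost double_body))"
    if k: "k < g + 2" and inv: "inv3 l p A m0 k s' m'" and s16: "s' 16 = k" for k s' m'
  proof -
    have s': "glob s'" "s' 11 = l" "s' 12 = p" and fr0: "\<And>a. a \<in> A \<Longrightarrow> a \<notin> region3 l p \<Longrightarrow> m' a = m0 a"
      and T: "\<And>c. c < Mc \<Longrightarrow> m' (cell (20 + k) l p c) = wsum l p (2 ^ k) c"
      using inv by (auto simp: inv3_def)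
    let ?R = "{a. lv w a = l \<and> ps w a = p \<and> kd w a = 21 + k \<and> ix w a < Mc}"
    have kH: "21 + k < HH w" "20 + k < HH w" "k < w" "k < HH w" "20 + k < 2 ^ w" "k + 1 < 2 ^ w" "20 + (k + 1) < 2 ^ w"
      using k HHs(16) rounds(2) HH_le[of w] by simp_all
    have sel: "kd w (cell q l p c) = q" "lv w (cell q l p c) = l" "ps w (cell q l p c) = p" "ix w (cell q l p c) = c"
      if "c < Mc" for q c using that adr_sel[OF h] Mc_bounds(5) by simp_all
    show ?thesis
    proof (rule ht_Par[where R="?R" and own="ix w" and P="\<lambda>c m. m (cell (21 + k) l p c) = wsum l p (2 ^ Suc k) c"])
      show "ev w A s' m' (Vr 10) Mc" by (rule ev_glob[OF s'(1)])
      show "?R \<subseteq> G" "?R \<subseteq> A" using A by (auto simp: own_def)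
    next
      fix c assume c: "c < Mc"
      have cH: "c < HH w" using c Mc_bounds(5) by simp
      let ?A = "A - {a \<in> ?R. ix w a \<noteq> c}" and ?G = "{a \<in> ?R. ix w a = c}" and ?s = "s'(13 := c)"
      have s2: "?s 11 = l" "?s 12 = p" "?s 13 = c" "?s 16 = k" "glob ?s" using s' s16 by (auto simp: glob_upd)
      have cA: "cell (20 + k) l p x \<in> ?A" if "x < Mc" for x using A(1) sel[OF that] by (auto simp: own_def)
      have a: "ev w ?A ?s m' (dblC (addE (Vr 16) (Cn 1)) (Vr 13)) (cell (20 + (k + 1)) l p c)"
        by (intro ev_cell ev_C ev_V ev_Add s2 h kH cH) (use kH in auto)
      have r: "ev w ?A ?s m' (dblC (Vr 16) x) (cell (20 + k) l p y)" if "ev w ?A ?s m' x y" "y < HH w" for x y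
        by (intro ev_cell ev_C ev_V ev_Add s2 h kH that) auto
      have i: "ev w ?A ?s m' (Ite (lessE (Vr 13) (pow2E (Vr 16))) (Cn 0) (Ld (dblC (Vr 16) (subE (Vr 13) (pow2E (Vr 16))))))
          (if c < 2 ^ k then 0 else m' (cell (20 + k) l p (c - 2 ^ k)))"
        by (intro ev_If ev_Less ev_V s2 ev_pow2 kH ev_C ev_M r ev_Sub cA) (use c cH H2 in auto)
      have v: "m' (cell (20 + k) l p c) + (if c < 2 ^ k then 0 else m' (cell (20 + k) l p (c - 2 ^ k))) = wsum l p (2 ^ Suc k) c"
        using T c window_double[of "shifted g (hist l p)" "2 ^ k" c] by simp
      have e: "ev w ?A ?s m' (addE (Ld (dblC (Vr 16) (Vr 13))) (Ite (lessE (Vr 13) (pow2E (Vr 16))) (Cn 0)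
          (Ld (dblC (Vr 16) (subE (Vr 13) (pow2E (Vr 16))))))) (wsum l p (2 ^ Suc k) c)"
        unfolding v[symmetric] by (intro ev_Add i ev_M r ev_V s2 cA c cH, unfold v)
          (rule le_less_trans[OF wsum_le H2[OF HHs(1)]])
      show "ht w ?A ?G double_body ?s m' (\<lambda>s'' m''. m'' (cell (21 + k) l p c) = wsum l p (2 ^ Suc k) c)
          (cost double_body) (cost double_body)"
        unfolding double_body_def
        by (rule ht_hs, rule hs_Wr[OF a e], use c sel in simp, rule hs_Nil) simp
    next
      fix m'' assume P: "\<And>c. c < Mc \<Longrightarrow> m'' (cell (21 + k) l p c) = wsum l p (2 ^ Suc k) c"
        and fr: "\<And>a. a \<in> A \<Longrightarrow> a \<notin> ?R \<or> Mc \<le> ix w a \<Longrightarrow> m'' a = m' a"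
      show "s' 16 = k \<and> inv3 l p A m0 (Suc k) (s'(16 := Suc k)) m''"
        using s' s16 P fr fr0 unfolding inv3_def by (auto simp: glob_upd region3_def)
    qed (use sel in auto)
  qed
  have "ht w A G [double_code] s m0 (inv3 l p A m0 (g + 2))
    (esz (addE (Vr 9) (Cn 2)) + 4 + (g + 2) * (esz (Vr 10) + 1 + cost double_body + esz (addE (Vr 9) (Cn 2)) + 4))
    (esz (addE (Vr 9) (Cn 2)) + 4 + (g + 2) * (esz (Vr 10) + 1 + (\<Sum>c<Mc. cost double_body) + esz (addE (Vr 9) (Cn 2)) + 4))"
    unfolding double_code_def
  proof (rule ht_For[where I="inv3 l p A m0", OF _ _ w(2) _ step])
    show "inv3 l p A m0 0 (s(16 := 0)) m0" using s t0 by (auto simp: inv3_def glob_upd window_1[unfolded One_nat_def])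
    show "g + 2 < 2 ^ w" using HHs(16) HH_le[of w] by simp
    then show "ev w A s' m' (addE (Vr 9) (Cn 2)) (g + 2)" if "inv3 l p A m0 i s' m'" for i s' m'
      using that by (intro ev_Add ev_glob ev_C) (auto simp: inv3_def)
  qed auto
  then show ?thesis by (rule ht_cost) (simp_all add: double_cost_def algebra_simps)
qed

lemma part_Suc: "part l (Suc p) i = dig l p i * R ^ p + part l p i"
  using mod_mult2_eq[of "kk l i" "R ^ p" R] unfolding part_def dig_def power_Suc2
  by (simp only: mult.commute[of "R ^ p" "kk l i div R ^ p mod R"])

lemma part_final: "i < n \<Longrightarrow> l \<le> L \<Longrightarrow> part l K i = kk l i"
proof -
  assume "i < n" "l \<le> L"
  then have "kk l i < 2 ^ l" by (intro key_less f)
  also have "\<dots> \<le> 2 ^ (K * d)" using \<open>l \<le> L\<close> passes(1) by (intro power_increasing) auto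
  also have "(2::nat) ^ (K * d) = R ^ K" unfolding R(1) by (simp add: power_mult[symmetric] mult.commute)
  finally show ?thesis by (simp add: part_def)
qed

text \<open>Correctness of a pass: prefix sum over smaller buckets plus offset is, by
  \<open>bucket_split\<close>, the number of smaller digits plus that of earlier equal ones, and by
  \<open>spos_digit\<close> this is the stable position for one more digit.\<close>

lemma target:
  assumes j: "j < n"
  shows "(\<Sum>e<bucket l p j. hist l p e) + offs l p j = spos (part l (Suc p)) n (item (part l p) n j)"
proof -
  let ?i = "item (part l p) n j"
  have i: "?i < n" by (rule item_less[OF j])
  have "spos (part l (Suc p)) n ?i = spos (\<lambda>i. dig l p i * R ^ p + part l p i) n ?i"
    by (rule spos_cong[OF part_Suc i])
  also have "\<dots> = card {k. k < n \<and> xd l p k < xd l p j} + card {k. k < j \<and> xd l p k = xd l p j}"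
    using spos_digit[of n "part l p" "R ^ p" ?i "dig l p"] i Rpos spos_item[OF j]
    by (simp add: part_def[of l p] xd_def)
  also have "\<dots> = (\<Sum>e<bucket l p j. hist l p e) + offs l p j"
    unfolding sum_hist offs_def bucket_def by (rule bucket_split[OF j div_R, symmetric])
  finally show ?thesis by simp
qed

definition region4 :: "nat \<Rightarrow> nat \<Rightarrow> nat set" where
  "region4 l p = {a. lv w a = l \<and> ps w a = Suc p \<and> kd w a = 1 \<and> ix w a < n}"

lemma ht_move:
  assumes s: "glob s" "s 11 = l" "s 12 = p"
    and m0: "inp m0" "sorted_upto l p m0" "\<And>e. e < Mc * g \<Longrightarrow> m0 (cell 4 l p e) = locs l p e"
      "\<And>c. c < Mc \<Longrightarrow> m0 (cell (20 + (g + 2)) l p c) = wsum l p (2 ^ (g + 2)) c"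
      "\<And>j. j < n \<Longrightarrow> m0 (cell 3 l p j) = offs l p j"
    and lp: "l \<le> L" "p < K" and A: "{..<n} \<subseteq> A" "own l \<subseteq> A" "own l \<subseteq> G"
  shows "ht w A G [move_code] s m0 (\<lambda>s' m. s' = s \<and> (\<forall>a\<in>A. a \<notin> region4 l p \<longrightarrow> m a = m0 a) \<and> sorted_upto l (Suc p) m)
    (esz (Vr 0) + 1 + cost move_body) (esz (Vr 0) + 1 + (\<Sum>j<n. cost move_body))"
proof -
  have h: "l < HH w" "p < HH w" "Suc p < HH w" using lp HHs by linarith+
  define to where "to j = spos (part l (Suc p)) n (item (part l p) n j)" for j
  \<comment> \<open>A target cell belongs to the current position of the item that moves there. Both
    orders are permutations, so distinct threads write to distinct cells.\<close>
  define own4 where "own4 a = spos (part l p) n (item (part l (Suc p)) n (ix w a))" for a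
  have to: "to j < n" "item (part l (Suc p)) n (to j) = item (part l p) n j" if "j < n" for j
    using that by (simp_all add: to_def spos_less item_less item_spos)
  have mem: "cell 1 l (Suc p) y \<in> region4 l p" "own4 (cell 1 l (Suc p) y) = spos (part l p) n (item (part l (Suc p)) n y)"
    if "y < n" for y using that h HHs(1) by (auto simp: region4_def own4_def adr_sel)
  show ?thesis unfolding move_code_def
  proof (rule ht_Par[where R="region4 l p" and own=own4 and P="\<lambda>j m. m (cell 1 l (Suc p) (to j)) = item (part l p) n j"])
    show "ev w A s m0 (Vr 0) n" by (rule ev_glob[OF s(1)])
    show "region4 l p \<subseteq> G" "region4 l p \<subseteq> A" using A by (auto simp: region4_def own_def)
  next
    fix j assume j: "j < n"
    have jH: "j < HH w" using j HHs(1) by simp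
    let ?A = "A - {a \<in> region4 l p. own4 a \<noteq> j}" and ?G = "{a \<in> region4 l p. own4 a = j}"
    have in_A: "cell q l p x \<in> ?A" if "x < HH w" "1 \<le> q" for q x
      using that A(2) h by (auto simp: own_def region4_def adr_sel)
    have inA: "{..<n} \<subseteq> ?A"
      using A(1) HHs(1) kd_small[of _ w] by (force simp: region4_def)
    let ?e = "bucket l p j"
    have eb: "?e < R * nb" unfolding bucket_def by (rule bucket_less[OF xd_less div_R[OF j]])
    have eg: "?e < Mc * g" using eb Mc_bounds(2) by linarith
    have ed: "?e div g < Mc" using eg g by (simp add: div_less_iff_less_mult)
    have eH: "?e < HH w" "?e div g < Mc" "?e < Mc * g" "?e div g < HH w"
      using eb HHs(3) Mc_bounds(5) eg ed by linarith+
    have s13: "glob (s(13 := j))" "(s(13 := j)) 11 = l" "(s(13 := j)) 12 = p" "(s(13 := j)) 13 = j"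
      using s by (auto simp: glob_upd)
    have b: "ev w ?A (s(13 := j)) m0 (addE (mulE (digitE (Vr 13)) (Vr 8)) (divE (Vr 13) (Vr 7))) ?e"
      unfolding bucket_def
      by (intro ev_Add ev_Mul ev_Div ev_digit[where l=l and p=p] ev_V ev_glob s13 m0 j inA in_A jH lp)
        (use eH(1) H2 in \<open>auto simp: bucket_def\<close>)
    let ?s = "s(13 := j, 14 := ?e)"
    have s14: "glob ?s" "?s 11 = l" "?s 12 = p" "?s 13 = j" "?s 14 = ?e" using s by (auto simp: glob_upd)
    have P: "locs l p ?e + wsum l p (2 ^ (g + 2)) (?e div g) = (\<Sum>e<?e. hist l p e)"
      unfolding prefix_split[where C="hist l p" and e="?e" and g=g] locs_def
      using window_shifted[of "?e div g" "2 ^ (g + 2)" g "hist l p"] eH(2) Mc_bounds(4) by simp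
    have tot: "locs l p ?e + wsum l p (2 ^ (g + 2)) (?e div g) + offs l p j = to j"
      unfolding P to_def by (rule target[OF j])
    have toH: "to j < 2 ^ w" using to(1)[OF j] H2[OF HHs(1)] by (rule less_trans)
    have l1: "ev w ?A ?s m0 (Ld (locC (Vr 14))) (locs l p ?e)"
      unfolding m0(3)[OF eH(3), symmetric] by (intro ev_M ev_cell ev_C ev_V s14 h eH in_A) (use HHs(10) in auto)
    have l2: "ev w ?A ?s m0 (Ld (dblC (addE (Vr 9) (Cn 2)) (divE (Vr 14) (Vr 9)))) (wsum l p (2 ^ (g + 2)) (?e div g))"
      unfolding m0(4)[OF eH(2), symmetric] by (intro ev_M ev_cell ev_C ev_V ev_Add ev_Div ev_glob s14 h eH in_A)
        (use HHs(16) HH_le[of w] in auto)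
    have l3: "ev w ?A ?s m0 (Ld (offC (Vr 13))) (offs l p j)"
      unfolding m0(5)[OF j, symmetric] by (intro ev_M ev_cell ev_C ev_V s14 h jH in_A) (use HHs(10) in auto)
    have t: "ev w ?A ?s m0 (addE (addE (Ld (locC (Vr 14))) (Ld (dblC (addE (Vr 9) (Cn 2)) (divE (Vr 14) (Vr 9))))) (Ld (offC (Vr 13)))) (to j)"
      unfolding tot[symmetric] by (intro ev_Add l1 l2 l3) (use tot toH in linarith)+
    let ?s' = "?s(15 := to j)"
    have s15: "?s' 11 = l" "?s' 12 = p" "?s' 13 = j" "?s' 15 = to j" using s by auto
    have o: "ev w ?A ?s' m0 (itemC (addE (Vr 12) (Cn 1)) (Vr 15)) (cell 1 l (p + 1) (to j))"
      by (intro ev_cell ev_C ev_V ev_Add s15 h) (use HHs(10) h H2 to(1)[OF j] HHs(1) in auto)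
    have i: "ev w ?A ?s' m0 (Ld (itemC (Vr 12) (Vr 13))) (m0 (cell 1 l p j))"
      by (intro ev_M ev_cell ev_C ev_V s15 h jH in_A) (use HHs(10) in auto)
    have mj: "m0 (cell 1 l p j) = item (part l p) n j" using m0(2) j by (simp add: sorted_upto_def)
    show "ht w ?A ?G move_body (s(13 := j)) m0 (\<lambda>s' m'. m' (cell 1 l (Suc p) (to j)) = item (part l p) n j)
        (cost move_body) (cost move_body)"
      unfolding move_body_def
      by (rule ht_hs, rule hs_Asg[OF b], rule hs_Asg[OF t], rule hs_Wr[OF o i])
        (use mem[OF to(1)[OF j]] to[OF j] j mj in \<open>auto simp: spos_item intro!: hs_Nil\<close>)
  next
    fix j m1 m2 assume j: "j < n" and eq: "\<And>a. a \<in> region4 l p \<Longrightarrow> own4 a = j \<Longrightarrow> m2 a = m1 a"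
      and P: "m1 (cell 1 l (Suc p) (to j)) = item (part l p) n j"
    then show "m2 (cell 1 l (Suc p) (to j)) = item (part l p) n j"
      using mem[OF to(1)[OF j]] to[OF j] by (simp add: spos_item)
  next
    fix m' assume P: "\<And>j. j < n \<Longrightarrow> m' (cell 1 l (Suc p) (to j)) = item (part l p) n j"
      and fr: "\<And>a. a \<in> A \<Longrightarrow> a \<notin> region4 l p \<or> n \<le> own4 a \<Longrightarrow> m' a = m0 a"
    have "m' (cell 1 l (Suc p) y) = item (part l (Suc p)) n y" if y: "y < n" for y
    proof -
      let ?j = "spos (part l p) n (item (part l (Suc p)) n y)"
      have "?j < n" "to ?j = y" "item (part l p) n ?j = item (part l (Suc p)) n y"
        using y by (simp_all add: to_def spos_less item_less item_spos spos_item)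
      then show ?thesis using P by metis
    qed
    then show "s = s \<and> (\<forall>a\<in>A. a \<notin> region4 l p \<longrightarrow> m' a = m0 a) \<and> sorted_upto l (Suc p) m'"
      using fr by (auto simp: sorted_upto_def)
  qed
qed

definition pass_cost :: nat where
  "pass_cost = 8 * (count_depth + chunk_cost + double_cost + cost move_body + esz (Vr 0) + esz (Vr 8) + esz (Vr 10) + 3)"

text \<open>The addresses that must survive pass \<open>p\<close>: the input, the results of the
  level, and the still untouched working cells of other passes.\<close>

definition quiet :: "nat \<Rightarrow> nat \<Rightarrow> bool" where
  "quiet p a \<longleftrightarrow> kd w a = 0 \<or> kd w a \<in> {7, 8, 9} \<or> kd w a \<noteq> 1 \<and> ps w a \<noteq> p"

lemma ht_pass:
  assumes s: "glob s" "s 11 = l" "s 12 = p"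
    and m0: "inp m0" "sorted_upto l p m0" "\<And>e. e < HH w \<Longrightarrow> m0 (cell 2 l p e) = 0" "m0 (cell 20 l p 0) = 0"
    and lp: "l \<le> L" "p < K" and A: "{..<n} \<subseteq> A" "own l \<subseteq> A" "own l \<subseteq> G"
  shows "ht w A G [count_code, chunk_code, double_code, move_code] s m0
    (\<lambda>s' m. glob s' \<and> s' 11 = l \<and> s' 12 = p \<and> sorted_upto l (Suc p) m \<and> (\<forall>a\<in>A. quiet p a \<longrightarrow> m a = m0 a))
    (pass_cost * (R + g)) (pass_cost * (R * nb + n + g))"
proof -
  have h: "l < HH w" "p < HH w" "Suc p < HH w" using lp HHs by linarith+
  have cA: "cell q l p e \<in> A" if "1 \<le> q" "e < HH w" for q e using that A(2) h by (auto simp: own_def adr_sel)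
  have in0: "inp m" if "\<And>i. i < n \<Longrightarrow> m i = m0 i" for m using m0(1) that by (simp add: inp_def)
  have k0: "kd w i = 0" if "i < n" for i using that HHs(1) by (intro kd_small) simp
  have iA: "i \<in> A" if "i < n" for i using A(1) that by auto
  let ?Q1 = "\<lambda>s' m. s' = s \<and> (\<forall>a\<in>A. a \<notin> region1 l p \<longrightarrow> m a = m0 a) \<and>
      (\<forall>e<R * nb. m (cell 2 l p e) = hist l p e) \<and> (\<forall>j<n. m (cell 3 l p j) = offs l p j)"
  let ?Q2 = "\<lambda>m1 s' m. s' = s \<and> (\<forall>a\<in>A. a \<notin> region2 l p \<longrightarrow> m a = m1 a) \<and>
      (\<forall>e<Mc * g. m (cell 4 l p e) = locs l p e) \<and> (\<forall>c<Mc. m (cell 20 l p c) = shifted g (hist l p) c)"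
  let ?Q4 = "\<lambda>s' m. glob s' \<and> s' 11 = l \<and> s' 12 = p \<and> sorted_upto l (Suc p) m \<and> (\<forall>a\<in>A. quiet p a \<longrightarrow> m a = m0 a)"
  have 4: "ht w A G [move_code] s' m ?Q4 (esz (Vr 0) + 1 + cost move_body) (esz (Vr 0) + 1 + (\<Sum>j<n. cost move_body))"
    if Q1: "?Q1 s m1" and Q2: "?Q2 m1 s m2" and i3: "inv3 l p A m2 (g + 2) s' m" for m1 m2 m s'
  proof -
    have s': "glob s'" "s' 11 = l" "s' 12 = p" and T: "\<And>c. c < Mc \<Longrightarrow> m (cell (20 + (g + 2)) l p c) = wsum l p (2 ^ (g + 2)) c"
      and i3': "\<And>a. a \<in> A \<Longrightarrow> a \<notin> region3 l p \<Longrightarrow> m a = m2 a"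
      using i3 by (auto simp: inv3_def)
    have fr: "m a = m0 a" if a: "a \<in> A" "quiet p a \<or> kd w a = 1" for a
    proof -
      have "a \<notin> region1 l p" "a \<notin> region2 l p" "a \<notin> region3 l p"
        using a(2) by (auto simp: quiet_def region1_def region2_def region3_def)
      then show ?thesis using a(1) Q1 Q2 i3' by auto
    qed
    have k3: "m (cell q l p e) = m2 (cell q l p e)" if "q = 3 \<or> q = 4" "e < HH w" for q e
      using that i3'[of "cell q l p e"] cA[of q e] h by (auto simp: region3_def adr_sel)
    have m23: "m2 (cell 3 l p j) = m1 (cell 3 l p j)" if "j < HH w" for j
      using that Q2 cA[of 3 j] h by (auto simp: region2_def adr_sel)
    show ?thesis
    proof (rule ht_post[OF ht_move[OF s' _ _ _ T _ lp A]])
      show "inp m" by (rule in0, rule fr) (use iA k0 in \<open>auto simp: quiet_def\<close>)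
      show "sorted_upto l p m" using m0(2) h HHs(1) cA[of 1] fr by (auto simp: sorted_upto_def adr_sel)
      show "m (cell 4 l p e) = locs l p e" if "e < Mc * g" for e
        using k3[of 4 e] that Q2 Mc_bounds(6) by simp
      show "m (cell 3 l p j) = offs l p j" if "j < n" for j
        using k3[of 3 j] m23[of j] that Q1 HHs(1) by simp
      fix s'' m'' assume a: "s'' = s' \<and> (\<forall>a\<in>A. a \<notin> region4 l p \<longrightarrow> m'' a = m a) \<and> sorted_upto l (Suc p) m''"
      have "m'' a = m0 a" if "a \<in> A" "quiet p a" for a
      proof -
        have "a \<notin> region4 l p" using that(2) by (auto simp: quiet_def region4_def)
        then show ?thesis using a that fr by auto
      qed
      then show "?Q4 s'' m''" using a s' by auto
    qed
  qed
  have 2: "ht w A G [chunk_code] s m1 (?Q2 m1)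
    (esz (Vr 10) + 1 + (g + 1) * chunk_cost) (esz (Vr 10) + 1 + Mc * ((g + 1) * chunk_cost))"
    if Q: "?Q1 s m1" for m1
  proof (rule ht_chunk[OF s _ _ lp A(2,3)])
    show "m1 (cell 2 l p e) = hist l p e" if e: "e < HH w" for e
    proof (cases "e < R * nb")
      case False
      then have "cell 2 l p e \<notin> region1 l p" using e h by (simp add: region1_def adr_sel)
      then show ?thesis using Q cA[of 2 e] e m0(3) False by (auto simp: hist_beyond)
    qed (use Q in auto)
    have "cell 20 l p 0 \<notin> region1 l p" using h HH_pos[of w] by (simp add: region1_def adr_sel)
    then show "m1 (cell 20 l p 0) = 0" using Q cA[of 20 0] m0(4) HH_pos[of w] by auto
  qed
  let ?K3 = "(g + 3) * double_cost + (esz (Vr 0) + 1 + cost move_body)"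
  let ?W3 = "(g + 3) * ((Mc + 1) * double_cost) + (esz (Vr 0) + 1 + (\<Sum>j<n. cost move_body))"
  have 3: "ht w A G [double_code, move_code] s m2 ?Q4 ?K3 ?W3" if Q: "?Q1 s m1" "?Q2 m1 s m2" for m1 m2
    by (rule ht_Cons[OF ht_double[OF s _ lp A(2,3)] 4[OF Q]]) (use Q in auto)
  let ?K1 = "esz (Vr 10) + 1 + (g + 1) * chunk_cost + ?K3"
  let ?W1 = "esz (Vr 10) + 1 + Mc * ((g + 1) * chunk_cost) + ?W3"
  have 1: "ht w A G [chunk_code, double_code, move_code] s m1 ?Q4 ?K1 ?W1" if Q: "?Q1 s m1" for m1
  proof (rule ht_Cons[OF 2[OF Q]])
    fix s2 m2 assume Q2: "?Q2 m1 s2 m2"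
    then have e: "s2 = s" by simp
    show "ht w A G [double_code, move_code] s2 m2 ?Q4 ?K3 ?W3"
      using 3[OF Q Q2[unfolded e]] unfolding e .
  qed
  have "ht w A G (count_code # [chunk_code, double_code, move_code]) s m0 ?Q4
    (esz (Vr 8) + 1 + (R + 1) * count_depth + ?K1) (esz (Vr 8) + 1 + nb * ((R + 1) * count_depth) + ?W1)"
  proof (rule ht_Cons[OF ht_count[OF s m0(1-3) lp A]])
    fix s1 m1 assume Q1: "?Q1 s1 m1"
    then have e: "s1 = s" by simp
    show "ht w A G [chunk_code, double_code, move_code] s1 m1 ?Q4 ?K1 ?W1"
      using 1[OF Q1[unfolded e]] unfolding e .
  qed
  then show ?thesis
  proof (rule ht_cost)
    have g3: "1 \<le> g" "1 \<le> R" "1 \<le> nb" using g Rpos nbpos by auto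
    have a: "(R + 1) * x \<le> 8 * ((R + g) * x)" "(g + 1) * x \<le> 8 * ((R + g) * x)" "(g + 3) * x \<le> 8 * ((R + g) * x)"
      "x \<le> 8 * ((R + g) * x)" for x
    proof -
      have gen: "y + 1 * x \<le> 8 * (y + z)" "z + 1 * x \<le> 8 * (y + z)" "z + 3 * x \<le> 8 * (y + z)" "x \<le> 8 * (y + z)"
        if "x \<le> y" "x \<le> z" for y z :: nat using that by simp_all
      have "x \<le> R * x" "x \<le> g * x" using g3 by simp_all
      from gen[OF this] show "(R + 1) * x \<le> 8 * ((R + g) * x)" "(g + 1) * x \<le> 8 * ((R + g) * x)" "(g + 3) * x \<le> 8 * ((R + g) * x)"
        "x \<le> 8 * ((R + g) * x)" by (simp_all only: add_mult_distrib)
    qed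
    have pc: "pass_cost * x = 8 * (x * count_depth) + 8 * (x * chunk_cost) + 8 * (x * double_cost) + 8 * (x * cost move_body) +
        8 * (x * (esz (Vr 0) + esz (Vr 8) + esz (Vr 10) + 3))" for x
      unfolding pass_cost_def by (simp add: algebra_simps)
    show "esz (Vr 8) + 1 + (R + 1) * count_depth + ?K1 \<le> pass_cost * (R + g)"
      unfolding pc using a(1)[of count_depth] a(2)[of chunk_cost] a(3)[of double_cost] a(4)[of "cost move_body"]
        a(4)[of "esz (Vr 0) + esz (Vr 8) + esz (Vr 10) + 3"] by linarith
    \<comment> \<open>Linearity of the work: \<open>Mc * g\<close> exceeds \<open>R * nb\<close> by
      at most \<open>g\<close>, so even \<open>g + 3\<close> rounds over \<open>Mc + 1\<close> cells
      are \<open>O(U)\<close>.\<close>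
    define U where "U = R * nb + n + g"
    have e: "nb * (R + 1) = R * nb + nb" "Mc * (g + 1) = Mc * g + Mc" "(g + 3) * (Mc + 1) = Mc * g + 3 * Mc + g + 3"
      by (simp_all add: algebra_simps)
    have le: "Mc \<le> Mc * g" "nb \<le> R * nb" using g3 by simp_all
    have gen2: "rb + b \<le> 8 * (rb + n + g)" "mg + mc \<le> 8 * (rb + n + g)" "mg + 3 * mc + g + 3 \<le> 8 * (rb + n + g)"
      if "mc \<le> mg" "b \<le> rb" "mg \<le> rb + g" for mc mg b rb :: nat using that g3 by simp_all
    have "nb * (R + 1) \<le> 8 * U" "Mc * (g + 1) \<le> 8 * U" "(g + 3) * (Mc + 1) \<le> 8 * U"
      unfolding e U_def by (rule gen2[OF le Mc_bounds(3)])+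
    then have u: "nb * (R + 1) \<le> 8 * U" "Mc * (g + 1) \<le> 8 * U" "(g + 3) * (Mc + 1) \<le> 8 * U" "n \<le> 8 * U" "1 \<le> 8 * U"
      using g3 by (simp_all add: U_def)
    have b: "nb * ((R + 1) * x) \<le> 8 * (U * x)" "Mc * ((g + 1) * x) \<le> 8 * (U * x)" "(g + 3) * ((Mc + 1) * x) \<le> 8 * (U * x)"
      "n * x \<le> 8 * (U * x)" "1 * x \<le> 8 * (U * x)" for x
      unfolding mult.assoc[symmetric] by (rule mult_right_mono, rule u, simp)+
    have fin: "e8 + 1 + a + (e10 + 1 + b + (c + (e0 + 1 + d))) \<le> 8 * A + 8 * B + 8 * C + 8 * D + 8 * E"
      if "a \<le> 8 * A" "b \<le> 8 * B" "c \<le> 8 * C" "d \<le> 8 * D" "1 * (e0 + e8 + e10 + 3) \<le> 8 * E"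
      for a b c d e0 e8 e10 A B C D E :: nat using that by simp
    show "esz (Vr 8) + 1 + nb * ((R + 1) * count_depth) + ?W1 \<le> pass_cost * (R * nb + n + g)"
      unfolding pc U_def[symmetric] sum_constant card_lessThan of_nat_id by (rule fin[OF b])
  qed
qed

end

section \<open>Inverse order and node boundaries of a level\<close>

text \<open>In the sorted order a node starts where the key differs from that of the predecessor and
  ends where it differs from that of the successor. The ends of the order count as a change of
  key.\<close>

definition finish_body :: "stmt list" where
  "finish_body = [Asg 14 (Ld (itemC (Vr 5) (Vr 13))),
     Wr (adrE (Cn 7) (Vr 11) (Cn 0) (Vr 14)) (Vr 13),
     Asg 15 (keyE (Vr 14) (Vr 11)),
     When (Ite (lessE (Cn 0) (Vr 13))
         (Bn Equal (keyE (Ld (itemC (Vr 5) (subE (Vr 13) (Cn 1)))) (Vr 11)) (Vr 15)) (Cn 0))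
       [] [Wr (adrE (Cn 8) (Vr 11) (Cn 0) (Vr 15)) (Vr 13)],
     When (Ite (lessE (addE (Vr 13) (Cn 1)) (Vr 0))
         (Bn Equal (keyE (Ld (itemC (Vr 5) (addE (Vr 13) (Cn 1)))) (Vr 11)) (Vr 15)) (Cn 0))
       [] [Wr (adrE (Cn 9) (Vr 11) (Cn 0) (Vr 15)) (addE (Vr 13) (Cn 1))]]"

definition init_body :: "stmt list" where
  "init_body = [Wr (itemC (Cn 0) (Vr 13)) (Vr 13)]"

definition level_body :: "stmt list" where
  "level_body = [Par 13 (Vr 0) init_body,
     For 12 (Vr 5) [count_code, chunk_code, double_code, move_code], Par 13 (Vr 0) finish_body]"

context level
begin

definition st :: "nat \<Rightarrow> nat \<Rightarrow> nat" where "st l c = card {j. j < n \<and> kk l j < c}"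
definition cn :: "nat \<Rightarrow> nat \<Rightarrow> nat" where "cn l c = card {j. j < n \<and> kk l j = c}"

lemma st_cn_le: "c < c' \<Longrightarrow> st l c + cn l c \<le> st l c'"
proof -
  assume "c < c'"
  have "st l c + cn l c = card ({j. j < n \<and> kk l j < c} \<union> {j. j < n \<and> kk l j = c})"
    unfolding st_def cn_def by (rule card_Un_disjoint[symmetric]) auto
  also have "\<dots> \<le> st l c'" unfolding st_def by (rule card_mono) (use \<open>c < c'\<close> in auto)
  finally show ?thesis .
qed

lemma st_cn_n: "st l c + cn l c \<le> n"
proof -
  have "st l c + cn l c \<le> st l (Suc c)" by (rule st_cn_le) simp
  also have "\<dots> \<le> card {..<n}" unfolding st_def by (rule card_mono) auto
  finally show ?thesis by simp
qed

lemma spos_key: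
  assumes "i < n" shows "spos (kk l) n i = st l (kk l i) + local_rank L f l i"
proof -
  have "{j. j < n \<and> j < i \<and> kk l j = kk l i} = {j. j < i \<and> kk l j = kk l i}" using assms by auto
  then show ?thesis unfolding spos_split st_def local_rank_def by simp
qed

lemma local_rank_cn: "i < n \<Longrightarrow> local_rank L f l i < cn l (kk l i)"
  using local_rank_less[of i n L f l] by (simp add: length_node_bits cn_def)

text \<open>The intervals of different nodes are disjoint and in order of \<open>c\<close>, and each
  position lies in the interval of its own item's key.\<close>

lemma key_range:
  assumes "j < n"
  shows "kk l (item (kk l) n j) = c \<longleftrightarrow> st l c \<le> j \<and> j < st l c + cn l c"
proof -
  let ?i = "item (kk l) n j" let ?c = "kk l ?i"
  have i: "?i < n" by (rule item_less[OF assms])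
  have r: "st l ?c \<le> j" "j < st l ?c + cn l ?c"
    using spos_key[OF i, of l] spos_item[OF assms, of "kk l"] local_rank_cn[OF i, of l] by simp_all
  show ?thesis
  proof (cases "?c" c rule: linorder_cases)
    case less
    then show ?thesis using st_cn_le[OF less, of l] r by auto
  next
    case equal
    then show ?thesis using r by auto
  next
    case greater
    then show ?thesis using st_cn_le[OF greater, of l] r by auto
  qed
qed

definition region5 :: "nat \<Rightarrow> nat set" where
  "region5 l = {a. lv w a = l \<and> ps w a = 0 \<and> (kd w a = 7 \<and> ix w a < n \<or>
     (kd w a = 8 \<or> kd w a = 9) \<and> 0 < cn l (ix w a))}"

text \<open>The boundaries of a node are written by the threads at its first and at its last
  position; this is well defined as only nonempty nodes are in the region.\<close>

definition owner5 :: "nat \<Rightarrow> nat \<Rightarrow> nat" where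
  "owner5 l a = (if kd w a = 7 then spos (kk l) n (ix w a) else if kd w a = 8 then st l (ix w a)
     else st l (ix w a) + cn l (ix w a) - 1)"

text \<open>The boundaries of an empty node are two initial zeros, from which its length 0 is still
  computed correctly.\<close>

definition level_done :: "nat \<Rightarrow> mem \<Rightarrow> bool" where
  "level_done l m \<longleftrightarrow> (\<forall>i<n. m (cell 7 l 0 i) = spos (kk l) n i) \<and> (\<forall>j<n. m (cell 1 l K j) = item (kk l) n j) \<and>
     (\<forall>c<HH w. m (cell 8 l 0 c) = (if 0 < cn l c then st l c else 0) \<and>
        m (cell 9 l 0 c) = (if 0 < cn l c then st l c + cn l c else 0))"

lemma ht_finish:
  assumes s: "glob s" "s 11 = l"
    and m0: "inp m0" "\<And>j. j < n \<Longrightarrow> m0 (cell 1 l K j) = item (kk l) n j"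
      "\<And>c. c < HH w \<Longrightarrow> m0 (cell 8 l 0 c) = 0" "\<And>c. c < HH w \<Longrightarrow> m0 (cell 9 l 0 c) = 0"
    and l: "l \<le> L" and A: "{..<n} \<subseteq> A" "own l \<subseteq> A" "own l \<subseteq> G"
  shows "ht w A G [Par 13 (Vr 0) finish_body] s m0 (\<lambda>s' m. level_done l m)
    (esz (Vr 0) + 1 + cost finish_body) (esz (Vr 0) + 1 + (\<Sum>j<n. cost finish_body))"
proof -
  have h: "l < HH w" "K < HH w" "0 < HH w" using l HHs HH_pos by auto
  note sel = adr_sel[OF h(1) h(3)] adr_sel[OF h(1) h(2)]
  let ?it = "item (kk l) n"
  let ?P = "\<lambda>j m. m (cell 7 l 0 (?it j)) = j \<and> (\<forall>c<HH w. 0 < cn l c \<longrightarrow>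
      (st l c = j \<longrightarrow> m (cell 8 l 0 c) = j) \<and> (st l c + cn l c - 1 = j \<longrightarrow> m (cell 9 l 0 c) = j + 1))"
  have mem: "cell 7 l 0 i \<in> region5 l" "owner5 l (cell 7 l 0 i) = spos (kk l) n i" if "i < n" for i
    using that HHs(1) by (auto simp: region5_def owner5_def sel)
  have mem8: "cell 8 l 0 c \<in> region5 l" "owner5 l (cell 8 l 0 c) = st l c"
    "cell 9 l 0 c \<in> region5 l" "owner5 l (cell 9 l 0 c) = st l c + cn l c - 1" if "c < HH w" "0 < cn l c" for c
    using that by (auto simp: region5_def owner5_def sel)
  show ?thesis
  proof (rule ht_Par[where R="region5 l" and own="owner5 l" and P="?P"])
    show "ev w A s m0 (Vr 0) n" by (rule ev_glob[OF s(1)])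
    show "region5 l \<subseteq> G" "region5 l \<subseteq> A" using A by (auto simp: region5_def own_def)
  next
    fix j assume j: "j < n"
    let ?A = "A - {a \<in> region5 l. owner5 l a \<noteq> j}" and ?G = "{a \<in> region5 l. owner5 l a = j}"
    define i where "i = ?it j"
    define k where "k = kk l i"
    have i: "i < n" unfolding i_def by (rule item_less[OF j])
    have "k < 2 ^ l" unfolding k_def by (rule key_less[of f i L l, OF f[OF i] l])
    also have "(2::nat) ^ l \<le> 2 ^ L" using l by (rule power_increasing) simp
    finally have bnd: "j < HH w" "i < HH w" "k < HH w" "j + 1 < 2 ^ w" "j < 2 ^ w"
      using j i HHs(1,9,14) HH_le[of w] by simp_all
    have rk: "st l k \<le> j" "j < st l k + cn l k" "0 < cn l k"
      using key_range[OF j, of l k] by (auto simp: k_def i_def)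
    have inA: "{..<n} \<subseteq> ?A" using A(1) HHs(1) kd_small[of _ w] by (force simp: region5_def)
    have c1A: "cell 1 l K y \<in> ?A" if "y < n" for y
      using that A(2) HHs(1) by (auto simp: own_def region5_def sel)
    \<comment> \<open>Orders and keys depend on kinds 0 and 1 only, which the thread does not write;
      so the expressions keep their values between its writes.\<close>
    define same where "same m \<longleftrightarrow> (\<forall>a. kd w a = 0 \<or> kd w a = 1 \<longrightarrow> m a = m0 a)" for m
    have inpm: "inp m" if "same m" for m
      using that m0(1) HHs(1) kd_small[of _ w] unfolding inp_def same_def by (metis less_trans)
    have itm: "m (cell 1 l K y) = ?it y" if "same m" "y < n" for m y
      using that m0(2) HHs(1) by (auto simp: same_def sel)
    have ld: "ev w ?A s' m (Ld (itemC (Vr 5) e)) (?it y)"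
      if "same m" "y < n" "glob s'" "s' 11 = l" "ev w ?A s' m e y" for s' m e y
      unfolding itm[OF that(1,2), symmetric]
      by (intro ev_M ev_cell ev_C ev_V ev_glob that h c1A) (use that(2) HHs(1,10) in auto)
    have ky: "ev w ?A s' m (keyE e (Vr 11)) (kk l y)"
      if "same m" "y < n" "glob s'" "s' 11 = l" "ev w ?A s' m e y" for s' m e y
      by (intro ev_key ev_V that inpm inA l)
    let ?s = "s(13 := j)" let ?s1 = "?s(14 := i)" let ?s2 = "?s1(15 := k)"
    have g1: "glob ?s" "glob ?s1" "glob ?s2" using s by (simp_all add: glob_upd)
    have l1: "?s 11 = l" "?s1 11 = l" "?s2 11 = l" using s by simp_all
    have sm0: "same m0" by (simp add: same_def)
    have e14: "ev w ?A ?s m0 (Ld (itemC (Vr 5) (Vr 13))) i"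
      unfolding i_def by (rule ld[OF sm0 j g1(1) l1(1)]) (simp add: ev_V)
    let ?m1 = "m0(cell 7 l 0 i := j)"
    have a7: "ev w ?A ?s1 m0 (adrE (Cn 7) (Vr 11) (Cn 0) (Vr 14)) (cell 7 l 0 i)"
      by (intro ev_cell ev_C ev_V l1 h bnd) (use HHs(10) in auto)
    have G7: "cell 7 l 0 i \<in> ?G" using mem[OF i] j by (simp add: i_def spos_item)
    have sm1: "same ?m1" using bnd by (auto simp: same_def sel)
    have e15: "ev w ?A ?s1 ?m1 (keyE (Vr 14) (Vr 11)) k"
      unfolding k_def by (rule ky[OF sm1 i g1(2) l1(2)]) (simp add: ev_V)
    have v13: "ev w ?A ?s2 m (Vr 13) j" "ev w ?A ?s2 m (Vr 15) k" "ev w ?A ?s2 m (Vr 0) n" for m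
      using g1(3) by (auto simp: ev_def glob_def)
    have c1: "ev w ?A ?s2 m (Ite (lessE (Cn 0) (Vr 13))
         (Bn Equal (keyE (Ld (itemC (Vr 5) (subE (Vr 13) (Cn 1)))) (Vr 11)) (Vr 15)) (Cn 0)) (of_bool (j \<noteq> st l k))"
      if sm: "same m" for m
    proof (rule ev_Ite[OF ev_Less[OF ev_C v13(1)]])
      assume "of_bool (0 < j) \<noteq> (0::nat)"
      then have j0: "0 < j" by simp
      have eq: "kk l (?it (j - 1)) = k \<longleftrightarrow> j \<noteq> st l k" using key_range[of "j - 1" l k] j j0 rk by auto
      show "ev w ?A ?s2 m (Bn Equal (keyE (Ld (itemC (Vr 5) (subE (Vr 13) (Cn 1)))) (Vr 11)) (Vr 15)) (of_bool (j \<noteq> st l k))"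
        unfolding eq[symmetric]
        by (intro ev_Equal ky[OF sm _ g1(3) l1(3)] ld[OF sm _ g1(3) l1(3)] v13 ev_Sub ev_C item_less) (use j j0 bnd in auto)
    next
      assume "of_bool (0 < j) = (0::nat)"
      then show "ev w ?A ?s2 m (Cn 0) (of_bool (j \<noteq> st l k))" using rk by (auto intro!: ev_C)
    qed simp
    have c2: "ev w ?A ?s2 m (Ite (lessE (addE (Vr 13) (Cn 1)) (Vr 0))
         (Bn Equal (keyE (Ld (itemC (Vr 5) (addE (Vr 13) (Cn 1)))) (Vr 11)) (Vr 15)) (Cn 0)) (of_bool (j \<noteq> st l k + cn l k - 1))"
      if sm: "same m" for m
    proof (rule ev_Ite[OF ev_Less[OF ev_Add[OF v13(1) ev_C bnd(4)] v13(3)]])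
      assume "of_bool (j + 1 < n) \<noteq> (0::nat)"
      then have j1: "j + 1 < n" by simp
      have eq: "kk l (?it (j + 1)) = k \<longleftrightarrow> j \<noteq> st l k + cn l k - 1" using key_range[OF j1, of l k] rk by auto
      show "ev w ?A ?s2 m (Bn Equal (keyE (Ld (itemC (Vr 5) (addE (Vr 13) (Cn 1)))) (Vr 11)) (Vr 15)) (of_bool (j \<noteq> st l k + cn l k - 1))"
        unfolding eq[symmetric]
        by (intro ev_Equal ky[OF sm _ g1(3) l1(3)] ld[OF sm _ g1(3) l1(3)] v13 ev_Add ev_C item_less) (use j1 bnd in auto)
    next
      assume "of_bool (j + 1 < n) = (0::nat)"
      then have "j = st l k + cn l k - 1" using rk st_cn_n[of l k] j by simp
      then show "ev w ?A ?s2 m (Cn 0) (of_bool (j \<noteq> st l k + cn l k - 1))" by (auto intro!: ev_C)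
    qed simp
    have a8: "ev w ?A ?s2 m (adrE (Cn q) (Vr 11) (Cn 0) (Vr 15)) (cell q l 0 k)" if "q \<le> 9" for q m
      by (intro ev_cell ev_C ev_V l1 h bnd) (use HHs(10) that in auto)
    let ?m2 = "if j = st l k then ?m1(cell 8 l 0 k := j) else ?m1"
    let ?m3 = "if j = st l k + cn l k - 1 then ?m2(cell 9 l 0 k := j + 1) else ?m2"
    have sm2: "same ?m2" using sm1 bnd by (auto simp: same_def sel)
    have c_eq: "c = k" if "0 < cn l c" "st l c = j \<or> st l c + cn l c - 1 = j" for c
      using key_range[OF j, of l c] that by (auto simp: k_def i_def)
    have ne: "cell 8 l 0 k \<noteq> cell 7 l 0 i" "cell 9 l 0 k \<noteq> cell 7 l 0 i" "cell 8 l 0 k \<noteq> cell 9 l 0 k"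
      "cell 7 l 0 i \<noteq> cell 8 l 0 k" "cell 7 l 0 i \<noteq> cell 9 l 0 k"
      using cell_inject[OF h(1,3) bnd(3) h(1,3) bnd(2)] cell_inject[OF h(1,3) bnd(2) h(1,3) bnd(3)]
        cell_inject[OF h(1,3) bnd(3) h(1,3) bnd(3)] by simp_all
    have fin: "?P j ?m3"
    proof (intro conjI allI impI)
      show "?m3 (cell 7 l 0 (?it j)) = j" using ne by (simp add: i_def[symmetric])
      fix c assume c: "c < HH w" "0 < cn l c"
      show "?m3 (cell 8 l 0 c) = j" if "st l c = j"
        using c_eq[OF c(2)] that ne by simp
      show "?m3 (cell 9 l 0 c) = j + 1" if "st l c + cn l c - 1 = j"
        using c_eq[OF c(2)] that ne by simp
    qed
    have last: "hs w ?A ?G [When (Ite (lessE (addE (Vr 13) (Cn 1)) (Vr 0))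
         (Bn Equal (keyE (Ld (itemC (Vr 5) (addE (Vr 13) (Cn 1)))) (Vr 11)) (Vr 15)) (Cn 0))
       [] [Wr (adrE (Cn 9) (Vr 11) (Cn 0) (Vr 15)) (addE (Vr 13) (Cn 1))]] ?s2 ?m2 (\<lambda>s' m'. ?P j m')"
    proof (rule hs_When[OF c2[OF sm2]], goal_cases)
      case 1
      then have "?m3 = ?m2" by auto
      then show ?case using fin by (auto intro!: hs_Nil)
    next
      case 2
      then have e: "j = st l k + cn l k - 1" by auto
      have gg: "cell 9 l 0 k \<in> ?G" using mem8[OF bnd(3) rk(3)] e by simp
      have m3: "?m3 = ?m2(cell 9 l 0 k := j + 1)" using e by (simp only: if_True simp_thms)
      show ?case unfolding append.simps
        by (rule hs_Wr[OF a8 ev_Add[OF v13(1) ev_C bnd(4)] gg], simp, simp, rule hs_Nil) (use fin[unfolded m3] in simp)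
    qed
    have "hs w ?A ?G finish_body ?s m0 (\<lambda>s' m'. ?P j m')"
      unfolding finish_body_def
    proof (rule hs_Asg[OF e14], rule hs_Wr[OF a7 ev_V G7], simp, rule hs_Asg[OF e15], rule hs_When[OF c1[OF sm1]], goal_cases)
      case 1
      then have "?m2 = ?m1" by auto
      then show ?case using last by simp
    next
      case 2
      then have e: "j = st l k" by auto
      have gg: "cell 8 l 0 k \<in> ?G" using mem8[OF bnd(3) rk(3)] e by simp
      have m2: "?m2 = ?m1(cell 8 l 0 k := j)" using e by (simp only: if_True simp_thms)
      show ?case unfolding append.simps
        by (rule hs_Wr[OF a8 v13(1) gg], simp) (use last[unfolded m2] in simp)
    qed
    then show "ht w ?A ?G finish_body ?s m0 (\<lambda>s' m'. ?P j m') (cost finish_body) (cost finish_body)" by (rule ht_hs)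
  next
    fix j m1 m2 assume j: "j < n" and eq: "\<And>a. a \<in> region5 l \<Longrightarrow> owner5 l a = j \<Longrightarrow> m2 a = m1 a" and P: "?P j m1"
    have "m2 (cell 7 l 0 (?it j)) = m1 (cell 7 l 0 (?it j))"
      using mem[OF item_less[OF j]] j by (intro eq) (simp_all add: spos_item)
    moreover have "m2 (cell 8 l 0 c) = m1 (cell 8 l 0 c)" if "c < HH w" "0 < cn l c" "st l c = j" for c
      using mem8[OF that(1,2)] that(3) by (intro eq) simp_all
    moreover have "m2 (cell 9 l 0 c) = m1 (cell 9 l 0 c)" if "c < HH w" "0 < cn l c" "st l c + cn l c - 1 = j" for c
      using mem8[OF that(1,2)] that(3) by (intro eq) simp_all
    ultimately show "?P j m2" using P by auto
  next
    fix m' assume P: "\<And>j. j < n \<Longrightarrow> ?P j m'" and fr: "\<And>a. a \<in> A \<Longrightarrow> a \<notin> region5 l \<or> n \<le> owner5 l a \<Longrightarrow> m' a = m0 a"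
    show "level_done l m'" unfolding level_done_def
    proof (intro conjI allI impI)
      show "m' (cell 7 l 0 i) = spos (kk l) n i" if "i < n" for i
        using P[OF spos_less[OF that, of "kk l"]] item_spos[OF that, of "kk l"] by simp
      show "m' (cell 1 l K j) = ?it j" if "j < n" for j
        unfolding m0(2)[OF that, symmetric] using that A(2) HHs(1) by (intro fr) (auto simp: own_def region5_def sel)
      fix c assume c: "c < HH w"
      show "m' (cell 8 l 0 c) = (if 0 < cn l c then st l c else 0)"
      proof (cases "0 < cn l c")
        case True
        then have "st l c < n" using st_cn_n[of l c] by simp
        then show ?thesis using P[of "st l c"] True c by simp
      next
        case False
        then have "m' (cell 8 l 0 c) = m0 (cell 8 l 0 c)"
          using c A(2) by (intro fr) (auto simp: own_def region5_def sel)
        then show ?thesis using False m0(3)[OF c] by simp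
      qed
      show "m' (cell 9 l 0 c) = (if 0 < cn l c then st l c + cn l c else 0)"
      proof (cases "0 < cn l c")
        case True
        then have "st l c + cn l c - 1 < n" using st_cn_n[of l c] by simp
        then show ?thesis using P[of "st l c + cn l c - 1"] True c by simp
      next
        case False
        then have "m' (cell 9 l 0 c) = m0 (cell 9 l 0 c)"
          using c A(2) by (intro fr) (auto simp: own_def region5_def sel)
        then show ?thesis using False m0(4)[OF c] by simp
      qed
    qed
  qed
qed

lemma ht_init:
  assumes s: "glob s" "s 11 = l" and l: "l \<le> L" and A: "own l \<subseteq> A" "own l \<subseteq> G"
  shows "ht w A G [Par 13 (Vr 0) init_body] s m0
     (\<lambda>s' m. s' = s \<and> (\<forall>j<n. m (cell 1 l 0 j) = j) \<and> (\<forall>a\<in>A. kd w a \<noteq> 1 \<longrightarrow> m a = m0 a))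
    (esz (Vr 0) + 1 + cost init_body) (esz (Vr 0) + 1 + (\<Sum>j<n. cost init_body))"
proof -
  have h: "l < HH w" "0 < HH w" using l HHs HH_pos by auto
  let ?R = "{a. lv w a = l \<and> kd w a = 1 \<and> ps w a = 0}"
  show ?thesis
  proof (rule ht_Par[where R="?R" and own="ix w" and P="\<lambda>j m. m (cell 1 l 0 j) = j"])
    show "ev w A s m0 (Vr 0) n" by (rule ev_glob[OF s(1)])
    show "?R \<subseteq> G" "?R \<subseteq> A" using A by (auto simp: own_def)
  next
    fix j assume j: "j < n"
    let ?A = "A - {a \<in> ?R. ix w a \<noteq> j}" and ?G = "{a \<in> ?R. ix w a = j}"
    have jH: "j < HH w" using j HHs(1) by simp
    have a: "ev w ?A (s(13 := j)) m0 (itemC (Cn 0) (Vr 13)) (cell 1 l 0 j)"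
      by (intro ev_cell ev_C ev_V h jH) (use HHs(10) s in auto)
    show "ht w ?A ?G init_body (s(13 := j)) m0 (\<lambda>s' m'. m' (cell 1 l 0 j) = j) (cost init_body) (cost init_body)"
      unfolding init_body_def by (rule ht_hs, rule hs_Wr[OF a ev_V[OF refl]]) (use h jH in \<open>auto simp: adr_sel intro!: hs_Nil\<close>)
  qed (use h HHs(1) s in \<open>auto simp: adr_sel\<close>)
qed

definition level_cost :: nat where
  "level_cost = pass_cost + cost init_body + cost finish_body + 2 * esz (Vr 0) + 2 * esz (Vr 5) + 10"

lemma ht_level:
  assumes s: "glob s" "s 11 = l" and l: "l \<le> L" and A: "{..<n} \<subseteq> A" "own l \<subseteq> A" "own l \<subseteq> G"
    and m0: "inp m0" "\<And>a. a \<in> own l \<Longrightarrow> m0 a = 0"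
  shows "ht w A G level_body s m0 (\<lambda>s' m. level_done l m)
    ((K + 1) * (level_cost * (R + g))) ((K + 1) * (level_cost * (R * nb + n + g)))"
proof -
  have h: "l < HH w" "0 < HH w" "K < HH w" using l HHs HH_pos by auto
  have oA: "cell q l p e \<in> own l" if "1 \<le> q" "p < HH w" "e < HH w" for q p e
    using that h by (auto simp: own_def adr_sel)
  \<comment> \<open>The cells of pass \<open>p\<close> and of all later passes are still 0 when pass
    \<open>p\<close> begins.\<close>
  let ?I = "\<lambda>p s m. glob s \<and> s 11 = l \<and> sorted_upto l p m \<and>
      (\<forall>q e. p \<le> q \<and> q < K \<and> e < HH w \<longrightarrow> m (cell 2 l q e) = 0 \<and> m (cell 20 l q e) = 0) \<and>
      (\<forall>a\<in>A. kd w a = 0 \<or> kd w a \<in> {7, 8, 9} \<longrightarrow> m a = m0 a)"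
  have inpI: "inp m" if "\<forall>a\<in>A. kd w a = 0 \<or> kd w a \<in> {7, 8, 9} \<longrightarrow> m a = m0 a" for m
    using that m0(1) A(1) HHs(1) kd_small[of _ w] unfolding inp_def by (metis less_trans lessThan_iff subsetD)
  have loop: "ht w A G [For 12 (Vr 5) [count_code, chunk_code, double_code, move_code]] s1 m1 (?I K)
     (esz (Vr 5) + 4 + K * (pass_cost * (R + g) + esz (Vr 5) + 4))
     (esz (Vr 5) + 4 + K * (pass_cost * (R * nb + n + g) + esz (Vr 5) + 4))"
    if s1: "s1 = s \<and> (\<forall>j<n. m1 (cell 1 l 0 j) = j) \<and> (\<forall>a\<in>A. kd w a \<noteq> 1 \<longrightarrow> m1 a = m0 a)" for s1 m1
  proof (rule ht_For[where I="?I"])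
    \<comment> \<open>Before the first pass all partial keys are equal, and the stable order is the
      identity.\<close>
    have "item (part l 0) n j = j" if "j < n" for j by (rule item_const[of _ _ 0, OF _ that]) (simp add: part_def)
    then have "sorted_upto l 0 m1" using s1 by (simp add: sorted_upto_def)
    moreover have "m1 (cell q l p e) = 0" if "q = 2 \<or> q = 20" "p < K" "e < HH w" for q p e
    proof -
      have o: "cell q l p e \<in> own l" using that h by (intro oA) auto
      moreover have "kd w (cell q l p e) \<noteq> 1" using that h by (auto simp: adr_sel)
      ultimately show ?thesis using s1 m0(2) A(2) by auto
    qed
    ultimately show "?I 0 (s1(12 := 0)) m1" using s s1 by (auto simp: glob_upd)
    show "K < 2 ^ w" by (rule H2[OF h(3)])
    show "0 < w" by (rule w)
    show "ev w A s' m' (Vr 5) K" if "?I i s' m'" for i s' m' by (rule ev_glob) (use that in simp)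
    fix p s' m' assume p: "p < K" and I: "?I p s' m'" and s12: "s' 12 = p"
    have pH: "p < HH w" using p h by simp
    have pr: "glob s'" "s' 11 = l" "sorted_upto l p m'" using I by auto
    have ip: "inp m'" by (rule inpI) (use I in blast)
    have z: "\<And>e. e < HH w \<Longrightarrow> m' (cell 2 l p e) = 0" "m' (cell 20 l p 0) = 0" using I p h by auto
    show "ht w A G [count_code, chunk_code, double_code, move_code] s' m'
        (\<lambda>s'' m''. s'' 12 = p \<and> ?I (Suc p) (s''(12 := Suc p)) m'') (pass_cost * (R + g)) (pass_cost * (R * nb + n + g))"
    proof (rule ht_post[OF ht_pass[OF pr(1,2) s12 ip pr(3) z l p A]])
      fix s'' m'' assume Q: "glob s'' \<and> s'' 11 = l \<and> s'' 12 = p \<and> sorted_upto l (Suc p) m'' \<and> (\<forall>a\<in>A. quiet p a \<longrightarrow> m'' a = m' a)"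
      have "m'' (cell q l r e) = 0" if "q = 2 \<or> q = 20" "Suc p \<le> r" "r < K" "e < HH w" for q r e
      proof -
        have "r < HH w" using that h by simp
        then have "cell q l r e \<in> A" "quiet p (cell q l r e)"
          using that h oA[of q r e] A(2) by (auto simp: quiet_def adr_sel)
        then show ?thesis using Q I that by auto
      qed
      moreover have "\<forall>a\<in>A. kd w a = 0 \<or> kd w a \<in> {7, 8, 9} \<longrightarrow> m'' a = m0 a"
        using Q I by (auto simp: quiet_def)
      ultimately show "s'' 12 = p \<and> ?I (Suc p) (s''(12 := Suc p)) m''" using Q by (auto simp: glob_upd)
    qed
  qed auto
  have fin: "ht w A G [Par 13 (Vr 0) finish_body] s' m' (\<lambda>s' m. level_done l m)
    (esz (Vr 0) + 1 + cost finish_body) (esz (Vr 0) + 1 + (\<Sum>j<n. cost finish_body))" if I: "?I K s' m'" for s' m'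
  proof (rule ht_finish[OF _ _ inpI _ _ _ l A])
    show "m' (cell 1 l K j) = item (kk l) n j" if "j < n" for j
      using I that item_cong[of n "part l K" "kk l" j] part_final[OF _ l] by (auto simp: sorted_upto_def)
    have "m' (cell q l 0 c) = 0" if "q = 8 \<or> q = 9" "c < HH w" for q c
    proof -
      have "cell q l 0 c \<in> own l" "kd w (cell q l 0 c) = q" using that h oA[of q 0 c] by (auto simp: adr_sel)
      then show ?thesis using I m0(2) A(2) that by auto
    qed
    then show "\<And>c. c < HH w \<Longrightarrow> m' (cell 8 l 0 c) = 0" "\<And>c. c < HH w \<Longrightarrow> m' (cell 9 l 0 c) = 0" by auto
  qed (use I in auto)
  have g1: "1 \<le> R + g" "1 \<le> R * nb + n + g" "n \<le> R * nb + n + g" using g by auto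
  have tot: "esz (Vr 0) + 1 + x + (esz (Vr 5) + 4 + K * (pass_cost * U + esz (Vr 5) + 4) + (esz (Vr 0) + 1 + y))
      \<le> (K + 1) * (level_cost * U)" if "x \<le> U * cost init_body" "y \<le> U * cost finish_body" "1 \<le> U" for x y U
  proof -
    have e: "level_cost * U = pass_cost * U + U * cost init_body + U * cost finish_body + (2 * esz (Vr 0) + 2 * esz (Vr 5) + 10) * U"
      by (simp add: level_cost_def algebra_simps)
    have "(2 * esz (Vr 0) + 2 * esz (Vr 5) + 10) * 1 \<le> (2 * esz (Vr 0) + 2 * esz (Vr 5) + 10) * U"
      by (rule mult_left_mono) (use that in auto)
    then have a: "pass_cost * U + esz (Vr 5) + 4 \<le> level_cost * U"
      "esz (Vr 0) + 1 + x + (esz (Vr 5) + 4 + (esz (Vr 0) + 1 + y)) \<le> level_cost * U" unfolding e using that(1,2) by simp_all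
    have gen: "u + x + (v + k + t) \<le> k' + z" if "k \<le> k'" "u + x + (v + t) \<le> z" for u x v k k' t z :: nat
      using that by simp
    have "K * (pass_cost * U + esz (Vr 5) + 4) \<le> K * (level_cost * U)" by (rule mult_left_mono[OF a(1)]) simp
    from gen[OF this a(2)] show ?thesis unfolding add_mult_distrib mult_1 .
  qed
  have "ht w A G level_body s m0 (\<lambda>s' m. level_done l m)
    (esz (Vr 0) + 1 + cost init_body + (esz (Vr 5) + 4 + K * (pass_cost * (R + g) + esz (Vr 5) + 4) + (esz (Vr 0) + 1 + cost finish_body)))
    (esz (Vr 0) + 1 + (\<Sum>j<n. cost init_body) + (esz (Vr 5) + 4 + K * (pass_cost * (R * nb + n + g) + esz (Vr 5) + 4) + (esz (Vr 0) + 1 + (\<Sum>j<n. cost finish_body))))"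
    unfolding level_body_def
    by (rule ht_Cons[OF ht_init[OF s l A(2,3)]], rule ht_Cons[OF loop fin]) auto
  then show ?thesis
  proof (rule ht_cost)
    have m1: "x \<le> U * x" "n * x \<le> U * x" if "1 \<le> U" "n \<le> U" for x U :: nat using that by simp_all
    have x1: "x \<le> (R + g) * x" for x using g1(1) by simp
    show "esz (Vr 0) + 1 + cost init_body + (esz (Vr 5) + 4 + K * (pass_cost * (R + g) + esz (Vr 5) + 4) + (esz (Vr 0) + 1 + cost finish_body))
       \<le> (K + 1) * (level_cost * (R + g))" by (rule tot[OF x1 x1 g1(1)])
    show "esz (Vr 0) + 1 + (\<Sum>j<n. cost init_body) + (esz (Vr 5) + 4 + K * (pass_cost * (R * nb + n + g) + esz (Vr 5) + 4) + (esz (Vr 0) + 1 + (\<Sum>j<n. cost finish_body)))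
       \<le> (K + 1) * (level_cost * (R * nb + n + g))"
      unfolding sum_constant card_lessThan of_nat_id by (rule tot[OF m1(2)[OF g1(2,3)] m1(2)[OF g1(2,3)] g1(2)])
  qed
qed

end

subsection \<open>Building a node\<close>

text \<open>Variables: 3 \<open>r\<close>, 11 level, 12 node; 17, 18 start and length of the node in its level; 19-22 the same
  for its children; 23-26 \<open>T1, D1, T2, D2\<close>; 27 bits of the first directory level; 28 bits in total; 29 bit address of the bitmap.
  Kind 10 contains the bits of a node and kind 11 its record, which starts at index \<open>r\<close>: this is how queries
  learn \<open>r\<close>.\<close>

abbreviation "nextE \<equiv> addE (Vr 11) (Cn 1)"

definition bitE :: "expr \<Rightarrow> expr" where
  "bitE i = modE (keyE i nextE) (Cn 2)"

definition memberE :: "expr \<Rightarrow> expr" where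
  "memberE y = Ld (adrE (Cn 1) (Vr 11) (Vr 5) (addE (Vr 17) y))"

definition child_stE :: "expr \<Rightarrow> expr" where "child_stE b = Ite b (Vr 21) (Vr 19)"
definition child_cnE :: "expr \<Rightarrow> expr" where "child_cnE b = Ite b (Vr 22) (Vr 20)"

text \<open>The rank up to and including position \<open>y - 1\<close>, of the bit at that position:
  the place of the item in the order of the next level, minus the start of its child, plus
  1.\<close>

definition inclE :: "expr \<Rightarrow> expr" where
  "inclE y = addE (subE (Ld (adrE (Cn 7) nextE (Cn 0) (memberE (subE y (Cn 1)))))
     (child_stE (bitE (memberE (subE y (Cn 1)))))) (Cn 1)"

text \<open>The lookup serves the bit value found at \<open>y - 1\<close>; the rank of the other
  value is the complement to \<open>y\<close>.\<close>

definition rankE :: "expr \<Rightarrow> expr \<Rightarrow> expr" where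
  "rankE b y = Ite y (Ite (Bn Equal (bitE (memberE (subE y (Cn 1)))) b) (inclE y) (subE y (inclE y))) (Cn 0)"

text \<open>The \<open>c\<close>-th item of the child is read from the order of the next level and
  located in the current level. Too large a \<open>c\<close> yields the length, as in
  \<open>after\<close>.\<close>

definition afterE :: "expr \<Rightarrow> expr \<Rightarrow> expr" where
  "afterE b c = Ite c (Ite (lessE (child_cnE b) c) (Vr 18)
     (addE (subE (Ld (adrE (Cn 7) (Vr 11) (Cn 0)
        (Ld (adrE (Cn 1) nextE (Vr 5) (addE (child_stE b) (subE c (Cn 1))))))) (Vr 17)) (Cn 1))) (Cn 0)"

definition coarseE :: "expr \<Rightarrow> expr \<Rightarrow> expr" where "coarseE x Tc = mulE (divE x Tc) Tc"

definition occE :: "expr \<Rightarrow> expr \<Rightarrow> expr \<Rightarrow> expr \<Rightarrow> expr" where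
  "occE T D v i = Ite (lessE i (divE (Vr 18) T)) (mulE (addE i (Cn 1)) T)
     (addE (addE (mulE (divE (rankE v (subE (mulE (addE (divE (subE i (divE (Vr 18) T)) T) (Cn 1)) D) (Cn 1))) T) T)
       (modE (subE i (divE (Vr 18) T)) T)) (Cn 1))"

definition halfE :: "expr \<Rightarrow> expr \<Rightarrow> expr" where
  "halfE T D = addE (divE (Vr 18) T) (mulE (divE (Vr 18) D) T)"

definition sideE :: "expr \<Rightarrow> expr \<Rightarrow> expr \<Rightarrow> expr" where
  "sideE T D j = Ite (lessE (subE j (divE (Vr 18) T)) (halfE T D)) (Cn 0) (Cn 1)"

definition sideoccE :: "expr \<Rightarrow> expr \<Rightarrow> expr \<Rightarrow> expr" where
  "sideoccE T D j = occE T D (sideE T D j)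
     (subE (subE j (divE (Vr 18) T)) (Ite (sideE T D j) (halfE T D) (Cn 0)))"

definition entryE :: "expr \<Rightarrow> expr \<Rightarrow> expr \<Rightarrow> expr \<Rightarrow> expr" where
  "entryE T D Tc j = Ite (lessE j (divE (Vr 18) T))
     (subE (rankE (Cn 1) (mulE (addE j (Cn 1)) T)) (rankE (Cn 1) (coarseE (mulE (addE j (Cn 1)) T) Tc)))
     (subE (afterE (sideE T D j) (sideoccE T D j))
       (afterE (sideE T D j) (coarseE (subE (sideoccE T D j) (Cn 1)) Tc)))"

definition pickE :: "expr \<Rightarrow> expr \<Rightarrow> expr" where "pickE e i = modE (Bn Shr e i) (Cn 2)"

definition node_bitE :: "expr \<Rightarrow> expr" where
  "node_bitE x = Ite (lessE x (Vr 18)) (bitE (memberE x))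
     (Ite (lessE (subE x (Vr 18)) (Vr 27))
       (pickE (entryE (Vr 23) (Vr 24) (Cn 0) (divE (subE x (Vr 18)) WL)) (modE (subE x (Vr 18)) WL))
       (pickE (entryE (Vr 25) (Vr 26) (Vr 23) (divE (subE (subE x (Vr 18)) (Vr 27)) (Vr 3)))
          (modE (subE (subE x (Vr 18)) (Vr 27)) (Vr 3))))"

lemma le_mult_pos: "0 < y \<Longrightarrow> x \<le> x * y" for x y :: nat
  by simp

text \<open>Each level contributes three terms for its samples and two for its slots. Multiplied by
  \<open>r\<close>, each of these ten terms is at most \<open>x\<close>, by the choice of the
  rates.\<close>

lemma aux_bits_bound:
  assumes "good w r"
  shows "aux_bits w r x * r \<le> 10 * x"
proof -
  note g = goodD[OF assms]
  have a: "x div D * y \<le> x" if "y \<le> D" for D y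
    by (rule order_trans[OF mult_left_mono[OF that]]) simp_all
  have 1: "x div T1 w r * (w * r) \<le> x" using g(1) by (intro a) (simp add: T1_def)
  have 2: "x div D1 w r * (T1 w r * (w * r)) \<le> x" by (rule a) (simp add: D1_def)
  have 3: "x div T2 r * (r * r) \<le> x" by (rule a) (simp add: T2_def)
  have 4: "x div D2 r * (T2 r * (r * r)) \<le> x" by (rule a) (simp add: D2_def T2_def)
  have "aux_bits w r x * r = 3 * (x div T1 w r * (w * r)) + 2 * (x div D1 w r * (T1 w r * (w * r))) +
     (3 * (x div T2 r * (r * r)) + 2 * (x div D2 r * (T2 r * (r * r))))"
    unfolding aux_bits_def ents1_def ents2_def entries_def by (simp add: algebra_simps)
  also have "\<dots> \<le> 10 * x" using 1 2 3 4 by linarith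
  finally show ?thesis .
qed

lemma aux_bits_le: "good w r \<Longrightarrow> aux_bits w r x \<le> 5 * x"
proof -
  assume good: "good w r"
  then have "aux_bits w r x * 2 \<le> aux_bits w r x * r" by (intro mult_left_mono) (auto simp: good_def)
  then show ?thesis using aux_bits_bound[OF good, of x] by linarith
qed

locale node = level +
  fixes r l c :: nat and m0 :: mem
  assumes good: "good w r" and l: "l < L" and c: "c < 2 ^ l"
    and lvl: "level_done l m0" "level_done (Suc l) m0" and inp0: "inp m0"
begin

abbreviation "B \<equiv> node_bits L f n l c"
abbreviation "mm \<equiv> length B"
definition sv :: "nat \<Rightarrow> nat \<Rightarrow> nat" where "sv k x = (if 0 < cn k x then st k x else 0)"
definition ch :: "bool \<Rightarrow> nat" where "ch v = 2 * c + of_bool v"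

lemmas gd = goodD[OF good]

lemma mm: "mm = cn l c" by (simp add: length_node_bits cn_def)

lemma mm_n: "mm \<le> n" unfolding mm using st_cn_n[of l c] by simp

lemma count_B: "count_list B v = cn (Suc l) (ch v)"
  using count_node_bits[OF l, of f n c v] by (simp add: cn_def ch_def)

definition tot :: nat where "tot = mm + aux_bits w r mm"

definition nrd :: "(nat \<Rightarrow> nat) \<Rightarrow> bool" where
  "nrd s \<longleftrightarrow> glob s \<and> s 3 = r \<and> s 11 = l \<and> s 12 = c \<and> s 17 = sv l c \<and> s 18 = mm \<and>
     s 19 = sv (Suc l) (ch False) \<and> s 20 = cn (Suc l) (ch False) \<and> s 21 = sv (Suc l) (ch True) \<and>
     s 22 = cn (Suc l) (ch True) \<and> s 23 = T1 w r \<and> s 24 = D1 w r \<and> s 25 = T2 r \<and> s 26 = D2 r \<and>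
     s 27 = ents1 w r mm * w \<and> s 28 = tot"

text \<open>Node threads write kinds 10 and 11 only, so the finished levels can be read as they
  were, whatever other nodes are doing.\<close>

definition good_mem :: "mem \<Rightarrow> bool" where
  "good_mem m \<longleftrightarrow> (\<forall>a. kd w a \<noteq> 10 \<and> kd w a \<noteq> 11 \<longrightarrow> m a = m0 a)"

definition visible :: "nat set \<Rightarrow> bool" where
  "visible A \<longleftrightarrow> (\<forall>a. kd w a \<noteq> 10 \<and> kd w a \<noteq> 11 \<longrightarrow> a \<in> A)"

lemma two_l: "(2::nat) ^ l \<le> 2 ^ L" "2 * (2::nat) ^ l \<le> 2 ^ L"
proof -
  have "(2::nat) ^ Suc l \<le> 2 ^ L" using l by (intro power_increasing) auto
  then show "2 * (2::nat) ^ l \<le> 2 ^ L" by simp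
  show "(2::nat) ^ l \<le> 2 ^ L" by (rule power_increasing) (use l in auto)
qed

lemma hs: "l < HH w" "Suc l < HH w" "K < HH w" "0 < HH w" "c < HH w" "ch v < HH w"
proof -
  have "ch v < 2 * 2 ^ l" using c by (cases v) (auto simp: ch_def)
  then show "l < HH w" "Suc l < HH w" "K < HH w" "0 < HH w" "c < HH w" "ch v < HH w"
    using l HHs(5,6,9) c two_l by linarith+
qed

lemma nrd_ev:
  assumes "nrd s"
  shows "ev w A s m (Vr 3) r" "ev w A s m (Vr 5) K" "ev w A s m (Vr 11) l" "ev w A s m (Vr 12) c" "ev w A s m (Vr 17) (sv l c)"
    "ev w A s m (Vr 18) mm" "ev w A s m (Vr 23) (T1 w r)" "ev w A s m (Vr 24) (D1 w r)" "ev w A s m (Vr 25) (T2 r)"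
    "ev w A s m (Vr 26) (D2 r)" "ev w A s m (Vr 27) (ents1 w r mm * w)" "ev w A s m (Vr 28) tot" "glob s"
    "ev w A s m nextE (Suc l)"
proof -
  have "l + 1 < 2 ^ w" using H2[OF hs(2)] by simp
  then have "ev w A s m nextE (l + 1)" using assms by (intro ev_Add ev_C ev_V) (auto simp: nrd_def)
  then show "ev w A s m nextE (Suc l)" by simp
qed (use assms in \<open>auto simp: nrd_def glob_def ev_def\<close>)

lemma ev_child:
  assumes "nrd s" "ev w A s m b (of_bool v)"
  shows "ev w A s m (child_stE b) (sv (Suc l) (ch v))" "ev w A s m (child_cnE b) (cn (Suc l) (ch v))"
  unfolding child_stE_def child_cnE_def
  using assms by (cases v; auto intro!: ev_Ite[OF assms(2)] simp: nrd_def ev_V)+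

lemma ev_read:
  assumes "ev w A s m iE i" "i < HH w" "nrd s" "good_mem m" "visible A" "k = 1 \<or> k = 7" "l' = l \<or> l' = Suc l"
    "ev w A s m lE l'"
  shows "k = 1 \<Longrightarrow> ev w A s m (Ld (adrE (Cn 1) lE (Vr 5) iE)) (m0 (cell 1 l' K i))"
    "k = 7 \<Longrightarrow> ev w A s m (Ld (adrE (Cn 7) lE (Cn 0) iE)) (m0 (cell 7 l' 0 i))"
proof -
  have l': "l' < HH w" using assms(7) hs by auto
  have kk: "kd w (cell 1 l' K i) = 1" "kd w (cell 7 l' 0 i) = 7" using l' assms(2) hs by (auto intro: adr_sel)
  then have e: "m0 (cell 1 l' K i) = m (cell 1 l' K i)" "m0 (cell 7 l' 0 i) = m (cell 7 l' 0 i)"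
    using assms(4) by (auto simp: good_mem_def)
  show "ev w A s m (Ld (adrE (Cn 1) lE (Vr 5) iE)) (m0 (cell 1 l' K i))"
    "ev w A s m (Ld (adrE (Cn 7) lE (Cn 0) iE)) (m0 (cell 7 l' 0 i))"
    unfolding e by (intro ev_M ev_cell ev_C nrd_ev(2)[OF assms(3)] assms l' hs; use HHs(10) kk assms(5) in \<open>auto simp: visible_def\<close>)+
qed

lemma member:
  assumes "y < mm"
  defines "i \<equiv> item (kk l) n (st l c + y)"
  shows "i < n" "kk l i = c" "local_rank L f l i = y" "sv l c = st l c" "st l c + y < n"
proof -
  have lt: "st l c + y < n" using st_cn_n[of l c] assms(1) mm by simp
  show i: "i < n" "st l c + y < n" using lt by (simp_all add: i_def item_less)
  show k: "kk l i = c" using key_range[OF lt, of l c] assms(1) mm by (simp add: i_def)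
  show "local_rank L f l i = y" using spos_key[OF i(1), of l] spos_item[OF lt, of "kk l"] k by (simp add: i_def)
  show "sv l c = st l c" using assms(1) mm by (simp add: sv_def)
qed

lemma ev_member:
  assumes "ev w A s m yE y" "y < mm" "nrd s" "good_mem m" "visible A"
  shows "ev w A s m (memberE yE) (item (kk l) n (st l c + y))"
proof -
  note mb = member[OF assms(2)]
  have "ev w A s m (addE (Vr 17) yE) (sv l c + y)"
    by (intro ev_Add nrd_ev assms) (use mb(4,5) HHs(1) HH_le[of w] in linarith)
  then have "ev w A s m (memberE yE) (m0 (cell 1 l K (sv l c + y)))" unfolding memberE_def
    by (rule ev_read(1)[where l'=l and k=1]) (use mb assms HHs(1) in \<open>auto intro: nrd_ev\<close>)
  then show ?thesis using lvl(1) mb by (simp add: level_done_def)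
qed

lemma in_visible: "visible A \<Longrightarrow> {..<n} \<subseteq> A"
  using HHs(1) kd_small[of _ w] unfolding visible_def by (metis lessThan_iff less_trans subsetI zero_neq_numeral)

lemma good_inp: "good_mem m \<Longrightarrow> inp m"
  using inp0 HHs(1) kd_small[of _ w] unfolding good_mem_def inp_def by (metis less_trans zero_neq_numeral)

lemma ev_bit:
  assumes "ev w A s m iE i" "i < n" "nrd s" "good_mem m" "visible A"
  shows "ev w A s m (bitE iE) (of_bool (odd (kk (Suc l) i)))"
proof -
  have "ev w A s m (bitE iE) (kk (Suc l) i mod 2)" unfolding bitE_def
    by (intro ev_Mod ev_key assms nrd_ev good_inp in_visible ev_C) (use l in auto)
  then show ?thesis by (simp add: mod_2_eq_odd)
qed

lemma ev_rank:
  assumes y: "ev w A s m yE y" "y \<le> mm" and b: "ev w A s m bE (of_bool b)" and s: "nrd s" "good_mem m" "visible A"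
  shows "ev w A s m (rankE bE yE) (rank b B y)"
  unfolding rankE_def
proof (rule ev_Ite[OF y(1)])
  assume "y = 0"
  then show "ev w A s m (Cn 0) (rank b B y)" by (simp add: ev_C)
next
  assume y0: "y \<noteq> 0"
  have yw: "y < 2 ^ w" using y(2) mm_n H2[OF HHs(1)] by linarith
  have y1: "ev w A s m (subE yE (Cn 1)) (y - 1)" by (intro ev_Sub y ev_C yw) (use y0 in auto)
  have lt: "y - 1 < mm" using y(2) y0 by simp
  note mb = member[OF lt]
  let ?i = "item (kk l) n (st l c + (y - 1))"
  define v where "v = odd (kk (Suc l) ?i)"
  have mi: "ev w A s m (memberE (subE yE (Cn 1))) ?i" by (rule ev_member[OF y1 lt s])
  have bi: "ev w A s m (bitE (memberE (subE yE (Cn 1)))) (of_bool v)" unfolding v_def by (rule ev_bit[OF mi mb(1) s])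
  have kc: "kk (Suc l) ?i = ch v" using key_Suc[OF l, of f ?i] mb(2) by (simp add: v_def ch_def)
  have cp: "0 < cn (Suc l) (ch v)" using local_rank_cn[OF mb(1), of "Suc l"] kc by simp
  have sp: "spos (kk (Suc l)) n ?i = sv (Suc l) (ch v) + local_rank L f (Suc l) ?i"
    using spos_key[OF mb(1), of "Suc l"] kc cp by (simp add: sv_def)
  have rk: "Suc (local_rank L f (Suc l) ?i) = rank v B y"
  proof -
    have "rank v (node_bits L f n l (kk l ?i)) (Suc (local_rank L f l ?i)) = Suc (local_rank L f (Suc l) ?i)"
      unfolding v_def by (rule rank_local_rank[OF mb(1) l])
    then show ?thesis unfolding mb(2,3) using y0 by simp
  qed
  have "ev w A s m (Ld (adrE (Cn 7) nextE (Cn 0) (memberE (subE yE (Cn 1))))) (m0 (cell 7 (Suc l) 0 ?i))"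
    by (rule ev_read(2)[where l'="Suc l" and k=7, OF mi _ s _ _ nrd_ev(14)[OF s(1)]]) (use mb(1) HHs(1) in auto)
  then have ps: "ev w A s m (Ld (adrE (Cn 7) nextE (Cn 0) (memberE (subE yE (Cn 1)))))
      (sv (Suc l) (ch v) + local_rank L f (Suc l) ?i)"
    using lvl(2) mb(1) sp by (simp add: level_done_def)
  have sn: "sv (Suc l) (ch v) + local_rank L f (Suc l) ?i < n" using sp spos_less[OF mb(1), of "kk (Suc l)"] by simp
  have inc: "ev w A s m (inclE yE) (rank v B y)"
    unfolding inclE_def rk[symmetric]
    by (rule ev_eq[OF ev_Add[OF ev_Sub[OF ps ev_child(1)[OF s(1) bi]] ev_C]])
      (use sn H2[OF HHs(1)] rk yw rank_le[of v B y] in auto)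
  show "ev w A s m (Ite (Bn Equal (bitE (memberE (subE yE (Cn 1)))) bE) (inclE yE) (subE yE (inclE yE))) (rank b B y)"
  proof (rule ev_Ite[OF ev_Equal[OF bi b]])
    assume "of_bool (of_bool v = (of_bool b :: nat)) \<noteq> (0::nat)"
    then show "ev w A s m (inclE yE) (rank b B y)" using inc by (cases v; cases b) auto
  next
    assume "of_bool (of_bool v = (of_bool b :: nat)) = (0::nat)"
    then have "b = (\<not> v)" by (cases v; cases b) auto
    then have "rank b B y = y - rank v B y"
      using rank_False[OF y(2)] rank_le[of True B y] by (cases v) auto
    then show "ev w A s m (subE yE (inclE yE)) (rank b B y)" using ev_Sub[OF y(1) inc rank_le yw] by simp
  qed
qed

lemma ev_after:
  assumes k: "ev w A s m kE k" "k < 2 ^ w" and b: "ev w A s m bE (of_bool v)" and s: "nrd s" "good_mem m" "visible A"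
  shows "ev w A s m (afterE bE kE) (after v B k)"
  unfolding afterE_def
proof (rule ev_Ite[OF k(1)])
  assume "k = 0"
  then show "ev w A s m (Cn 0) (after v B k)" by (simp add: ev_C)
next
  assume k0: "k \<noteq> 0"
  show "ev w A s m (Ite (lessE (child_cnE bE) kE) (Vr 18) (addE (subE (Ld (adrE (Cn 7) (Vr 11) (Cn 0)
        (Ld (adrE (Cn 1) nextE (Vr 5) (addE (child_stE bE) (subE kE (Cn 1))))))) (Vr 17)) (Cn 1))) (after v B k)"
  proof (rule ev_Ite[OF ev_Less[OF ev_child(2)[OF s(1) b] k(1)]])
    assume "of_bool (cn (Suc l) (ch v) < k) \<noteq> (0::nat)"
    then have "after v B k = mm" by (simp add: after_def count_B)
    then show "ev w A s m (Vr 18) (after v B k)" using nrd_ev(6)[OF s(1)] by simp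
  next
    assume "of_bool (cn (Suc l) (ch v) < k) = (0::nat)"
    then have le: "k \<le> cn (Suc l) (ch v)" by simp
    define y where "y = st (Suc l) (ch v) + (k - 1)"
    let ?i = "item (kk (Suc l)) n y"
    have yn: "y < n" using st_cn_n[of "Suc l" "ch v"] le k0 by (simp add: y_def)
    have i: "?i < n" by (rule item_less[OF yn])
    have "st (Suc l) (ch v) \<le> y" "y < st (Suc l) (ch v) + cn (Suc l) (ch v)" using le k0 unfolding y_def by linarith+
    then have ki: "kk (Suc l) ?i = ch v" using key_range[OF yn, of "Suc l" "ch v"] by simp
    have kl: "kk l ?i = c" using key_child[OF l, of f ?i c v] ki by (simp add: ch_def)
    have lr: "local_rank L f (Suc l) ?i = k - 1"
      using spos_key[OF i, of "Suc l"] spos_item[OF yn, of "kk (Suc l)"] ki by (simp add: y_def)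
    have af: "after v B k = Suc (local_rank L f l ?i)"
      using after_local_rank[OF i l, of f c v] ki lr k0 by (simp add: ch_def)
    have sv1: "sv (Suc l) (ch v) = st (Suc l) (ch v)" using le k0 by (simp add: sv_def)
    have cp: "0 < cn l c" using local_rank_cn[OF i, of l] kl by simp
    have sp: "spos (kk l) n ?i = sv l c + local_rank L f l ?i" using spos_key[OF i, of l] kl cp by (simp add: sv_def)
    have "ev w A s m (addE (child_stE bE) (subE kE (Cn 1))) (sv (Suc l) (ch v) + (k - 1))"
      by (intro ev_Add ev_Sub ev_child[OF s(1) b] k ev_C) (use k0 yn sv1 y_def H2[OF HHs(1)] in auto)
    then have y: "ev w A s m (addE (child_stE bE) (subE kE (Cn 1))) y" by (simp add: sv1 y_def)
    have "ev w A s m (Ld (adrE (Cn 1) nextE (Vr 5) (addE (child_stE bE) (subE kE (Cn 1))))) (m0 (cell 1 (Suc l) K y))"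
      by (rule ev_read(1)[where l'="Suc l" and k=1, OF y _ s _ _ nrd_ev(14)[OF s(1)]]) (use yn HHs(1) in auto)
    then have it: "ev w A s m (Ld (adrE (Cn 1) nextE (Vr 5) (addE (child_stE bE) (subE kE (Cn 1))))) ?i"
      using lvl(2) yn by (simp add: level_done_def)
    have "ev w A s m (Ld (adrE (Cn 7) (Vr 11) (Cn 0) (Ld (adrE (Cn 1) nextE (Vr 5) (addE (child_stE bE) (subE kE (Cn 1)))))))
        (m0 (cell 7 l 0 ?i))"
      by (rule ev_read(2)[where l'=l and k=7, OF it _ s _ _ nrd_ev(3)[OF s(1)]]) (use i HHs(1) in auto)
    then have ps: "ev w A s m (Ld (adrE (Cn 7) (Vr 11) (Cn 0) (Ld (adrE (Cn 1) nextE (Vr 5) (addE (child_stE bE) (subE kE (Cn 1)))))))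
        (sv l c + local_rank L f l ?i)" using lvl(1) i sp by (simp add: level_done_def)
    have sn: "sv l c + local_rank L f l ?i < n" using sp spos_less[OF i, of "kk l"] by simp
    show "ev w A s m (addE (subE (Ld (adrE (Cn 7) (Vr 11) (Cn 0)
        (Ld (adrE (Cn 1) nextE (Vr 5) (addE (child_stE bE) (subE kE (Cn 1))))))) (Vr 17)) (Cn 1)) (after v B k)"
      unfolding af by (rule ev_eq[OF ev_Add[OF ev_Sub[OF ps nrd_ev(5)[OF s(1)]] ev_C]])
        (use sn H2[OF HHs(14)] H2[OF HHs(1)] in auto)
  qed
qed

lemma ev_coarse: "ev w A s m e x \<Longrightarrow> ev w A s m e' t \<Longrightarrow> x < 2 ^ w \<Longrightarrow> ev w A s m (coarseE e e') (x div t * t)"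
  unfolding coarseE_def by (intro ev_Mul ev_Div) (auto intro: le_less_trans[OF div_times_less_eq_dividend])

lemma ev_pick: "ev w A s m e x \<Longrightarrow> ev w A s m e' i \<Longrightarrow> ev w A s m (pickE e e') (of_bool (bit x i))"
  unfolding pickE_def by (rule ev_eq[OF ev_Mod[OF ev_Shr ev_C]]) (auto simp: bit_iff_odd mod_2_eq_odd)

text \<open>The number computed for a slot may exceed the number of occurrences; the bound
  \<open>mm + T\<close> only excludes overflow, and \<open>afterE\<close> copes with the
  rest.\<close>

lemma ev_occ:
  assumes e: "ev w A s m TE T" "ev w A s m DE D" "ev w A s m iE i" "ev w A s m vE (of_bool v)"
    and i: "i < mm div T + mm div D * T" and T: "0 < T" "0 < D" "mm + T < 2 ^ w" "entries mm T D < 2 ^ w"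
    and s: "nrd s" "good_mem m" "visible A"
  shows "ev w A s m (occE TE DE vE iE) (occ B T D v i)" "occ B T D v i \<le> mm + T" "0 < occ B T D v i"
proof -
  define q where "q = mm div T"
  define k where "k = i - q"
  have q: "ev w A s m (divE (Vr 18) TE) q" unfolding q_def by (intro ev_Div nrd_ev s e)
  have iw: "i + 1 < 2 ^ w" using i entries_bound(3)[of mm T D] T(4) by linarith
  have A: "Suc i * T \<le> mm" if "i < q"
  proof -
    have "Suc i * T \<le> q * T" using that by (intro mult_right_mono) auto
    then show ?thesis unfolding q_def using div_times_less_eq_dividend[of mm T] by linarith
  qed
  define y where "y = Suc (k div T) * D - 1"
  have Bq: "Suc (k div T) * D \<le> mm" "y \<le> mm" if "\<not> i < q"
  proof -
    have "k < mm div D * T" using i that unfolding k_def q_def by linarith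
    then have "k div T < mm div D" using T(1) by (simp add: div_less_iff_less_mult)
    then have "Suc (k div T) * D \<le> mm div D * D" by (intro mult_right_mono) auto
    then show "Suc (k div T) * D \<le> mm" using div_times_less_eq_dividend[of mm D] by linarith
    then show "y \<le> mm" unfolding y_def by linarith
  qed
  have o: "occ B T D v i = (if i < q then (i + 1) * T else rank v B y div T * T + k mod T + 1)"
    unfolding occ_def q_def k_def y_def by simp
  have rT: "rank v B y div T * T \<le> rank v B y" "k mod T < T" using T(1) by auto
  have rm: "rank v B y \<le> mm" if "\<not> i < q" using rank_le[of v B y] Bq[OF that] by linarith
  have mw: "mm < 2 ^ w" using T by linarith
  have kE: "ev w A s m (subE iE (divE (Vr 18) TE)) k" if "\<not> i < q"
    unfolding k_def by (intro ev_Sub q e) (use that iw in auto)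
  have yE: "ev w A s m (subE (mulE (addE (divE (subE iE (divE (Vr 18) TE)) TE) (Cn 1)) DE) (Cn 1)) y" if nq: "\<not> i < q"
  proof -
    have D1: "Suc (k div T) \<le> Suc (k div T) * D" by (rule le_mult_pos[OF T(2)])
    have "ev w A s m (mulE (addE (divE (subE iE (divE (Vr 18) TE)) TE) (Cn 1)) DE) ((k div T + 1) * D)"
      by (intro ev_Mul ev_Add ev_Div kE nq e ev_C) (use Bq[OF nq] mw D1 in auto)
    from ev_Sub[OF this ev_C] show ?thesis using Bq[OF nq] mw T(2) by (simp add: y_def)
  qed
  show "ev w A s m (occE TE DE vE iE) (occ B T D v i)" unfolding o occE_def
  proof (intro ev_If ev_Less e(3) q)
    assume "i < q"
    then show "ev w A s m (mulE (addE iE (Cn 1)) TE) ((i + 1) * T)"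
      by (intro ev_Mul ev_Add ev_C e iw) (use A mw in auto)
  next
    assume nq: "\<not> i < q"
    show "ev w A s m (addE (addE (mulE (divE (rankE vE (subE (mulE (addE (divE (subE iE (divE (Vr 18) TE)) TE) (Cn 1)) DE) (Cn 1))) TE) TE)
       (modE (subE iE (divE (Vr 18) TE)) TE)) (Cn 1)) (rank v B y div T * T + k mod T + 1)"
      by (intro ev_Add ev_Mul ev_Div ev_rank yE nq Bq e s ev_Mod kE ev_C) (use rT rm[OF nq] T(3) in linarith)+
  qed
  show "occ B T D v i \<le> mm + T" unfolding o using A rT rm by (cases "i < q"; simp; linarith)
  show "0 < occ B T D v i" unfolding o using T(1) by simp
qed

lemma ev_entry:
  assumes e: "ev w A s m TE T" "ev w A s m DE D" "ev w A s m CE Tc" "ev w A s m jE j"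
    and j: "j < entries mm T D" and T: "0 < T" "0 < D" "mm + T < 2 ^ w" "entries mm T D < 2 ^ w"
    and s: "nrd s" "good_mem m" "visible A"
  shows "ev w A s m (entryE TE DE CE jE) (entry B T D Tc j)"
proof -
  define q where "q = mm div T"
  define hf where "hf = q + mm div D * T"
  define v where "v = (hf \<le> j - q)"
  define i where "i = (j - q) - (if v then hf else 0)"
  define c' where "c' = occ B T D v i"
  have q: "ev w A s m (divE (Vr 18) TE) q" unfolding q_def by (intro ev_Div nrd_ev s e)
  have hw: "hf < 2 ^ w" "mm div D * T < 2 ^ w"
    using T(4) entries_bound(2,3)[of mm T D] unfolding hf_def q_def by linarith+
  have hf: "ev w A s m (halfE TE DE) hf" unfolding halfE_def hf_def
    by (intro ev_Add ev_Mul ev_Div q e nrd_ev s hw hw(1)[unfolded hf_def])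
  have mw: "mm < 2 ^ w" "j < 2 ^ w" using T j by linarith+
  have en: "entry B T D Tc j = (if j < q then rank True B ((j + 1) * T) - rank True B ((j + 1) * T div Tc * Tc)
      else after v B c' - after v B ((c' - 1) div Tc * Tc))"
    unfolding entry_def Let_def q_def[symmetric] hf_def[symmetric] c'_def i_def v_def by simp
  show ?thesis unfolding en entryE_def
  proof (intro ev_If ev_Less e(4) q)
    assume jq: "j < q"
    have "(j + 1) * T \<le> q * T" using jq by (intro mult_right_mono) auto
    then have le: "(j + 1) * T \<le> mm" unfolding q_def using div_times_less_eq_dividend order_trans by blast
    have j1: "j + 1 \<le> (j + 1) * T" by (rule le_mult_pos[OF T(1)])
    have m: "ev w A s m (mulE (addE jE (Cn 1)) TE) ((j + 1) * T)"
      by (intro ev_Mul ev_Add e ev_C) (use le mw(1) j1 in linarith)+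
    have one: "ev w A s m (Cn 1) (of_bool True)" by (simp add: ev_C)
    have cm: "(j + 1) * T div Tc * Tc \<le> (j + 1) * T" by (rule div_times_less_eq_dividend)
    show "ev w A s m (subE (rankE (Cn 1) (mulE (addE jE (Cn 1)) TE)) (rankE (Cn 1) (coarseE (mulE (addE jE (Cn 1)) TE) CE)))
        (rank True B ((j + 1) * T) - rank True B ((j + 1) * T div Tc * Tc))"
      by (intro ev_Sub ev_rank m le one s ev_coarse e rank_mono cm order_trans[OF cm le])
        (use le mw(1) rank_le[of True B "(j + 1) * T"] in linarith)+
  next
    assume nq: "\<not> j < q"
    have jq: "ev w A s m (subE jE (divE (Vr 18) TE)) (j - q)" by (rule ev_Sub[OF e(4) q _ mw(2)]) (use nq in simp)
    have side: "ev w A s m (sideE TE DE jE) (of_bool v)"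
      unfolding sideE_def by (rule ev_Ite[OF ev_Less[OF jq hf]]) (auto simp: v_def ev_C)
    have iE: "ev w A s m (subE (subE jE (divE (Vr 18) TE)) (Ite (sideE TE DE jE) (halfE TE DE) (Cn 0))) i"
      unfolding i_def
    proof (rule ev_Sub[OF jq])
      show "ev w A s m (Ite (sideE TE DE jE) (halfE TE DE) (Cn 0)) (if v then hf else 0)"
        by (intro ev_If side hf ev_C) auto
    qed (use mw in \<open>auto simp: v_def\<close>)
    have ih: "i < mm div T + mm div D * T"
      using j nq unfolding entries_def q_def[symmetric] hf_def[symmetric] i_def v_def by auto
    note oc = ev_occ[OF e(1,2) iE side ih T s, folded c'_def]
    have cE: "ev w A s m (sideoccE TE DE jE) c'" unfolding sideoccE_def by (rule oc(1))
    have cw: "c' < 2 ^ w" using oc(2) T(3) by linarith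
    have c1: "ev w A s m (subE (sideoccE TE DE jE) (Cn 1)) (c' - 1)" by (intro ev_Sub cE ev_C cw) (use oc(3) in auto)
    have cm: "(c' - 1) div Tc * Tc \<le> c' - 1" by (rule div_times_less_eq_dividend)
    show "ev w A s m (subE (afterE (sideE TE DE jE) (sideoccE TE DE jE))
       (afterE (sideE TE DE jE) (coarseE (subE (sideoccE TE DE jE) (Cn 1)) CE)))
       (after v B c' - after v B ((c' - 1) div Tc * Tc))"
      by (intro ev_Sub ev_after cE cw side s ev_coarse c1 e after_mono)
        (use cm cw le_less_trans[OF after_le_length[of v B c'] mw(1)] in linarith)+
  qed
qed

lemma t_bd: "mm + T1 w r < 2 ^ w" "mm + T2 r < 2 ^ w" "entries mm (T1 w r) (D1 w r) < 2 ^ w" "entries mm (T2 r) (D2 r) < 2 ^ w"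
    "T1 w r < 2 ^ w" "D1 w r < 2 ^ w" "T2 r < 2 ^ w" "D2 r < 2 ^ w" "tot < HH w" "ents1 w r mm * w \<le> tot" "ents2 r mm * r \<le> tot"
    "tot \<le> 6 * n" "r * r < 2 ^ w" "w * r < 2 ^ w" "w * (r * r) < 2 ^ w" "r < HH w"
proof -
  show "tot \<le> 6 * n" unfolding tot_def using aux_bits_le[OF good, of mm] mm_n by linarith
  moreover have "8 * n < HH w" using room by simp
  ultimately show t: "tot < HH w" by linarith
  have "r * 1 \<le> r * r" using gd(1) by (intro mult_left_mono) auto
  then have rw: "r < w" using gd(12,17,18) unfolding T2_def by linarith
  have "(2::nat) ^ Suc r \<le> 2 ^ w" using rw by (intro power_increasing) auto
  then have r2: "2 * 2 ^ r \<le> (2::nat) ^ w" by simp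
  show rh: "r < HH w" using good by (simp add: good_def)
  have "HH w * HH w = 2 ^ (w div 16 + w div 16)" by (simp add: HH_def power_add)
  also have "\<dots> \<le> 2 ^ w" by (rule power_increasing) auto
  finally have hh: "HH w * HH w \<le> 2 ^ w" .
  \<comment> \<open>Twice either summand is still below or at \<open>2 ^ w\<close>, whichever of
    them is larger.\<close>
  have "mm + T < 2 ^ w" if "T \<le> 2 ^ r" for T
  proof (cases "mm < 2 ^ r")
    case True
    then show ?thesis using that r2 by linarith
  next
    case False
    have "8 * n < HH w" "HH w \<le> HH w * HH w" using room HH_pos[of w] by simp_all
    then have "2 * mm < 2 ^ w" using mm_n hh by linarith
    then show ?thesis using False that by linarith
  qed
  moreover have "T2 r \<le> T1 w r" using gd(3,9) by simp
  ultimately show "mm + T1 w r < 2 ^ w" "mm + T2 r < 2 ^ w" using gd(10,11) by simp_all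
  have p: "0 < (2::nat) ^ r" by simp
  show "T1 w r < 2 ^ w" "D1 w r < 2 ^ w" using gd(10,11) r2 p by linarith+
  show "D2 r < 2 ^ w" "T2 r < 2 ^ w" using gd(12,17,18) by linarith+
  then show "r * r < 2 ^ w" by (simp add: T2_def)
  show "w * (r * r) < 2 ^ w" using \<open>T1 w r < 2 ^ w\<close> by (simp add: T1_def)
  show "w * r < 2 ^ w" using \<open>D1 w r < 2 ^ w\<close> gd(15) by linarith
  show e: "ents1 w r mm * w \<le> tot" "ents2 r mm * r \<le> tot" unfolding tot_def aux_bits_def by simp_all
  have "ents1 w r mm \<le> ents1 w r mm * w" "ents2 r mm \<le> ents2 r mm * r" using gd(1,3) by simp_all
  then show "entries mm (T1 w r) (D1 w r) < 2 ^ w" "entries mm (T2 r) (D2 r) < 2 ^ w"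
    using e t HH_le[of w] unfolding ents1_def ents2_def by linarith+
qed

lemma ev_node_bit:
  assumes x: "ev w A s m xE x" "x < tot" and s: "nrd s" "good_mem m" "visible A"
  shows "ev w A s m (node_bitE xE) (of_bool (node_bit w r B x))"
proof -
  have xw: "x < 2 ^ w" using x(2) t_bd(9) HH_le[of w] by linarith
  define y where "y = x - mm"
  define e1 where "e1 = ents1 w r mm * w"
  have e1: "ev w A s m (Vr 27) e1" unfolding e1_def by (rule nrd_ev[OF s(1)])
  show ?thesis unfolding node_bitE_def
  proof (rule ev_Ite[OF ev_Less[OF x(1) nrd_ev(6)[OF s(1)]]])
    assume "of_bool (x < mm) \<noteq> (0::nat)"
    then have xm: "x < mm" by simp
    note mb = member[OF xm]
    have "B ! x = odd (kk (Suc l) (item (kk l) n (st l c + x)))"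
      using node_bits_nth[OF mb(1), of L f l] mb(2,3) by simp
    then show "ev w A s m (bitE (memberE xE)) (of_bool (node_bit w r B x))"
      using ev_bit[OF ev_member[OF x(1) xm s] mb(1) s] xm by (simp add: node_bit_def)
  next
    assume "of_bool (x < mm) = (0::nat)"
    then have xm: "mm \<le> x" by simp
    have y: "ev w A s m (subE xE (Vr 18)) y" unfolding y_def by (intro ev_Sub x nrd_ev s xm xw)
    have yt: "y < e1 + ents2 r mm * r" using x(2) xm unfolding y_def e1_def tot_def aux_bits_def by linarith
    have nb: "node_bit w r B x = (if y < e1 then bit (entry B (T1 w r) (D1 w r) 0 (y div w)) (y mod w)
        else bit (entry B (T2 r) (D2 r) (T1 w r) ((y - e1) div r)) ((y - e1) mod r))"
      using xm unfolding node_bit_def y_def e1_def by (simp add: Let_def)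
    show "ev w A s m (Ite (lessE (subE xE (Vr 18)) (Vr 27))
       (pickE (entryE (Vr 23) (Vr 24) (Cn 0) (divE (subE xE (Vr 18)) WL)) (modE (subE xE (Vr 18)) WL))
       (pickE (entryE (Vr 25) (Vr 26) (Vr 23) (divE (subE (subE xE (Vr 18)) (Vr 27)) (Vr 3)))
          (modE (subE (subE xE (Vr 18)) (Vr 27)) (Vr 3)))) (of_bool (node_bit w r B x))"
    proof (rule ev_Ite[OF ev_Less[OF y e1]])
      assume "of_bool (y < e1) \<noteq> (0::nat)"
      then have ye: "y < e1" by simp
      then have "y div w < entries mm (T1 w r) (D1 w r)"
        using gd(3) by (simp add: e1_def ents1_def div_less_iff_less_mult)
      then have "ev w A s m (pickE (entryE (Vr 23) (Vr 24) (Cn 0) (divE (subE xE (Vr 18)) WL)) (modE (subE xE (Vr 18)) WL))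
          (of_bool (bit (entry B (T1 w r) (D1 w r) 0 (y div w)) (y mod w)))"
        by (intro ev_pick ev_entry ev_Div ev_Mod y ev_WL nrd_ev s ev_C gd t_bd) auto
      then show "ev w A s m (pickE (entryE (Vr 23) (Vr 24) (Cn 0) (divE (subE xE (Vr 18)) WL)) (modE (subE xE (Vr 18)) WL))
          (of_bool (node_bit w r B x))" using ye nb by simp
    next
      assume "of_bool (y < e1) = (0::nat)"
      then have ye: "e1 \<le> y" by simp
      have yw: "y < 2 ^ w" using xw by (simp add: y_def)
      have z: "ev w A s m (subE (subE xE (Vr 18)) (Vr 27)) (y - e1)" by (intro ev_Sub y e1 ye yw)
      have "(y - e1) div r < entries mm (T2 r) (D2 r)"
        using gd(1) ye yt by (simp add: ents2_def div_less_iff_less_mult)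
      then have "ev w A s m (pickE (entryE (Vr 25) (Vr 26) (Vr 23) (divE (subE (subE xE (Vr 18)) (Vr 27)) (Vr 3)))
          (modE (subE (subE xE (Vr 18)) (Vr 27)) (Vr 3))) (of_bool (bit (entry B (T2 r) (D2 r) (T1 w r) ((y - e1) div r)) ((y - e1) mod r)))"
        by (intro ev_pick ev_entry ev_Div ev_Mod z nrd_ev s gd t_bd)
      then show "ev w A s m (pickE (entryE (Vr 25) (Vr 26) (Vr 23) (divE (subE (subE xE (Vr 18)) (Vr 27)) (Vr 3)))
          (modE (subE (subE xE (Vr 18)) (Vr 27)) (Vr 3))) (of_bool (node_bit w r B x))" using ye nb by simp
    qed
  qed
qed

end

section \<open>Packing the bits of a node and writing its record\<close>

definition lenE :: expr where
  "lenE = Ite (lessE (subE (Vr 28) (mulE (Vr 13) WL)) WL) (subE (Vr 28) (mulE (Vr 13) WL)) WL"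

definition gather_body :: "stmt list" where
  "gather_body = [Asg 31 (addE (Vr 31) (Bn Shl (node_bitE (addE (mulE (Vr 13) WL) (Vr 14))) (Vr 14)))]"

definition pack_body :: "stmt list" where
  "pack_body = [Asg 31 (Cn 0), For 14 lenE gather_body, Wr (adrE (Cn 10) (Vr 11) (Vr 12) (Vr 13)) (Vr 31)]"

definition pack_code :: stmt where
  "pack_code = Par 13 (divE (subE (addE (Vr 28) WL) (Cn 1)) WL) pack_body"

abbreviation "startE l c \<equiv> Ld (adrE (Cn 8) l (Cn 0) c)"
abbreviation "sizeE l c x \<equiv> subE (Ld (adrE (Cn 9) l (Cn 0) c)) x"
abbreviation "leftE \<equiv> mulE (Cn 2) (Vr 12)"

definition prelude :: "stmt list" where
  "prelude = [Asg 17 (startE (Vr 11) (Vr 12)), Asg 18 (sizeE (Vr 11) (Vr 12) (Vr 17)),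
     Asg 19 (startE nextE leftE), Asg 20 (sizeE nextE leftE (Vr 19)),
     Asg 21 (startE nextE (addE leftE (Cn 1))), Asg 22 (sizeE nextE (addE leftE (Cn 1)) (Vr 21)),
     Asg 23 (mulE WL (mulE (Vr 3) (Vr 3))), Asg 24 (mulE (Vr 23) (mulE WL (Vr 3))),
     Asg 25 (mulE (Vr 3) (Vr 3)), Asg 26 (mulE (Vr 25) (Vr 25)),
     Asg 27 (mulE (entriesE (Vr 18) (Vr 23) (Vr 24)) WL),
     Asg 28 (addE (Vr 18) (addE (Vr 27) (mulE (entriesE (Vr 18) (Vr 25) (Vr 26)) (Vr 3)))),
     Asg 29 (mulE (adrE (Cn 10) (Vr 11) (Vr 12) (Cn 0)) WL)]"

abbreviation "recE i \<equiv> adrE (Cn 11) (Vr 11) (Vr 12) (addE (Vr 3) (Cn i))"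

definition record_code :: "stmt list" where
  "record_code = [Wr (recE 0) (Vr 29), Wr (recE 1) (Vr 18), Wr (recE 2) (addE (Vr 29) (Vr 18)),
     Wr (recE 3) (subE (Vr 28) (Vr 18)), Wr (recE 4) (adrE (Cn 11) nextE leftE (Vr 3)),
     Wr (recE 5) (adrE (Cn 11) nextE (addE leftE (Cn 1)) (Vr 3))]"

definition node_code :: "stmt list" where
  "node_code = prelude @ pack_code # record_code"

definition node_cost :: nat where
  "node_cost = cost prelude + cost record_code + esz (divE (subE (addE (Vr 28) WL) (Cn 1)) WL) +
     cost gather_body + 3 * esz lenE + cost pack_body + 20"

text \<open>Packing a word costs as many steps as it has bits, and only the last word is short. The
  lengths add up to at most \<open>t\<close>, which keeps the work linear in the size of the
  node.\<close>

lemma sum_min_blocks: "(\<Sum>k<N. min w (t - k * w)) = min (N * w) t" for w t :: nat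
proof (induction N)
  case (Suc N)
  have "min x t + min w (t - x) = min (w + x) t" for x by simp
  then show ?case using Suc by simp
qed simp

text \<open>A bit address is a word address times \<open>w\<close>, that is, one more digit in base
  \<open>HH w\<close>; five digits still fit.\<close>

lemma cell_word_less:
  assumes "k < HH w" "l < HH w" "p < HH w" "i < HH w" "w < HH w" "x < HH w"
  shows "adr w k l p i * w + x < 2 ^ w"
proof -
  have s: "a * HH w + y < z * HH w" if "a < z" "y < HH w" for a y z
    using digit_less[of a z y "HH w" 0] that by simp
  have "adr w k l p i < HH w * HH w * HH w * HH w" unfolding adr_def by (intro s assms)
  moreover have "adr w k l p i * w \<le> adr w k l p i * HH w" using assms by (intro mult_left_mono) auto
  ultimately have "adr w k l p i * w + x < HH w * HH w * HH w * HH w * HH w"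
    using s[of "adr w k l p i" "HH w * HH w * HH w * HH w" x] assms(6) by linarith
  also have "\<dots> = 2 ^ (w div 16 + w div 16 + w div 16 + w div 16 + w div 16)" by (simp add: HH_def power_add)
  also have "\<dots> \<le> 2 ^ w" by (intro power_increasing) auto
  finally show ?thesis .
qed

context node
begin

definition words :: nat where "words = (tot + w - 1) div w"
abbreviation "clen k \<equiv> min w (tot - k * w)"
definition word :: "nat \<Rightarrow> nat" where
  "word k = dsum 1 (clen k) (\<lambda>i. of_bool (node_bit w r B (k * w + i)))"

definition base :: nat where "base = cell 10 l c 0 * w"

definition node_done :: "mem \<Rightarrow> bool" where
  "node_done m \<longleftrightarrow> (\<forall>k<words. m (cell 10 l c k) = word k) \<and>
     m (cell 11 l c (r + 0)) = base \<and> m (cell 11 l c (r + 1)) = mm \<and> m (cell 11 l c (r + 2)) = base + mm \<and>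
     m (cell 11 l c (r + 3)) = tot - mm \<and> m (cell 11 l c (r + 4)) = cell 11 (Suc l) (2 * c) r \<and>
     m (cell 11 l c (r + 5)) = cell 11 (Suc l) (2 * c + 1) r"

lemma words: "k < words \<longleftrightarrow> k * w < tot" "words \<le> tot"
proof -
  have "k < words \<longleftrightarrow> Suc k \<le> words" by auto
  also have "\<dots> \<longleftrightarrow> Suc k * w \<le> tot + w - 1"
    unfolding words_def using gd(3) by (rule less_eq_div_iff_mult_less_eq)
  also have "\<dots> \<longleftrightarrow> k * w < tot" using gd(3) by auto
  finally show "k < words \<longleftrightarrow> k * w < tot" .
  show "words \<le> tot"
  proof (cases words)
    case (Suc q)
    have "q * w < tot" if "q < words" for q
    proof -
      have "Suc q * w \<le> words * w" using that by (intro mult_right_mono) auto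
      also have "\<dots> \<le> tot + w - 1" unfolding words_def by (rule div_times_less_eq_dividend)
      finally show ?thesis using gd(3) by simp
    qed
    then have "q * w < tot" using Suc by simp
    moreover have "q \<le> q * w" by (rule le_mult_pos[OF gd(3)])
    ultimately show ?thesis using Suc by linarith
  qed simp
qed

lemma wH: "words < HH w" "r + 6 < HH w" "2 * c + 1 < HH w" "2 * c < HH w"
proof -
  show "words < HH w" using words(2) t_bd(9) by linarith
  have "8 * w + 256 < HH w" using room by simp
  then show "r + 6 < HH w" using gd(2) by linarith
  show "2 * c + 1 < HH w" "2 * c < HH w" using hs(6)[of True] hs(6)[of False] by (auto simp: ch_def)
qed

lemma word_bit: "k < words \<Longrightarrow> i < clen k \<Longrightarrow> bit (word k) i \<longleftrightarrow> node_bit w r B (k * w + i)"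
  unfolding word_def by (subst bit_dsum) (auto simp: bit_Suc_0_iff)

lemma node_done_bits:
  assumes "node_done m" "x < tot"
  shows "mem_bit w m (base + x) = node_bit w r B x"
proof -
  have "x div w * w \<le> x" by (rule div_times_less_eq_dividend)
  then have k: "x div w < words" unfolding words(1) using assms(2) by linarith
  have "(base + x) div w = cell 10 l c 0 + x div w" "(base + x) mod w = x mod w"
    using gd(3) by (simp_all add: base_def)
  moreover have "cell 10 l c 0 + x div w = cell 10 l c (x div w)" by (simp add: adr_def)
  moreover have "x mod w < clen (x div w)"
  proof -
    have "x div w * w + x mod w = x" by simp
    then show ?thesis using assms(2) gd(3) by (metis add_less_imp_less_left less_diff_conv add.commute min_less_iff_conj mod_less_divisor)
  qed
  ultimately show ?thesis using assms(1) k word_bit[OF k, of "x mod w"]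
    by (simp add: mem_bit_def node_done_def)
qed

lemma ev_boundary:
  assumes "ev w A s m lE l'" "ev w A s m cE c'" "l' = l \<or> l' = Suc l" "c' < HH w" "good_mem m" "visible A"
  shows "ev w A s m (startE lE cE) (sv l' c')"
    "ev w A s m xE (sv l' c') \<Longrightarrow> ev w A s m (sizeE lE cE xE) (cn l' c')"
proof -
  have l': "l' < HH w" using assms(3) hs by auto
  have k: "kd w (cell q l' 0 c') = q" for q using l' assms(4) hs by (auto intro: adr_sel)
  have e: "m (cell q l' 0 c') = m0 (cell q l' 0 c')" if "q = 8 \<or> q = 9" for q
    using assms(5) k[of q] that by (auto simp: good_mem_def)
  have r: "ev w A s m (Ld (adrE (Cn q) lE (Cn 0) cE)) (m0 (cell q l' 0 c'))" if "q = 8 \<or> q = 9" for q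
    unfolding e[OF that, symmetric] using that
    by (intro ev_M ev_cell ev_C assms l' hs; use HHs(10) k assms(6) in \<open>auto simp: visible_def\<close>)+
  have v: "m0 (cell 8 l' 0 c') = sv l' c'" "m0 (cell 9 l' 0 c') = sv l' c' + cn l' c'"
    using lvl assms(3,4) by (auto simp: level_done_def sv_def)
  show "ev w A s m (startE lE cE) (sv l' c')" using r[of 8] v by simp
  assume x: "ev w A s m xE (sv l' c')"
  have "sv l' c' + cn l' c' \<le> n" using st_cn_n[of l' c'] by (auto simp: sv_def)
  then have "sv l' c' + cn l' c' < 2 ^ w" using H2[OF HHs(1)] by linarith
  then show "ev w A s m (sizeE lE cE xE) (cn l' c')"
    using ev_Sub[OF r[of 9, unfolded v] x] by simp
qed

lemma hs_prelude:
  assumes s: "glob s" "s 3 = r" "s 11 = l" "s 12 = c" and v: "good_mem m" "visible A"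
    and Q: "\<And>s'. nrd s' \<Longrightarrow> s' 29 = base \<Longrightarrow> Q s' m"
  shows "hs w A G prelude s m Q"
proof -
  have l1: "l + 1 < 2 ^ w" "2 * c + 1 < 2 ^ w" using H2[OF hs(2)] H2[OF wH(3)] by auto
  have nx: "ev w A s' m nextE (Suc l)" if "s' 11 = l" for s'
    by (rule ev_eq[OF ev_Add[OF ev_V[where s=s' and x=11, OF that] ev_C l1(1)]]) auto
  have c0: "ev w A s' m leftE (2 * c)" if "s' 12 = c" for s'
    by (rule ev_Mul[OF ev_C ev_V[where s=s' and x=12, OF that]]) (use l1(2) in auto)
  have c1: "ev w A s' m (addE leftE (Cn 1)) (2 * c + 1)" if "s' 12 = c" for s'
    by (rule ev_Add[OF c0[of s', OF that] ev_C l1(2)]) auto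
  have e2w: "ents1 w r mm * w < 2 ^ w" "ents2 r mm * r < 2 ^ w" "tot < 2 ^ w"
    "ents1 w r mm * w + ents2 r mm * r < 2 ^ w"
    using t_bd(9-11) HH_le[of w] unfolding tot_def aux_bits_def by linarith+
  have bw: "base < 2 ^ w" using cell_word_less[of 10 w l c 0 0] hs HHs(7,10) by (simp add: base_def)
  have T: "ev w A s' m (mulE WL (mulE (Vr 3) (Vr 3))) (T1 w r)" "ev w A s' m (mulE WL (Vr 3)) (w * r)"
    "ev w A s' m (mulE (Vr 3) (Vr 3)) (T2 r)" if "s' 3 = r" for s'
    unfolding T1_def T2_def by (intro ev_Mul ev_WL ev_V that t_bd)+
  let ?s1 = "s(17 := sv l c)"
  let ?s2 = "?s1(18 := mm)"
  let ?s3 = "?s2(19 := sv (Suc l) (2 * c))"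
  let ?s4 = "?s3(20 := cn (Suc l) (2 * c))"
  let ?s5 = "?s4(21 := sv (Suc l) (2 * c + 1))"
  let ?s6 = "?s5(22 := cn (Suc l) (2 * c + 1))"
  let ?s7 = "?s6(23 := T1 w r)"
  let ?s8 = "?s7(24 := D1 w r)"
  let ?s9 = "?s8(25 := T2 r)"
  let ?s10 = "?s9(26 := D2 r)"
  let ?s11 = "?s10(27 := ents1 w r mm * w)"
  let ?s12 = "?s11(28 := tot)"
  let ?s13 = "?s12(29 := base)"
  have 1: "ev w A s m (startE (Vr 11) (Vr 12)) (sv l c)"
    by (rule ev_boundary(1)[OF _ _ _ hs(5) v]) (simp_all add: ev_V s)
  have 2: "ev w A ?s1 m (sizeE (Vr 11) (Vr 12) (Vr 17)) mm" unfolding mm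
    by (rule ev_boundary(2)[OF _ _ _ hs(5) v]) (simp_all add: ev_V s)
  have 3: "ev w A ?s2 m (startE nextE leftE) (sv (Suc l) (2 * c))"
    by (rule ev_boundary(1)[OF nx c0 _ wH(4) v]) (simp_all add: ev_V s)
  have 4: "ev w A ?s3 m (sizeE nextE leftE (Vr 19)) (cn (Suc l) (2 * c))"
    by (rule ev_boundary(2)[OF nx c0 _ wH(4) v]) (simp_all add: ev_V s)
  have 5: "ev w A ?s4 m (startE nextE (addE leftE (Cn 1))) (sv (Suc l) (2 * c + 1))"
    by (rule ev_boundary(1)[OF nx c1 _ wH(3) v]) (simp_all add: ev_V s)
  have 6: "ev w A ?s5 m (sizeE nextE (addE leftE (Cn 1)) (Vr 21)) (cn (Suc l) (2 * c + 1))"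
    by (rule ev_boundary(2)[OF nx c1 _ wH(3) v]) (simp_all add: ev_V s)
  have 7: "ev w A ?s6 m (mulE WL (mulE (Vr 3) (Vr 3))) (T1 w r)" by (rule T(1)) (simp add: s)
  have t7: "ev w A ?s7 m (mulE WL (Vr 3)) (w * r)" by (rule T(2)) (simp add: s)
  have 8: "ev w A ?s7 m (mulE (Vr 23) (mulE WL (Vr 3))) (D1 w r)"
    unfolding D1_def by (rule ev_Mul[OF _ t7 t_bd(6)[unfolded D1_def]]) (simp add: ev_V)
  have 9: "ev w A ?s8 m (mulE (Vr 3) (Vr 3)) (T2 r)" by (rule T(3)) (simp add: s)
  have 10: "ev w A ?s9 m (mulE (Vr 25) (Vr 25)) (D2 r)"
    unfolding D2_def by (rule ev_Mul[OF _ _ t_bd(8)[unfolded D2_def]]) (simp_all add: ev_V)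
  have 11: "ev w A ?s10 m (mulE (entriesE (Vr 18) (Vr 23) (Vr 24)) WL) (ents1 w r mm * w)" unfolding ents1_def
    by (rule ev_Mul[OF ev_entries[OF _ _ _ t_bd(3) w(1)] ev_WL e2w(1)[unfolded ents1_def]]) (simp_all add: ev_V)
  have en: "ev w A ?s11 m (entriesE (Vr 18) (Vr 25) (Vr 26)) (ents2 r mm)" unfolding ents2_def
    by (rule ev_entries[OF _ _ _ t_bd(4) w(1)]) (simp_all add: ev_V)
  have 12: "ev w A ?s11 m (addE (Vr 18) (addE (Vr 27) (mulE (entriesE (Vr 18) (Vr 25) (Vr 26)) (Vr 3)))) tot"
    unfolding tot_def aux_bits_def
    by (intro ev_Add ev_Mul en e2w e2w(3)[unfolded tot_def aux_bits_def]) (simp_all add: ev_V s)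
  have 13: "ev w A ?s12 m (mulE (adrE (Cn 10) (Vr 11) (Vr 12) (Cn 0)) WL) base"
    unfolding base_def by (intro ev_Mul ev_cell ev_C ev_WL hs bw[unfolded base_def]) (use HHs(10) in \<open>simp_all add: ev_V s\<close>)
  have n: "nrd ?s13" "?s13 29 = base" using s by (simp_all add: nrd_def glob_upd ch_def)
  show ?thesis unfolding prelude_def
    by (rule hs_Asg[OF 1], rule hs_Asg[OF 2], rule hs_Asg[OF 3], rule hs_Asg[OF 4], rule hs_Asg[OF 5],
        rule hs_Asg[OF 6], rule hs_Asg[OF 7], rule hs_Asg[OF 8], rule hs_Asg[OF 9], rule hs_Asg[OF 10],
        rule hs_Asg[OF 11], rule hs_Asg[OF 12], rule hs_Asg[OF 13], rule hs_Nil, rule Q[OF n])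
qed

lemma ht_word:
  assumes k: "k < words" and s: "nrd s" "s 13 = k" and v: "good_mem m0'" "visible A"
    and G: "cell 10 l c k \<in> G"
  shows "ht w A G pack_body s m0' (\<lambda>s' m. m (cell 10 l c k) = word k)
     (node_cost * w) (node_cost * clen k)"
proof -
  have kt: "k * w < tot" "k < HH w" using k[unfolded words(1)] k wH(1) by linarith+
  have tw: "tot < 2 ^ w" using t_bd(9) HH_le[of w] by linarith
  have kw: "ev w A s' m (mulE (Vr 13) WL) (k * w)" if "s' 13 = k" for s' m
    by (rule ev_Mul[OF ev_V[where s=s' and x=13, OF that] ev_WL]) (use kt tw in linarith)
  have c1: "1 \<le> clen k" using kt gd(3) by simp
  have ln: "ev w A s' m lenE (clen k)" if "nrd s'" "s' 13 = k" for s' m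
  proof -
    have d: "ev w A s' m (subE (Vr 28) (mulE (Vr 13) WL)) (tot - k * w)"
      by (rule ev_Sub[OF nrd_ev(12)[OF that(1)] kw[of s', OF that(2)]]) (use kt tw in auto)
    have "ev w A s' m lenE (if tot - k * w < w then tot - k * w else w)"
      unfolding lenE_def by (intro ev_If ev_Less d ev_WL)
    then show ?thesis by (rule ev_eq) (simp add: min_def)
  qed
  let ?d = "\<lambda>i. of_bool (node_bit w r B (k * w + i)) :: nat"
  let ?I = "\<lambda>t s' m. nrd s' \<and> s' 13 = k \<and> s' 31 = dsum 1 t ?d \<and> good_mem m"
  have small: "dsum 1 t ?d < 2 ^ t" for t using dsum_less[of t ?d 1] by simp
  have nu: "nrd (s'(x := y)) = nrd s'" if "x \<in> {14, 31}" for s' x y using that by (auto simp: nrd_def glob_upd)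
  have loop: "ht w A G [For 14 lenE gather_body] s1 m1 (\<lambda>s' m. nrd s' \<and> s' 13 = k \<and> s' 31 = word k)
      (esz lenE + 4 + clen k * (cost gather_body + esz lenE + 4)) (esz lenE + 4 + clen k * (cost gather_body + esz lenE + 4))"
    if "s1 = s(31 := 0) \<and> m1 = m0'" for s1 m1
  proof (rule ht_For[where I="?I"])
    show "?I 0 (s1(14 := 0)) m1" using that s v by (simp add: nu)
    show "clen k < 2 ^ w" by (rule le_less_trans[OF min.cobounded1 gd(17)])
    show "0 < w" by (rule w)
    show "ev w A s' m lenE (clen k)" if "?I t s' m" for t s' m using that by (intro ln) auto
    fix t s' m assume t: "t < clen k" and I: "?I t s' m" and s14: "s' 14 = t"
    have x: "k * w + t < tot" using t[unfolded min_less_iff_conj] by linarith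
    have v14: "ev w A s' m (Vr 14) t" using s14 by (simp add: ev_V)
    have xe: "ev w A s' m (addE (mulE (Vr 13) WL) (Vr 14)) (k * w + t)"
      by (rule ev_Add[OF kw v14]) (use I x tw in auto)
    have be: "ev w A s' m (node_bitE (addE (mulE (Vr 13) WL) (Vr 14))) (?d t)"
      by (rule ev_node_bit[OF xe x]) (use I v in auto)
    have tlt: "t < w" using t by simp
    have p: "?d t * 2 ^ t < 2 ^ w"
    proof -
      have "?d t * 2 ^ t \<le> (2::nat) ^ t" by (cases "node_bit w r B (k * w + t)") auto
      also have "\<dots> < 2 ^ w" using tlt by (rule power_strict_increasing) simp
      finally show ?thesis .
    qed
    have q: "dsum 1 (Suc t) ?d = dsum 1 t ?d + ?d t * 2 ^ t" by (simp add: dsum_Suc)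
    have "(2::nat) ^ Suc t \<le> 2 ^ w" using tlt by (intro power_increasing) auto
    then have qb: "dsum 1 t ?d + ?d t * 2 ^ t < 2 ^ w" using small[of "Suc t"] unfolding q by linarith
    have "ev w A s' m (addE (Vr 31) (Bn Shl (node_bitE (addE (mulE (Vr 13) WL) (Vr 14))) (Vr 14))) (dsum 1 t ?d + ?d t * 2 ^ t)"
      by (rule ev_Add[OF _ ev_Shl_small[OF be v14 p] qb]) (use I in \<open>simp add: ev_V\<close>)
    then show "ht w A G gather_body s' m (\<lambda>s'' m''. s'' 14 = t \<and> ?I (Suc t) (s''(14 := Suc t)) m'')
        (cost gather_body) (cost gather_body)" unfolding gather_body_def
      by (rule ht_hs[OF hs_Asg[OF _ hs_Nil]]) (use I s14 q in \<open>simp_all add: nu\<close>)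
  qed (auto simp: word_def)
  have fin: "ht w A G [Wr (adrE (Cn 10) (Vr 11) (Vr 12) (Vr 13)) (Vr 31)] s' m (\<lambda>s' m. m (cell 10 l c k) = word k)
      (cost [Wr (adrE (Cn 10) (Vr 11) (Vr 12) (Vr 13)) (Vr 31)]) (cost [Wr (adrE (Cn 10) (Vr 11) (Vr 12) (Vr 13)) (Vr 31)])"
    if n: "nrd s' \<and> s' 13 = k \<and> s' 31 = word k" for s' m
  proof (rule ht_hs, rule hs_Wr[OF _ _ G])
    show "ev w A s' m (adrE (Cn 10) (Vr 11) (Vr 12) (Vr 13)) (cell 10 l c k)"
      by (intro ev_cell ev_C nrd_ev hs kt ev_V) (use n HHs(10) in auto)
    show "ev w A s' m (Vr 31) (word k)" using n by (simp add: ev_V)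
  qed (simp add: hs_Nil)
  have a: "ht w A G [Asg 31 (Cn 0)] s m0' (\<lambda>s1 m1. s1 = s(31 := 0) \<and> m1 = m0') (cost [Asg 31 (Cn 0)]) (cost [Asg 31 (Cn 0)])"
    by (rule ht_hs, rule hs_Asg[OF ev_C hs_Nil]) auto
  define q where "q = clen k"
  have q1: "1 \<le> q" "q \<le> w" using c1 by (auto simp: q_def)
  have cost: "cost [Asg 31 (Cn 0)] + (esz lenE + 4 + q * (cost gather_body + esz lenE + 4) +
     cost [Wr (adrE (Cn 10) (Vr 11) (Vr 12) (Vr 13)) (Vr 31)]) \<le> node_cost * q"
  proof -
    define e where "e = esz lenE"
    define y where "y = cost gather_body"
    have pb: "cost pack_body = cost [Asg 31 (Cn 0)] + (stmt_cost (For 14 lenE gather_body) + cost [Wr (adrE (Cn 10) (Vr 11) (Vr 12) (Vr 13)) (Vr 31)])"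
      by (simp add: pack_body_def cost_def)
    have "cost [Asg 31 (Cn 0)] + (e + 4 + q * (y + e + 4) + cost [Wr (adrE (Cn 10) (Vr 11) (Vr 12) (Vr 13)) (Vr 31)])
       \<le> (cost pack_body + e + 4) * 1 + (y + e + 4) * q" unfolding pb by (simp add: mult.commute)
    also have "\<dots> \<le> (cost pack_body + e + 4) * q + (y + e + 4) * q" using q1 by (intro add_right_mono mult_left_mono) auto
    also have "\<dots> = (cost pack_body + e + 4 + (y + e + 4)) * q" by (simp add: add_mult_distrib)
    also have "\<dots> \<le> node_cost * q" unfolding node_cost_def e_def y_def by (intro mult_right_mono) simp_all
    finally show ?thesis by (simp only: e_def y_def)
  qed
  have "node_cost * q \<le> node_cost * w" using q1 by (intro mult_left_mono) auto
  then show ?thesis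
    unfolding pack_body_def
    by (intro ht_cost[OF ht_Cons[OF a ht_Cons[OF loop fin]]] order_trans[OF cost[unfolded q_def]] cost[unfolded q_def])
      (simp_all add: q_def)
qed

definition bits_at :: "nat set" where "bits_at = {a. kd w a = 10 \<and> lv w a = l \<and> ps w a = c}"
definition node_at :: "nat set" where "node_at = {a. (kd w a = 10 \<or> kd w a = 11) \<and> lv w a = l \<and> ps w a = c}"

lemma ht_pack:
  assumes s: "nrd s" and v: "good_mem m" "visible A" and G: "bits_at \<subseteq> G" "bits_at \<subseteq> A"
  shows "ht w A G [pack_code] s m (\<lambda>s' m'. s' = s \<and> (\<forall>k<words. m' (cell 10 l c k) = word k))
     (esz (divE (subE (addE (Vr 28) WL) (Cn 1)) WL) + 1 + node_cost * w)
     (esz (divE (subE (addE (Vr 28) WL) (Cn 1)) WL) + 1 + (\<Sum>k<words. node_cost * clen k))"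
  unfolding pack_code_def
proof (rule ht_Par[where R="bits_at" and own="ix w" and P="\<lambda>k m. m (cell 10 l c k) = word k"])
  have sel: "kd w (cell 10 l c k) = 10" "lv w (cell 10 l c k) = l" "ps w (cell 10 l c k) = c" "ix w (cell 10 l c k) = k"
    if "k < words" for k using that wH(1) hs by (auto intro!: adr_sel)
  have b: "tot + w < 2 ^ w"
  proof -
    have "8 * w + 256 < HH w" using room by simp
    moreover have "HH w * 2 \<le> 2 ^ w"
    proof -
      have "HH w * HH w = 2 ^ (w div 16 + w div 16)" by (simp add: HH_def power_add)
      also have "\<dots> \<le> 2 ^ w" by (rule power_increasing) auto
      finally have "HH w * HH w \<le> 2 ^ w" .
      moreover have "HH w * 2 \<le> HH w * HH w" using HHs(10) by (intro mult_left_mono) auto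
      ultimately show ?thesis by linarith
    qed
    ultimately show ?thesis using t_bd(9) by linarith
  qed
  show "ev w A s m (divE (subE (addE (Vr 28) WL) (Cn 1)) WL) words"
    unfolding words_def by (intro ev_Div ev_Sub ev_Add nrd_ev s ev_WL ev_C b) (use gd(3) in auto)
  show "ht w (A - {a \<in> bits_at. ix w a \<noteq> k}) {a \<in> bits_at. ix w a = k} pack_body (s(13 := k)) m
      (\<lambda>s' m'. m' (cell 10 l c k) = word k) (node_cost * w) (node_cost * clen k)" if k: "k < words" for k
  proof (rule ht_word[OF k])
    show "nrd (s(13 := k))" using s by (simp add: nrd_def glob_upd)
    show "visible (A - {a \<in> bits_at. ix w a \<noteq> k})" using v(2) by (auto simp: visible_def bits_at_def)
  qed (use v sel[OF k] in \<open>auto simp: bits_at_def\<close>)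
  show "m2 (cell 10 l c k) = word k"
    if "k < words" "\<And>a. a \<in> bits_at \<Longrightarrow> ix w a = k \<Longrightarrow> m2 a = m1 a" "m1 (cell 10 l c k) = word k" for k m1 m2
    using that sel[OF that(1)] by (simp add: bits_at_def)
qed (use G in auto)

lemma ht_node:
  assumes s: "glob s" "s 3 = r" "s 11 = l" "s 12 = c" and v: "good_mem m" "visible A"
    and G: "node_at \<subseteq> G" "node_at \<subseteq> A"
  shows "ht w A G node_code s m (\<lambda>s' m'. node_done m') (node_cost * (w + 1)) (node_cost * (tot + 1))"
proof -
  have b10: "bits_at \<subseteq> node_at" by (auto simp: bits_at_def node_at_def)
  let ?Q1 = "\<lambda>s' m'. nrd s' \<and> s' 29 = base \<and> m' = m"
  have 1: "ht w A G prelude s m ?Q1 (cost prelude) (cost prelude)"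
    by (rule ht_hs, rule hs_prelude[OF s v]) auto
  let ?e = "esz (divE (subE (addE (Vr 28) WL) (Cn 1)) WL)"
  have 2: "ht w A G [pack_code] s1 m1 (\<lambda>s' m'. s' = s1 \<and> (\<forall>k<words. m' (cell 10 l c k) = word k))
      (?e + 1 + node_cost * w) (?e + 1 + (\<Sum>k<words. node_cost * clen k))" if "?Q1 s1 m1" for s1 m1
    by (rule ht_pack) (use that v G b10 in auto)
  have 3: "ht w A G record_code s1 m1 (\<lambda>s' m'. node_done m') (cost record_code) (cost record_code)"
    if n: "nrd s1" "s1 29 = base" and wd: "\<forall>k<words. m1 (cell 10 l c k) = word k" for s1 m1
  proof -
    have sel: "kd w (cell 11 l c (r + i)) = 11" "lv w (cell 11 l c (r + i)) = l" "ps w (cell 11 l c (r + i)) = c"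
      if "i \<le> 5" for i using that wH(2) hs by (auto intro!: adr_sel)
    have in_G: "cell 11 l c (r + i) \<in> G" if "i \<le> 5" for i using sel[OF that] G by (auto simp: node_at_def)
    have k10: "kd w (cell 10 l c k) = 10" if "k < words" for k using that wH(1) hs by (auto intro!: adr_sel)
    have ne: "cell 10 l c k \<noteq> cell 11 l c (r + i)" if "k < words" "i \<le> 5" for k i
      using k10[OF that(1)] sel[OF that(2)] by auto
    define p where "p = cell 11 l c r"
    have e: "cell 11 l c (r + i) = p + i" for i by (simp add: p_def adr_def)
    have ne': "cell 10 l c k \<noteq> p + 0" "cell 10 l c k \<noteq> p + 1" "cell 10 l c k \<noteq> p + 2" "cell 10 l c k \<noteq> p + 3"
      "cell 10 l c k \<noteq> p + 4" "cell 10 l c k \<noteq> p + 5" if "k < words" for k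
      unfolding e[symmetric] by (rule ne[OF that], simp)+
    have R: "ev w A s1 m' (recE i) (cell 11 l c (r + i))" if "i \<le> 5" for i m'
    proof -
      have "ev w A s1 m' (addE (Vr 3) (Cn i)) (r + i)"
        by (rule ev_Add[OF nrd_ev(1)[OF n(1)] ev_C]) (use that wH(2) HH_le[of w] in linarith)+
      then show ?thesis by (intro ev_cell ev_C nrd_ev n hs) (use that wH(2) HHs(10) in auto)
    qed
    have bw: "base + mm < 2 ^ w" using cell_word_less[of 10 w l c 0 mm] hs HHs(1,7,10) mm_n by (simp add: base_def)
    have tw: "mm \<le> tot" "tot < 2 ^ w" using t_bd(9) HH_le[of w] unfolding tot_def by linarith+
    have c0: "ev w A s1 m' leftE (2 * c)" for m'
      by (rule ev_Mul[OF ev_C nrd_ev(4)[OF n(1)]]) (use H2[OF wH(4)] in auto)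
    have c1: "ev w A s1 m' (addE leftE (Cn 1)) (2 * c + 1)" for m'
      by (rule ev_Add[OF c0 ev_C]) (use H2[OF wH(3)] in auto)
    have V: "ev w A s1 m' (Vr 29) base" "ev w A s1 m' (Vr 18) mm" "ev w A s1 m' (addE (Vr 29) (Vr 18)) (base + mm)"
      "ev w A s1 m' (subE (Vr 28) (Vr 18)) (tot - mm)"
      "ev w A s1 m' (adrE (Cn 11) nextE leftE (Vr 3)) (cell 11 (Suc l) (2 * c) r)"
      "ev w A s1 m' (adrE (Cn 11) nextE (addE leftE (Cn 1)) (Vr 3)) (cell 11 (Suc l) (2 * c + 1) r)" for m'
    proof -
      show b: "ev w A s1 m' (Vr 29) base" using n by (simp add: ev_V)
      show "ev w A s1 m' (Vr 18) mm" by (rule nrd_ev[OF n(1)])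
      show "ev w A s1 m' (addE (Vr 29) (Vr 18)) (base + mm)" by (rule ev_Add[OF b nrd_ev(6)[OF n(1)] bw])
      show "ev w A s1 m' (subE (Vr 28) (Vr 18)) (tot - mm)" by (rule ev_Sub[OF nrd_ev(12,6)[OF n(1)] tw])
      have h: "11 < HH w" "11 \<le> (32::nat)" using HHs(10) by auto
      show "ev w A s1 m' (adrE (Cn 11) nextE leftE (Vr 3)) (cell 11 (Suc l) (2 * c) r)"
        by (intro ev_cell ev_C nrd_ev(1,14) n c0 h hs wH t_bd)
      show "ev w A s1 m' (adrE (Cn 11) nextE (addE leftE (Cn 1)) (Vr 3)) (cell 11 (Suc l) (2 * c + 1) r)"
        by (intro ev_cell ev_C nrd_ev(1,14) n c1 h hs wH t_bd)
    qed
    show ?thesis unfolding record_code_def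
      by (rule ht_hs, rule hs_Wr[OF R V(1) in_G], simp, simp, rule hs_Wr[OF R V(2) in_G], simp, simp,
          rule hs_Wr[OF R V(3) in_G], simp, simp, rule hs_Wr[OF R V(4) in_G], simp, simp,
          rule hs_Wr[OF R V(5) in_G], simp, simp, rule hs_Wr[OF R V(6) in_G], simp, simp, rule hs_Nil,
          unfold node_done_def e) (use wd ne' in simp)
  qed
  have "ht w A G (prelude @ pack_code # record_code) s m (\<lambda>s' m'. node_done m')
     (cost prelude + (?e + 1 + node_cost * w + cost record_code))
     (cost prelude + (?e + 1 + (\<Sum>k<words. node_cost * clen k) + cost record_code))"
    by (rule ht_append[OF 1], rule ht_Cons[OF 2 3]) auto
  moreover have "(\<Sum>k<words. node_cost * clen k) \<le> node_cost * tot"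
    unfolding sum_distrib_left[symmetric] sum_min_blocks by (intro mult_left_mono) auto
  ultimately show ?thesis unfolding node_code_def
    by (elim ht_cost) (simp_all add: node_cost_def add_mult_distrib2)
qed

end

subsection \<open>All levels and all nodes\<close>

text \<open>One more level is sorted than there are levels of nodes: the lowest nodes need the order
  and the boundaries of their would-be children.\<close>

definition levels_code :: stmt where "levels_code = Par 11 (addE (Vr 4) (Cn 1)) level_body"

definition nodes_code :: stmt where "nodes_code = Par 11 (Vr 4) [Par 12 (pow2E (Vr 11)) node_code]"

context level
begin

abbreviation "ND r l c m \<equiv> node.node_done w n L f r l c m"

lemma cell_sel: "l \<le> L \<Longrightarrow> p < HH w \<Longrightarrow> i < HH w \<Longrightarrow>
    kd w (cell k l p i) = k \<and> lv w (cell k l p i) = l \<and> ps w (cell k l p i) = p"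
  using adr_sel[of l w p i k] HHs(6) by auto

lemma ht_levels:
  assumes s: "glob s" and m0: "inp m0" "\<And>a. 1 \<le> kd w a \<Longrightarrow> m0 a = 0"
  shows "ht w UNIV UNIV [levels_code] s m0 (\<lambda>s' m. s' = s \<and> inp m \<and> (\<forall>l\<le>L. level_done l m))
    (esz (addE (Vr 4) (Cn 1)) + 1 + (K + 1) * (level_cost * (R + g)))
    (esz (addE (Vr 4) (Cn 1)) + 1 + (\<Sum>l<L + 1. (K + 1) * (level_cost * (R * nb + n + g))))"
  unfolding levels_code_def
proof (rule ht_Par[where R="{a. 1 \<le> kd w a}" and own="lv w" and P="level_done"])
  let ?R = "{a. 1 \<le> kd w a}"
  have k0: "kd w i = 0" if "i < n" for i using that HHs(1) by (intro kd_small) simp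
  show "ev w UNIV s m0 (addE (Vr 4) (Cn 1)) (L + 1)"
    by (intro ev_Add ev_glob[OF s] ev_C) (use H2[OF HHs(13)] passes HHs(6) HHs(10) H2[of "L + 1"] room in auto)
  show "ht w (UNIV - {a \<in> ?R. lv w a \<noteq> l}) {a \<in> ?R. lv w a = l} level_body (s(11 := l)) m0
      (\<lambda>s' m'. level_done l m') ((K + 1) * (level_cost * (R + g))) ((K + 1) * (level_cost * (R * nb + n + g)))"
    if "l < L + 1" for l
    by (rule ht_level) (use that s m0 k0 in \<open>auto simp: glob_upd own_def\<close>)
  show "level_done l m2"
    if "l < L + 1" and eq: "\<And>a. a \<in> ?R \<Longrightarrow> lv w a = l \<Longrightarrow> m2 a = m1 a" and d: "level_done l m1" for l m1 m2
  proof -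
    have e: "m2 (cell k l p i) = m1 (cell k l p i)" if "1 \<le> k" "p < HH w" "i < HH w" for k p i
      using cell_sel[of l p i k] that \<open>l < L + 1\<close> by (intro eq) auto
    have h: "i < HH w" if "i < n" for i using that HHs(1) by simp
    show ?thesis using d by (simp add: level_done_def e h HHs(5) HH_pos)
  qed
  show "s = s \<and> inp m' \<and> (\<forall>l\<le>L. level_done l m')"
    if "\<And>l. l < L + 1 \<Longrightarrow> level_done l m'"
      and "\<And>a. a \<in> UNIV \<Longrightarrow> a \<notin> ?R \<or> L + 1 \<le> lv w a \<Longrightarrow> m' a = m0 a" for m'
    using that m0(1) k0 by (auto simp: inp_def)
qed auto

text \<open>A finished node depends on its own cells only, so it persists while the other nodes are
  being built.\<close>

lemma node_done_cong:
  assumes good: "good w r" and lc: "l < L" "c < 2 ^ l"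
    and lvl: "level_done l m0" "level_done (Suc l) m0" "inp m0"
    and eq: "\<And>a. kd w a = 10 \<or> kd w a = 11 \<Longrightarrow> lv w a = l \<Longrightarrow> ps w a = c \<Longrightarrow> m2 a = m1 a" and d: "ND r l c m1"
  shows "ND r l c m2"
proof -
  interpret node w n L K d R nb g Mc ad f r l c m0 by unfold_locales (use assms in auto)
  have e: "m2 (cell k l c i) = m1 (cell k l c i)" if "k = 10 \<or> k = 11" "i < HH w" for k i
    using cell_sel[of l c i k] that lc hs(5) by (intro eq) auto
  have "m2 (cell 10 l c k) = m1 (cell 10 l c k)" if "k < words" for k using that wH(1) by (intro e) auto
  moreover have "m2 (cell 11 l c (r + i)) = m1 (cell 11 l c (r + i))" if "i \<le> 5" for i
    using that wH(2) by (intro e) auto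
  note c11 = this[of 0] this[of 1] this[of 2] this[of 3] this[of 4] this[of 5]
  ultimately show ?thesis using d c11 unfolding node_done_def by simp
qed

lemma sum_length_node_bits: "(\<Sum>c<2 ^ l. length (node_bits L f n l c)) \<le> n"
proof -
  have "(\<Sum>c<2 ^ l. length (node_bits L f n l c)) = card {j. j < n \<and> kk l j < 2 ^ l}"
    unfolding length_node_bits by (rule sum_card_fibres)
  also have "\<dots> \<le> card {..<n}" by (rule card_mono) auto
  finally show ?thesis by simp
qed

lemma ht_nodes:
  assumes s: "glob s" "s 3 = r" and good: "good w r"
    and lvl: "\<And>l. l \<le> L \<Longrightarrow> level_done l m0" "inp m0"
  shows "ht w UNIV UNIV [nodes_code] s m0 (\<lambda>s' m. s' = s \<and> (\<forall>l<L. \<forall>c<2 ^ l. ND r l c m))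
    (esz (Vr 4) + 1 + (esz (pow2E (Vr 11)) + 1 + node_cost * (w + 1)))
    (esz (Vr 4) + 1 + (\<Sum>l<L. esz (pow2E (Vr 11)) + 1 + node_cost * (6 * n + 2 ^ l)))"
  unfolding nodes_code_def
proof (rule ht_Par[where R="{a. kd w a = 10 \<or> kd w a = 11}" and own="lv w" and P="\<lambda>l m. \<forall>c<2 ^ l. ND r l c m"])
  let ?R = "{a. kd w a = 10 \<or> kd w a = 11}"
  show "ev w UNIV s m0 (Vr 4) L" by (rule ev_glob[OF s(1)])
  show "\<forall>c<2 ^ l. ND r l c m2"
    if "l < L" and eq: "\<And>a. a \<in> ?R \<Longrightarrow> lv w a = l \<Longrightarrow> m2 a = m1 a" and d: "\<forall>c<2 ^ l. ND r l c m1" for l m1 m2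
  proof (intro allI impI)
    fix c :: nat assume c: "c < 2 ^ l"
    show "ND r l c m2"
      by (rule node_done_cong[OF good that(1) c lvl(1) lvl(1) lvl(2) eq]) (use that(1) d c in auto)
  qed
  fix l assume l: "l < L"
  let ?A = "UNIV - {a \<in> ?R. lv w a \<noteq> l}" and ?G = "{a \<in> ?R. lv w a = l}" and ?s = "s(11 := l)"
  have "(2::nat) ^ L < 2 ^ (w div 16)" using HHs(9) by (simp add: HH_def)
  then have lw: "l < w" using l power_less_imp_less_exp[of "2::nat" L "w div 16"] by simp
  have tot: "node.tot w n L f r l c \<le> 6 * length (node_bits L f n l c)" if "c < 2 ^ l" for c
  proof -
    interpret node w n L K d R nb g Mc ad f r l c m0 by unfold_locales (use that l good lvl in auto)
    show ?thesis unfolding tot_def using aux_bits_le[OF good, of mm] by linarith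
  qed
  have "ht w ?A ?G [Par 12 (pow2E (Vr 11)) node_code] ?s m0 (\<lambda>s' m'. \<forall>c<2 ^ l. ND r l c m')
     (esz (pow2E (Vr 11)) + 1 + node_cost * (w + 1))
     (esz (pow2E (Vr 11)) + 1 + (\<Sum>c<2 ^ l. node_cost * (6 * length (node_bits L f n l c) + 1)))"
  proof (rule ht_Par[where R="?G" and own="ps w" and P="\<lambda>c m. ND r l c m"])
    show "ev w ?A ?s m0 (pow2E (Vr 11)) (2 ^ l)" by (rule ev_pow2[OF ev_V lw]) simp
    show "?G \<subseteq> ?A" by auto
    show "ND r l c m2" if "c < 2 ^ l" "\<And>a. a \<in> ?G \<Longrightarrow> ps w a = c \<Longrightarrow> m2 a = m1 a" "ND r l c m1" for c m1 m2
      by (rule node_done_cong[OF good l that(1) lvl(1) lvl(1) lvl(2) that(2)]) (use l that in auto)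
    fix c :: nat assume c: "c < 2 ^ l"
    interpret node w n L K d R nb g Mc ad f r l c m0 by unfold_locales (use c l good lvl in auto)
    have "ht w (?A - {a \<in> ?G. ps w a \<noteq> c}) {a \<in> ?G. ps w a = c} node_code (?s(12 := c)) m0 (\<lambda>s' m'. ND r l c m')
       (node_cost * (w + 1)) (node_cost * (tot + 1))"
      by (rule ht_node) (use s in \<open>auto simp: glob_upd good_mem_def visible_def node_at_def\<close>)
    then show "ht w (?A - {a \<in> ?G. ps w a \<noteq> c}) {a \<in> ?G. ps w a = c} node_code (?s(12 := c)) m0 (\<lambda>s' m'. ND r l c m')
       (node_cost * (w + 1)) (node_cost * (6 * length (node_bits L f n l c) + 1))"
      by (rule ht_cost) (use tot[OF c] in \<open>auto intro!: mult_left_mono\<close>)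
  qed auto
  moreover have "(\<Sum>c<2 ^ l. node_cost * (6 * length (node_bits L f n l c) + 1)) \<le> node_cost * (6 * n + 2 ^ l)"
    using sum_length_node_bits[of l]
    by (simp add: sum_distrib_left[symmetric] sum.distrib add_mult_distrib2)
  ultimately show "ht w ?A ?G [Par 12 (pow2E (Vr 11)) node_code] ?s m0 (\<lambda>s' m'. \<forall>c<2 ^ l. ND r l c m')
     (esz (pow2E (Vr 11)) + 1 + node_cost * (w + 1)) (esz (pow2E (Vr 11)) + 1 + node_cost * (6 * n + 2 ^ l))"
    by (elim ht_cost) auto
qed auto

text \<open>The record, bitmap and directory determine everything a query evaluates, so any memory
  that shares them satisfies the assumptions of \<open>node_view\<close>.\<close>

lemma ND_stores_node:
  assumes good: "good w r" and lc: "l < L" "c < 2 ^ l"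
    and lvl: "level_done l m0" "level_done (Suc l) m0" "inp m0" and d: "ND r l c m"
    and F: "\<And>x. x \<le> n \<Longrightarrow> real (aux_bits w r x) \<le> F x" and C: "query_cost \<le> C"
  shows "stores_node w C F rank_prog select_prog m (cell 11 l c r) (node_bits L f n l c)"
    "m (cell 11 l c r + 4) = cell 11 (Suc l) (2 * c) r" "m (cell 11 l c r + 5) = cell 11 (Suc l) (2 * c + 1) r"
proof -
  interpret node w n L K d R nb g Mc ad f r l c m0 by unfold_locales (use assms in auto)
  let ?p = "cell 11 l c r"
  have e: "cell 11 l c (r + i) = ?p + i" for i by (simp add: adr_def)
  note rec = d[unfolded node_done_def e]
  show "m (?p + 4) = cell 11 (Suc l) (2 * c) r" "m (?p + 5) = cell 11 (Suc l) (2 * c + 1) r" using rec by auto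
  have m: "m ?p = base" "m (?p + 1) = mm" "m (?p + 2) = base + mm" "m (?p + 3) = aux_bits w r mm"
    using rec by (auto simp: tot_def)
  have bits: "mem_bit w m (base + x) = node_bit w r B x" if "x < tot" for x
    by (rule node_done_bits[OF d that])
  show "stores_node w C F rank_prog select_prog m ?p B" unfolding stores_node_def
  proof (intro conjI allI impI)
    show "m (?p + 1) = mm" by (rule m)
    show "mem_bit w m (m ?p + i) = B ! i" if "i < mm" for i
      using bits[of i] that by (simp add: m tot_def node_bit_def)
    show "real (m (?p + 3)) \<le> F mm" unfolding m using mm_n by (rule F)
    fix m' assume m': "(\<forall>a. m' a < 2 ^ w) \<and> same_node_data w ?p m m'"
    then have q: "\<And>a. a \<in> {?p..?p + 3} \<Longrightarrow> m' a = m a"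
      "\<And>j. j \<in> {base..<base + mm} \<union> {base + mm..<base + mm + aux_bits w r mm} \<Longrightarrow> mem_bit w m' j = mem_bit w m j"
      unfolding same_node_data_def m by auto
    \<comment> \<open>The interpretation is for the modified memory \<open>m'\<close>; the record
      address still ends in the digit \<open>r\<close>.\<close>
    interpret node_view w r m' ?p B
    proof
      show "good w r" by fact
      show "m' a < 2 ^ w" for a using m' by simp
      have q0: "m' ?p = base" using q(1)[of ?p] m by simp
      show "m' (?p + 1) = mm" "m' (?p + 2) = m' ?p + mm" unfolding q0 using q(1) m by auto
      show "?p mod HH w = r" using t_bd(16) by (simp add: adr_def)
      have "8 * w + 256 < HH w" "8 * n + 8 * w < HH w" using room by simp_all
      then have "r + 3 < HH w" "tot + w < HH w" using gd(2) t_bd(12) by linarith+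
      then show "?p + 3 < 2 ^ w" "m' ?p + mm + aux_bits w r mm + w < 2 ^ w"
        using cell_word_less[of 10 w l c 0 "tot + w"] adr_less[of 11 w l c "r + 3"] hs HHs(7,10) e[of 3] q0
        by (auto simp: base_def tot_def)
      show "mem_bit w m' (m' ?p + x) = node_bit w r B x" if x: "x < mm + aux_bits w r mm" for x
      proof -
        have "mem_bit w m' (base + x) = mem_bit w m (base + x)" by (rule q(2)) (use x in \<open>cases "x < mm"; simp\<close>)
        then show ?thesis unfolding q0 using bits[of x] x by (simp add: tot_def)
      qed
    qed
    show "answers w C rank_prog ?p m' b i (rank b B i)" if "i \<le> mm" for b i by (rule answers_rank[OF that C])
    show "answers w C select_prog ?p m' b k (select b B k)" if "k < count_list B b" for b k by (rule answers_select[OF that C])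
  qed
qed

lemma ND_stores_tree:
  assumes good: "good w r" and lvl: "\<And>l. l \<le> L \<Longrightarrow> level_done l m0" "inp m0"
    and d: "\<forall>l<L. \<forall>c<2 ^ l. ND r l c m"
    and F: "\<And>x. x \<le> n \<Longrightarrow> real (aux_bits w r x) \<le> F x" and C: "query_cost \<le> C"
  shows "l < L \<Longrightarrow> c < 2 ^ l \<Longrightarrow> stores_tree w C F rank_prog select_prog m (cell 11 l c r)
     (wavelet (c * 2 ^ (L - l)) (Suc c * 2 ^ (L - l) - 1) (map f [0..<n]))"
proof (induction "L - l" arbitrary: l c)
  case (Suc k)
  have nd: "ND r l c m" using d Suc by simp
  note sn = ND_stores_node[OF good Suc.prems lvl(1) lvl(1) lvl(2) nd F C]
  have sn: "stores_node w C F rank_prog select_prog m (cell 11 l c r) (node_bits L f n l c)"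
    "m (cell 11 l c r + 4) = cell 11 (Suc l) (2 * c) r" "m (cell 11 l c r + 5) = cell 11 (Suc l) (2 * c + 1) r"
    by (rule sn; use Suc.prems in simp)+
  show ?case
  proof (cases "Suc l = L \<or> node_bits L f n l c = []")
    case True
    then show ?thesis unfolding wavelet_node_bits[OF Suc.prems(1)] using sn(1) by simp
  next
    case False
    then have "Suc l < L" "k = L - Suc l" using Suc by auto
    then show ?thesis unfolding wavelet_node_bits[OF Suc.prems(1)]
      using False sn Suc.hyps(1)[of "Suc l" "2 * c"] Suc.hyps(1)[of "Suc l" "2 * c + 1"] Suc.prems by simp
  qed
qed simp

end

subsection \<open>The program\<close>

abbreviation "sqE e \<equiv> mulE e e"

text \<open>Over all rounds the last \<open>t\<close> with \<open>2 ^ t < \<sigma>\<close> leaves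
  \<open>t + 1\<close>, the rounded-up logarithm. The initial value 1 provides the minimum of one
  level.\<close>

definition log_code :: "stmt list" where
  "log_code = [When (lessE (pow2E (Vr 11)) (Vr 1)) [Asg 4 (addE (Vr 11) (Cn 1))] []]"

text \<open>Searches the largest \<open>r\<close> with \<open>r ^ 10 \<le> w\<close>.\<close>

definition root_code :: "stmt list" where
  "root_code = [When (lessE (mulE (sqE (sqE (sqE (Vr 11)))) (sqE (Vr 11))) (addE WL (Cn 1))) [Asg 3 (Vr 11)] []]"

text \<open>Repeated \<open>k0\<close> times this computes \<open>min k0 L\<close>. A literal would
  not do: literals are reduced modulo \<open>2 ^ w\<close>, and \<open>1 / \<epsilon>\<close> may be
  too large for a word when \<open>n\<close> is small.\<close>

definition pass_count_step :: stmt where "pass_count_step = Asg 5 (addE (Vr 5) (lessE (Vr 5) (Vr 4)))"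

text \<open>The word length is \<open>2 ^ 100 * g\<close>, so one division provides the rounded-up
  logarithm of \<open>n\<close>.\<close>

definition start_code :: "stmt list" where
  "start_code = [Asg 9 (divE WL (Cn (2 ^ 100))), Asg 2 (Bn Equal (Vr 1) (Cn 1)), Asg 4 (Cn 1), Asg 3 (Cn 0)]"

definition radix_code :: "stmt list" where
  "radix_code = [Asg 6 (divE (subE (addE (Vr 4) (Vr 5)) (Cn 1)) (Vr 5)), Asg 7 (pow2E (Vr 6)),
     Asg 8 (divE (subE (addE (Vr 0) (Vr 7)) (Cn 1)) (Vr 7)), Asg 10 (addE (divE (mulE (Vr 7) (Vr 8)) (Vr 9)) (Cn 1))]"

definition main_code :: "nat \<Rightarrow> stmt list" where
  "main_code k0 = start_code @ For 11 (Vr 9) log_code # For 11 WL root_code # replicate k0 pass_count_step @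
     radix_code @ levels_code # nodes_code # [Asg 0 (adrE (Cn 11) (Cn 0) (Cn 0) (Vr 3))]"

definition wavelet_prog :: "real \<Rightarrow> prog" where
  "wavelet_prog \<epsilon> = move_args @ comps (main_code (nat \<lceil>1 / \<epsilon>\<rceil>))"

definition main_cost :: nat where
  "main_cost = 2 * (cost start_code + cost log_code + cost root_code + stmt_cost pass_count_step + cost radix_code +
     esz (Vr 9) + esz WL + level.level_cost + 2 * node_cost + esz (addE (Vr 4) (Cn 1)) + esz (Vr 4) + esz (pow2E (Vr 11)) +
     cost [Asg 0 (adrE (Cn 11) (Cn 0) (Cn 0) (Vr 3))] + 20)"

text \<open>Exponent 25 is what \<open>w ^ 2 * r ^ 3\<close> becomes under
  \<open>w \<le> r ^ 11\<close>. With \<open>2 ^ k\<close> the leading power of \<open>r\<close>, it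
  suffices that \<open>25 * (k + 1) \<le> 2 ^ k\<close>, which holds from \<open>k = 10\<close>
  on.\<close>

lemma power25_le: "1024 \<le> r \<Longrightarrow> r ^ 25 \<le> 2 ^ r" for r :: nat
proof -
  assume r: "1024 \<le> r"
  obtain k where k: "2 ^ k \<le> r" "r < 2 ^ (k + 1)" using ex_power_ivl1[of 2 r] r by auto
  have "(2::nat) ^ 10 < 2 ^ (k + 1)" using r k by simp
  then have k10: "10 \<le> k" using power_less_imp_less_exp[of "2::nat" 10 "k + 1"] by simp
  have "25 * (k + 1) \<le> 2 ^ k" using k10
  proof (induction k rule: dec_induct)
    case (step k)
    then show ?case by simp
  qed simp
  then have e: "25 * (k + 1) \<le> r" using k by linarith
  have "r ^ 25 \<le> (2 ^ (k + 1)) ^ 25" using k by (intro power_mono) auto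
  also have "\<dots> = 2 ^ (25 * (k + 1))" by (simp only: power_mult[symmetric] mult.commute)
  also have "\<dots> \<le> 2 ^ r" using e by (intro power_increasing) auto
  finally show ?thesis .
qed

text \<open>The size of the word makes \<open>r\<close> at least \<open>1024 = 2 ^ 10\<close>. Then
  \<open>(r + 1) ^ 10 \<le> 2 ^ 10 * r ^ 10 \<le> r ^ 11\<close>, so \<open>w\<close> is polynomial
  in \<open>r\<close> and the exponential bound of \<open>good\<close> follows.\<close>

lemma good_root:
  assumes r: "r ^ 10 \<le> w" "\<And>u. u < w \<Longrightarrow> u ^ 10 \<le> w \<Longrightarrow> u \<le> r" and w: "2 ^ 100 \<le> w" "w < HH w"
  shows "good w r" "w < (r + 1) ^ 10" "1024 \<le> r"
proof -
  have "(1024::nat) < 2 ^ 100" by simp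
  then have "(1024::nat) < w" using w(1) by linarith
  moreover have "(1024::nat) ^ 10 \<le> w" using w(1) by simp
  ultimately show r1: "1024 \<le> r" by (rule r(2))
  show w1: "w < (r + 1) ^ 10"
  proof (rule ccontr)
    assume a: "\<not> w < (r + 1) ^ 10"
    have "(r + 1) ^ 1 < (r + 1) ^ 10" using r1 by (intro power_strict_increasing) auto
    then have "r + 1 < w" using a by simp
    then show False using r(2)[of "r + 1"] a by simp
  qed
  have "(r + 1) ^ 10 \<le> (2 * r) ^ 10" using r1 by (intro power_mono) auto
  then have "w \<le> 2 ^ 10 * r ^ 10" using w1 by (simp add: power_mult_distrib)
  also have "\<dots> \<le> r * r ^ 10" using r1 by (intro mult_right_mono) auto
  finally have "w \<le> r ^ 11" by (simp flip: power_Suc)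
  then have "w ^ 2 \<le> (r ^ 11) ^ 2" by (intro power_mono) auto
  then have "w ^ 2 * r ^ 3 \<le> (r ^ 11) ^ 2 * r ^ 3" by (intro mult_right_mono) auto
  also have "\<dots> = r ^ 25" by (simp flip: power_mult power_add)
  also have "\<dots> \<le> 2 ^ r" by (rule power25_le[OF r1])
  finally have "w ^ 2 * r ^ 3 \<le> 2 ^ r" .
  moreover have "r ^ 1 \<le> r ^ 10" using r1 by (intro power_increasing) auto
  ultimately show "good w r" using r(1) r1 w(2) by (simp add: good_def)
qed

section \<open>The parameters of an input\<close>

locale input =
  fixes S :: "nat list" and \<sigma> k0 :: nat
  assumes valid: "valid_input \<sigma> S" and k0: "0 < k0"
begin

definition n :: nat where "n = length S"
definition g :: nat where "g = nat \<lceil>lg n\<rceil>"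
definition w :: nat where "w = 2 ^ 100 * g"
definition L :: nat where "L = max 1 (nat \<lceil>log 2 (real \<sigma>)\<rceil>)"
definition K :: nat where "K = min k0 L"
definition d :: nat where "d = (L + K - 1) div K"
definition R :: nat where "R = 2 ^ d"
definition nb :: nat where "nb = (n + R - 1) div R"
definition Mc :: nat where "Mc = R * nb div g + 1"
definition ad :: nat where "ad = of_bool (\<sigma> = 1)"
definition f :: "nat \<Rightarrow> nat" where "f i = S ! i + ad"

lemma n: "1 \<le> n" "1 \<le> \<sigma>" "\<sigma> \<le> n"
proof -
  have v: "S \<noteq> []" "set S \<subseteq> {0..<\<sigma>}" "\<sigma> \<le> length S" using valid by (simp_all add: valid_input_def)
  then have "hd S \<in> {0..<\<sigma>}" using hd_in_set by blast
  then show "1 \<le> \<sigma>" by simp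
  show "1 \<le> n" using v(1) unfolding n_def by (cases S) simp_all
  show "\<sigma> \<le> n" using v(3) by (simp only: n_def)
qed

lemma g: "1 \<le> g" "n \<le> 2 ^ g" "g \<le> n" "real g \<le> 2 * lg n" "lg n \<le> real g" "g < 2 ^ g"
proof -
  have l1: "1 \<le> lg n" by (simp add: lg_def)
  have rg: "real g < lg n + 1" "lg n \<le> real g" using l1 by (simp_all add: g_def, linarith)
  show "lg n \<le> real g" "real g \<le> 2 * lg n" using rg l1 by linarith+
  show "1 \<le> g" using rg l1 by linarith
  have "real n = 2 powr (log 2 n)" using n(1) by simp
  also have "\<dots> \<le> 2 powr (real g)" using rg by (intro powr_mono) (auto simp: lg_def)
  also have "\<dots> = real (2 ^ g)" by (simp add: powr_realpow)
  finally show "n \<le> 2 ^ g" by linarith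
  have "real n \<le> real (2 ^ n)" using less_exp[of n] by linarith
  then have "real n \<le> 2 powr (real n)" by (simp add: powr_realpow)
  then have "log 2 n \<le> real n" using n(1) by (simp add: log_le_iff)
  then have "lg n \<le> real n" using n(1) by (simp add: lg_def)
  then show "g \<le> n" using rg by linarith
  show "g < 2 ^ g" by (rule less_exp)
qed

lemma L: "1 \<le> L" "\<sigma> \<le> 2 ^ L" "L = 1 \<or> 2 ^ (L - 1) < \<sigma>" "2 ^ (L - 1) \<le> \<sigma>" "L \<le> g" "2 ^ L \<le> 2 * n" "real L \<le> 2 * lg \<sigma>"
proof -
  show 1: "1 \<le> L" by (simp add: L_def)
  have s: "real \<sigma> = 2 powr (log 2 \<sigma>)" using n(2) by simp
  have "log 2 \<sigma> \<le> real L" unfolding L_def by linarith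
  then have "2 powr (log 2 \<sigma>) \<le> 2 powr (real L)" by (rule powr_mono) simp
  also have "\<dots> = real (2 ^ L)" by (simp add: powr_realpow)
  finally show "\<sigma> \<le> 2 ^ L" using s by linarith
  have lt: "L = 1 \<or> real (L - 1) < log 2 \<sigma>" unfolding L_def by (auto simp: max_def of_nat_diff) linarith+
  show 2: "L = 1 \<or> 2 ^ (L - 1) < \<sigma>"
  proof (cases "L = 1")
    case False
    then have "2 powr (real (L - 1)) < 2 powr (log 2 \<sigma>)" using lt by (intro powr_less_mono) auto
    moreover have "2 powr (real (L - 1)) = real (2 ^ (L - 1))" by (simp add: powr_realpow)
    ultimately show ?thesis using s by linarith
  qed simp
  then show 3: "2 ^ (L - 1) \<le> \<sigma>" using n(2) by auto
  show "L \<le> g"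
  proof (cases "L = 1")
    case False
    then have "(2::nat) ^ (L - 1) < 2 ^ g" using 2 n g by linarith
    then show ?thesis using power_less_imp_less_exp[of "2::nat" "L - 1" g] by simp
  qed (use g in simp)
  have "(2::nat) ^ L = 2 * 2 ^ (L - 1)" using 1 by (simp flip: power_Suc)
  then show "2 ^ L \<le> 2 * n" using 3 n by linarith
  show "real L \<le> 2 * lg \<sigma>" using lt unfolding lg_def by (auto simp: max_def)
qed

text \<open>Exactly the condition that the search loop of the program establishes.\<close>

lemma L_unique:
  assumes "1 \<le> l" "\<sigma> \<le> 2 ^ l" "l = 1 \<or> 2 ^ (l - 1) < \<sigma>"
  shows "l = L"
proof -
  have "a \<le> b" if "1 \<le> b" "\<sigma> \<le> 2 ^ b" "a = 1 \<or> 2 ^ (a - 1) < \<sigma>" for a b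
  proof (cases "a = 1")
    case False
    then have "(2::nat) ^ (a - 1) < 2 ^ b" using that by linarith
    then show ?thesis using power_less_imp_less_exp[of "2::nat" "a - 1" b] by simp
  qed (use that in simp)
  then show ?thesis using assms L by (meson le_antisym)
qed

lemma K: "1 \<le> K" "K \<le> L" "K \<le> k0"
  using L(1) k0 by (auto simp: K_def)

lemma d: "L \<le> K * d" "K * d \<le> 2 * L" "1 \<le> d" "d \<le> L" "d - 1 = (L - 1) div K"
proof -
  have LK: "L + K - 1 = (L - 1) + K" using L(1) by simp
  have dv: "d = (L - 1) div K + 1" unfolding d_def LK by (rule div_add_self2) (use K(1) in linarith)
  show e: "d - 1 = (L - 1) div K" and d1: "1 \<le> d" unfolding dv by simp_all
  have "K * ((L - 1) div K) + (L - 1) mod K = L - 1" by simp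
  moreover have "(L - 1) mod K < K" using K(1) by simp
  moreover have "K * d = K * ((L - 1) div K) + K" unfolding dv by simp
  ultimately show "L \<le> K * d" "K * d \<le> 2 * L" using K(2) L(1) by linarith+
  have "(L - 1) div K \<le> L - 1" by (rule div_le_dividend)
  then show "d \<le> L" using e d1 L(1) by linarith
qed

lemma R: "R \<le> 2 ^ L" "1 \<le> R" "R * nb \<le> n + R - 1"
  using d(4) by (auto simp: R_def nb_def intro: power_increasing)

lemma w: "w div 16 = 2 ^ 96 * g" "2 ^ 100 \<le> w" "w = word_len (2 ^ 100) (length S)"
  using g(1) by (simp_all add: w_def word_len_def g_def n_def)

text \<open>The search for \<open>r\<close> evaluates tenth powers of numbers below
  \<open>w\<close>; they must not overflow.\<close>

lemma w10: "w ^ 10 < 2 ^ w" 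
proof -
  have "w \<le> 2 ^ 100 * 2 ^ g" unfolding w_def using g(6) by (intro mult_left_mono) auto
  also have "\<dots> = 2 ^ (100 + g)" by (simp only: power_add)
  finally have "w ^ 10 \<le> (2 ^ (100 + g)) ^ 10" by (intro power_mono) auto
  also have "\<dots> = 2 ^ ((100 + g) * 10)" by (rule power_mult[symmetric])
  also have "\<dots> < 2 ^ w" using g(1) by (intro power_strict_increasing) (simp_all add: w_def)
  finally show ?thesis .
qed

text \<open>Every quantity is at most a constant times \<open>2 ^ g\<close>, the word length itself
  contributing the factor \<open>2 ^ 100\<close>, while \<open>HH w\<close> is
  \<open>2 ^ (2 ^ 96 * g)\<close>. This is where the huge constant in the word length pays
  off.\<close>

lemma room: "8 * (n + R + R * nb + g + K + L + w + 2 ^ g + 2 ^ L + 32) < HH w"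
proof -
  define X :: nat where "X = 2 ^ g"
  have L2: "2 ^ L \<le> X" unfolding X_def using L(5) by (intro power_increasing) auto
  have nX: "n \<le> X" "g < X" using g by (simp_all add: X_def)
  then have X: "n \<le> X" "R \<le> X" "R * nb \<le> 2 * X" "g \<le> X" "K \<le> X" "L \<le> X" "1 \<le> X"
    using R L2 L(5) K(2) by linarith+
  have wX: "w \<le> 2 ^ 100 * X" unfolding w_def using X(4) by (intro mult_left_mono) auto
  have "n + R + R * nb + g + K + L + w + X + 2 ^ L + 32 \<le> 2 ^ 100 * X + 41 * X"
    using X wX L2 by linarith
  then have "8 * (n + R + R * nb + g + K + L + w + X + 2 ^ L + 32) \<le> 8 * (2 ^ 100 * X + 41 * X)"
    by (rule mult_left_mono) simp
  also have "\<dots> = (8 * (2 ^ 100 + 41)) * X" by (simp only: add_mult_distrib mult.assoc)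
  also have "\<dots> \<le> 2 ^ 104 * X" by (rule mult_right_mono) simp_all
  also have "\<dots> = 2 ^ (104 + g)" unfolding X_def by (simp only: power_add)
  also have "\<dots> < 2 ^ (2 ^ 96 * g)" using g(1) by (intro power_strict_increasing) simp_all
  finally show ?thesis unfolding HH_def w(1) X_def .
qed

lemma f: "i < n \<Longrightarrow> f i < 2 ^ L"
proof -
  assume "i < n"
  then have "S ! i \<in> set S" by (simp add: n_def)
  then have s: "S ! i < \<sigma>" using valid unfolding valid_input_def by (metis atLeastLessThan_iff subsetD)
  show ?thesis
  proof (cases "\<sigma> = 1")
    case True
    have "(2::nat) ^ 1 \<le> 2 ^ L" using L(1) by (intro power_increasing) auto
    moreover have "f i = 1" unfolding f_def ad_def using True s by simp
    ultimately show ?thesis unfolding power_one_right by linarith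
  qed (use s L(2) in \<open>simp add: f_def ad_def\<close>)
qed

lemma is_level: "level w n L K d R nb g Mc f"
proof
  show "(16::nat) < 2 ^ w"
  proof -
    have "(5::nat) < 2 ^ 100" by simp
    then have "(2::nat) ^ 5 \<le> 2 ^ w" using w(2) by (intro power_increasing) auto
    then show ?thesis by simp
  qed
  show "0 < w" "g + 2 < w" using g(1) by (simp_all add: w_def)
  have "(2::nat) ^ L \<le> 2 ^ g" by (rule power_increasing[OF L(5)]) simp
  moreover have "(2::nat) ^ (g + 2) = 4 * 2 ^ g" by (simp add: power_add)
  moreover have "0 < (2::nat) ^ g" by simp
  ultimately show "R * nb < 2 ^ (g + 2)" using R g(2) by linarith
qed (use n g d f room R_def nb_def Mc_def in auto)

end

text \<open>A directory has at most \<open>10 * x / r\<close> bits, and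
  \<open>lg x \<le> w < (r + 1) ^ 10 \<le> (2 * r) ^ 10\<close> turns \<open>1 / r\<close> into at
  most twice the inverse tenth root of \<open>lg x\<close>. The bound thus depends on the length of
  the bitmap alone.\<close>

definition aux_bound :: "nat \<Rightarrow> real" where
  "aux_bound x = 20 * real x / lg x powr (1 / 10)"

lemma aux_bound_small: "aux_bound \<in> o(\<lambda>m. real m)"
  unfolding aux_bound_def lg_def by real_asymp

lemma aux_bits_bound_lg:
  assumes good: "good w r" and w: "w < (r + 1) ^ 10" "lg x \<le> real w"
  shows "real (aux_bits w r x) \<le> aux_bound x"
proof -
  have r: "1 \<le> r" using goodD(1)[OF good] by simp
  have l1: "1 \<le> lg x" by (simp add: lg_def)
  have "real w < real ((r + 1) ^ 10)" using w(1) by linarith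
  then have "lg x \<le> real (r + 1) ^ 10" using w(2) by simp
  then have "lg x powr (1 / 10) \<le> (real (r + 1) ^ 10) powr (1 / 10)" using l1 by (intro powr_mono2) auto
  also have "\<dots> = real (r + 1)"
  proof -
    define y where "y = real (r + 1)"
    have y: "0 < y" by (simp add: y_def)
    then have "y ^ 10 = y powr 10" using powr_realpow[of y 10] by simp
    then have "(y ^ 10) powr (1 / 10) = y powr (10 * (1 / 10))" by (simp only: powr_powr)
    then show ?thesis using y by (simp add: y_def)
  qed
  also have "\<dots> \<le> 2 * real r" using r by simp
  finally have le: "lg x powr (1 / 10) \<le> 2 * real r" .
  have "real (aux_bits w r x * r) \<le> real (10 * x)" using aux_bits_bound[OF good, of x] by linarith
  then have a: "real (aux_bits w r x) * (2 * real r) \<le> 20 * real x" by (simp add: mult.commute)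
  have "real (aux_bits w r x) * lg x powr (1 / 10) \<le> real (aux_bits w r x) * (2 * real r)"
    using le by (intro mult_left_mono) auto
  then have "real (aux_bits w r x) * lg x powr (1 / 10) \<le> 20 * real x" using a by linarith
  moreover have "0 < lg x powr (1 / 10)" using l1 by simp
  ultimately show ?thesis unfolding aux_bound_def by (simp add: pos_le_divide_eq)
qed

lemma loop_bound: "N \<le> U \<Longrightarrow> 1 \<le> U \<Longrightarrow> e + 4 + N * (k + e + 4) \<le> (k + 2 * e + 8) * U" for N U e k :: nat
proof -
  assume a: "N \<le> U" "1 \<le> U"
  have "e + 4 + N * (k + e + 4) \<le> (e + 4) * U + U * (k + e + 4)"
    by (intro add_mono mult_right_mono le_mult_pos) (use a in simp_all)
  also have "\<dots> = (k + 2 * e + 8) * U" by (simp add: algebra_simps)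
  finally show ?thesis .
qed

section \<open>Correctness and cost of the whole program\<close>

context input
begin

lemmas sizes = n g w R

interpretation level w n L K d R nb g Mc ad f
  by (rule is_level)

lemma wbig: "g + 100 < w" "2 ^ 100 < (2::nat) ^ w" "L + 1 < w"
proof -
  show "g + 100 < w" using sizes(4) by (simp add: w_def)
  then show "2 ^ 100 < (2::nat) ^ w" by (intro power_strict_increasing) auto
  show "L + 1 < w" using L(5) \<open>g + 100 < w\<close> by simp
qed

lemma lt2w: "x \<le> w + 1 \<Longrightarrow> x < 2 ^ w"
proof -
  have "8 * w + 256 < HH w" using room by simp
  then show "x < 2 ^ w" if "x \<le> w + 1" using that HH_le[of w] by linarith
qed

definition base0 :: "(nat \<Rightarrow> nat) \<Rightarrow> bool" where
  "base0 s \<longleftrightarrow> s 0 = n \<and> s 1 = \<sigma> \<and> s 2 = ad \<and> s 9 = g \<and> s 5 = 0"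

lemma ht_start: "ht w UNIV UNIV start_code (input_regs n \<sigma>) m0 (\<lambda>s m. m = m0 \<and> base0 s \<and> s 4 = 1 \<and> s 3 = 0)
    (cost start_code) (cost start_code)"
proof -
  have 1: "ev w UNIV s m (divE WL (Cn (2 ^ 100))) g" for s m
    by (rule ev_eq[OF ev_Div[OF ev_WL ev_N[OF wbig(2)]]]) (simp add: w_def)
  have 2: "ev w UNIV s m (Bn Equal (Vr 1) (Cn 1)) ad" if "s 1 = \<sigma>" for s m
    unfolding ad_def by (rule ev_Equal[OF ev_V ev_C]) (use that in auto)
  show ?thesis unfolding start_code_def
    by (rule ht_hs, rule hs_Asg[OF 1], rule hs_Asg[OF 2], simp add: input_regs_def, rule hs_Asg[OF ev_C], simp,
        rule hs_Asg[OF ev_C], simp, rule hs_Nil) (simp add: base0_def input_regs_def)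
qed

lemma ht_log:
  assumes s: "m = m0 \<and> base0 s \<and> s 4 = 1 \<and> s 3 = 0"
  shows "ht w UNIV UNIV [For 11 (Vr 9) log_code] s m (\<lambda>s m. m = m0 \<and> base0 s \<and> s 4 = L \<and> s 3 = 0)
    (esz (Vr 9) + 4 + g * (cost log_code + esz (Vr 9) + 4)) (esz (Vr 9) + 4 + g * (cost log_code + esz (Vr 9) + 4))"
proof (rule ht_For[where I="\<lambda>t s m. m = m0 \<and> base0 s \<and> s 3 = 0 \<and> 1 \<le> s 4 \<and> (s 4 = 1 \<or> 2 ^ (s 4 - 1) < \<sigma>) \<and>
      (\<forall>u<t. 2 ^ u < \<sigma> \<longrightarrow> u < s 4)"])
  fix t s m assume t: "t < g" and s11: "s 11 = t"
    and I: "m = m0 \<and> base0 s \<and> s 3 = 0 \<and> 1 \<le> s 4 \<and> (s 4 = 1 \<or> 2 ^ (s 4 - 1) < \<sigma>) \<and> (\<forall>u<t. 2 ^ u < \<sigma> \<longrightarrow> u < s 4)"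
  have tw: "t < w" "t + 1 < 2 ^ w" using t wbig(1) lt2w[of "t + 1"] by auto
  have v: "ev w UNIV s m (Vr 11) t" "ev w UNIV s m (Vr 1) \<sigma>" using s11 I by (simp_all add: ev_V base0_def)
  have c: "ev w UNIV s m (lessE (pow2E (Vr 11)) (Vr 1)) (of_bool (2 ^ t < \<sigma>))"
    by (rule ev_Less[OF ev_pow2[OF v(1) tw(1)] v(2)])
  have a: "ev w UNIV s m (addE (Vr 11) (Cn 1)) (t + 1)" by (rule ev_Add[OF v(1) ev_C tw(2)]) simp
  show "ht w UNIV UNIV log_code s m (\<lambda>s' m'. s' 11 = t \<and> (m' = m0 \<and> base0 (s'(11 := Suc t)) \<and> (s'(11 := Suc t)) 3 = 0 \<and>
      1 \<le> (s'(11 := Suc t)) 4 \<and> ((s'(11 := Suc t)) 4 = 1 \<or> 2 ^ ((s'(11 := Suc t)) 4 - 1) < \<sigma>) \<and>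
      (\<forall>u<Suc t. 2 ^ u < \<sigma> \<longrightarrow> u < (s'(11 := Suc t)) 4))) (cost log_code) (cost log_code)"
    unfolding log_code_def
  proof (rule ht_hs, rule hs_When[OF c], goal_cases)
    case 1
    then have "2 ^ t < \<sigma>" by (cases "2 ^ t < \<sigma>") auto
    then show ?case unfolding append_Cons append_Nil
      by (intro hs_Asg[OF a] hs_Nil) (use I s11 in \<open>auto simp: base0_def less_Suc_eq\<close>)
  next
    case 2
    then have "\<not> 2 ^ t < \<sigma>" by (cases "2 ^ t < \<sigma>") auto
    then show ?case unfolding append_Nil
      by (intro hs_Nil) (use I s11 in \<open>auto simp: base0_def less_Suc_eq\<close>)
  qed
next
  fix s m assume I: "m = m0 \<and> base0 s \<and> s 3 = 0 \<and> 1 \<le> s 4 \<and> (s 4 = 1 \<or> 2 ^ (s 4 - 1) < \<sigma>) \<and> (\<forall>u<g. 2 ^ u < \<sigma> \<longrightarrow> u < s 4)"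
  have "\<sigma> \<le> 2 ^ s 4"
  proof (rule ccontr)
    assume a: "\<not> \<sigma> \<le> 2 ^ s 4"
    then have "(2::nat) ^ s 4 < 2 ^ g" using sizes(1-5) by linarith
    then have "s 4 < g" using power_less_imp_less_exp[of "2::nat" "s 4" g] by simp
    then show False using I a by auto
  qed
  then have "s 4 = L" using I by (intro L_unique) auto
  then show "m = m0 \<and> base0 s \<and> s 4 = L \<and> s 3 = 0" using I by simp
qed (use s sizes(11) wbig lt2w[of g] in \<open>auto simp: base0_def ev_V\<close>)

definition root_done :: "nat \<Rightarrow> bool" where
  "root_done r \<longleftrightarrow> r ^ 10 \<le> w \<and> (\<forall>u<w. u ^ 10 \<le> w \<longrightarrow> u \<le> r)"

lemma root_good: "root_done r \<Longrightarrow> good w r" "root_done r \<Longrightarrow> w < (r + 1) ^ 10"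
proof -
  have "8 * w + 256 < HH w" using room by simp
  then have "w < HH w" by linarith
  then show "root_done r \<Longrightarrow> good w r" "root_done r \<Longrightarrow> w < (r + 1) ^ 10"
    using good_root[of r w] sizes(11) unfolding root_done_def by blast+
qed

lemma ht_root:
  assumes s: "m = m0 \<and> base0 s \<and> s 4 = L \<and> s 3 = 0"
  shows "ht w UNIV UNIV [For 11 WL root_code] s m (\<lambda>s m. m = m0 \<and> base0 s \<and> s 4 = L \<and> root_done (s 3))
    (esz WL + 4 + w * (cost root_code + esz WL + 4)) (esz WL + 4 + w * (cost root_code + esz WL + 4))"
proof (rule ht_For[where I="\<lambda>t s m. m = m0 \<and> base0 s \<and> s 4 = L \<and> s 3 ^ 10 \<le> w \<and> (\<forall>u<t. u ^ 10 \<le> w \<longrightarrow> u \<le> s 3)"])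
  fix t s m assume t: "t < w" and s11: "s 11 = t"
    and I: "m = m0 \<and> base0 s \<and> s 4 = L \<and> s 3 ^ 10 \<le> w \<and> (\<forall>u<t. u ^ 10 \<le> w \<longrightarrow> u \<le> s 3)"
  have pw: "t ^ k < 2 ^ w" if "k \<le> 10" for k
  proof -
    have "t ^ k \<le> w ^ k" using t by (intro power_mono) auto
    also have "\<dots> \<le> w ^ 10" using that t by (intro power_increasing) auto
    finally show ?thesis using w10 by linarith
  qed
  have sq: "ev w UNIV s m (sqE e) (t ^ (k + k))" if "ev w UNIV s m e (t ^ k)" "k + k \<le> 10" for e k
    unfolding power_add by (rule ev_Mul[OF that(1,1)]) (use pw[OF that(2)] in \<open>simp add: power_add\<close>)
  have v: "ev w UNIV s m (Vr 11) (t ^ 1)" using s11 by (simp add: ev_V)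
  have v2: "ev w UNIV s m (sqE (Vr 11)) (t ^ (1 + 1))" by (rule sq[OF v]) simp
  have v8: "ev w UNIV s m (sqE (sqE (sqE (Vr 11)))) (t ^ (1 + 1 + (1 + 1) + (1 + 1 + (1 + 1))))"
    by (rule sq[OF sq[OF v2]]) simp_all
  have "ev w UNIV s m (mulE (sqE (sqE (sqE (Vr 11)))) (sqE (Vr 11))) (t ^ 8 * t ^ 2)"
    by (rule ev_Mul) (use v8 v2 pw[of 10] in \<open>simp_all add: numeral_2_eq_2[symmetric] flip: power_add\<close>)
  then have v10: "ev w UNIV s m (mulE (sqE (sqE (sqE (Vr 11)))) (sqE (Vr 11))) (t ^ 10)" by (simp flip: power_add)
  have w1: "ev w UNIV s m (addE WL (Cn 1)) (w + 1)" by (rule ev_Add[OF ev_WL ev_C lt2w]) auto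
  note c = ev_Less[OF v10 w1]
  show "ht w UNIV UNIV root_code s m (\<lambda>s' m'. s' 11 = t \<and> (m' = m0 \<and> base0 (s'(11 := Suc t)) \<and> (s'(11 := Suc t)) 4 = L \<and>
      (s'(11 := Suc t)) 3 ^ 10 \<le> w \<and> (\<forall>u<Suc t. u ^ 10 \<le> w \<longrightarrow> u \<le> (s'(11 := Suc t)) 3))) (cost root_code) (cost root_code)"
    unfolding root_code_def
  proof (rule ht_hs, rule hs_When[OF c], goal_cases)
    case 1
    then have "t ^ 10 \<le> w" by (cases "t ^ 10 < w + 1") auto
    then show ?case unfolding append_Cons append_Nil
      by (intro hs_Asg[OF v[unfolded power_one_right]] hs_Nil) (use I s11 in \<open>auto simp: base0_def less_Suc_eq\<close>)
  next
    case 2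
    then have "\<not> t ^ 10 \<le> w" by (cases "t ^ 10 < w + 1") auto
    then show ?case unfolding append_Nil
      by (intro hs_Nil) (use I s11 in \<open>auto simp: base0_def less_Suc_eq\<close>)
  qed
qed (use s sizes(11) wbig lt2w[of w] in \<open>auto simp: base0_def ev_WL root_done_def\<close>)

lemma hs_pass_count:
  "s 4 = L \<Longrightarrow> s 5 \<le> L \<Longrightarrow> Q (s(5 := min (s 5 + k) L)) m \<Longrightarrow> hs w UNIV UNIV (replicate k pass_count_step) s m Q"
proof (induction k arbitrary: s)
  case 0
  then show ?case by (simp add: hs_Nil)
next
  case (Suc k)
  have e: "ev w UNIV s m (addE (Vr 5) (lessE (Vr 5) (Vr 4))) (s 5 + of_bool (s 5 < L))"
    by (intro ev_Add ev_Less ev_V lt2w refl) (use Suc.prems wbig in auto)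
  have q: "min (s 5 + of_bool (s 5 < L) + k) L = min (s 5 + Suc k) L" using Suc.prems(2) by auto
  have "hs w UNIV UNIV (replicate k pass_count_step) (s(5 := s 5 + of_bool (s 5 < L))) m Q"
  proof (rule Suc.IH)
    have "(s(5 := v))(5 := min ((s(5 := v)) 5 + k) L) = s(5 := min (s 5 + Suc k) L)"
      if "v = s 5 + of_bool (s 5 < L)" for v by (simp only: that fun_upd_upd fun_upd_same q)
    from this[OF refl] show "Q ((s(5 := s 5 + of_bool (s 5 < L)))
        (5 := min ((s(5 := s 5 + of_bool (s 5 < L))) 5 + k) L)) m" using Suc.prems(3) by (simp only:)
  qed (use Suc.prems in auto)
  then show ?case unfolding replicate_Suc pass_count_step_def by (rule hs_Asg[OF e])
qed

lemma ht_radix: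
  assumes s: "m = m0 \<and> base0 s \<and> s 4 = L \<and> root_done (s 3)"
  shows "ht w UNIV UNIV (replicate k0 pass_count_step @ radix_code) s m (\<lambda>s m. m = m0 \<and> glob s \<and> root_done (s 3))
    (cost (replicate k0 pass_count_step) + cost radix_code) (cost (replicate k0 pass_count_step) + cost radix_code)"
proof (rule ht_append)
  show "ht w UNIV UNIV (replicate k0 pass_count_step) s m (\<lambda>s' m'. m' = m0 \<and> s' = s(5 := K))
      (cost (replicate k0 pass_count_step)) (cost (replicate k0 pass_count_step))"
    by (rule ht_hs, rule hs_pass_count) (use s in \<open>auto simp: base0_def K_def\<close>)
  fix s' m' assume a: "m' = m0 \<and> s' = s(5 := K)"
  let ?s1 = "s'(6 := d)" and ?s2 = "s'(6 := d, 7 := R)" and ?s3 = "s'(6 := d, 7 := R, 8 := nb)"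
  have h2: "n + R < 2 ^ w" "R * nb < 2 ^ w" "Mc < 2 ^ w"
  proof -
    have r: "8 * n + 8 * R < HH w" "8 * (R * nb) + 8 < HH w" using room by simp_all
    then show "n + R < 2 ^ w" "R * nb < 2 ^ w" using HH_le[of w] by linarith+
    have "R * nb div g \<le> R * nb" by simp
    then have "Mc \<le> R * nb + 1" by (simp add: Mc_def)
    then show "Mc < 2 ^ w" using r HH_le[of w] by linarith
  qed
  have s0: "s' 0 = n" "s' 4 = L" "s' 5 = K" "s' 9 = g" using a s by (simp_all add: base0_def)
  have 1: "ev w UNIV s' m' (divE (subE (addE (Vr 4) (Vr 5)) (Cn 1)) (Vr 5)) d" unfolding d_def
    by (intro ev_Div ev_Sub ev_Add ev_V ev_C) (use a s K L(5) lt2w[of "L + K"] sizes(4) wbig in \<open>auto simp: w_def\<close>)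
  have 2: "ev w UNIV ?s1 m' (pow2E (Vr 6)) R" unfolding R_def
    by (rule ev_pow2[OF ev_V]) (use d(4) wbig in auto)
  have 3: "ev w UNIV ?s2 m' (divE (subE (addE (Vr 0) (Vr 7)) (Cn 1)) (Vr 7)) nb" unfolding nb_def
    by (intro ev_Div ev_Sub ev_Add ev_V ev_C) (use s0 sizes(14) h2 in simp_all)
  have 4: "ev w UNIV ?s3 m' (addE (divE (mulE (Vr 7) (Vr 8)) (Vr 9)) (Cn 1)) Mc" unfolding Mc_def
    by (intro ev_Add ev_Div ev_Mul ev_V ev_C) (use s0 h2(2) h2(3)[unfolded Mc_def] in simp_all)
  show "ht w UNIV UNIV radix_code s' m' (\<lambda>s m. m = m0 \<and> glob s \<and> root_done (s 3)) (cost radix_code) (cost radix_code)"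
    unfolding radix_code_def
    by (rule ht_hs, rule hs_Asg[OF 1], rule hs_Asg[OF 2], rule hs_Asg[OF 3], rule hs_Asg[OF 4], rule hs_Nil)
      (use a s in \<open>simp add: base0_def glob_def\<close>)
qed

lemma memory: "inp (input_mem S)" "1 \<le> kd w a \<Longrightarrow> input_mem S a = 0"
proof -
  show "inp (input_mem S)" unfolding inp_def input_mem_def f_def by (simp add: n_def)
  show "1 \<le> kd w a \<Longrightarrow> input_mem S a = 0" using kd_small[of a w] HHs(1)
    by (cases "a < n") (auto simp: input_mem_def n_def)
qed

text \<open>\<open>k0\<close> pays for the choice of the number of passes and \<open>w\<close> for
  the search of \<open>r\<close>; \<open>w\<close> also covers the packing of one word in the depth.
  In the work, \<open>5 * n\<close> bounds \<open>R * nb + n + g\<close>, since \<open>R\<close> is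
  at most \<open>2 * n\<close>.\<close>

abbreviation "dunit \<equiv> k0 + w + (K + 1) * (R + g)"
abbreviation "wunit \<equiv> k0 + w + (L + 1) * (K + 1) * (5 * n)"

lemma ht_main:
  assumes C: "query_cost \<le> C"
  shows "ht w UNIV UNIV (main_code k0) (input_regs n \<sigma>) (input_mem S)
    (\<lambda>s m. stores_tree w C aux_bound rank_prog select_prog m (s 0) (wavelet_tree \<sigma> S))
    (main_cost * dunit) (main_cost * wunit)"
proof -
  let ?a = "esz (addE (Vr 4) (Cn 1))" and ?p = "esz (pow2E (Vr 11))"
  let ?F = "[Asg 0 (adrE (Cn 11) (Cn 0) (Cn 0) (Vr 3))]"
  let ?T = "\<lambda>s m. stores_tree w C aux_bound rank_prog select_prog m (s 0) (wavelet_tree \<sigma> S)"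
  have fin: "ht w UNIV UNIV ?F s m ?T (cost ?F) (cost ?F)"
    if r: "root_done (s 3)" and d: "\<forall>l<L. \<forall>c<2 ^ l. ND (s 3) l c m" and lv: "\<And>l. l \<le> L \<Longrightarrow> level_done l m1" "inp m1" for s m m1
  proof (rule ht_hs, rule hs_Asg[where v="cell 11 0 0 (s 3)"], goal_cases)
    case 1
    have "s 3 < HH w" using root_good(1)[OF r] by (simp add: good_def)
    then show ?case by (intro ev_cell ev_C ev_V refl) (use HHs(10) in auto)
  next
    case 2
    have F: "real (aux_bits w (s 3) x) \<le> aux_bound x" if "x \<le> n" for x
    proof (rule aux_bits_bound_lg[OF root_good[OF r]])
      have "lg x \<le> lg n"
        using that by (cases "x = 0") (auto simp: lg_def max_def log_def divide_right_mono intro: order_trans)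
      also have "\<dots> \<le> real g" by (rule sizes)
      also have "\<dots> \<le> real w" using wbig(1) by simp
      finally show "lg x \<le> real w" .
    qed
    have "stores_tree w C aux_bound rank_prog select_prog m (cell 11 0 0 (s 3))
       (wavelet (0 * 2 ^ (L - 0)) (Suc 0 * 2 ^ (L - 0) - 1) (map f [0..<n]))"
      by (rule ND_stores_tree[OF root_good(1)[OF r] lv d F C]) (use L(1) in auto)
    moreover have "wavelet_tree \<sigma> S = wavelet 0 (2 ^ L - 1) (map f [0..<n])"
      using wavelet_tree_root[of S \<sigma>] valid unfolding L_def n_def f_def[abs_def] ad_def valid_input_def by blast
    ultimately show ?case by (intro hs_Nil) simp
  qed
  have lev: "ht w UNIV UNIV (levels_code # nodes_code # ?F) s m ?T
     ((?a + 1 + (K + 1) * (level_cost * (R + g))) + ((esz (Vr 4) + 1 + (?p + 1 + node_cost * (w + 1))) + cost ?F))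
     ((?a + 1 + (\<Sum>l<L + 1. (K + 1) * (level_cost * (R * nb + n + g)))) +
       ((esz (Vr 4) + 1 + (\<Sum>l<L. ?p + 1 + node_cost * (6 * n + 2 ^ l))) + cost ?F))"
    if s: "m = input_mem S \<and> glob s \<and> root_done (s 3)" for s m
  proof (rule ht_Cons[OF ht_levels])
    fix s1 m1 assume 1: "s1 = s \<and> inp m1 \<and> (\<forall>l\<le>L. level_done l m1)"
    show "ht w UNIV UNIV (nodes_code # ?F) s1 m1 ?T ((esz (Vr 4) + 1 + (?p + 1 + node_cost * (w + 1))) + cost ?F)
       ((esz (Vr 4) + 1 + (\<Sum>l<L. ?p + 1 + node_cost * (6 * n + 2 ^ l))) + cost ?F)"
    proof (rule ht_Cons[OF ht_nodes])
      fix s2 m2 assume "s2 = s1 \<and> (\<forall>l<L. \<forall>c<2 ^ l. ND (s 3) l c m2)"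
      then show "ht w UNIV UNIV ?F s2 m2 ?T (cost ?F) (cost ?F)" using 1 s by (intro fin[of s2 m2 m1]) auto
    qed (use s 1 root_good in auto)
  qed (use s memory in auto)
  have all: "ht w UNIV UNIV (main_code k0) (input_regs n \<sigma>) (input_mem S) ?T
     (cost start_code + ((esz (Vr 9) + 4 + g * (cost log_code + esz (Vr 9) + 4)) +
       ((esz WL + 4 + w * (cost root_code + esz WL + 4)) +
       ((cost (replicate k0 pass_count_step) + cost radix_code) +
       ((?a + 1 + (K + 1) * (level_cost * (R + g))) + ((esz (Vr 4) + 1 + (?p + 1 + node_cost * (w + 1))) + cost ?F))))))
     (cost start_code + ((esz (Vr 9) + 4 + g * (cost log_code + esz (Vr 9) + 4)) +
       ((esz WL + 4 + w * (cost root_code + esz WL + 4)) +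
       ((cost (replicate k0 pass_count_step) + cost radix_code) +
       ((?a + 1 + (\<Sum>l<L + 1. (K + 1) * (level_cost * (R * nb + n + g)))) +
       ((esz (Vr 4) + 1 + (\<Sum>l<L. ?p + 1 + node_cost * (6 * n + 2 ^ l))) + cost ?F))))))"
    unfolding main_code_def
    by (rule ht_append[OF ht_start], rule ht_Cons[OF ht_log], assumption, rule ht_Cons[OF ht_root], assumption,
        rule ht_append[OF ht_radix lev, unfolded append_assoc])
  have cr: "cost (replicate k0 pass_count_step) = stmt_cost pass_count_step * k0"
    by (simp add: cost_def sum_list_replicate)
  have tot: "cost start_code + ((esz (Vr 9) + 4 + g * (cost log_code + esz (Vr 9) + 4)) +
       ((esz WL + 4 + w * (cost root_code + esz WL + 4)) +
       ((cost (replicate k0 pass_count_step) + cost radix_code) + ((?a + 1 + X) + ((esz (Vr 4) + 1 + Y) + cost ?F)))))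
      \<le> main_cost * U"
    if U: "k0 + w \<le> U" and X: "X \<le> level_cost * U" and Y: "Y \<le> (?p + 1 + 2 * node_cost) * U" for U X Y
  proof -
    have U1: "1 \<le> U" "g \<le> U" "w \<le> U" "k0 \<le> U" using U k0 wbig(1) by auto
    have c: "x \<le> x * U" for x using U1(1) by simp
    have "cost start_code + ((esz (Vr 9) + 4 + g * (cost log_code + esz (Vr 9) + 4)) +
       ((esz WL + 4 + w * (cost root_code + esz WL + 4)) +
       ((cost (replicate k0 pass_count_step) + cost radix_code) + ((?a + 1 + X) + ((esz (Vr 4) + 1 + Y) + cost ?F)))))
      \<le> cost start_code * U + ((cost log_code + 2 * esz (Vr 9) + 8) * U + ((cost root_code + 2 * esz WL + 8) * U +
        ((stmt_cost pass_count_step * U + cost radix_code * U) + (((?a + 1) * U + level_cost * U) +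
        (((esz (Vr 4) + 1) * U + (?p + 1 + 2 * node_cost) * U) + cost ?F * U)))))"
      unfolding cr by (intro add_mono c loop_bound U1 X Y mult_left_mono) simp_all
    also have "\<dots> = (cost start_code + (cost log_code + 2 * esz (Vr 9) + 8) + (cost root_code + 2 * esz WL + 8) +
        stmt_cost pass_count_step + cost radix_code + (?a + 1) + level_cost + (esz (Vr 4) + 1) + (?p + 1 + 2 * node_cost) + cost ?F) * U"
      by (simp only: add_mult_distrib add.assoc)
    also have "\<dots> \<le> main_cost * U" unfolding main_cost_def by (intro mult_right_mono) simp_all
    finally show ?thesis .
  qed
  have le: "R * nb + n + g \<le> 5 * n" "1 \<le> n" using sizes L(6) by linarith+
  show ?thesis
  proof (rule ht_cost[OF all])
    have "(K + 1) * (level_cost * (R + g)) = level_cost * ((K + 1) * (R + g))" by (simp add: ac_simps)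
    also have "\<dots> \<le> level_cost * dunit" by (intro mult_left_mono) simp_all
    finally have X: "(K + 1) * (level_cost * (R + g)) \<le> level_cost * dunit" .
    have d1: "1 \<le> dunit" "w + 1 \<le> 2 * dunit" using k0 by simp_all
    have "?p + 1 + node_cost * (w + 1) \<le> (?p + 1) * dunit + node_cost * (2 * dunit)"
      using d1 by (intro add_mono mult_left_mono) simp_all
    also have "\<dots> = (?p + 1 + 2 * node_cost) * dunit" by (simp only: add_mult_distrib)
    finally have Y: "?p + 1 + node_cost * (w + 1) \<le> (?p + 1 + 2 * node_cost) * dunit" .
    show "cost start_code + ((esz (Vr 9) + 4 + g * (cost log_code + esz (Vr 9) + 4)) +
       ((esz WL + 4 + w * (cost root_code + esz WL + 4)) +
       ((cost (replicate k0 pass_count_step) + cost radix_code) +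
       ((?a + 1 + (K + 1) * (level_cost * (R + g))) + ((esz (Vr 4) + 1 + (?p + 1 + node_cost * (w + 1))) + cost ?F)))))
       \<le> main_cost * dunit" by (rule tot[OF _ X Y]) simp
  next
    define V where "V = (L + 1) * (K + 1) * (5 * n)"
    have "(\<Sum>l<L + 1. (K + 1) * (level_cost * (R * nb + n + g))) = level_cost * ((L + 1) * (K + 1) * (R * nb + n + g))"
      unfolding sum_constant card_lessThan of_nat_id by (simp only: mult.assoc mult.left_commute)
    also have "\<dots> \<le> level_cost * V" unfolding V_def using le by (intro mult_left_mono) simp_all
    also have "\<dots> \<le> level_cost * (k0 + w + V)" by (intro mult_left_mono) simp_all
    finally have X: "(\<Sum>l<L + 1. (K + 1) * (level_cost * (R * nb + n + g))) \<le> level_cost * (k0 + w + V)" .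
    have l2: "(2::nat) ^ l \<le> n" if "l < L" for l
    proof -
      have "(2::nat) ^ l \<le> 2 ^ (L - 1)" using that by (intro power_increasing) auto
      then show ?thesis using L(4) sizes(3) by linarith
    qed
    have "(\<Sum>l<L. ?p + 1 + node_cost * (6 * n + 2 ^ l)) \<le> (\<Sum>l<L. ?p + 1 + node_cost * (7 * n))"
      by (intro sum_mono add_left_mono mult_left_mono) (use l2 in auto)
    also have "\<dots> = (?p + 1) * L + node_cost * (L * (7 * n))" by (simp add: algebra_simps)
    also have "\<dots> \<le> (?p + 1) * V + node_cost * (2 * V)"
    proof (intro add_mono mult_left_mono)
      define T where "T = (L + 1) * (K + 1) * n"
      have "L * n \<le> T" unfolding T_def by (intro mult_right_mono) simp_all
      moreover have "L \<le> L * n" by (rule le_mult_pos) (use sizes(1) in simp)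
      moreover have "V = 5 * T" "L * (7 * n) = 7 * (L * n)" by (simp_all add: V_def T_def)
      ultimately show "L \<le> V" "L * (7 * n) \<le> 2 * V" by linarith+
    qed simp_all
    also have "\<dots> = (?p + 1 + 2 * node_cost) * V" by (simp only: add_mult_distrib)
    also have "\<dots> \<le> (?p + 1 + 2 * node_cost) * (k0 + w + V)" by (intro mult_left_mono) simp_all
    finally have Y: "(\<Sum>l<L. ?p + 1 + node_cost * (6 * n + 2 ^ l)) \<le> (?p + 1 + 2 * node_cost) * (k0 + w + V)" .
    show "cost start_code + ((esz (Vr 9) + 4 + g * (cost log_code + esz (Vr 9) + 4)) +
       ((esz WL + 4 + w * (cost root_code + esz WL + 4)) +
       ((cost (replicate k0 pass_count_step) + cost radix_code) +
       ((?a + 1 + (\<Sum>l<L + 1. (K + 1) * (level_cost * (R * nb + n + g)))) +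
       ((esz (Vr 4) + 1 + (\<Sum>l<L. ?p + 1 + node_cost * (6 * n + 2 ^ l))) + cost ?F))))) \<le> main_cost * wunit"
      by (rule tot[OF _ X[unfolded V_def] Y[unfolded V_def]]) simp
  qed
qed

text \<open>The point is the radix: \<open>R\<close> is twice \<open>2 ^ ((L - 1) div K)\<close>,
  and \<open>2 ^ (L - 1) \<le> \<sigma>\<close> together with \<open>K \<ge> 1 / \<epsilon>\<close>
  bounds this by \<open>2 * \<sigma> powr \<epsilon>\<close>.\<close>

lemma units_real:
  assumes e: "0 < \<epsilon>" "\<epsilon> < 1" "k0 = nat \<lceil>1 / \<epsilon>\<rceil>"
  shows "real dunit \<le> 2 ^ 102 * (1 / \<epsilon> * (real \<sigma> powr \<epsilon> + lg n))"
    "real wunit \<le> 2 ^ 102 * (real n / \<epsilon> * lg \<sigma>)"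
proof -
  define i where "i = 1 / \<epsilon>"
  define P where "P = real \<sigma> powr \<epsilon>"
  have i: "1 \<le> i" "0 < i" using e by (simp_all add: i_def)
  have lgs: "1 \<le> lg n" "1 \<le> lg \<sigma>" by (simp_all add: lg_def)
  have k0i: "real k0 \<le> 2 * i" "i \<le> real k0" using i unfolding e(3) i_def[symmetric] by linarith+
  then have K1: "real (K + 1) \<le> 3 * i" using K(3) i by simp
  have \<sigma>1: "1 \<le> real \<sigma>" using sizes(2) by simp
  have P1: "1 \<le> P" unfolding P_def using \<sigma>1 e by (intro ge_one_powr_ge_zero) auto
  \<comment> \<open>If \<open>K\<close> was cut down to \<open>L\<close>, the exponent is 0;
    otherwise \<open>K = k0 \<ge> 1 / \<epsilon>\<close>.\<close>
  have "real (2 ^ ((L - 1) div K)) \<le> P"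
  proof (cases "K = L")
    case True
    then have "(L - 1) div K = 0" using L(1) by simp
    then show ?thesis using P1 by simp
  next
    case False
    then have Kk: "K = k0" by (auto simp: K_def)
    have "real ((L - 1) div K) \<le> real (L - 1) / real k0" 
    proof -
      have "real ((L - 1) div K * K) \<le> real (L - 1)" by (simp only: of_nat_le_iff div_times_less_eq_dividend)
      then show ?thesis using k0 unfolding Kk by (simp add: pos_le_divide_eq)
    qed
    also have "\<dots> \<le> real (L - 1) / i" using k0i(2) i by (intro divide_left_mono) auto
    also have "\<dots> = real (L - 1) * \<epsilon>" by (simp add: i_def)
    finally have "2 powr (real ((L - 1) div K)) \<le> 2 powr (real (L - 1) * \<epsilon>)" by (intro powr_mono) auto
    also have "\<dots> = (2 powr real (L - 1)) powr \<epsilon>" by (simp add: powr_powr)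
    also have "\<dots> = real (2 ^ (L - 1)) powr \<epsilon>" by (simp add: powr_realpow)
    also have "\<dots> \<le> P" unfolding P_def using L(4) e by (intro powr_mono2) (auto simp only: of_nat_le_iff of_nat_0_le_iff less_imp_le)
    finally show ?thesis by (simp add: powr_realpow)
  qed
  moreover have "R = 2 * 2 ^ ((L - 1) div K)" unfolding R_def d(5)[symmetric] using d(3) by (simp flip: power_Suc)
  ultimately have RP: "real R \<le> 2 * P" by simp
  have Rg: "real (R + g) \<le> 2 * P + 2 * lg n" using RP sizes(7) by simp
  define X where "X = i * P"
  define Y where "Y = i * lg n"
  have iY: "i * 1 \<le> Y" unfolding Y_def using i lgs by (intro mult_left_mono) auto
  have lY: "1 * lg n \<le> Y" unfolding Y_def using i lgs by (intro mult_right_mono) auto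
  have X0: "0 \<le> X" using i P1 by (simp add: X_def)
  have wr: "real w = 2 ^ 100 * real g" by (simp add: w_def)
  have "real ((K + 1) * (R + g)) \<le> (3 * i) * (2 * P + 2 * lg n)"
    unfolding of_nat_mult using K1 Rg i by (intro mult_mono) auto
  also have "\<dots> = 6 * X + 6 * Y" by (simp add: X_def Y_def algebra_simps)
  finally have "real ((K + 1) * (R + g)) \<le> 6 * X + 6 * Y" .
  moreover have "real dunit = real k0 + real w + real ((K + 1) * (R + g))" by simp
  \<comment> \<open>The dominating term is
    \<open>w = 2 ^ 100 * g \<le> 2 ^ 101 * lg n\<close>.\<close>
  ultimately have "real dunit \<le> 2 ^ 102 * (X + Y)" using k0i iY lY X0 sizes(7) wr lgs by simp
  then show "real dunit \<le> 2 ^ 102 * (1 / \<epsilon> * (real \<sigma> powr \<epsilon> + lg n))"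
    by (simp only: X_def Y_def i_def P_def distrib_left)
  define Z where "Z = i * (real n * lg \<sigma>)"
  have n1: "1 \<le> real n" using sizes(1) by simp
  have "real n * 1 \<le> real n * lg \<sigma>" using lgs by (intro mult_left_mono) auto
  then have nl: "real n \<le> real n * lg \<sigma>" by simp
  have z1: "i * 1 \<le> Z" unfolding Z_def by (intro mult_left_mono) (use i n1 nl in linarith)+
  have z2: "1 * (real n * lg \<sigma>) \<le> Z" unfolding Z_def by (intro mult_right_mono) (use i n1 nl in linarith)+
  have z3: "real g \<le> real n" using sizes(6) by simp
  have z4: "real ((L + 1) * (K + 1) * (5 * n)) \<le> 45 * Z"
  proof -
    have "real (L + 1) \<le> 3 * lg \<sigma>" using L(7) lgs by simp
    then have "real (L + 1) * real (K + 1) \<le> (3 * lg \<sigma>) * (3 * i)" using K1 lgs by (intro mult_mono) auto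
    then have "real (L + 1) * real (K + 1) * real (5 * n) \<le> (3 * lg \<sigma>) * (3 * i) * real (5 * n)"
      by (intro mult_right_mono) auto
    also have "\<dots> = 45 * Z" by (simp add: Z_def)
    finally show ?thesis by (simp only: of_nat_mult)
  qed
  have gen: "a + b + y \<le> 2 ^ 102 * Z" if "a \<le> 2 * i" "b = 2 ^ 100 * real g" "y \<le> 45 * Z" for a b y :: real
  proof -
    have "a \<le> 2 * Z" "real g \<le> Z" "0 \<le> Z" using that z1 z2 z3 nl i by linarith+
    then show ?thesis using that by simp
  qed
  have "real wunit = real k0 + real w + real ((L + 1) * (K + 1) * (5 * n))" by (simp only: of_nat_add)
  then have "real wunit \<le> 2 ^ 102 * Z" using gen[OF k0i(1) wr z4] by (simp only:)
  then show "real wunit \<le> 2 ^ 102 * (real n / \<epsilon> * lg \<sigma>)" by (simp add: Z_def i_def)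
qed

lemma unit_cost:
  assumes "real U \<le> 2 ^ 102 * x" "1 \<le> U" "0 \<le> q"
  shows "real (main_cost * U + 2) \<le> (q + real (main_cost + 2) * 2 ^ 102) * x"
proof -
  have "real 1 \<le> real U" using assms(2) by (simp only: of_nat_le_iff)
  then have "0 \<le> 2 ^ 102 * x" using assms(1) by linarith
  then have "0 \<le> x" by (simp add: zero_le_mult_iff)
  then have qx: "0 \<le> q * x" using assms(3) by simp
  have "main_cost * U + 2 \<le> (main_cost + 2) * U" using assms(2) by (simp add: add_mult_distrib)
  then have "real (main_cost * U + 2) \<le> real ((main_cost + 2) * U)" by (simp only: of_nat_le_iff)
  also have "\<dots> = real (main_cost + 2) * real U" by (simp only: of_nat_mult)
  also have "\<dots> \<le> real (main_cost + 2) * (2 ^ 102 * x)" using assms(1) by (rule mult_left_mono) simp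
  also have "\<dots> \<le> (q + real (main_cost + 2) * 2 ^ 102) * x" using qx by (simp only: distrib_right mult.assoc)
  finally show ?thesis .
qed

end

text \<open>One constant has to serve as the bound of a query and as the factor of both construction
  bounds.\<close>

definition total_const :: real where
  "total_const = query_cost + real (main_cost + 2) * 2 ^ 102"

lemma query_cost_nonneg: "0 \<le> query_cost"
  by (simp add: query_cost_def)

lemma total_const: "query_cost \<le> total_const" "0 \<le> total_const"
  using query_cost_nonneg by (simp_all add: total_const_def)

lemma constructs_wavelet_prog:
  assumes "valid_input \<sigma> S" and e: "0 < \<epsilon>" "\<epsilon> < 1"
  shows "constructs_wavelet_tree (2 ^ 100) total_const aux_bound rank_prog select_prog (wavelet_prog \<epsilon>) \<sigma> S
    (total_const * (real (length S) / \<epsilon> * lg \<sigma>)) (total_const * (1 / \<epsilon> * (real \<sigma> powr \<epsilon> + lg (length S))))"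
proof -
  have k: "0 < nat \<lceil>1 / \<epsilon>\<rceil>" using e by simp
  interpret input S \<sigma> "nat \<lceil>1 / \<epsilon>\<rceil>" by unfold_locales (rule assms k)+
  have nl: "n = length S" by (rule n_def)
  note u = units_real[OF e refl, unfolded nl]
  show ?thesis unfolding constructs_wavelet_tree_def Let_def wavelet_prog_def w(3)[symmetric]
  proof (rule ht_computes[OF ht_main[OF total_const(1)]])
    have p: "1 \<le> k0' + x" if "0 < k0'" for k0' x :: nat using that by simp
    show "real (main_cost * (nat \<lceil>1 / \<epsilon>\<rceil> + w + (L + 1) * (K + 1) * (5 * n)) + 2) \<le> total_const * (real (length S) / \<epsilon> * lg \<sigma>)"
      unfolding total_const_def nl
      by (rule unit_cost[OF u(2) _ query_cost_nonneg]) (use k in \<open>simp only: add.assoc p\<close>)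
    show "real (main_cost * (nat \<lceil>1 / \<epsilon>\<rceil> + w + (K + 1) * (R + g)) + 2) \<le> total_const * (1 / \<epsilon> * (real \<sigma> powr \<epsilon> + lg (length S)))"
      unfolding total_const_def
      by (rule unit_cost[OF u(1) _ query_cost_nonneg]) (use k in \<open>simp only: add.assoc p\<close>)
  qed (auto simp: input_regs_def n_def)
qed

text \<open>Word factor, constant, space bound and query programs are the same for all \<epsilon>;
  only the construction program varies, through the rounded-up
  \<open>1 / \<epsilon>\<close>.\<close>

theorem mainTheorem3:
  "\<exists>(W :: nat) (C :: real) (f :: nat \<Rightarrow> real) (rankP :: prog) (selectP :: prog) (alg :: real \<Rightarrow> prog).
     2 \<le> W \<and> f \<in> o(\<lambda>m. real m) \<and>
     (\<forall>\<epsilon>. 0 < \<epsilon> \<and> \<epsilon> < 1 \<longrightarrow>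
        (\<forall>\<sigma> S. valid_input \<sigma> S \<longrightarrow>
           constructs_wavelet_tree W C f rankP selectP (alg \<epsilon>) \<sigma> S
             (C * (real (length S) / \<epsilon> * lg \<sigma>))
             (C * (1 / \<epsilon> * (real \<sigma> powr \<epsilon> + lg (length S)))))) \<and>
     (\<forall>c :: real. \<exists>\<epsilon>. 0 < \<epsilon> \<and> \<epsilon> < 1 \<and>
        (\<forall>A :: real. \<exists>D :: real. \<forall>\<sigma> S.
           valid_input \<sigma> S \<and> real \<sigma> \<le> A * lg (length S) powr c \<longrightarrow>
           constructs_wavelet_tree W C f rankP selectP (alg \<epsilon>) \<sigma> S
             (C * (real (length S) / \<epsilon> * lg \<sigma>))
             (D * lg (length S))))"
proof (intro exI conjI allI impI)
  show "(2::nat) \<le> 2 ^ 100" by simp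
  show "aux_bound \<in> o(\<lambda>m. real m)" by (rule aux_bound_small)
  show "constructs_wavelet_tree (2 ^ 100) total_const aux_bound rank_prog select_prog (wavelet_prog \<epsilon>) \<sigma> S
     (total_const * (real (length S) / \<epsilon> * lg \<sigma>)) (total_const * (1 / \<epsilon> * (real \<sigma> powr \<epsilon> + lg (length S))))"
    if "0 < \<epsilon> \<and> \<epsilon> < 1" "valid_input \<sigma> S" for \<epsilon> \<sigma> S using constructs_wavelet_prog that by blast
  fix c A :: real
  \<comment> \<open>With this choice \<open>c * e \<le> 1\<close>, so
    \<open>(lg n powr c) powr e\<close> is at most \<open>lg n\<close>. The absolute value and the
    summand 2 keep \<open>e\<close> between 0 and 1 for every real \<open>c\<close>.\<close>
  define e where "e = 1 / (\<bar>c\<bar> + 2)"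
  show e: "0 < 1 / (\<bar>c\<bar> + 2)" "1 / (\<bar>c\<bar> + 2) < 1" by simp_all
  have ce: "c * e \<le> 1" unfolding e_def by (simp add: divide_le_eq; linarith)
  \<comment> \<open>A base of at least 1 gives \<open>B powr e \<le> B\<close>, whatever the sign of
    \<open>A\<close>.\<close>
  define B where "B = max 1 A"
  fix \<sigma> S assume a: "valid_input \<sigma> S \<and> real \<sigma> \<le> A * lg (length S) powr c"
  define l where "l = lg (length S)"
  have l: "1 \<le> l" by (simp add: l_def lg_def)
  have "real \<sigma> \<le> B * l powr c"
    using a by (rule_tac order_trans[of _ "A * l powr c"]) (auto simp: B_def l_def intro: mult_right_mono)
  then have "real \<sigma> powr e \<le> (B * l powr c) powr e" using e unfolding e_def by (intro powr_mono2) auto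
  also have "\<dots> = B powr e * l powr (c * e)" using l by (simp add: B_def powr_mult powr_powr)
  also have "\<dots> \<le> B * l"
  proof (rule mult_mono)
    have "B powr e \<le> B powr 1" using e(2) by (intro powr_mono) (auto simp: B_def e_def)
    then show "B powr e \<le> B" by (simp add: B_def)
    have "l powr (c * e) \<le> l powr 1" using ce l by (intro powr_mono) auto
    then show "l powr (c * e) \<le> l" using l by simp
  qed (simp_all add: B_def)
  finally have "real \<sigma> powr e + l \<le> (B + 1) * l" by (simp add: algebra_simps)
  then have "total_const * (1 / e * (real \<sigma> powr e + l)) \<le> total_const * (1 / e * ((B + 1) * l))"
    using total_const(2) e by (intro mult_left_mono) (auto simp: e_def)
  then have le: "total_const * (1 / e * (real \<sigma> powr e + l)) \<le> (total_const / e * (B + 1)) * l" by simp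
  show "constructs_wavelet_tree (2 ^ 100) total_const aux_bound rank_prog select_prog (wavelet_prog (1 / (\<bar>c\<bar> + 2))) \<sigma> S
     (total_const * (real (length S) / (1 / (\<bar>c\<bar> + 2)) * lg \<sigma>))
     (total_const / (1 / (\<bar>c\<bar> + 2)) * (max 1 A + 1) * lg (length S))"
    using constructs_wavelet_prog[of \<sigma> S e] a e le unfolding constructs_wavelet_tree_def Let_def
    by (auto simp: e_def[symmetric] B_def[symmetric] l_def[symmetric] elim!: computes_mono)
qed

end
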